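(* Let $k$ be a field of characteristic $0$, let $A$ be a commutative $k$-algebra, let $\mathfrak{m} \subset A$ be a prime ideal, and let $M$ be a finitely generated $A$-module annihilated by a power of $\mathfrak{m}$. Assume that $A$ and $A/\mathfrak{m}$ are Noetherian and regular. Assume in addition that we are given a first-order one-parameter deformation $A_h$ of the algebra $A$, and that there exists a left $A_h$-module $M_h$ which is flat over $k[h]/h^2$ and satisfies $M_h/hM_h \cong M$. Let $\{-,-\}$ be the bracket operation on $A$ defined by $$a'b' - b'a' = h\{a,b\}$$ for any $a,b \in A$, where $a',b' \in A_h$ are arbitrary liftings of $a,b$. Then the ideal $\mathfrak{m} \subset A$ is involutive, that is, $\{\mathfrak{m},\mathfrak{m}\} \subset \mathfrak{m}$.
   Context: A first-order one-parameter (flat) deformation of a commutative $k$-algebra $A$ is an associative (not necessarily commutative) algebra $A_h$ over $k[h]/h^2$ which is flat over $k[h]/h^2$ and is equipped with an isomorphism $A_h/hA_h \cong A$. By flatness, multiplication by $h$ induces an isomorphism $A \cong A_h/hA_h \to hA_h$; for $x \in A$, the notation $hx$ means the image of $x$ under this isomorphism. Since $A_h/hA_h \cong A$ is commutative, $a'b'-b'a'$ lies in $hA_h$ and does not depend on the choice of the liftings $a',b'$ of $a,b$, so the bracket $\{-,-\}$ on $A$ is well-defined.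
   Formalization: The formal theorem also assumes that the localization of M at 𝔪 is nonzero; without this the claim fails, e.g. for M = 0, M_h = 0, A = k[x,y] with {x,y} = 1 and 𝔪 = (x,y). *)

theory Defs
  imports "HOL-Algebra.Algebra" "HOL-Library.Extended_Nat"
begin

section \<open>Modules over not necessarily commutative rings, and algebras\<close>

text \<open>The library locale \<^locale>\<open>module\<close> requires a commutative ring of scalars and
  \<^locale>\<open>algebra\<close> a commutative algebra; the next two locales drop these restrictions.\<close>

locale left_module = R?: ring R + M?: abelian_group M
  for R :: "('r, 'x) ring_scheme" (structure) and M :: "('r, 'm, 'y) module_scheme" (structure) +
  assumes smult_closed:
      "\<lbrakk> a \<in> carrier R; x \<in> carrier M \<rbrakk> \<Longrightarrow> a \<odot>\<^bsub>M\<^esub> x \<in> carrier M"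
    and smult_l_distr:
      "\<lbrakk> a \<in> carrier R; b \<in> carrier R; x \<in> carrier M \<rbrakk> \<Longrightarrow>
        (a \<oplus>\<^bsub>R\<^esub> b) \<odot>\<^bsub>M\<^esub> x = a \<odot>\<^bsub>M\<^esub> x \<oplus>\<^bsub>M\<^esub> b \<odot>\<^bsub>M\<^esub> x"
    and smult_r_distr:
      "\<lbrakk> a \<in> carrier R; x \<in> carrier M; y \<in> carrier M \<rbrakk> \<Longrightarrow>
        a \<odot>\<^bsub>M\<^esub> (x \<oplus>\<^bsub>M\<^esub> y) = a \<odot>\<^bsub>M\<^esub> x \<oplus>\<^bsub>M\<^esub> a \<odot>\<^bsub>M\<^esub> y"
    and smult_assoc:
      "\<lbrakk> a \<in> carrier R; b \<in> carrier R; x \<in> carrier M \<rbrakk> \<Longrightarrow>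
        (a \<otimes>\<^bsub>R\<^esub> b) \<odot>\<^bsub>M\<^esub> x = a \<odot>\<^bsub>M\<^esub> (b \<odot>\<^bsub>M\<^esub> x)"
    and smult_one:
      "x \<in> carrier M \<Longrightarrow> \<one>\<^bsub>R\<^esub> \<odot>\<^bsub>M\<^esub> x = x"

locale assoc_algebra = module R A + ring A
  for R :: "('r, 'x) ring_scheme" (structure) and A :: "('r, 'a, 'y) module_scheme" (structure) +
  assumes smult_mult_left:
      "\<lbrakk> c \<in> carrier R; x \<in> carrier A; y \<in> carrier A \<rbrakk> \<Longrightarrow>
        (c \<odot>\<^bsub>A\<^esub> x) \<otimes>\<^bsub>A\<^esub> y = c \<odot>\<^bsub>A\<^esub> (x \<otimes>\<^bsub>A\<^esub> y)"
    and smult_mult_right: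
      "\<lbrakk> c \<in> carrier R; x \<in> carrier A; y \<in> carrier A \<rbrakk> \<Longrightarrow>
        x \<otimes>\<^bsub>A\<^esub> (c \<odot>\<^bsub>A\<^esub> y) = c \<odot>\<^bsub>A\<^esub> (x \<otimes>\<^bsub>A\<^esub> y)"

text \<open>A module over an \<open>R\<close>-algebra \<open>A\<close>, viewed as an \<open>R\<close>-module via \<open>r \<mapsto> r 1\<^sub>A\<close>.\<close>

definition restrict_scalars ::
  "('r, 'a, 'x) module_scheme \<Rightarrow> ('a, 'm, 'y) module_scheme \<Rightarrow> ('r, 'm) module"
  where "restrict_scalars A M =
    \<lparr> carrier = carrier M, monoid.mult = monoid.mult M, one = \<one>\<^bsub>M\<^esub>,
      ring.zero = \<zero>\<^bsub>M\<^esub>, add = add M,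
      smult = (\<lambda>r x. (r \<odot>\<^bsub>A\<^esub> \<one>\<^bsub>A\<^esub>) \<odot>\<^bsub>M\<^esub> x) \<rparr>"

definition finitely_generated_module ::
  "('r, 'x) ring_scheme \<Rightarrow> ('r, 'm, 'y) module_scheme \<Rightarrow> bool"
  where "finitely_generated_module R M \<longleftrightarrow>
    (\<exists>S. finite S \<and> S \<subseteq> carrier M \<and>
      (\<forall>x\<in>carrier M. \<exists>c\<in>S \<rightarrow> carrier R. x = (\<Oplus>\<^bsub>M\<^esub>s\<in>S. c s \<odot>\<^bsub>M\<^esub> s)))"

text \<open>\<open>\<pp>\<close> lies in the support of \<open>M\<close>: some \<open>x\<close> in \<open>M\<close> has nonzero image
  \<open>x/1\<close> in the localization \<open>M\<^bsub>\<pp>\<^esub>\<close>. A module annihilated by a power of \<open>\<pp>\<close> may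
  be zero, or supported on a proper closed subset of \<open>V(\<pp>)\<close>; a deformation of such a
  module gives no information about \<open>\<pp>\<close>.\<close>

definition in_support ::
  "('r, 'x) ring_scheme \<Rightarrow> ('r, 'm, 'y) module_scheme \<Rightarrow> 'r set \<Rightarrow> bool"
  where "in_support R M \<pp> \<longleftrightarrow>
    (\<exists>x\<in>carrier M. \<forall>s\<in>carrier R - \<pp>. s \<odot>\<^bsub>M\<^esub> x \<noteq> \<zero>\<^bsub>M\<^esub>)"


section \<open>Tensor products and flatness\<close>

definition tensor_relations ::
  "('r, 'x) ring_scheme \<Rightarrow> ('r, 'p, 'y) module_scheme \<Rightarrow> ('r, 'n, 'z) module_scheme
    \<Rightarrow> (('p \<times> 'n) \<Rightarrow>\<^sub>0 int) set"
  where "tensor_relations R P N =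
     {frag_of (p \<oplus>\<^bsub>P\<^esub> p', n) - frag_of (p, n) - frag_of (p', n) | p p' n.
        p \<in> carrier P \<and> p' \<in> carrier P \<and> n \<in> carrier N}
   \<union> {frag_of (p, n \<oplus>\<^bsub>N\<^esub> n') - frag_of (p, n) - frag_of (p, n') | p n n'.
        p \<in> carrier P \<and> n \<in> carrier N \<and> n' \<in> carrier N}
   \<union> {frag_of (r \<odot>\<^bsub>P\<^esub> p, n) - frag_of (p, r \<odot>\<^bsub>N\<^esub> n) | r p n.
        r \<in> carrier R \<and> p \<in> carrier P \<and> n \<in> carrier N}"

definition tensor_kernel ::
  "('r, 'x) ring_scheme \<Rightarrow> ('r, 'p, 'y) module_scheme \<Rightarrow> ('r, 'n, 'z) module_scheme
    \<Rightarrow> (('p \<times> 'n) \<Rightarrow>\<^sub>0 int) set"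
  where "tensor_kernel R P N =
    generate (free_Abelian_group (carrier P \<times> carrier N)) (tensor_relations R P N)"

definition tensor_product ::
  "('r, 'x) ring_scheme \<Rightarrow> ('r, 'p, 'y) module_scheme \<Rightarrow> ('r, 'n, 'z) module_scheme
    \<Rightarrow> (('p \<times> 'n) \<Rightarrow>\<^sub>0 int) set monoid"
  where "tensor_product R P N =
    free_Abelian_group (carrier P \<times> carrier N) Mod tensor_kernel R P N"

definition pure_tensor ::
  "('r, 'x) ring_scheme \<Rightarrow> ('r, 'p, 'y) module_scheme \<Rightarrow> ('r, 'n, 'z) module_scheme
    \<Rightarrow> 'p \<Rightarrow> 'n \<Rightarrow> (('p \<times> 'n) \<Rightarrow>\<^sub>0 int) set"
  where "pure_tensor R P N p n =
    tensor_kernel R P N #>\<^bsub>free_Abelian_group (carrier P \<times> carrier N)\<^esub> frag_of (p, n)"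

definition module_hom ::
  "('r, 'x) ring_scheme \<Rightarrow> ('r, 'p, 'y) module_scheme \<Rightarrow> ('r, 'q, 'z) module_scheme
    \<Rightarrow> ('p \<Rightarrow> 'q) set"
  where "module_hom R P Q =
    {f \<in> hom (add_monoid P) (add_monoid Q).
       \<forall>r\<in>carrier R. \<forall>p\<in>carrier P. f (r \<odot>\<^bsub>P\<^esub> p) = r \<odot>\<^bsub>Q\<^esub> f p}"

text \<open>\<open>N\<close> is flat over \<open>R\<close> if \<open>f \<otimes> id\<^sub>N\<close> is injective for every injective
  homomorphism \<open>f\<close> of \<open>R\<close>-modules. A definition cannot quantify over all types, so \<open>P\<close> and
  \<open>Q\<close> have carriers in the type \<^typ>\<open>(nat \<Rightarrow> 'r) set\<close>. Every countably generated
  \<open>R\<close>-module, being a quotient of a free module of finitely supported sequences, is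
  isomorphic to one with carrier in this type. These include \<open>R\<close> and its finitely
  generated ideals, on which flatness is already detected.\<close>

definition flat_module ::
  "('r, 'x) ring_scheme \<Rightarrow> ('r, 'n, 'y) module_scheme \<Rightarrow> bool"
  where "flat_module R N \<longleftrightarrow> module R N \<and>
    (\<forall>(P :: ('r, (nat \<Rightarrow> 'r) set) module) (Q :: ('r, (nat \<Rightarrow> 'r) set) module) f.
       module R P \<and> module R Q \<and> f \<in> module_hom R P Q \<and> inj_on f (carrier P) \<longrightarrow>
       (\<exists>F \<in> hom (tensor_product R P N) (tensor_product R Q N).
          (\<forall>p\<in>carrier P. \<forall>n\<in>carrier N.
             F (pure_tensor R P N p n) = pure_tensor R Q N (f p) n) \<and>
          inj_on F (carrier (tensor_product R P N))))"


section \<open>Regular rings\<close>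

definition fraction_rel :: "('a, 'x) ring_scheme \<Rightarrow> 'a set \<Rightarrow> (('a \<times> 'a) \<times> ('a \<times> 'a)) set"
  where "fraction_rel R S =
    {((a, s), (b, t)). a \<in> carrier R \<and> b \<in> carrier R \<and> s \<in> S \<and> t \<in> S \<and>
       (\<exists>u\<in>S. u \<otimes>\<^bsub>R\<^esub> (a \<otimes>\<^bsub>R\<^esub> t \<ominus>\<^bsub>R\<^esub> b \<otimes>\<^bsub>R\<^esub> s) = \<zero>\<^bsub>R\<^esub>)}"

definition ring_of_fractions :: "('a, 'x) ring_scheme \<Rightarrow> 'a set \<Rightarrow> ('a \<times> 'a) set ring"
  where "ring_of_fractions R S =
    \<lparr> carrier = (carrier R \<times> S) // fraction_rel R S,
      monoid.mult = (\<lambda>F G. fraction_rel R S ``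
        {(a \<otimes>\<^bsub>R\<^esub> b, s \<otimes>\<^bsub>R\<^esub> t) | a b s t. (a, s) \<in> F \<and> (b, t) \<in> G}),
      one = fraction_rel R S `` {(\<one>\<^bsub>R\<^esub>, \<one>\<^bsub>R\<^esub>)},
      ring.zero = fraction_rel R S `` {(\<zero>\<^bsub>R\<^esub>, \<one>\<^bsub>R\<^esub>)},
      add = (\<lambda>F G. fraction_rel R S ``
        {(a \<otimes>\<^bsub>R\<^esub> t \<oplus>\<^bsub>R\<^esub> b \<otimes>\<^bsub>R\<^esub> s, s \<otimes>\<^bsub>R\<^esub> t) | a b s t. (a, s) \<in> F \<and> (b, t) \<in> G}) \<rparr>"

definition localization_at :: "('a, 'x) ring_scheme \<Rightarrow> 'a set \<Rightarrow> ('a \<times> 'a) set ring"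
  where "localization_at R \<pp> = ring_of_fractions R (carrier R - \<pp>)"

definition krull_dim :: "('a, 'x) ring_scheme \<Rightarrow> enat"
  where "krull_dim R =
    Sup {enat n | n. \<exists>P :: nat \<Rightarrow> 'a set.
      (\<forall>i\<le>n. primeideal (P i) R) \<and> (\<forall>i<n. P i \<subset> P (Suc i))}"

definition regular_local_ring :: "('a, 'x) ring_scheme \<Rightarrow> bool"
  where "regular_local_ring R \<longleftrightarrow> cring R \<and> noetherian_ring R \<and>
    (\<exists>\<mm>. maximalideal \<mm> R \<and> (\<forall>\<nn>. maximalideal \<nn> R \<longrightarrow> \<nn> = \<mm>) \<and>
      (\<exists>S. finite S \<and> S \<subseteq> carrier R \<and> genideal R S = \<mm> \<and> enat (card S) = krull_dim R))"

definition regular_ring :: "('a, 'x) ring_scheme \<Rightarrow> bool"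
  where "regular_ring R \<longleftrightarrow> cring R \<and> noetherian_ring R \<and>
    (\<forall>\<pp>. primeideal \<pp> R \<longrightarrow> regular_local_ring (localization_at R \<pp>))"


section \<open>First-order deformations\<close>

text \<open>The ring \<open>k[h]/h\<^sup>2\<close>, the class of \<open>h\<close>, and the structure map from \<open>k\<close>.\<close>

definition dual_ideal :: "('k, 'x) ring_scheme \<Rightarrow> (nat \<Rightarrow> 'k) set"
  where "dual_ideal k = PIdl\<^bsub>UP k\<^esub> (monom (UP k) \<one>\<^bsub>k\<^esub> 2)"

definition dual_numbers :: "('k, 'x) ring_scheme \<Rightarrow> (nat \<Rightarrow> 'k) set ring"
  where "dual_numbers k = UP k Quot dual_ideal k"

definition dual_h :: "('k, 'x) ring_scheme \<Rightarrow> (nat \<Rightarrow> 'k) set"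
  where "dual_h k = dual_ideal k +>\<^bsub>UP k\<^esub> monom (UP k) \<one>\<^bsub>k\<^esub> 1"

definition dual_const :: "('k, 'x) ring_scheme \<Rightarrow> 'k \<Rightarrow> (nat \<Rightarrow> 'k) set"
  where "dual_const k c = dual_ideal k +>\<^bsub>UP k\<^esub> monom (UP k) c 0"

definition h_multiples ::
  "('k, 'x) ring_scheme \<Rightarrow> ((nat \<Rightarrow> 'k) set, 'n, 'y) module_scheme \<Rightarrow> 'n set"
  where "h_multiples k N = (\<lambda>x. dual_h k \<odot>\<^bsub>N\<^esub> x) ` carrier N"

text \<open>\<open>\<phi>\<close> is the given isomorphism of \<open>k\<close>-algebras \<open>A\<^sub>h/hA\<^sub>h \<cong> A\<close>.\<close>

locale first_order_deformation =
  fixes k :: "('k, 'x) ring_scheme"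
    and A :: "('k, 'a, 'y) module_scheme"
    and Ah :: "((nat \<Rightarrow> 'k) set, 'ah, 'z) module_scheme"
    and \<phi> :: "'ah set \<Rightarrow> 'a"
  assumes base_field: "field k"
    and base_algebra: "algebra k A"
    and deformed_algebra: "assoc_algebra (dual_numbers k) Ah"
    and flat: "flat_module (dual_numbers k) Ah"
    and reduction_iso: "\<phi> \<in> ring_iso (Ah Quot h_multiples k Ah) A"
    and reduction_smult: "\<And>c x. c \<in> carrier k \<Longrightarrow> x \<in> carrier Ah \<Longrightarrow>
      \<phi> (h_multiples k Ah +>\<^bsub>Ah\<^esub> (dual_const k c \<odot>\<^bsub>Ah\<^esub> x)) =
        c \<odot>\<^bsub>A\<^esub> \<phi> (h_multiples k Ah +>\<^bsub>Ah\<^esub> x)"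

definition liftings ::
  "('k, 'x) ring_scheme \<Rightarrow> ((nat \<Rightarrow> 'k) set, 'ah, 'z) module_scheme \<Rightarrow> ('ah set \<Rightarrow> 'a)
    \<Rightarrow> 'a \<Rightarrow> 'ah set"
  where "liftings k Ah \<phi> a = {a' \<in> carrier Ah. \<phi> (h_multiples k Ah +>\<^bsub>Ah\<^esub> a') = a}"

text \<open>The element \<open>hc\<close> of \<open>hA\<^sub>h\<close>, for \<open>c\<close> in \<open>A\<close>, is \<open>h\<close> times any lifting of \<open>c\<close>.\<close>

definition deformation_bracket ::
  "('k, 'x) ring_scheme \<Rightarrow> ((nat \<Rightarrow> 'k) set, 'ah, 'z) module_scheme \<Rightarrow> ('ah set \<Rightarrow> 'a)
    \<Rightarrow> 'a \<Rightarrow> 'a \<Rightarrow> 'a"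
  where "deformation_bracket k Ah \<phi> a b =
    (THE c. \<forall>a'\<in>liftings k Ah \<phi> a. \<forall>b'\<in>liftings k Ah \<phi> b. \<exists>c'\<in>liftings k Ah \<phi> c.
       a' \<otimes>\<^bsub>Ah\<^esub> b' \<ominus>\<^bsub>Ah\<^esub> b' \<otimes>\<^bsub>Ah\<^esub> a' = dual_h k \<odot>\<^bsub>Ah\<^esub> c')"

text \<open>\<open>\<psi>\<close> is an isomorphism \<open>M\<^sub>h/hM\<^sub>h \<cong> M\<close>, linear over \<open>A\<^sub>h/hA\<^sub>h \<cong> A\<close>.\<close>

locale first_order_module_deformation = first_order_deformation k A Ah \<phi>
  for k :: "('k, 'x) ring_scheme"
    and A :: "('k, 'a, 'y) module_scheme"
    and Ah :: "((nat \<Rightarrow> 'k) set, 'ah, 'z) module_scheme"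
    and \<phi> :: "'ah set \<Rightarrow> 'a" +
  fixes M :: "('a, 'm, 'u) module_scheme"
    and Mh :: "('ah, 'mh, 'v) module_scheme"
    and \<psi> :: "'mh set \<Rightarrow> 'm"
  assumes base_module: "module A M"
    and deformed_module: "left_module Ah Mh"
    and flat_restricted: "flat_module (dual_numbers k) (restrict_scalars Ah Mh)"
    and module_reduction_iso:
      "\<psi> \<in> iso (Mh A_Mod h_multiples k (restrict_scalars Ah Mh)) (add_monoid M)"
    and module_reduction_smult: "\<And>a x. a \<in> carrier Ah \<Longrightarrow> x \<in> carrier Mh \<Longrightarrow>
      \<psi> (h_multiples k (restrict_scalars Ah Mh) +>\<^bsub>Mh\<^esub> (a \<odot>\<^bsub>Mh\<^esub> x)) =
        \<phi> (h_multiples k Ah +>\<^bsub>Ah\<^esub> a) \<odot>\<^bsub>M\<^esub>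
          \<psi> (h_multiples k (restrict_scalars Ah Mh) +>\<^bsub>Mh\<^esub> x)"

definition involutive :: "('a \<Rightarrow> 'a \<Rightarrow> 'a) \<Rightarrow> 'a set \<Rightarrow> bool"
  where "involutive br I \<longleftrightarrow> (\<forall>a\<in>I. \<forall>b\<in>I. br a b \<in> I)"

end

theory Submission
  imports Defs
begin

text \<open>
  The idea is to take the trace of a commutator. Localize at \<open>\<mm>\<close>. A power of \<open>\<mm>\<close> kills the
  finitely generated module \<open>M\<close> over the Noetherian ring \<open>A\<close>, and \<open>\<mm>\<close> lies in its support, so the
  localization of \<open>M\<close> has a finite length \<open>d > 0\<close>. Suppose that the residue field of \<open>\<mm>\<close> is \<open>k\<close>. The localization
  is then a vector space of dimension \<open>d\<close> over \<open>k\<close>, a \<open>k\<close>-linear splitting of \<open>M\<^sub>h \<rightarrow> M\<close> lets a lifting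
  of \<open>a\<close> act as \<open>a + h D\<^sub>a\<close>, and comparing coefficients of \<open>h\<close> shows that \<open>{a,b}\<close> acts as
  \<open>[D\<^sub>a, b] + [a, D\<^sub>b]\<close>. The trace of this operator is zero. But an element of a local ring acts with
  trace \<open>d\<close> times its residue, so in characteristic zero the residue of \<open>{a,b}\<close> vanishes, that is,
  \<open>{a,b} \<in> \<mm>\<close>.

  In general the residue field is larger than \<open>k\<close>, the operators \<open>D\<^sub>a\<close> are not linear over it, and
  it does not even act on \<open>M\<^sub>h\<close>. For \<open>a\<close> and \<open>b\<close> in \<open>\<mm>\<close> the argument survives, because the failure
  of linearity stays strictly below the diagonal. In characteristic zero a commutative ring with a nil
  maximal ideal outside of which all elements are units contains a field \<open>C\<close> that represents all
  residues (\<open>coefficient_field\<close>). Over \<open>C\<close> the localization of \<open>M\<close> has a basis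
  \<open>e\<^sub>0, \<dots>, e\<^sub>d\<^sub>-\<^sub>1\<close> in which \<open>\<mm>\<close> maps every \<open>e\<^sub>i\<close> into the span of
  the earlier vectors (\<open>triangular_basis_exists\<close>). Lift the basis to \<open>M\<^sub>h\<close>, write
  \<open>a e\<^sub>i = \<Sum> A\<^sub>i\<^sub>j e\<^sub>j + h \<alpha>\<^sub>i\<close> and \<open>b e\<^sub>i = \<Sum> B\<^sub>i\<^sub>j e\<^sub>j + h \<beta>\<^sub>i\<close> with strictly triangular matrices
  of liftings of elements of \<open>C\<close>, and compute \<open>a b e\<^sub>i\<close> and \<open>b a e\<^sub>i\<close>. Moving \<open>a\<close> past \<open>B\<^sub>i\<^sub>j\<close> costs
  \<open>h {a, B\<^sub>i\<^sub>j} e\<^sub>j\<close> with \<open>j < i\<close>. The matrices \<open>A\<close> and \<open>B\<close> commute over \<open>C\<close>, as \<open>a\<close> and \<open>b\<close> do, and the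
  failure of their liftings to commute again contributes only multiples of \<open>h e\<^sub>k\<close> with \<open>k < i\<close>. So
  \<open>{a,b} e\<^sub>i + \<Sum> A\<^sub>i\<^sub>j \<beta>\<^sub>j + b \<alpha>\<^sub>i = \<Sum> B\<^sub>i\<^sub>j \<alpha>\<^sub>j + a \<beta>\<^sub>i\<close> modulo earlier basis vectors
  (\<open>lifted_commutator\<close>). Taking the coordinate at \<open>e\<^sub>i\<close>, summing over \<open>i\<close> and using
  \<open>tr(XY) = tr(YX)\<close> gives \<open>d {a,b} \<in> \<mm>\<close> (\<open>commutator_trace\<close>).

  Two points need care. First, \<open>A\<^sub>h\<close> is not commutative, and fractions are formed only on the
  commutative side. There \<open>A\<close> and \<open>M\<close> are combined into the ring \<open>A \<oplus> M\<close> in which \<open>M\<close> has square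
  zero, so that one ring of fractions serves both (\<open>localized_extension_exists\<close>). Denominators
  \<open>s\<close> are cleared before anything is lifted, and \<open>{sa, sb}\<close> agrees with \<open>s\<^sup>2{a,b}\<close> modulo \<open>a\<close> and \<open>b\<close>
  (\<open>scaled_commutator\<close>). Secondly, an equation between elements of \<open>C\<close> becomes one in \<open>A\<close> only modulo
  an ideal that is divided out to make \<open>\<mm>\<close> nil. The annihilator \<open>I\<close> of \<open>M\<close> would be too large for
  this: a lifting of an element of \<open>I\<close> maps \<open>e\<^sub>k\<close> to \<open>h\<close> times an arbitrary vector. A lifting of an
  element of \<open>I\<^sup>2\<close>, however, acts as \<open>h w\<close> for some \<open>w\<close> in \<open>A\<^sub>h\<close> (\<open>annihilator_square_lift\<close>), which
  keeps the error triangular.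

  Flatness enters only through its consequence that \<open>h x = 0\<close> forces \<open>x\<close> to be a multiple of \<open>h\<close>
  (\<open>flat_module_torsion\<close>).
\<close>


section \<open>Flatness over the dual numbers\<close>

text \<open>A copy of the ideal \<open>I\<close>, as a module, with carrier in the type over which
  \<^const>\<open>flat_module\<close> quantifies: \<open>a\<close> is represented by the singleton of a constant sequence.\<close>

definition const_module :: "('r, 'x) ring_scheme \<Rightarrow> 'r set \<Rightarrow> ('r, (nat \<Rightarrow> 'r) set) module" where
  "const_module R I = \<lparr> carrier = (\<lambda>a. {\<lambda>_. a}) ` I,
     monoid.mult = (\<lambda>U V. {\<lambda>_. the_elem U 0 \<otimes>\<^bsub>R\<^esub> the_elem V 0}), one = {\<lambda>_. \<one>\<^bsub>R\<^esub>},
     ring.zero = {\<lambda>_. \<zero>\<^bsub>R\<^esub>}, add = (\<lambda>U V. {\<lambda>_. the_elem U 0 \<oplus>\<^bsub>R\<^esub> the_elem V 0}),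
     smult = (\<lambda>r U. {\<lambda>_. r \<otimes>\<^bsub>R\<^esub> the_elem U 0}) \<rparr>"

lemma module_const_module:
  assumes "cring R" "ideal I R"
  shows "module R (const_module R I)"
proof -
  interpret cring R by fact
  interpret ideal I R by fact
  show ?thesis
  proof (rule moduleI)
    show "cring R" by fact
    show "abelian_group (const_module R I)"
    proof (rule abelian_groupI)
      fix x assume "x \<in> carrier (const_module R I)"
      then obtain a where a: "a \<in> I" "x = {\<lambda>_. a}" by (auto simp: const_module_def)
      then have "a \<in> carrier R" by (simp add: Icarr)
      then show "\<exists>y\<in>carrier (const_module R I). y \<oplus>\<^bsub>const_module R I\<^esub> x = \<zero>\<^bsub>const_module R I\<^esub>"
        using a by (intro bexI[of _ "{\<lambda>_. \<ominus>\<^bsub>R\<^esub> a}"]) (auto simp: const_module_def l_neg)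
    qed (auto simp: const_module_def Icarr a_ac)
  qed (auto simp: const_module_def Icarr I_l_closed l_distr r_distr m_assoc)
qed

lemma pure_tensor_smult:
  assumes "module R P" "module R N" "r \<in> carrier R" "p \<in> carrier P" "n \<in> carrier N"
  shows "pure_tensor R P N (r \<odot>\<^bsub>P\<^esub> p) n = pure_tensor R P N p (r \<odot>\<^bsub>N\<^esub> n)"
proof -
  interpret P: module R P by fact
  interpret N: module R N by fact
  define F where "F = free_Abelian_group (carrier P \<times> carrier N)"
  interpret F: comm_group F unfolding F_def by (rule abelian_free_Abelian_group)
  have sub: "tensor_relations R P N \<subseteq> carrier F"
    unfolding tensor_relations_def F_def
    by (auto dest!: subsetD[OF keys_diff] simp: P.smult_closed N.smult_closed)
  have K: "subgroup (tensor_kernel R P N) F"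
    unfolding tensor_kernel_def F_def[symmetric] using sub by (rule F.generate_is_subgroup)
  let ?x = "frag_of (r \<odot>\<^bsub>P\<^esub> p, n)" and ?y = "frag_of (p, r \<odot>\<^bsub>N\<^esub> n)"
  have "?x - ?y \<in> tensor_relations R P N" using assms unfolding tensor_relations_def by blast
  then have "?x - ?y \<in> tensor_kernel R P N" unfolding tensor_kernel_def by (rule generate.incl)
  moreover have "?x = (?x - ?y) \<otimes>\<^bsub>F\<^esub> ?y" by (simp add: F_def)
  ultimately have "?x \<in> tensor_kernel R P N #>\<^bsub>F\<^esub> ?y" unfolding r_coset_def by blast
  then have "tensor_kernel R P N #>\<^bsub>F\<^esub> ?y = tensor_kernel R P N #>\<^bsub>F\<^esub> ?x"
    using K assms by (intro F.repr_independence) (auto simp: F_def N.smult_closed)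
  then show ?thesis by (simp add: pure_tensor_def F_def)
qed

text \<open>A balanced biadditive map into a commutative group factors through the tensor
  product, so it cannot separate equal pure tensors.\<close>

lemma pure_tensor_eqD:
  assumes "module R P" "module R N" and G: "comm_group G"
    and f: "\<And>p n. p \<in> carrier P \<Longrightarrow> n \<in> carrier N \<Longrightarrow> f (p, n) \<in> carrier G"
    and add_left: "\<And>p q n. p \<in> carrier P \<Longrightarrow> q \<in> carrier P \<Longrightarrow> n \<in> carrier N \<Longrightarrow>
      f (p \<oplus>\<^bsub>P\<^esub> q, n) = f (p, n) \<otimes>\<^bsub>G\<^esub> f (q, n)"
    and add_right: "\<And>p m n. p \<in> carrier P \<Longrightarrow> m \<in> carrier N \<Longrightarrow> n \<in> carrier N \<Longrightarrow>
      f (p, m \<oplus>\<^bsub>N\<^esub> n) = f (p, m) \<otimes>\<^bsub>G\<^esub> f (p, n)"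
    and balanced: "\<And>r p n. r \<in> carrier R \<Longrightarrow> p \<in> carrier P \<Longrightarrow> n \<in> carrier N \<Longrightarrow>
      f (r \<odot>\<^bsub>P\<^esub> p, n) = f (p, r \<odot>\<^bsub>N\<^esub> n)"
    and pn: "p \<in> carrier P" "n \<in> carrier N" "q \<in> carrier P" "m \<in> carrier N"
    and eq: "pure_tensor R P N p n = pure_tensor R P N q m"
  shows "f (p, n) = f (q, m)"
proof -
  interpret P: module R P by fact
  interpret N: module R N by fact
  interpret G: comm_group G by fact
  define F where "F = free_Abelian_group (carrier P \<times> carrier N)"
  interpret F: comm_group F unfolding F_def by (rule abelian_free_Abelian_group)
  obtain g where g: "g \<in> hom F G" "\<And>x. x \<in> carrier P \<times> carrier N \<Longrightarrow> g (frag_of x) = f x"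
    unfolding F_def using G.free_Abelian_group_universal[of f "carrier P \<times> carrier N"] f by auto
  interpret g: group_hom F G g by unfold_locales (rule g(1))
  have diff: "x - y \<in> carrier F" "g (x - y) = g x \<otimes>\<^bsub>G\<^esub> inv\<^bsub>G\<^esub> g y" if "x \<in> carrier F" "y \<in> carrier F" for x y
  proof -
    have "x - y = x \<otimes>\<^bsub>F\<^esub> inv\<^bsub>F\<^esub> y" using that by (simp add: F_def)
    then show "x - y \<in> carrier F" "g (x - y) = g x \<otimes>\<^bsub>G\<^esub> inv\<^bsub>G\<^esub> g y" using that by simp_all
  qed
  have base: "frag_of x \<in> carrier F" if "x \<in> carrier P \<times> carrier N" for x using that by (simp add: F_def)
  have rel: "x \<in> kernel F G g" if "x \<in> tensor_relations R P N" for x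
    using that unfolding tensor_relations_def
  proof (elim UnE CollectE exE conjE)
    fix p p' n assume x: "x = frag_of (p \<oplus>\<^bsub>P\<^esub> p', n) - frag_of (p, n) - frag_of (p', n)"
      and c: "p \<in> carrier P" "p' \<in> carrier P" "n \<in> carrier N"
    note b = base[of "(p \<oplus>\<^bsub>P\<^esub> p', n)"] base[of "(p, n)"] base[of "(p', n)"]
    show "x \<in> kernel F G g" unfolding x kernel_def
      using c b f by (auto simp: diff g(2) add_left G.inv_mult_group G.m_ac)
  next
    fix p n n' assume x: "x = frag_of (p, n \<oplus>\<^bsub>N\<^esub> n') - frag_of (p, n) - frag_of (p, n')"
      and c: "p \<in> carrier P" "n \<in> carrier N" "n' \<in> carrier N"
    note b = base[of "(p, n \<oplus>\<^bsub>N\<^esub> n')"] base[of "(p, n)"] base[of "(p, n')"]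
    show "x \<in> kernel F G g" unfolding x kernel_def
      using c b f by (auto simp: diff g(2) add_right G.m_ac)
  next
    fix r p n assume x: "x = frag_of (r \<odot>\<^bsub>P\<^esub> p, n) - frag_of (p, r \<odot>\<^bsub>N\<^esub> n)"
      and c: "r \<in> carrier R" "p \<in> carrier P" "n \<in> carrier N"
    note b = base[of "(r \<odot>\<^bsub>P\<^esub> p, n)"] base[of "(p, r \<odot>\<^bsub>N\<^esub> n)"]
    show "x \<in> kernel F G g" unfolding x kernel_def
      using c b f by (auto simp: diff g(2) balanced P.smult_closed N.smult_closed)
  qed
  have sub: "tensor_relations R P N \<subseteq> carrier F" using rel by (auto simp: kernel_def)
  have K: "subgroup (tensor_kernel R P N) F"
    unfolding tensor_kernel_def F_def[symmetric] using sub by (rule F.generate_is_subgroup)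
  have ker: "tensor_kernel R P N \<subseteq> kernel F G g"
    unfolding tensor_kernel_def F_def[symmetric] 
    using rel g.subgroup_kernel by (intro F.generate_subgroup_incl) auto
  have "frag_of (p, n) \<in> tensor_kernel R P N #>\<^bsub>F\<^esub> frag_of (p, n)"
    using pn base K by (intro F.rcos_self) auto
  then have "frag_of (p, n) \<in> tensor_kernel R P N #>\<^bsub>F\<^esub> frag_of (q, m)"
    using eq by (simp add: pure_tensor_def F_def)
  then obtain k where k: "k \<in> tensor_kernel R P N" "frag_of (p, n) = k \<otimes>\<^bsub>F\<^esub> frag_of (q, m)"
    by (auto simp: r_coset_def)
  have "g k = \<one>\<^bsub>G\<^esub>" "k \<in> carrier F" using k(1) ker by (auto simp: kernel_def)
  then have "g (frag_of (p, n)) = g (frag_of (q, m))" using k(2) pn base f by (simp add: g(2))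
  then show ?thesis using g(2) pn by simp
qed

text \<open>Apply flatness to the inclusion of \<open>hR\<close> into \<open>R\<close>. If \<open>h n = 0\<close> then
  \<open>h \<otimes> n = 1 \<otimes> h n\<close> vanishes in \<open>R \<otimes> N\<close>, hence already in \<open>hR \<otimes> N\<close>. Since the annihilator of \<open>h\<close> is
  contained in \<open>hR\<close>, the rule \<open>h b \<otimes> x \<mapsto> b x\<close> is well defined modulo \<open>hN\<close>, and it sends \<open>h \<otimes> n\<close> to the class
  of \<open>n\<close>.\<close>

theorem flat_module_torsion:
  assumes flat: "flat_module R N" and h: "h \<in> carrier R"
    and ann: "\<And>b. b \<in> carrier R \<Longrightarrow> h \<otimes>\<^bsub>R\<^esub> b = \<zero>\<^bsub>R\<^esub> \<Longrightarrow> \<exists>c\<in>carrier R. b = h \<otimes>\<^bsub>R\<^esub> c"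
    and n: "n \<in> carrier N" "h \<odot>\<^bsub>N\<^esub> n = \<zero>\<^bsub>N\<^esub>"
  shows "\<exists>x\<in>carrier N. n = h \<odot>\<^bsub>N\<^esub> x"
proof -
  have N: "module R N" using flat by (simp add: flat_module_def)
  interpret N: module R N by (rule N)
  define hR where "hR = (\<lambda>b. h \<otimes>\<^bsub>R\<^esub> b) ` carrier R"
  have hR: "ideal hR R"
  proof -
    have "hR = PIdl\<^bsub>R\<^esub> h" using h by (auto simp: hR_def cgenideal_def N.R.m_comm)
    then show ?thesis using N.R.cgenideal_ideal[OF h] by simp
  qed
  define P where "P = const_module R hR"
  define Q where "Q = const_module R (carrier R)"
  have P: "module R P" unfolding P_def by (rule module_const_module[OF N.R.is_cring hR])
  have Q: "module R Q" unfolding Q_def by (rule module_const_module[OF N.R.is_cring N.R.oneideal])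
  have "hR \<subseteq> carrier R" using h by (auto simp: hR_def)
  then have id: "id \<in> module_hom R P Q" "inj_on id (carrier P)"
    by (auto simp: module_hom_def hom_def P_def Q_def const_module_def)
  have "\<exists>F \<in> hom (tensor_product R P N) (tensor_product R Q N).
      (\<forall>p\<in>carrier P. \<forall>n\<in>carrier N. F (pure_tensor R P N p n) = pure_tensor R Q N (id p) n) \<and>
      inj_on F (carrier (tensor_product R P N))"
    using flat P Q id unfolding flat_module_def by blast
  then obtain F where F: "\<And>p n. p \<in> carrier P \<Longrightarrow> n \<in> carrier N \<Longrightarrow>
      F (pure_tensor R P N p n) = pure_tensor R Q N p n"
    "inj_on F (carrier (tensor_product R P N))" by auto
  define hh where "hh = {\<lambda>_::nat. h}"
  have hh: "hh \<in> carrier P" 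
  proof -
    have "h \<in> hR" unfolding hR_def using h by (intro image_eqI[of _ _ "\<one>\<^bsub>R\<^esub>"]) auto
    then show ?thesis by (auto simp: hh_def P_def const_module_def)
  qed
  have oo: "{\<lambda>_::nat. \<one>\<^bsub>R\<^esub>} \<in> carrier Q" by (auto simp: Q_def const_module_def)
  have hQ: "hh = h \<odot>\<^bsub>Q\<^esub> {\<lambda>_. \<one>\<^bsub>R\<^esub>}" using h by (simp add: hh_def Q_def const_module_def)
  have inT: "pure_tensor R P N p x \<in> carrier (tensor_product R P N)" if "p \<in> carrier P" "x \<in> carrier N" for p x
    using that by (auto simp: pure_tensor_def tensor_product_def carrier_FactGroup)
  have "F (pure_tensor R P N hh n) = F (pure_tensor R P N hh \<zero>\<^bsub>N\<^esub>)"
    using F(1)[OF hh n(1)] F(1)[OF hh N.M.zero_closed] pure_tensor_smult[OF Q N h oo n(1)]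
      pure_tensor_smult[OF Q N h oo N.M.zero_closed] n(2) h by (simp add: hQ)
  then have eq: "pure_tensor R P N hh n = pure_tensor R P N hh \<zero>\<^bsub>N\<^esub>"
    using F(2) inT hh n(1) by (auto dest: inj_onD)
  define H where "H = (\<lambda>x. h \<odot>\<^bsub>N\<^esub> x) ` carrier N"
  have H: "subgroup H (add_monoid N)"
  proof (rule N.M.add.subgroupI)
    show "H \<subseteq> carrier N" "H \<noteq> {}" using h N.smult_closed by (auto simp: H_def)
    show "\<ominus>\<^bsub>N\<^esub> x \<in> H" if "x \<in> H" for x
      using that h by (auto simp: H_def N.smult_r_minus[symmetric])
    show "x \<oplus>\<^bsub>N\<^esub> y \<in> H" if "x \<in> H" "y \<in> H" for x y
      using that h by (auto simp: H_def N.smult_r_distr[symmetric])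
  qed
  have gN: "group (add_monoid N)" by (rule N.M.a_group)
  have G: "comm_group (add_monoid N Mod H)" by (rule comm_group.abelian_FactGroup[OF N.M.a_comm_group H])
  have nH: "normal H (add_monoid N)" by (rule comm_group.subgroup_imp_normal[OF N.M.a_comm_group H])
  define co where "co x = H #>\<^bsub>add_monoid N\<^esub> x" for x
  have co_add: "co (x \<oplus>\<^bsub>N\<^esub> y) = co x \<otimes>\<^bsub>add_monoid N Mod H\<^esub> co y" if "x \<in> carrier N" "y \<in> carrier N" for x y
    using normal.rcos_sum[OF nH, of x y] that by (simp add: co_def)
  have co_cl: "co x \<in> carrier (add_monoid N Mod H)" if "x \<in> carrier N" for x
    using that by (auto simp: co_def carrier_FactGroup)
  have co_h: "co x = co y" if "x \<in> carrier N" "y \<in> carrier N" "z \<in> carrier N" "x = h \<odot>\<^bsub>N\<^esub> z \<oplus>\<^bsub>N\<^esub> y" for x y z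
  proof -
    have "x \<in> H #>\<^bsub>add_monoid N\<^esub> y" using that by (auto simp: r_coset_def H_def)
    then show ?thesis using group.repr_independence[OF gN _ _ H, of x y] that by (simp add: co_def)
  qed
  define b where "b U = (SOME c. c \<in> carrier R \<and> the_elem U (0::nat) = h \<otimes>\<^bsub>R\<^esub> c)" for U
  have b: "b U \<in> carrier R" "the_elem U 0 = h \<otimes>\<^bsub>R\<^esub> b U" if "U \<in> carrier P" for U
  proof -
    have "\<exists>c. c \<in> carrier R \<and> the_elem U 0 = h \<otimes>\<^bsub>R\<^esub> c" using that by (auto simp: P_def const_module_def hR_def)
    then have "b U \<in> carrier R \<and> the_elem U 0 = h \<otimes>\<^bsub>R\<^esub> b U" unfolding b_def by (rule someI_ex)
    then show "b U \<in> carrier R" "the_elem U 0 = h \<otimes>\<^bsub>R\<^esub> b U" by auto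
  qed
  have co_b: "co (b U \<odot>\<^bsub>N\<^esub> x) = co (c \<odot>\<^bsub>N\<^esub> x)"
    if c: "U \<in> carrier P" "c \<in> carrier R" "the_elem U 0 = h \<otimes>\<^bsub>R\<^esub> c" "x \<in> carrier N" for U c x
  proof -
    have "h \<otimes>\<^bsub>R\<^esub> (b U \<ominus>\<^bsub>R\<^esub> c) = h \<otimes>\<^bsub>R\<^esub> b U \<ominus>\<^bsub>R\<^esub> h \<otimes>\<^bsub>R\<^esub> c" 
      using h b(1)[OF c(1)] c(2) by (simp add: N.R.minus_eq N.R.r_distr N.R.r_minus)
    also have "\<dots> = \<zero>\<^bsub>R\<^esub>" using b[OF c(1)] c(2,3) h N.R.m_closed[OF h c(2)] by (simp add: N.R.minus_eq N.R.r_neg)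
    finally obtain z where z: "z \<in> carrier R" "b U \<ominus>\<^bsub>R\<^esub> c = h \<otimes>\<^bsub>R\<^esub> z" 
      using ann[of "b U \<ominus>\<^bsub>R\<^esub> c"] b(1)[OF c(1)] c(2) by auto
    have "b U = (b U \<ominus>\<^bsub>R\<^esub> c) \<oplus>\<^bsub>R\<^esub> c" 
      using b(1)[OF c(1)] c(2) by (simp add: N.R.minus_eq N.R.add.m_assoc N.R.l_neg)
    then have "b U \<odot>\<^bsub>N\<^esub> x = h \<odot>\<^bsub>N\<^esub> (z \<odot>\<^bsub>N\<^esub> x) \<oplus>\<^bsub>N\<^esub> c \<odot>\<^bsub>N\<^esub> x"
      using z c h N.smult_l_distr[of "h \<otimes>\<^bsub>R\<^esub> z" c x] N.smult_assoc1[of h z x] by simp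
    then show ?thesis using co_h[of "b U \<odot>\<^bsub>N\<^esub> x" "c \<odot>\<^bsub>N\<^esub> x" "z \<odot>\<^bsub>N\<^esub> x"] b(1)[OF c(1)] c z h N.smult_closed by auto
  qed
  interpret P: module R P by (rule P)
  \<comment> \<open>the map \<open>(h b, x) \<mapsto> b x + hN\<close>, which is balanced and biadditive\<close>
  define f where "f = (\<lambda>(U, x). co (b U \<odot>\<^bsub>N\<^esub> x))"
  have "f (hh, n) = f (hh, \<zero>\<^bsub>N\<^esub>)"
  proof (rule pure_tensor_eqD[OF P N G _ _ _ _ hh n(1) hh N.M.zero_closed eq])
    show "f (p, x) \<in> carrier (add_monoid N Mod H)" if "p \<in> carrier P" "x \<in> carrier N" for p x
      using that b(1) N.smult_closed by (auto simp: f_def intro: co_cl)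
    show "f (p \<oplus>\<^bsub>P\<^esub> q, x) = f (p, x) \<otimes>\<^bsub>add_monoid N Mod H\<^esub> f (q, x)"
      if c: "p \<in> carrier P" "q \<in> carrier P" "x \<in> carrier N" for p q x
    proof -
      have "the_elem (p \<oplus>\<^bsub>P\<^esub> q) 0 = the_elem p 0 \<oplus>\<^bsub>R\<^esub> the_elem q 0" by (simp add: P_def const_module_def)
      also have "\<dots> = h \<otimes>\<^bsub>R\<^esub> (b p \<oplus>\<^bsub>R\<^esub> b q)" using b c h by (simp add: N.R.r_distr)
      finally have "f (p \<oplus>\<^bsub>P\<^esub> q, x) = co ((b p \<oplus>\<^bsub>R\<^esub> b q) \<odot>\<^bsub>N\<^esub> x)"
        using co_b[of "p \<oplus>\<^bsub>P\<^esub> q" "b p \<oplus>\<^bsub>R\<^esub> b q" x] c b(1) by (simp add: f_def)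
      then show ?thesis using c b(1) by (simp add: f_def N.smult_l_distr co_add N.smult_closed)
    qed
    show "f (p, x \<oplus>\<^bsub>N\<^esub> y) = f (p, x) \<otimes>\<^bsub>add_monoid N Mod H\<^esub> f (p, y)"
      if c: "p \<in> carrier P" "x \<in> carrier N" "y \<in> carrier N" for p x y
      using c b(1) by (simp add: f_def N.smult_r_distr co_add N.smult_closed)
    show "f (r \<odot>\<^bsub>P\<^esub> p, x) = f (p, r \<odot>\<^bsub>N\<^esub> x)" if c: "r \<in> carrier R" "p \<in> carrier P" "x \<in> carrier N" for r p x
    proof -
      have "the_elem (r \<odot>\<^bsub>P\<^esub> p) 0 = r \<otimes>\<^bsub>R\<^esub> the_elem p 0" by (simp add: P_def const_module_def)
      also have "\<dots> = h \<otimes>\<^bsub>R\<^esub> (b p \<otimes>\<^bsub>R\<^esub> r)" using b c h by (simp add: N.R.m_ac)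
      finally have "f (r \<odot>\<^bsub>P\<^esub> p, x) = co ((b p \<otimes>\<^bsub>R\<^esub> r) \<odot>\<^bsub>N\<^esub> x)"
        using co_b[of "r \<odot>\<^bsub>P\<^esub> p" "b p \<otimes>\<^bsub>R\<^esub> r" x] c b(1) P.smult_closed by (simp add: f_def)
      then show ?thesis using c b(1) by (simp add: f_def N.smult_assoc1)
    qed
  qed
  moreover have "co (b hh \<odot>\<^bsub>N\<^esub> x) = co x" if "x \<in> carrier N" for x
    using co_b[OF hh N.R.one_closed _ that] h that by (simp add: hh_def)
  ultimately have "co n = co \<zero>\<^bsub>N\<^esub>" using n by (simp add: f_def)
  moreover have "co \<zero>\<^bsub>N\<^esub> = H" using group.coset_mult_one[OF gN, of H] H subgroup.subset[OF H] by (simp add: co_def)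
  moreover have "n \<in> co n" unfolding co_def using group.rcos_self[OF gN _ H, of n] n by simp
  ultimately show ?thesis by (auto simp: H_def)
qed

context
  fixes k :: "('k, 'x) ring_scheme"
  assumes k: "field k"
begin

interpretation UP: UP_domain k "UP k"
  using k by (intro UP_domain.intro) (simp add: field_def)

lemma ideal_dual_ideal: "ideal (dual_ideal k) (UP k)"
  unfolding dual_ideal_def by (intro UP.P.cgenideal_ideal) simp

lemma zero_dual_numbers: "\<zero>\<^bsub>dual_numbers k\<^esub> = dual_ideal k"
  unfolding dual_numbers_def FactRing_def by simp

text \<open>The last part holds because \<open>X\<close> may be cancelled in \<open>k[X]\<close>: if \<open>X p\<close> is a multiple
  of \<open>X\<^sup>2\<close>, then \<open>p\<close> is a multiple of \<open>X\<close>.\<close>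

lemma dual_h_props:
  shows "dual_h k \<in> carrier (dual_numbers k)"
    and "dual_h k \<otimes>\<^bsub>dual_numbers k\<^esub> dual_h k = \<zero>\<^bsub>dual_numbers k\<^esub>"
    and "\<And>b. b \<in> carrier (dual_numbers k) \<Longrightarrow> dual_h k \<otimes>\<^bsub>dual_numbers k\<^esub> b = \<zero>\<^bsub>dual_numbers k\<^esub> \<Longrightarrow>
      \<exists>c\<in>carrier (dual_numbers k). b = dual_h k \<otimes>\<^bsub>dual_numbers k\<^esub> c"
proof -
  let ?I = "dual_ideal k" and ?t = "monom (UP k) \<one>\<^bsub>k\<^esub> 1"
  interpret I: ideal ?I "UP k" by (rule ideal_dual_ideal)
  interpret c: ring_hom_ring "UP k" "dual_numbers k" "(+>\<^bsub>UP k\<^esub>) ?I"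
    unfolding dual_numbers_def by (rule I.rcos_ring_hom_ring)
  have U: "?t \<in> carrier (UP k)" by simp
  have tt: "?t \<otimes>\<^bsub>UP k\<^esub> ?t = monom (UP k) \<one>\<^bsub>k\<^esub> 2"
    using UP.monom_mult[of "\<one>\<^bsub>k\<^esub>" "\<one>\<^bsub>k\<^esub>" 1 1] by (simp add: numeral_2_eq_2)
  have zero: "?I +>\<^bsub>UP k\<^esub> p = \<zero>\<^bsub>dual_numbers k\<^esub> \<longleftrightarrow> p \<in> ?I" if "p \<in> carrier (UP k)" for p
  proof -
    show ?thesis unfolding zero_dual_numbers
    proof
      assume "?I +>\<^bsub>UP k\<^esub> p = ?I"
      then show "p \<in> ?I" by (rule I.rcos_const_imp_mem[OF that])
    next
      assume "p \<in> ?I"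
      then show "?I +>\<^bsub>UP k\<^esub> p = ?I" by (rule UP.P.a_rcos_zero[OF I.ideal_axioms])
    qed
  qed
  show "dual_h k \<in> carrier (dual_numbers k)" unfolding dual_h_def using U by (rule c.hom_closed)
  have "?t \<otimes>\<^bsub>UP k\<^esub> ?t \<in> ?I" unfolding tt dual_ideal_def by (intro UP.P.cgenideal_self) simp
  then have "?I +>\<^bsub>UP k\<^esub> (?t \<otimes>\<^bsub>UP k\<^esub> ?t) = \<zero>\<^bsub>dual_numbers k\<^esub>"
    using zero[of "?t \<otimes>\<^bsub>UP k\<^esub> ?t"] U by blast
  then show "dual_h k \<otimes>\<^bsub>dual_numbers k\<^esub> dual_h k = \<zero>\<^bsub>dual_numbers k\<^esub>"
    unfolding dual_h_def c.hom_mult[OF U U] .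
  fix b assume b: "b \<in> carrier (dual_numbers k)" "dual_h k \<otimes>\<^bsub>dual_numbers k\<^esub> b = \<zero>\<^bsub>dual_numbers k\<^esub>"
  obtain p where p: "p \<in> carrier (UP k)" "b = ?I +>\<^bsub>UP k\<^esub> p"
    using b(1)[unfolded dual_numbers_def FactRing_def A_RCOSETS_def'] that by auto
  have "?I +>\<^bsub>UP k\<^esub> (?t \<otimes>\<^bsub>UP k\<^esub> p) = \<zero>\<^bsub>dual_numbers k\<^esub>"
    using b(2) unfolding dual_h_def p(2) c.hom_mult[OF U p(1)] .
  then have "?t \<otimes>\<^bsub>UP k\<^esub> p \<in> ?I" using zero[of "?t \<otimes>\<^bsub>UP k\<^esub> p"] U p(1) by blast
  then obtain q where q: "q \<in> carrier (UP k)" "?t \<otimes>\<^bsub>UP k\<^esub> p = q \<otimes>\<^bsub>UP k\<^esub> (?t \<otimes>\<^bsub>UP k\<^esub> ?t)"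
    unfolding tt dual_ideal_def cgenideal_def by auto
  have "?t \<noteq> \<zero>\<^bsub>UP k\<^esub>"
  proof
    assume "?t = \<zero>\<^bsub>UP k\<^esub>"
    then have "UnivPoly.coeff (UP k) ?t 1 = UnivPoly.coeff (UP k) \<zero>\<^bsub>UP k\<^esub> 1" by simp
    then show False by simp
  qed
  moreover have "?t \<otimes>\<^bsub>UP k\<^esub> p = ?t \<otimes>\<^bsub>UP k\<^esub> (?t \<otimes>\<^bsub>UP k\<^esub> q)" using q U p by (simp add: UP.P.m_ac)
  ultimately have "p = ?t \<otimes>\<^bsub>UP k\<^esub> q" using UP.m_lcancel[of ?t p "?t \<otimes>\<^bsub>UP k\<^esub> q"] U p q by simp
  then have "b = dual_h k \<otimes>\<^bsub>dual_numbers k\<^esub> (?I +>\<^bsub>UP k\<^esub> q)"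
    unfolding dual_h_def p(2) using U q by simp
  then show "\<exists>c\<in>carrier (dual_numbers k). b = dual_h k \<otimes>\<^bsub>dual_numbers k\<^esub> c" using q(1) by auto
qed

end


section \<open>Finite sums\<close>

context abelian_monoid
begin

lemma finsum_lessThan_Suc:
  fixes n :: nat
  assumes "f \<in> {..<Suc n} \<rightarrow> carrier G"
  shows "finsum G f {..<Suc n} = finsum G f {..<n} \<oplus> f n"
  using assms by (simp add: lessThan_Suc Pi_iff a_comm)

lemma finsum_swap:
  assumes "finite A" "finite B" "\<And>i j. i \<in> A \<Longrightarrow> j \<in> B \<Longrightarrow> f i j \<in> carrier G"
  shows "(\<Oplus>i\<in>A. \<Oplus>j\<in>B. f i j) = (\<Oplus>j\<in>B. \<Oplus>i\<in>A. f i j)"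
  using assms(1,3)
proof (induction A rule: finite_induct)
  case empty
  then show ?case by simp
next
  case (insert a A)
  have "(\<Oplus>j\<in>B. \<Oplus>i\<in>insert a A. f i j) = (\<Oplus>j\<in>B. f a j \<oplus> (\<Oplus>i\<in>A. f i j))"
    using insert by (intro finsum_cong') (auto simp: Pi_iff)
  also have "\<dots> = (\<Oplus>j\<in>B. f a j) \<oplus> (\<Oplus>j\<in>B. \<Oplus>i\<in>A. f i j)"
    using insert by (intro finsum_addf) (auto simp: Pi_iff)
  finally show ?case using insert by (simp add: Pi_iff)
qed

end

text \<open>The map only needs to be additive on a subset \<open>S\<close>; taking the identity for \<open>g\<close> turns this
  into the closure of \<open>S\<close> under finite sums.\<close>

lemma finsum_hom:
  assumes "abelian_monoid G" "abelian_monoid H" "finite A" "f \<in> A \<rightarrow> S" "S \<subseteq> carrier G"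
    and closed: "\<zero>\<^bsub>G\<^esub> \<in> S" "\<And>x y. x \<in> S \<Longrightarrow> y \<in> S \<Longrightarrow> x \<oplus>\<^bsub>G\<^esub> y \<in> S"
    and g: "g \<in> S \<rightarrow> carrier H" "g \<zero>\<^bsub>G\<^esub> = \<zero>\<^bsub>H\<^esub>"
      "\<And>x y. x \<in> S \<Longrightarrow> y \<in> S \<Longrightarrow> g (x \<oplus>\<^bsub>G\<^esub> y) = g x \<oplus>\<^bsub>H\<^esub> g y"
  shows "finsum G f A \<in> S \<and> g (finsum G f A) = finsum H (\<lambda>i. g (f i)) A"
proof -
  interpret G: abelian_monoid G by fact
  interpret H: abelian_monoid H by fact
  show ?thesis using assms(3,4)
  proof (induction A rule: finite_induct)
    case empty
    then show ?case using closed g by simp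
  next
    case (insert a A)
    then have fS: "f a \<in> S" "f \<in> A \<rightarrow> S" by auto
    have G: "finsum G f (insert a A) = f a \<oplus>\<^bsub>G\<^esub> finsum G f A"
      using insert.hyps fS assms(5) by (intro G.finsum_insert) auto
    have H: "finsum H (\<lambda>i. g (f i)) (insert a A) = g (f a) \<oplus>\<^bsub>H\<^esub> finsum H (\<lambda>i. g (f i)) A"
      using insert.hyps fS g by (intro H.finsum_insert) auto
    show ?case unfolding G H using insert.IH[OF fS(2)] fS closed g by simp
  qed
qed

lemma (in abelian_group) add_left_imp_eq:
  assumes "x \<in> carrier G" "y \<in> carrier G" "z \<in> carrier G" "x \<oplus> y = x \<oplus> z"
  shows "y = z"
  using assms by (metis r_neg1)

lemma (in ring) ideal_finsum:
  assumes "ideal I R" "finite F" "f \<in> F \<rightarrow> I"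
  shows "finsum R f F \<in> I"
proof -
  interpret I: ideal I R by fact
  show ?thesis
    using finsum_hom[OF abelian_monoid_axioms abelian_monoid_axioms assms(2,3) I.a_subset, of "\<lambda>x. x"] I.a_subset by auto
qed


section \<open>Fractions and the idealization of a module\<close>

text \<open>Nagata's idealization \<open>R \<oplus> M\<close>: the elements of \<open>M\<close> form an ideal of square zero.
  Fractions of \<open>R\<close> and of \<open>M\<close> then live in a single commutative ring, and a span of elements of \<open>M\<close>
  is a span inside that ring.\<close>

definition idealization ::
  "('r, 'x) ring_scheme \<Rightarrow> ('r, 'm, 'y) module_scheme \<Rightarrow> ('r \<times> 'm) ring" where
  "idealization R M = \<lparr> carrier = carrier R \<times> carrier M,
     monoid.mult = (\<lambda>(a, x) (b, y). (a \<otimes>\<^bsub>R\<^esub> b, a \<odot>\<^bsub>M\<^esub> y \<oplus>\<^bsub>M\<^esub> b \<odot>\<^bsub>M\<^esub> x)),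
     one = (\<one>\<^bsub>R\<^esub>, \<zero>\<^bsub>M\<^esub>), ring.zero = (\<zero>\<^bsub>R\<^esub>, \<zero>\<^bsub>M\<^esub>),
     add = (\<lambda>(a, x) (b, y). (a \<oplus>\<^bsub>R\<^esub> b, x \<oplus>\<^bsub>M\<^esub> y)) \<rparr>"

lemma idealization_simps [simp]:
  "carrier (idealization R M) = carrier R \<times> carrier M"
  "(a, x) \<otimes>\<^bsub>idealization R M\<^esub> (b, y) = (a \<otimes>\<^bsub>R\<^esub> b, a \<odot>\<^bsub>M\<^esub> y \<oplus>\<^bsub>M\<^esub> b \<odot>\<^bsub>M\<^esub> x)"
  "\<one>\<^bsub>idealization R M\<^esub> = (\<one>\<^bsub>R\<^esub>, \<zero>\<^bsub>M\<^esub>)"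
  "\<zero>\<^bsub>idealization R M\<^esub> = (\<zero>\<^bsub>R\<^esub>, \<zero>\<^bsub>M\<^esub>)"
  "(a, x) \<oplus>\<^bsub>idealization R M\<^esub> (b, y) = (a \<oplus>\<^bsub>R\<^esub> b, x \<oplus>\<^bsub>M\<^esub> y)"
  by (simp_all add: idealization_def)

lemma (in module) cring_idealization: "cring (idealization R M)"
proof (rule cringI)
  show "abelian_group (idealization R M)"
  proof (rule abelian_groupI)
    fix p assume "p \<in> carrier (idealization R M)"
    then show "\<exists>q\<in>carrier (idealization R M). q \<oplus>\<^bsub>idealization R M\<^esub> p = \<zero>\<^bsub>idealization R M\<^esub>"
      by (intro bexI[of _ "(\<ominus> fst p, \<ominus>\<^bsub>M\<^esub> snd p)"]) (auto simp: R.l_neg M.l_neg)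
  qed (auto simp: R.a_ac M.a_ac)
  show "comm_monoid (idealization R M)"
  proof (rule comm_monoidI)
    fix p q r assume *: "p \<in> carrier (idealization R M)" "q \<in> carrier (idealization R M)" "r \<in> carrier (idealization R M)"
    obtain a x b y c z where p: "p = (a, x)" "q = (b, y)" "r = (c, z)" by (cases p, cases q, cases r)
    have car: "a \<in> carrier R" "b \<in> carrier R" "c \<in> carrier R" "x \<in> carrier M" "y \<in> carrier M" "z \<in> carrier M"
      using * p by auto
    show "p \<otimes>\<^bsub>idealization R M\<^esub> q \<otimes>\<^bsub>idealization R M\<^esub> r = p \<otimes>\<^bsub>idealization R M\<^esub> (q \<otimes>\<^bsub>idealization R M\<^esub> r)"
      unfolding p using car
      by (simp add: R.m_assoc smult_r_distr M.a_assoc smult_assoc1[symmetric] R.m_comm[of c])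
  qed (auto simp: R.m_comm M.a_comm smult_closed)
  fix p q r assume *: "p \<in> carrier (idealization R M)" "q \<in> carrier (idealization R M)" "r \<in> carrier (idealization R M)"
  obtain a x b y c z where p: "p = (a, x)" "q = (b, y)" "r = (c, z)" by (cases p, cases q, cases r)
  have car: "a \<in> carrier R" "b \<in> carrier R" "c \<in> carrier R" "x \<in> carrier M" "y \<in> carrier M" "z \<in> carrier M"
    using * p by auto
  show "(p \<oplus>\<^bsub>idealization R M\<^esub> q) \<otimes>\<^bsub>idealization R M\<^esub> r =
      p \<otimes>\<^bsub>idealization R M\<^esub> r \<oplus>\<^bsub>idealization R M\<^esub> q \<otimes>\<^bsub>idealization R M\<^esub> r"
    unfolding p using car by (simp add: R.l_distr smult_l_distr smult_r_distr M.a_ac)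
qed

locale fractions = cring R for R (structure) +
  fixes S
  assumes S_carrier: "S \<subseteq> carrier R" and S_one [simp]: "\<one> \<in> S"
    and S_mult [simp]: "s \<in> S \<Longrightarrow> t \<in> S \<Longrightarrow> s \<otimes> t \<in> S"
begin

abbreviation "Q \<equiv> ring_of_fractions R S"

definition frac :: "'a \<Rightarrow> 'a \<Rightarrow> ('a \<times> 'a) set" where
  "frac a s = fraction_rel R S `` {(a, s)}"

lemma S_closed [simp]: "s \<in> S \<Longrightarrow> s \<in> carrier R"
  using S_carrier by auto

lemma fraction_rel_iff:
  "((a, s), (b, t)) \<in> fraction_rel R S \<longleftrightarrow>
    a \<in> carrier R \<and> b \<in> carrier R \<and> s \<in> S \<and> t \<in> S \<and> (\<exists>u\<in>S. u \<otimes> (a \<otimes> t) = u \<otimes> (b \<otimes> s))"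
proof -
  have "u \<otimes> (a \<otimes> t \<ominus> b \<otimes> s) = \<zero> \<longleftrightarrow> u \<otimes> (a \<otimes> t) = u \<otimes> (b \<otimes> s)"
    if "a \<in> carrier R" "b \<in> carrier R" "s \<in> S" "t \<in> S" "u \<in> S" for u
  proof -
    have c: "u \<in> carrier R" "s \<in> carrier R" "t \<in> carrier R" using that by auto
    have "u \<otimes> (a \<otimes> t \<ominus> b \<otimes> s) = u \<otimes> (a \<otimes> t) \<ominus> u \<otimes> (b \<otimes> s)" using c that(1,2) by algebra
    then show ?thesis using c that(1,2) by (simp add: r_right_minus_eq)
  qed
  then show ?thesis by (auto simp: fraction_rel_def)
qed

lemma equiv_fraction_rel: "equiv (carrier R \<times> S) (fraction_rel R S)"
proof (rule equivI)
  show "fraction_rel R S \<subseteq> (carrier R \<times> S) \<times> (carrier R \<times> S)"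
    by (auto simp: fraction_rel_def)
  show "refl_on (carrier R \<times> S) (fraction_rel R S)"
    by (intro refl_onI) (auto simp: fraction_rel_iff)
  show "sym (fraction_rel R S)"
    by (intro symI) (clarsimp simp: fraction_rel_iff, metis)
  show "trans (fraction_rel R S)"
  proof (intro transI)
    fix x y z assume "(x, y) \<in> fraction_rel R S" "(y, z) \<in> fraction_rel R S"
    moreover obtain a s b t c r where x: "x = (a, s)" "y = (b, t)" "z = (c, r)" by (cases x, cases y, cases z)
    ultimately obtain u v where u: "u \<in> S" "u \<otimes> (a \<otimes> t) = u \<otimes> (b \<otimes> s)" "v \<in> S" "v \<otimes> (b \<otimes> r) = v \<otimes> (c \<otimes> t)"
      and m: "a \<in> carrier R" "b \<in> carrier R" "c \<in> carrier R" "s \<in> S" "t \<in> S" "r \<in> S"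
      by (auto simp: fraction_rel_iff)
    have c: "u \<in> carrier R" "v \<in> carrier R" "s \<in> carrier R" "t \<in> carrier R" "r \<in> carrier R" using u m by auto
    have "(u \<otimes> v \<otimes> t) \<otimes> (a \<otimes> r) = (u \<otimes> (a \<otimes> t)) \<otimes> (v \<otimes> r)" using c m(1-3) by algebra
    also have "\<dots> = (v \<otimes> (b \<otimes> r)) \<otimes> (u \<otimes> s)" unfolding u(2) using c m(1-3) by algebra
    also have "\<dots> = (u \<otimes> v \<otimes> t) \<otimes> (c \<otimes> s)" unfolding u(4) using c m(1-3) by algebra
    finally show "(x, z) \<in> fraction_rel R S" unfolding x fraction_rel_iff
      using m u by (intro conjI bexI[of _ "u \<otimes> v \<otimes> t"]) auto
  qed
qed

lemma frac_eq_iff: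
  assumes "a \<in> carrier R" "s \<in> S" "b \<in> carrier R" "t \<in> S"
  shows "frac a s = frac b t \<longleftrightarrow> (\<exists>u\<in>S. u \<otimes> (a \<otimes> t) = u \<otimes> (b \<otimes> s))"
  unfolding frac_def using assms by (subst eq_equiv_class_iff[OF equiv_fraction_rel]) (auto simp: fraction_rel_iff)

lemma frac_memD:
  assumes "(b, t) \<in> frac a s"
  shows "b \<in> carrier R \<and> t \<in> S \<and> a \<in> carrier R \<and> s \<in> S \<and> frac b t = frac a s"
proof -
  have *: "((a, s), (b, t)) \<in> fraction_rel R S" using assms by (simp add: frac_def)
  then have "frac a s = frac b t" unfolding frac_def by (rule equiv_class_eq[OF equiv_fraction_rel])
  then show ?thesis using * by (simp add: fraction_rel_iff)
qed

lemma frac_mem: "a \<in> carrier R \<Longrightarrow> s \<in> S \<Longrightarrow> (a, s) \<in> frac a s"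
  unfolding frac_def by (auto simp: fraction_rel_iff)

text \<open>The operations on fractions are images of sets of pairs under the equivalence
  relation; such an image is a single fraction when all pairs are equivalent to one of them.\<close>

lemma Image_eq_frac:
  assumes "\<And>b t. (b, t) \<in> P \<Longrightarrow> b \<in> carrier R \<and> t \<in> S \<and> frac b t = frac a s" "(a, s) \<in> P"
  shows "fraction_rel R S `` P = frac a s"
proof -
  have "fraction_rel R S `` P = (\<Union>(b, t)\<in>P. frac b t)" unfolding frac_def by auto
  also have "\<dots> = (\<Union>(b, t)\<in>P. frac a s)" using assms(1) by (intro SUP_cong) auto
  also have "\<dots> = frac a s" using assms(2) by auto
  finally show ?thesis .
qed

lemma carrier_Q: "carrier Q = {frac a s | a s. a \<in> carrier R \<and> s \<in> S}"
  by (auto simp: ring_of_fractions_def quotient_def frac_def)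

lemma frac_closed [simp]: "a \<in> carrier R \<Longrightarrow> s \<in> S \<Longrightarrow> frac a s \<in> carrier Q"
  by (auto simp: carrier_Q)

lemma mult_Q:
  assumes "a \<in> carrier R" "s \<in> S" "b \<in> carrier R" "t \<in> S"
  shows "frac a s \<otimes>\<^bsub>Q\<^esub> frac b t = frac (a \<otimes> b) (s \<otimes> t)"
proof -
  have "fraction_rel R S `` {(a' \<otimes> b', s' \<otimes> t') | a' b' s' t'. (a', s') \<in> frac a s \<and> (b', t') \<in> frac b t} =
    frac (a \<otimes> b) (s \<otimes> t)"
  proof (rule Image_eq_frac)
    fix x r assume "(x, r) \<in> {(a' \<otimes> b', s' \<otimes> t') | a' b' s' t'. (a', s') \<in> frac a s \<and> (b', t') \<in> frac b t}"
    then obtain a' b' s' t' where x: "x = a' \<otimes> b'" "r = s' \<otimes> t'" "(a', s') \<in> frac a s" "(b', t') \<in> frac b t" by blast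
    note d = frac_memD[OF x(3)] frac_memD[OF x(4)]
    obtain u v where u: "u \<in> S" "u \<otimes> (a' \<otimes> s) = u \<otimes> (a \<otimes> s')" "v \<in> S" "v \<otimes> (b' \<otimes> t) = v \<otimes> (b \<otimes> t')"
      using d frac_eq_iff[of a' s' a s] frac_eq_iff[of b' t' b t] by auto
    have c: "u \<in> carrier R" "v \<in> carrier R" "s \<in> carrier R" "t \<in> carrier R" "s' \<in> carrier R" "t' \<in> carrier R"
      "a \<in> carrier R" "b \<in> carrier R" "a' \<in> carrier R" "b' \<in> carrier R" using u d assms by auto
    have "(u \<otimes> v) \<otimes> ((a' \<otimes> b') \<otimes> (s \<otimes> t)) = (u \<otimes> (a' \<otimes> s)) \<otimes> (v \<otimes> (b' \<otimes> t))" using c by algebra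
    also have "\<dots> = (u \<otimes> v) \<otimes> ((a \<otimes> b) \<otimes> (s' \<otimes> t'))" unfolding u(2,4) using c by algebra
    finally have "frac (a' \<otimes> b') (s' \<otimes> t') = frac (a \<otimes> b) (s \<otimes> t)"
      using u d assms by (subst frac_eq_iff) auto
    then show "x \<in> carrier R \<and> r \<in> S \<and> frac x r = frac (a \<otimes> b) (s \<otimes> t)" using d x by auto
  qed (use assms frac_mem in blast)
  then show ?thesis by (simp add: ring_of_fractions_def)
qed

lemma add_Q:
  assumes "a \<in> carrier R" "s \<in> S" "b \<in> carrier R" "t \<in> S"
  shows "frac a s \<oplus>\<^bsub>Q\<^esub> frac b t = frac (a \<otimes> t \<oplus> b \<otimes> s) (s \<otimes> t)"
proof -
  have "fraction_rel R S `` {(a' \<otimes> t' \<oplus> b' \<otimes> s', s' \<otimes> t') | a' b' s' t'. (a', s') \<in> frac a s \<and> (b', t') \<in> frac b t} =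
    frac (a \<otimes> t \<oplus> b \<otimes> s) (s \<otimes> t)"
  proof (rule Image_eq_frac)
    fix x r assume "(x, r) \<in> {(a' \<otimes> t' \<oplus> b' \<otimes> s', s' \<otimes> t') | a' b' s' t'. (a', s') \<in> frac a s \<and> (b', t') \<in> frac b t}"
    then obtain a' b' s' t' where x: "x = a' \<otimes> t' \<oplus> b' \<otimes> s'" "r = s' \<otimes> t'" "(a', s') \<in> frac a s" "(b', t') \<in> frac b t" by blast
    note d = frac_memD[OF x(3)] frac_memD[OF x(4)]
    obtain u v where u: "u \<in> S" "u \<otimes> (a' \<otimes> s) = u \<otimes> (a \<otimes> s')" "v \<in> S" "v \<otimes> (b' \<otimes> t) = v \<otimes> (b \<otimes> t')"
      using d frac_eq_iff[of a' s' a s] frac_eq_iff[of b' t' b t] by auto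
    have c: "u \<in> carrier R" "v \<in> carrier R" "s \<in> carrier R" "t \<in> carrier R" "s' \<in> carrier R" "t' \<in> carrier R"
      "a \<in> carrier R" "b \<in> carrier R" "a' \<in> carrier R" "b' \<in> carrier R" using u d assms by auto
    have "(u \<otimes> v) \<otimes> ((a' \<otimes> t' \<oplus> b' \<otimes> s') \<otimes> (s \<otimes> t))
      = (u \<otimes> (a' \<otimes> s)) \<otimes> (v \<otimes> t \<otimes> t') \<oplus> (v \<otimes> (b' \<otimes> t)) \<otimes> (u \<otimes> s \<otimes> s')" using c by algebra
    also have "\<dots> = (u \<otimes> v) \<otimes> ((a \<otimes> t \<oplus> b \<otimes> s) \<otimes> (s' \<otimes> t'))" unfolding u(2,4) using c by algebra
    finally have "frac (a' \<otimes> t' \<oplus> b' \<otimes> s') (s' \<otimes> t') = frac (a \<otimes> t \<oplus> b \<otimes> s) (s \<otimes> t)"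
      using u d assms by (subst frac_eq_iff) auto
    then show "x \<in> carrier R \<and> r \<in> S \<and> frac x r = frac (a \<otimes> t \<oplus> b \<otimes> s) (s \<otimes> t)" using d x by auto
  qed (use assms frac_mem in blast)
  then show ?thesis by (simp add: ring_of_fractions_def)
qed

lemma one_Q: "\<one>\<^bsub>Q\<^esub> = frac \<one> \<one>" and zero_Q: "\<zero>\<^bsub>Q\<^esub> = frac \<zero> \<one>"
  by (simp_all add: ring_of_fractions_def frac_def)

lemma frac_same_denominator:
  assumes "a \<in> carrier R" "s \<in> S" "t \<in> S"
  shows "frac (a \<otimes> t) (s \<otimes> t) = frac a s"
proof -
  have "(a \<otimes> t) \<otimes> s = a \<otimes> (s \<otimes> t)" using assms S_closed[OF assms(2)] S_closed[OF assms(3)] by algebra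
  then show ?thesis using assms by (subst frac_eq_iff) (auto intro!: bexI[of _ \<one>])
qed

lemma cring_Q: "cring Q"
proof (rule cringI)
  show "abelian_group Q"
  proof (rule abelian_groupI)
    fix x y z assume "x \<in> carrier Q" "y \<in> carrier Q" "z \<in> carrier Q"
    then obtain a s b t c r where x: "x = frac a s" "y = frac b t" "z = frac c r"
      and S: "s \<in> S" "t \<in> S" "r \<in> S" and R: "a \<in> carrier R" "b \<in> carrier R" "c \<in> carrier R"
      by (auto simp: carrier_Q)
    note SR = S[THEN S_closed]
    show "x \<oplus>\<^bsub>Q\<^esub> y \<in> carrier Q" using x S R by (simp add: add_Q)
    show "x \<oplus>\<^bsub>Q\<^esub> y = y \<oplus>\<^bsub>Q\<^esub> x" using x S R by (simp add: add_Q a_comm m_comm)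
    have "(a \<otimes> t \<oplus> b \<otimes> s) \<otimes> r \<oplus> c \<otimes> (s \<otimes> t) = a \<otimes> (t \<otimes> r) \<oplus> (b \<otimes> r \<oplus> c \<otimes> t) \<otimes> s"
      using SR R by algebra
    then show "x \<oplus>\<^bsub>Q\<^esub> y \<oplus>\<^bsub>Q\<^esub> z = x \<oplus>\<^bsub>Q\<^esub> (y \<oplus>\<^bsub>Q\<^esub> z)" using x S R SR by (simp add: add_Q m_assoc)
    show "\<zero>\<^bsub>Q\<^esub> \<oplus>\<^bsub>Q\<^esub> x = x" using x S R SR by (simp add: add_Q zero_Q)
    have "frac (\<ominus> a) s \<oplus>\<^bsub>Q\<^esub> x = frac (\<ominus> a \<otimes> s \<oplus> a \<otimes> s) (s \<otimes> s)" using x S R by (simp add: add_Q)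
    also have "\<ominus> a \<otimes> s \<oplus> a \<otimes> s = \<zero> \<otimes> (s \<otimes> s)" using R SR by algebra
    also have "frac (\<zero> \<otimes> (s \<otimes> s)) (s \<otimes> s) = \<zero>\<^bsub>Q\<^esub>" 
      using frac_same_denominator[of \<zero> \<one> "s \<otimes> s"] S SR by (simp add: zero_Q)
    finally show "\<exists>y\<in>carrier Q. y \<oplus>\<^bsub>Q\<^esub> x = \<zero>\<^bsub>Q\<^esub>" using R S by (intro bexI[of _ "frac (\<ominus> a) s"]) auto
  qed (simp add: zero_Q)
  show "comm_monoid Q"
  proof (rule comm_monoidI)
    fix x y z assume "x \<in> carrier Q" "y \<in> carrier Q" "z \<in> carrier Q"
    then obtain a s b t c r where x: "x = frac a s" "y = frac b t" "z = frac c r"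
      and S: "s \<in> S" "t \<in> S" "r \<in> S" and R: "a \<in> carrier R" "b \<in> carrier R" "c \<in> carrier R"
      by (auto simp: carrier_Q)
    note SR = S[THEN S_closed]
    show "x \<otimes>\<^bsub>Q\<^esub> y \<in> carrier Q" using x S R by (simp add: mult_Q)
    show "x \<otimes>\<^bsub>Q\<^esub> y = y \<otimes>\<^bsub>Q\<^esub> x" using x S R by (simp add: mult_Q m_comm)
    show "x \<otimes>\<^bsub>Q\<^esub> y \<otimes>\<^bsub>Q\<^esub> z = x \<otimes>\<^bsub>Q\<^esub> (y \<otimes>\<^bsub>Q\<^esub> z)" using x S R SR by (simp add: mult_Q m_assoc)
    show "\<one>\<^bsub>Q\<^esub> \<otimes>\<^bsub>Q\<^esub> x = x" using x S R SR by (simp add: mult_Q one_Q)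
  qed (simp add: one_Q)
  fix x y z assume "x \<in> carrier Q" "y \<in> carrier Q" "z \<in> carrier Q"
  then obtain a s b t c r where x: "x = frac a s" "y = frac b t" "z = frac c r"
    and S: "s \<in> S" "t \<in> S" "r \<in> S" and R: "a \<in> carrier R" "b \<in> carrier R" "c \<in> carrier R"
    by (auto simp: carrier_Q)
  note SR = S[THEN S_closed]
  have "x \<otimes>\<^bsub>Q\<^esub> z \<oplus>\<^bsub>Q\<^esub> y \<otimes>\<^bsub>Q\<^esub> z = frac ((a \<otimes> c) \<otimes> (t \<otimes> r) \<oplus> (b \<otimes> c) \<otimes> (s \<otimes> r)) ((s \<otimes> r) \<otimes> (t \<otimes> r))"
    using x S R SR by (simp add: add_Q mult_Q)
  also have "(a \<otimes> c) \<otimes> (t \<otimes> r) \<oplus> (b \<otimes> c) \<otimes> (s \<otimes> r) = ((a \<otimes> t \<oplus> b \<otimes> s) \<otimes> c) \<otimes> r" using SR R by algebra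
  also have "(s \<otimes> r) \<otimes> (t \<otimes> r) = ((s \<otimes> t) \<otimes> r) \<otimes> r" using SR by algebra
  also have "frac (((a \<otimes> t \<oplus> b \<otimes> s) \<otimes> c) \<otimes> r) (((s \<otimes> t) \<otimes> r) \<otimes> r) = frac ((a \<otimes> t \<oplus> b \<otimes> s) \<otimes> c) ((s \<otimes> t) \<otimes> r)"
    using S R SR by (intro frac_same_denominator) auto
  also have "\<dots> = (x \<oplus>\<^bsub>Q\<^esub> y) \<otimes>\<^bsub>Q\<^esub> z" using x S R SR by (simp add: add_Q mult_Q)
  finally show "(x \<oplus>\<^bsub>Q\<^esub> y) \<otimes>\<^bsub>Q\<^esub> z = x \<otimes>\<^bsub>Q\<^esub> z \<oplus>\<^bsub>Q\<^esub> y \<otimes>\<^bsub>Q\<^esub> z" by simp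
qed

text \<open>These four properties characterize the ring of fractions together with its map
  from \<open>R\<close>.\<close>

theorem localization_map:
  "(\<lambda>a. frac a \<one>) \<in> ring_hom R Q"
  "s \<in> S \<Longrightarrow> frac s \<one> \<in> Units Q"
  "x \<in> carrier Q \<Longrightarrow> \<exists>a\<in>carrier R. \<exists>s\<in>S. x \<otimes>\<^bsub>Q\<^esub> frac s \<one> = frac a \<one>"
  "a \<in> carrier R \<Longrightarrow> frac a \<one> = \<zero>\<^bsub>Q\<^esub> \<longleftrightarrow> (\<exists>u\<in>S. u \<otimes> a = \<zero>)"
proof -
  interpret Q: cring Q by (rule cring_Q)
  show "(\<lambda>a. frac a \<one>) \<in> ring_hom R Q"
    by (intro ring_hom_memI) (auto simp: mult_Q add_Q one_Q)
  show "frac s \<one> \<in> Units Q" if s: "s \<in> S"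
  proof -
    have "frac \<one> s \<otimes>\<^bsub>Q\<^esub> frac s \<one> = \<one>\<^bsub>Q\<^esub>" 
      using s frac_same_denominator[of \<one> \<one> s] by (simp add: mult_Q one_Q)
    moreover have "frac \<one> s \<in> carrier Q" "frac s \<one> \<in> carrier Q" using s by auto
    ultimately show ?thesis unfolding Units_def using Q.m_comm by fastforce
  qed
  show "\<exists>a\<in>carrier R. \<exists>s\<in>S. x \<otimes>\<^bsub>Q\<^esub> frac s \<one> = frac a \<one>" if x: "x \<in> carrier Q"
  proof -
    obtain a s where a: "x = frac a s" "a \<in> carrier R" "s \<in> S" using x by (auto simp: carrier_Q)
    then have "x \<otimes>\<^bsub>Q\<^esub> frac s \<one> = frac (a \<otimes> s) (\<one> \<otimes> s)" by (simp add: mult_Q)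
    then show ?thesis using a frac_same_denominator[of a \<one> s] by auto
  qed
  show "a \<in> carrier R \<Longrightarrow> frac a \<one> = \<zero>\<^bsub>Q\<^esub> \<longleftrightarrow> (\<exists>u\<in>S. u \<otimes> a = \<zero>)"
    by (simp add: zero_Q frac_eq_iff)
qed

end

text \<open>Dividing by \<open>I\<close> and then inverting \<open>S\<close>, packaged as one homomorphism. What follows
  uses only the listed properties of this homomorphism and never the elements of the ring.\<close>

theorem localized_quotient:
  fixes E :: "('e, 'x) ring_scheme"
  assumes "cring E" and I: "ideal I E" and S: "S \<subseteq> carrier E" "\<one>\<^bsub>E\<^esub> \<in> S"
    "\<And>s t. s \<in> S \<Longrightarrow> t \<in> S \<Longrightarrow> s \<otimes>\<^bsub>E\<^esub> t \<in> S"
  shows "\<exists>(Q :: ('e set \<times> 'e set) set ring) \<theta>. cring Q \<and> \<theta> \<in> ring_hom E Q \<and> (\<forall>s\<in>S. \<theta> s \<in> Units Q) \<and>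
    (\<forall>x\<in>carrier Q. \<exists>a\<in>carrier E. \<exists>s\<in>S. x \<otimes>\<^bsub>Q\<^esub> \<theta> s = \<theta> a) \<and>
    (\<forall>a\<in>carrier E. \<theta> a = \<zero>\<^bsub>Q\<^esub> \<longleftrightarrow> (\<exists>u\<in>S. u \<otimes>\<^bsub>E\<^esub> a \<in> I))"
proof -
  interpret E: cring E by fact
  interpret I: ideal I E by (rule I)
  define \<kappa> where "\<kappa> = (\<lambda>a. I +>\<^bsub>E\<^esub> a)"
  interpret \<kappa>: ring_hom_ring E "E Quot I" \<kappa>
    unfolding \<kappa>_def by (rule I.rcos_ring_hom_ring)
  have quot: "cring (E Quot I)" by (rule I.quotient_is_cring[OF assms(1)])
  interpret F: fractions "E Quot I" "\<kappa> ` S"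
  proof (intro fractions.intro quot fractions_axioms.intro)
    show "\<kappa> ` S \<subseteq> carrier (E Quot I)" using S by auto
    show "\<one>\<^bsub>E Quot I\<^esub> \<in> \<kappa> ` S" using S(2) \<kappa>.hom_one by (metis imageI)
    show "s \<otimes>\<^bsub>E Quot I\<^esub> t \<in> \<kappa> ` S" if "s \<in> \<kappa> ` S" "t \<in> \<kappa> ` S" for s t
      using that S by (auto simp flip: \<kappa>.hom_mult simp: subset_iff)
  qed
  define \<theta> where "\<theta> = (\<lambda>a. F.frac (\<kappa> a) \<one>\<^bsub>E Quot I\<^esub>)"
  have surj: "\<exists>a\<in>carrier E. x = \<kappa> a" if "x \<in> carrier (E Quot I)" for x
    using that by (auto simp: FactRing_def A_RCOSETS_def' \<kappa>_def)
  have zero: "\<kappa> a = \<zero>\<^bsub>E Quot I\<^esub> \<longleftrightarrow> a \<in> I" if "a \<in> carrier E" for a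
    using I.rcos_const_imp_mem that E.a_rcos_zero[OF I] by (auto simp: \<kappa>_def FactRing_def)
  show ?thesis
  proof (intro exI[of _ "ring_of_fractions (E Quot I) (\<kappa> ` S)"] exI[of _ \<theta>] conjI ballI)
    show "cring (ring_of_fractions (E Quot I) (\<kappa> ` S))" by (rule F.cring_Q)
    show "\<theta> \<in> ring_hom E (ring_of_fractions (E Quot I) (\<kappa> ` S))"
      using ring_hom_trans[OF \<kappa>.homh F.localization_map(1)] by (simp add: \<theta>_def comp_def)
    show "\<theta> s \<in> Units (ring_of_fractions (E Quot I) (\<kappa> ` S))" if "s \<in> S" for s
      unfolding \<theta>_def using that by (intro F.localization_map(2)) auto
    show "\<exists>a\<in>carrier E. \<exists>s\<in>S. x \<otimes>\<^bsub>ring_of_fractions (E Quot I) (\<kappa> ` S)\<^esub> \<theta> s = \<theta> a"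
      if "x \<in> carrier (ring_of_fractions (E Quot I) (\<kappa> ` S))" for x
      using F.localization_map(3)[OF that] surj unfolding \<theta>_def by fastforce
    show "\<theta> a = \<zero>\<^bsub>ring_of_fractions (E Quot I) (\<kappa> ` S)\<^esub> \<longleftrightarrow> (\<exists>u\<in>S. u \<otimes>\<^bsub>E\<^esub> a \<in> I)" if a: "a \<in> carrier E" for a
    proof -
      have "\<theta> a = \<zero>\<^bsub>ring_of_fractions (E Quot I) (\<kappa> ` S)\<^esub> \<longleftrightarrow> (\<exists>u\<in>S. \<kappa> u \<otimes>\<^bsub>E Quot I\<^esub> \<kappa> a = \<zero>\<^bsub>E Quot I\<^esub>)"
        unfolding \<theta>_def using a by (subst F.localization_map(4)) auto
      also have "\<dots> \<longleftrightarrow> (\<exists>u\<in>S. u \<otimes>\<^bsub>E\<^esub> a \<in> I)"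
        using a S(1) zero by (intro bex_cong refl) (auto simp flip: \<kappa>.hom_mult simp: subset_iff)
      finally show ?thesis .
    qed
  qed
qed


section \<open>Coefficient fields in characteristic zero\<close>

primrec horner :: "('a, 'b) ring_scheme \<Rightarrow> 'a list \<Rightarrow> 'a \<Rightarrow> 'a" where
  "horner R [] t = \<zero>\<^bsub>R\<^esub>"
| "horner R (c # cs) t = c \<oplus>\<^bsub>R\<^esub> t \<otimes>\<^bsub>R\<^esub> horner R cs t"

primrec horner_deriv :: "('a, 'b) ring_scheme \<Rightarrow> 'a list \<Rightarrow> 'a \<Rightarrow> 'a" where
  "horner_deriv R [] t = \<zero>\<^bsub>R\<^esub>"
| "horner_deriv R (c # cs) t = horner R cs t \<oplus>\<^bsub>R\<^esub> t \<otimes>\<^bsub>R\<^esub> horner_deriv R cs t"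

text \<open>With \<open>n = 1\<close> and applied to the tail of a list of coefficients, this gives the
  coefficients of the derivative. The extra argument makes the recursion possible.\<close>

primrec weighted_coeffs :: "('a, 'b) ring_scheme \<Rightarrow> nat \<Rightarrow> 'a list \<Rightarrow> 'a list" where
  "weighted_coeffs R n [] = []"
| "weighted_coeffs R n (c # cs) = add_pow R n c # weighted_coeffs R (Suc n) cs"

lemma length_weighted_coeffs [simp]: "length (weighted_coeffs R n cs) = length cs"
  by (induction cs arbitrary: n) auto

lemma last_weighted_coeffs:
  "cs \<noteq> [] \<Longrightarrow> last (weighted_coeffs R n cs) = add_pow R (n + length cs - 1) (last cs)"
proof (induction cs arbitrary: n)
  case (Cons c cs)
  then show ?case by (cases cs) auto
qed simp

context cring
begin

lemma horner_closed [simp]: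
  "set cs \<subseteq> carrier R \<Longrightarrow> t \<in> carrier R \<Longrightarrow> horner R cs t \<in> carrier R"
  by (induction cs) auto

lemma horner_deriv_closed [simp]:
  "set cs \<subseteq> carrier R \<Longrightarrow> t \<in> carrier R \<Longrightarrow> horner_deriv R cs t \<in> carrier R"
  by (induction cs) auto

lemma horner_zeros: "set cs \<subseteq> {\<zero>} \<Longrightarrow> t \<in> carrier R \<Longrightarrow> horner R cs t = \<zero>"
  by (induction cs) auto

lemma horner_append:
  "set cs \<subseteq> carrier R \<Longrightarrow> c \<in> carrier R \<Longrightarrow> t \<in> carrier R \<Longrightarrow>
    horner R (cs @ [c]) t = horner R cs t \<oplus> t [^] length cs \<otimes> c"
proof (induction cs)
  case (Cons a cs)
  then have [simp]: "horner R cs t \<in> carrier R" "a \<in> carrier R" by auto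
  have "horner R ((a # cs) @ [c]) t = a \<oplus> t \<otimes> (horner R cs t \<oplus> t [^] length cs \<otimes> c)"
    using Cons by simp
  also have "\<dots> = (a \<oplus> t \<otimes> horner R cs t) \<oplus> (t [^] length cs \<otimes> t) \<otimes> c"
    using Cons(3,4) by (simp add: r_distr m_assoc[symmetric] a_assoc[symmetric] m_comm)
  finally show ?case by simp
qed simp

text \<open>For \<open>P(t)\<close> with coefficients \<open>cs\<close>, the weighted list represents \<open>n P + t P'\<close>; at
  \<open>n = 1\<close> this is the derivative of \<open>t P\<close>.\<close>

lemma horner_weighted_coeffs:
  "set cs \<subseteq> carrier R \<Longrightarrow> t \<in> carrier R \<Longrightarrow>
    horner R (weighted_coeffs R n cs) t = add_pow R n (horner R cs t) \<oplus> t \<otimes> horner_deriv R cs t"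
proof (induction cs arbitrary: n)
  case (Cons c cs)
  then have [simp]: "horner R cs t \<in> carrier R" "horner_deriv R cs t \<in> carrier R" "c \<in> carrier R" by auto
  have "horner R (weighted_coeffs R n (c # cs)) t
      = add_pow R n c \<oplus> t \<otimes> ((add_pow R n (horner R cs t) \<oplus> horner R cs t) \<oplus> t \<otimes> horner_deriv R cs t)"
    using Cons by simp
  also have "\<dots> = (add_pow R n c \<oplus> t \<otimes> add_pow R n (horner R cs t))
        \<oplus> t \<otimes> (horner R cs t \<oplus> t \<otimes> horner_deriv R cs t)"
    using Cons(3) add.nat_pow_closed[of "horner R cs t" n] add.nat_pow_closed[of c n]
    by (simp add: r_distr add.m_assoc)
  also have "add_pow R n c \<oplus> t \<otimes> add_pow R n (horner R cs t) = add_pow R n (c \<oplus> t \<otimes> horner R cs t)"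
    using Cons(3) by (simp add: add_pow_rdistr add.nat_pow_distrib)
  finally show ?case by simp
qed simp

lemma horner_taylor:
  assumes "set cs \<subseteq> carrier R" and [simp]: "t \<in> carrier R" "z \<in> carrier R"
  shows "\<exists>r\<in>carrier R. horner R cs (t \<oplus> z) =
    horner R cs t \<oplus> z \<otimes> horner_deriv R cs t \<oplus> (z \<otimes> z) \<otimes> r"
  using assms(1)
proof (induction cs)
  case (Cons c cs)
  then obtain r where [simp]: "r \<in> carrier R" and r: "horner R cs (t \<oplus> z) =
    horner R cs t \<oplus> z \<otimes> horner_deriv R cs t \<oplus> (z \<otimes> z) \<otimes> r" by auto
  have [simp]: "horner R cs t \<in> carrier R" "horner_deriv R cs t \<in> carrier R" "c \<in> carrier R" 
    using Cons by auto
  define E F where "E = horner R cs t" and "F = horner_deriv R cs t"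
  have EF: "E \<in> carrier R" "F \<in> carrier R" by (auto simp: E_def F_def)
  have "c \<oplus> (t \<oplus> z) \<otimes> (E \<oplus> z \<otimes> F \<oplus> (z \<otimes> z) \<otimes> r) =
     (c \<oplus> t \<otimes> E) \<oplus> z \<otimes> (E \<oplus> t \<otimes> F) \<oplus> (z \<otimes> z) \<otimes> (F \<oplus> t \<otimes> r \<oplus> z \<otimes> r)"
    using EF assms(2,3) \<open>r \<in> carrier R\<close> \<open>c \<in> carrier R\<close> by algebra
  then show ?case using r EF by (intro bexI[of _ "F \<oplus> t \<otimes> r \<oplus> z \<otimes> r"]) (auto simp: E_def F_def)
qed (auto intro!: bexI[of _ \<zero>])

lemma horner_shift:
  assumes "set cs \<subseteq> carrier R" and [simp]: "t \<in> carrier R" "z \<in> carrier R"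
  shows "\<exists>r\<in>carrier R. horner R cs (t \<oplus> z) = horner R cs t \<oplus> z \<otimes> r"
proof -
  obtain r where [simp]: "r \<in> carrier R" and r: "horner R cs (t \<oplus> z) =
    horner R cs t \<oplus> z \<otimes> horner_deriv R cs t \<oplus> (z \<otimes> z) \<otimes> r" 
    using horner_taylor[OF assms] by auto
  define E F where "E = horner R cs t" and "F = horner_deriv R cs t"
  have EF: "E \<in> carrier R" "F \<in> carrier R" using assms(1) by (auto simp: E_def F_def)
  have "E \<oplus> z \<otimes> F \<oplus> (z \<otimes> z) \<otimes> r = E \<oplus> z \<otimes> (F \<oplus> z \<otimes> r)"
    using EF assms(2,3) \<open>r \<in> carrier R\<close> by algebra
  with r EF show ?thesis by (intro bexI[of _ "F \<oplus> z \<otimes> r"]) (auto simp: E_def F_def)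
qed

text \<open>The bound \<open>n\<close> on the number of coefficients matters: when \<open>t\<close> satisfies a
  relation of degree \<open>n\<close> with leading coefficient invertible in \<open>C\<close>, every polynomial in \<open>t\<close> can be
  rewritten with at most \<open>n\<close> coefficients.\<close>

definition horner_span :: "'a set \<Rightarrow> 'a \<Rightarrow> nat \<Rightarrow> 'a set" where
  "horner_span C t n = {horner R cs t | cs. set cs \<subseteq> C \<and> length cs \<le> n}"

lemma horner_span_add:
  assumes C: "subring C R" and t: "t \<in> carrier R"
    and x: "x \<in> horner_span C t n" and y: "y \<in> horner_span C t n"
  shows "x \<oplus> y \<in> horner_span C t n"
proof -
  note CC = subringE[OF C]
  have "\<exists>es. set es \<subseteq> C \<and> length es = max (length cs) (length ds) \<and>
        horner R es t = horner R cs t \<oplus> horner R ds t" 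
    if "set cs \<subseteq> C" "set ds \<subseteq> C" for cs ds
    using that
  proof (induction cs arbitrary: ds)
    case Nil
    then show ?case using t CC(1) by (intro exI[of _ ds]) (auto dest: subsetD)
  next
    case (Cons c cs)
    show ?case
    proof (cases ds)
      case Nil
      moreover have "horner R (c # cs) t \<in> carrier R"
        using Cons(2) t CC(1) by (intro horner_closed) auto
      ultimately show ?thesis using Cons(2) by (intro exI[of _ "c # cs"]) auto
    next
      case d: (Cons d ds')
      obtain es where es: "set es \<subseteq> C" "length es = max (length cs) (length ds')"
        "horner R es t = horner R cs t \<oplus> horner R ds' t"
        using Cons.IH[of ds'] Cons.prems d by auto
      have m: "horner R cs t \<in> carrier R" "horner R ds' t \<in> carrier R" "c \<in> carrier R" "d \<in> carrier R"
        using Cons.prems CC(1) d t by auto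
      show ?thesis 
      proof (intro exI[of _ "(c \<oplus> d) # es"] conjI)
        show "set ((c \<oplus> d) # es) \<subseteq> C" using Cons.prems d es(1) CC(7) by auto
        show "length ((c \<oplus> d) # es) = max (length (c # cs)) (length ds)" using d es(2) by simp
        show "horner R ((c \<oplus> d) # es) t = horner R (c # cs) t \<oplus> horner R ds t"
          using m t d es(3) by simp algebra
      qed
    qed
  qed
  note sums = this
  obtain cs ds where cd: "set cs \<subseteq> C" "length cs \<le> n" "x = horner R cs t"
    "set ds \<subseteq> C" "length ds \<le> n" "y = horner R ds t"
    using x y by (auto simp: horner_span_def)
  obtain es where "set es \<subseteq> C" "length es = max (length cs) (length ds)"
    "horner R es t = horner R cs t \<oplus> horner R ds t"
    using sums[OF cd(1,4)] by blast
  then show ?thesis using cd unfolding horner_span_def by (intro CollectI exI[of _ es]) simp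
qed

lemma horner_span_smult:
  assumes C: "subring C R" and t: "t \<in> carrier R" and c: "c \<in> C"
    and x: "x \<in> horner_span C t n"
  shows "c \<otimes> x \<in> horner_span C t n"
proof -
  note CC = subringE[OF C]
  obtain cs where cs: "set cs \<subseteq> C" "length cs \<le> n" "x = horner R cs t"
    using x by (auto simp: horner_span_def)
  have "c \<otimes> horner R cs t = horner R (map ((\<otimes>) c) cs) t" if "set cs \<subseteq> C" for cs
    using that
  proof (induction cs)
    case (Cons a cs)
    then have m: "horner R cs t \<in> carrier R" "c \<in> carrier R" "a \<in> carrier R"
      using CC(1) t c by auto
    have "c \<otimes> (a \<oplus> t \<otimes> horner R cs t) = c \<otimes> a \<oplus> t \<otimes> (c \<otimes> horner R cs t)"
      using m t by algebra
    then show ?case using Cons by simp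
  qed (use c CC(1) in auto)
  then show ?thesis using cs c CC(6) unfolding horner_span_def 
    by (intro CollectI exI[of _ "map ((\<otimes>) c) cs"]) (auto simp: subset_iff)
qed

lemma horner_span_carrier:
  assumes "C \<subseteq> carrier R" "t \<in> carrier R"
  shows "horner_span C t n \<subseteq> carrier R"
  using assms by (auto simp: horner_span_def)

lemma horner_span_const:
  assumes "subring C R" "t \<in> carrier R" "c \<in> C" "0 < n"
  shows "c \<in> horner_span C t n"
  using assms subringE(1)[OF assms(1)] unfolding horner_span_def
  by (intro CollectI exI[of _ "[c]"]) auto

lemma horner_span_shift:
  assumes C: "subring C R" and t: "t \<in> carrier R" and x: "x \<in> horner_span C t n"
  shows "t \<otimes> x \<in> horner_span C t (Suc n)"
proof -
  obtain cs where cs: "set cs \<subseteq> C" "length cs \<le> n" "x = horner R cs t"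
    using x by (auto simp: horner_span_def)
  then have "horner R cs t \<in> carrier R" using subringE(1)[OF C] t by auto
  then show ?thesis using cs t subringE(2)[OF C] unfolding horner_span_def 
    by (intro CollectI exI[of _ "\<zero> # cs"]) auto
qed

definition adjoin :: "'a set \<Rightarrow> 'a \<Rightarrow> 'a set" where
  "adjoin C t = {horner R cs t | cs. set cs \<subseteq> C}"

lemma adjoin_eq: "adjoin C t = (\<Union>n. horner_span C t n)"
  by (auto simp: adjoin_def horner_span_def)

lemma horner_span_mono: "m \<le> n \<Longrightarrow> horner_span C t m \<subseteq> horner_span C t n"
  by (fastforce simp: horner_span_def)

lemma subring_adjoin:
  assumes C: "subring C R" and t: "t \<in> carrier R"
  shows "subring (adjoin C t) R" "C \<subseteq> adjoin C t" "t \<in> adjoin C t"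
proof -
  note CC = subringE[OF C]
  have add: "x \<oplus> y \<in> adjoin C t" if xy: "x \<in> adjoin C t" "y \<in> adjoin C t" for x y
  proof -
    obtain m n where "x \<in> horner_span C t m" "y \<in> horner_span C t n"
      using xy by (auto simp: adjoin_eq)
    then have "x \<in> horner_span C t (max m n)" "y \<in> horner_span C t (max m n)"
      using horner_span_mono[of m "max m n" C t] horner_span_mono[of n "max m n" C t] by auto
    then show ?thesis using horner_span_add[OF C t] by (auto simp: adjoin_eq)
  qed
  have smult: "c \<otimes> x \<in> adjoin C t" if "c \<in> C" "x \<in> adjoin C t" for c x
    using that horner_span_smult[OF C t] by (auto simp: adjoin_eq)
  show sub: "C \<subseteq> adjoin C t"
    using horner_span_const[OF C t, of _ 1] by (auto simp: adjoin_eq)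
  have carr: "adjoin C t \<subseteq> carrier R"
    using horner_span_carrier[OF CC(1) t] by (auto simp: adjoin_eq)
  have shift: "t \<otimes> x \<in> adjoin C t" if "x \<in> adjoin C t" for x
    using that horner_span_shift[OF C t] by (fastforce simp: adjoin_eq)
  have mult: "horner R cs t \<otimes> y \<in> adjoin C t" if "set cs \<subseteq> C" "y \<in> adjoin C t" for cs y
    using that(1)
  proof (induction cs)
    case Nil
    have "y \<in> carrier R" using carr that(2) by blast
    then show ?case using sub CC(2) by auto
  next
    case (Cons c cs)
    then have m: "horner R cs t \<in> carrier R" "c \<in> carrier R" "y \<in> carrier R"
      using CC(1) t that carr by auto
    have "(c \<oplus> t \<otimes> horner R cs t) \<otimes> y = c \<otimes> y \<oplus> t \<otimes> (horner R cs t \<otimes> y)"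
      using m t by algebra
    then show ?case using Cons add smult shift that(2) by simp
  qed
  show "subring (adjoin C t) R"
  proof (rule subringI)
    fix x y assume xy: "x \<in> adjoin C t" "y \<in> adjoin C t"
    then show "x \<oplus> y \<in> adjoin C t" by (rule add)
    from xy show "x \<otimes> y \<in> adjoin C t" using mult by (auto simp: adjoin_def[of C t])
    have "\<ominus> \<one> \<otimes> x \<in> adjoin C t" using smult[of "\<ominus> \<one>" x] CC(3,5) xy by auto
    then show "\<ominus> x \<in> adjoin C t" using xy carr by (auto simp: l_minus)
  qed (use sub CC carr in auto)
  have "t \<otimes> \<one> \<in> adjoin C t" using sub CC(3) by (intro shift) auto
  then show "t \<in> adjoin C t" using t by simp
qed

lemma Units_complement_prime:
  assumes N: "ideal N R" and one: "\<one> \<notin> N" and unit: "\<And>x. x \<in> carrier R - N \<Longrightarrow> x \<in> Units R"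
    and xy: "x \<in> carrier R - N" "y \<in> carrier R - N"
  shows "x \<otimes> y \<in> carrier R - N"
proof
  have "x \<otimes> y \<in> Units R" using unit xy by auto
  then have "inv (x \<otimes> y) \<otimes> (x \<otimes> y) = \<one>" "inv (x \<otimes> y) \<in> carrier R" by auto
  then show "x \<otimes> y \<notin> N" using ideal.I_l_closed[OF N] one by metis
qed (use xy in auto)

text \<open>Newton's iteration \<open>t \<mapsto> t - P(t) / P'(t)\<close> starting at \<open>x\<close>. Every step raises the power
  of \<open>\<epsilon> = P(x)\<close> that divides \<open>P(t)\<close> and changes \<open>t\<close> by an element of \<open>N\<close>, so \<open>P'(t)\<close> stays a unit. As
  \<open>\<epsilon>\<close> is nilpotent, finitely many steps reach a root. The derivative is also given by a list \<open>ds\<close> of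
  coefficients so that its values at \<open>t\<close> and \<open>x\<close> can be compared.\<close>

lemma Newton_root:
  assumes N: "ideal N R" and one: "\<one> \<notin> N"
    and nil: "\<And>x. x \<in> N \<Longrightarrow> \<exists>n::nat. x [^] n = \<zero>"
    and unit: "\<And>x. x \<in> carrier R - N \<Longrightarrow> x \<in> Units R"
    and cs: "set cs \<subseteq> carrier R" and x: "x \<in> carrier R"
    and root: "horner R cs x \<in> N" and simple: "horner_deriv R cs x \<notin> N"
    and ds: "set ds \<subseteq> carrier R" "\<And>t. t \<in> carrier R \<Longrightarrow> horner R ds t = horner_deriv R cs t"
  shows "\<exists>t\<in>carrier R. t \<ominus> x \<in> N \<and> horner R cs t = \<zero>"
proof -
  interpret N: ideal N R by (rule N)
  define \<epsilon> where "\<epsilon> = horner R cs x"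
  have eps: "\<epsilon> \<in> carrier R" "\<epsilon> \<in> N" using cs x root by (auto simp: \<epsilon>_def)
  have step: "\<exists>t\<in>carrier R. \<exists>g\<in>carrier R. t \<ominus> x \<in> N \<and> horner R cs t = \<epsilon> [^] Suc k \<otimes> g" for k
  proof (induction k)
    case 0
    show ?case using x eps(1) by (intro bexI[of _ x] bexI[of _ \<one>]) (auto simp: \<epsilon>_def r_neg minus_eq)
  next
    case (Suc k)
    then obtain t g where t: "t \<in> carrier R" "g \<in> carrier R" "t \<ominus> x \<in> N"
      "horner R cs t = \<epsilon> [^] Suc k \<otimes> g" by blast
    have tx: "t = x \<oplus> (t \<ominus> x)" using t(1) x by algebra
    obtain r where r: "r \<in> carrier R" "horner R ds t = horner R ds x \<oplus> (t \<ominus> x) \<otimes> r"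
      using horner_shift[OF ds(1) x, of "t \<ominus> x"] t(1) x tx by auto
    have dt: "horner_deriv R cs t \<in> carrier R - N"
    proof
      show "horner_deriv R cs t \<notin> N"
      proof
        assume "horner_deriv R cs t \<in> N"
        then have "horner R ds x \<oplus> (t \<ominus> x) \<otimes> r \<in> N" using ds(2) t(1) r by simp
        moreover have "(t \<ominus> x) \<otimes> r \<in> N" using t(3) r(1) by (rule N.I_r_closed)
        ultimately have "(horner R ds x \<oplus> (t \<ominus> x) \<otimes> r) \<oplus> \<ominus> ((t \<ominus> x) \<otimes> r) \<in> N"
          using N.a_closed N.a_inv_closed by blast
        moreover have "horner R ds x \<in> carrier R" using ds(1) x by (rule horner_closed)
        ultimately show False using simple ds(2) x t(1) r(1)
          by (simp add: add.m_assoc r_neg)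
      qed
    qed (use cs t in auto)
    define w where "w = inv (horner_deriv R cs t)"
    have w: "w \<in> carrier R" "w \<otimes> horner_deriv R cs t = \<one>" using unit[OF dt] by (auto simp: w_def)
    define z where "z = \<ominus> (horner R cs t \<otimes> w)"
    have ht: "horner R cs t \<in> carrier R" "horner_deriv R cs t \<in> carrier R" using cs t(1) by auto
    have z: "z \<in> carrier R" using ht w by (simp add: z_def)
    have ek: "\<epsilon> [^] k \<in> carrier R" using eps(1) by simp
    have "z = \<epsilon> \<otimes> \<ominus> (\<epsilon> [^] k \<otimes> g \<otimes> w)"
      unfolding z_def t(4) nat_pow_Suc using ek eps(1) t(2) w(1) by algebra
    then have zN: "z \<in> N" using N.I_r_closed[OF eps(2)] ek t(2) w(1) by simp
    obtain s where s: "s \<in> carrier R" "horner R cs (t \<oplus> z) =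
        horner R cs t \<oplus> z \<otimes> horner_deriv R cs t \<oplus> (z \<otimes> z) \<otimes> s"
      using horner_taylor[OF cs t(1) z] by blast
    have "horner R cs t \<oplus> z \<otimes> horner_deriv R cs t = horner R cs t \<oplus> \<ominus> (horner R cs t \<otimes> (w \<otimes> horner_deriv R cs t))"
      unfolding z_def using ht w(1) by algebra
    also have "\<dots> = \<zero>" using ht w by (simp add: r_neg)
    finally have "horner R cs (t \<oplus> z) = (z \<otimes> z) \<otimes> s" using s z by simp
    also have "\<dots> = \<epsilon> [^] Suc (Suc k) \<otimes> (\<epsilon> [^] k \<otimes> g \<otimes> g \<otimes> w \<otimes> w \<otimes> s)"
      unfolding z_def t(4) nat_pow_Suc using ek eps(1) t(2) w(1) s(1) by algebra
    finally have "horner R cs (t \<oplus> z) = \<epsilon> [^] Suc (Suc k) \<otimes> (\<epsilon> [^] k \<otimes> g \<otimes> g \<otimes> w \<otimes> w \<otimes> s)" .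
    moreover have "t \<oplus> z \<ominus> x = (t \<ominus> x) \<oplus> z" using t(1) z x by algebra
    then have "t \<oplus> z \<ominus> x \<in> N" using t(3) zN by simp
    ultimately show ?case using t(1,2) z ek w(1) s(1) 
      by (intro bexI[of _ "t \<oplus> z"] bexI[of _ "\<epsilon> [^] k \<otimes> g \<otimes> g \<otimes> w \<otimes> w \<otimes> s"]) auto
  qed
  obtain n :: nat where n: "\<epsilon> [^] n = \<zero>" using nil eps(2) by blast
  obtain t g where t: "t \<in> carrier R" "g \<in> carrier R" "t \<ominus> x \<in> N" "horner R cs t = \<epsilon> [^] Suc n \<otimes> g"
    using step[of n] by blast
  have "horner R cs t = \<zero>" unfolding t(4) nat_pow_Suc using n eps(1) t(2) by simp
  with t show ?thesis by blast
qed


text \<open>Take a maximal subring \<open>C\<close> that meets \<open>N\<close> only in zero. It is closed under inverses,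
  because adjoining \<open>1/c\<close> creates no new element of \<open>N\<close>. For an element \<open>x\<close> that satisfies no
  polynomial relation over \<open>C\<close> modulo \<open>N\<close>, the ring \<open>C[x]\<close> meets \<open>N\<close> in zero, so \<open>x \<in> C\<close> by maximality.
  Otherwise a relation of minimal degree has a derivative at \<open>x\<close> outside \<open>N\<close>, characteristic zero being
  used here, and lifts to an exact root \<open>t\<close> with the same residue as \<open>x\<close>. Polynomials in \<open>t\<close> reduce to
  degrees below the minimal one, so \<open>C[t]\<close> meets \<open>N\<close> in zero and \<open>t \<in> C\<close>.\<close>

theorem coefficient_field:
  assumes N: "ideal N R" and one: "\<one> \<notin> N"
    and nil: "\<And>x. x \<in> N \<Longrightarrow> \<exists>n::nat. x [^] n = \<zero>"
    and unit: "\<And>x. x \<in> carrier R - N \<Longrightarrow> x \<in> Units R"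
    and char: "\<And>n::nat. n > 0 \<Longrightarrow> add_pow R n \<one> \<notin> N"
  shows "\<exists>C. subring C R \<and> C \<inter> N = {\<zero>} \<and> (\<forall>c\<in>C - {\<zero>}. \<exists>d\<in>C. c \<otimes> d = \<one>) \<and>
    (\<forall>x\<in>carrier R. \<exists>c\<in>C. x \<ominus> c \<in> N)"
proof -
  interpret N: ideal N R by (rule N)
  define \<A> where "\<A> = {C. subring C R \<and> C \<inter> N \<subseteq> {\<zero>}}"
  have prime: "x \<otimes> y \<notin> N" if "x \<in> carrier R" "x \<notin> N" "y \<in> carrier R" "y \<notin> N" for x y
  proof -
    have "x \<otimes> y \<in> carrier R - N"
      by (rule Units_complement_prime[OF N one]) (use unit that in auto)
    then show ?thesis by simp
  qed
  \<comment> \<open>the image of the integers is a member, by the assumption on the characteristic\<close>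
  have "range (\<lambda>n::int. add_pow R n \<one>) \<in> \<A>"
  proof -
    have "subring (range (\<lambda>n::int. add_pow R n \<one>)) R"
    proof (rule subringI)
      show "\<one> \<in> range (\<lambda>n::int. add_pow R n \<one>)" by (rule range_eqI[of _ _ 1]) (simp add: add.int_pow_1)
      fix x y assume "x \<in> range (\<lambda>n::int. add_pow R n \<one>)" "y \<in> range (\<lambda>n::int. add_pow R n \<one>)"
      then obtain m n :: int where mn: "x = add_pow R m \<one>" "y = add_pow R n \<one>" by blast
      show "x \<oplus> y \<in> range (\<lambda>n::int. add_pow R n \<one>)"
        unfolding mn by (rule range_eqI[of _ _ "m + n"]) (simp add: add.int_pow_mult)
      show "x \<otimes> y \<in> range (\<lambda>n::int. add_pow R n \<one>)"
        unfolding mn by (rule range_eqI[of _ _ "n * m"]) (simp add: add_pow_ldistr_int add.int_pow_pow)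
      show "\<ominus> x \<in> range (\<lambda>n::int. add_pow R n \<one>)"
        unfolding mn by (rule range_eqI[of _ _ "- m"]) (simp add: add.int_pow_neg)
    qed auto
    moreover have "add_pow R n \<one> = \<zero>" if "add_pow R n \<one> \<in> N" for n :: int
    proof (rule ccontr)
      assume "add_pow R n \<one> \<noteq> \<zero>"
      then have n0: "n \<noteq> 0" using add_pow_int_ge[of 0 R \<one>] by auto
      have "add_pow R (nat \<bar>n\<bar>) \<one> \<in> N"
      proof (cases "n \<ge> 0")
        case True
        then show ?thesis using that add_pow_int_ge[of n R \<one>] by simp
      next
        case False
        then have "add_pow R n \<one> = \<ominus> (add_pow R (nat \<bar>n\<bar>) \<one>)"
          using add_pow_int_lt[of n R \<one>] by simp
        then have "add_pow R (nat \<bar>n\<bar>) \<one> = \<ominus> (add_pow R n \<one>)" by simp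
        then show ?thesis using that N.a_inv_closed by simp
      qed
      then show False using char[of "nat \<bar>n\<bar>"] n0 by simp
    qed
    ultimately show ?thesis by (auto simp: \<A>_def)
  qed
  then have ne: "\<A> \<noteq> {}" by blast
  have chain: "\<Union>\<C> \<in> \<A>" if "\<C> \<noteq> {}" "subset.chain \<A> \<C>" for \<C>
  proof -
    have sub: "\<And>C. C \<in> \<C> \<Longrightarrow> subring C R \<and> C \<inter> N \<subseteq> {\<zero>}"
      and tot: "\<And>C D. C \<in> \<C> \<Longrightarrow> D \<in> \<C> \<Longrightarrow> C \<subseteq> D \<or> D \<subseteq> C"
      using that(2) by (auto simp: subset_chain_def \<A>_def)
    have "subring (\<Union>\<C>) R"
    proof (rule subringI)
      show "\<Union>\<C> \<subseteq> carrier R" 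
        by (rule Union_least) (rule subringE(1)[OF conjunct1[OF sub]])
      from \<open>\<C> \<noteq> {}\<close> obtain C where "C \<in> \<C>" by auto
      then show "\<one> \<in> \<Union>\<C>" using sub[of C] subringE(3)[of C R] by (intro UnionI[of C]) auto
      fix x assume x: "x \<in> \<Union>\<C>"
      then obtain C where C: "C \<in> \<C>" "x \<in> C" by auto
      then show "\<ominus> x \<in> \<Union>\<C>" using sub[of C] subringE(5)[of C R x] by (intro UnionI[of C]) auto
      fix y assume "y \<in> \<Union>\<C>"
      then obtain D where D: "D \<in> \<C>" "y \<in> D" by auto
      obtain E where E: "E \<in> \<C>" "x \<in> E" "y \<in> E" using tot[OF C(1) D(1)] C D by auto
      then show "x \<oplus> y \<in> \<Union>\<C>" "x \<otimes> y \<in> \<Union>\<C>" 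
        using sub[of E] subringE(6,7)[of E R x y] by (auto intro: UnionI[of E])
    qed
    then show ?thesis using sub by (auto simp: \<A>_def)
  qed
  obtain C where C: "C \<in> \<A>" and max: "\<And>D. D \<in> \<A> \<Longrightarrow> C \<subseteq> D \<Longrightarrow> D = C"
    using subset_Zorn_nonempty[OF ne chain] by blast
  have subC: "subring C R" and CN: "C \<inter> N \<subseteq> {\<zero>}" using C by (auto simp: \<A>_def)
  note CC = subringE[OF subC]
  have CNz: "c \<notin> N" if "c \<in> C" "c \<noteq> \<zero>" for c using that CN by auto
  \<comment> \<open>a power of \<open>c\<close> moves any element of \<open>C[1/c]\<close> into \<open>C\<close>, and being a unit it does not change membership in \<open>N\<close>\<close>
  have inverse: "\<exists>d\<in>C. c \<otimes> d = \<one>" if c: "c \<in> C" "c \<noteq> \<zero>" for c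
  proof -
    have uc: "c \<in> Units R" using unit[of c] CNz[OF c] c CC(1) by blast
    have u: "inv c \<in> carrier R" "c \<otimes> inv c = \<one>" "c \<in> carrier R" using uc by auto
    have "adjoin C (inv c) \<in> \<A>"
    proof -
      have "\<exists>n::nat. c [^] n \<otimes> horner R cs (inv c) \<in> C" if "set cs \<subseteq> C" for cs
        using that
      proof (induction cs)
        case Nil
        have "c [^] (0::nat) \<otimes> horner R [] (inv c) \<in> C" using CC(2) by simp
        then show ?case by blast
      next
        case (Cons a cs)
        then obtain n :: nat where n: "c [^] n \<otimes> horner R cs (inv c) \<in> C" by auto
        have m: "horner R cs (inv c) \<in> carrier R" "a \<in> carrier R" "c [^] n \<in> carrier R"
          using Cons.prems CC(1) u by auto
        have cn: "c [^] n \<in> C" using c(1) CC(3,6) by (induction n) auto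
        have "(c [^] n \<otimes> c) \<otimes> (a \<oplus> inv c \<otimes> horner R cs (inv c)) 
            = (c [^] n \<otimes> c) \<otimes> a \<oplus> (c \<otimes> inv c) \<otimes> (c [^] n \<otimes> horner R cs (inv c))"
          using m u(1,3) by algebra
        also have "\<dots> = (c [^] n \<otimes> c) \<otimes> a \<oplus> c [^] n \<otimes> horner R cs (inv c)"
          using m u by simp
        also have "\<dots> \<in> C" using n cn c(1) Cons.prems CC(6,7) by simp
        finally have "c [^] Suc n \<otimes> horner R (a # cs) (inv c) \<in> C" by simp
        then show ?case by blast
      qed
      moreover have "y = \<zero>" if y: "y \<in> N" "c [^] n \<otimes> y \<in> C" for y and n :: nat
      proof -
        have yR: "y \<in> carrier R" using y N.Icarr by auto
        have "c [^] n \<otimes> y \<in> N" using N.I_l_closed[OF y(1)] u(3) by simp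
        then have *: "c [^] n \<otimes> y = \<zero>" using y(2) CN by auto
        have "inv c [^] n \<otimes> c [^] n = \<one>"
          using u by (simp add: m_comm nat_pow_distrib[symmetric])
        then have "y = inv c [^] n \<otimes> (c [^] n \<otimes> y)" using yR u
          by (simp add: m_assoc[symmetric])
        then show ?thesis using * u by simp
      qed
      ultimately have "adjoin C (inv c) \<inter> N \<subseteq> {\<zero>}" by (auto simp: adjoin_def)
      then show ?thesis using subring_adjoin(1)[OF subC u(1)] by (auto simp: \<A>_def)
    qed
    then have "adjoin C (inv c) = C" using max[OF _ subring_adjoin(2)[OF subC u(1)]] by simp
    then have "inv c \<in> C" using subring_adjoin(3)[OF subC u(1)] by simp
    then show ?thesis using u by blast
  qed
  have surj: "\<exists>c\<in>C. x \<ominus> c \<in> N" if x: "x \<in> carrier R" for x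
  proof (cases "\<exists>cs. set cs \<subseteq> C \<and> \<not> set cs \<subseteq> {\<zero>} \<and> horner R cs x \<in> N")
    case False
    have "adjoin C x \<inter> N \<subseteq> {\<zero>}"
    proof
      fix y assume "y \<in> adjoin C x \<inter> N"
      then obtain cs where "set cs \<subseteq> C" "y = horner R cs x" "y \<in> N" by (auto simp: adjoin_def)
      then show "y \<in> {\<zero>}" using False horner_zeros[OF _ x, of cs] by auto
    qed
    then have "adjoin C x \<in> \<A>" using subring_adjoin(1)[OF subC x] by (auto simp: \<A>_def)
    then have "adjoin C x = C" using max[OF _ subring_adjoin(2)[OF subC x]] by simp
    then have "x \<in> C" using subring_adjoin(3)[OF subC x] by simp
    moreover have "x \<ominus> x \<in> N" using x by (simp add: minus_eq r_neg)
    ultimately show ?thesis by blast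
  next
    case True
    let ?P = "\<lambda>cs. set cs \<subseteq> C \<and> \<not> set cs \<subseteq> {\<zero>} \<and> horner R cs x \<in> N"
    obtain cs where cs: "?P cs" and least: "\<And>ds. ?P ds \<Longrightarrow> length cs \<le> length ds"
      using ex_has_least_nat[of ?P _ length] True by blast
    have small: "set ds \<subseteq> {\<zero>}" if "set ds \<subseteq> C" "length ds < length cs" "horner R ds x \<in> N" for ds
      using least[of ds] that by linarith
    have csR: "set cs \<subseteq> carrier R" using cs CC(1) by blast
    have "cs \<noteq> []" using cs by auto
    then obtain cs0 l where cs0: "cs = cs0 @ [l]" by (metis rev_exhaust)
    have l: "l \<in> C" "set cs0 \<subseteq> C" "l \<in> carrier R" "set cs0 \<subseteq> carrier R" using cs csR cs0 by auto
    have l0: "l \<noteq> \<zero>"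
    proof
      assume l0: "l = \<zero>"
      have "horner R cs0 x \<in> N" using cs horner_append[OF l(4,3) x] l x cs0 by (simp add: l0)
      then have "set cs0 \<subseteq> {\<zero>}" using small[of cs0] cs0 l(2) by simp
      then show False using cs cs0 l0 by auto
    qed
    have ne0: "cs0 \<noteq> []"
    proof
      assume "cs0 = []"
      then have "horner R cs x = l" using cs0 l x by simp
      then show False using cs CNz[OF l(1) l0] by simp
    qed
    obtain c' cs' where cs': "cs = c' # cs'" using \<open>cs \<noteq> []\<close> by (cases cs) auto
    define ds where "ds = weighted_coeffs R 1 cs'"
    have cs'ne: "cs' \<noteq> []" "last cs' = l" using cs' cs0 ne0 by (auto simp: append_eq_Cons_conv Cons_eq_append_conv)
    have weighted: "set (weighted_coeffs R n es) \<subseteq> C" if "set es \<subseteq> C" for n es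
      using that
    proof (induction es arbitrary: n)
      case (Cons e es)
      have "add_pow R n e \<in> C" using Cons.prems CC(2,7) by (induction n) auto
      then show ?case using Cons by auto
    qed simp
    have dsC: "set ds \<subseteq> C" using weighted[of cs' 1] cs cs' by (auto simp: ds_def)
    have dsd: "horner R ds t = horner_deriv R cs t" if "t \<in> carrier R" for t
      using horner_weighted_coeffs[of cs' t 1] csR cs' that by (simp add: ds_def)
    \<comment> \<open>the derivative has fewer coefficients, so it would vanish identically by minimality; but its leading coefficient is a positive multiple of \<open>l \<noteq> 0\<close>\<close>
    have "horner_deriv R cs x \<notin> N"
    proof
      assume "horner_deriv R cs x \<in> N"
      then have "horner R ds x \<in> N" using dsd x by simp
      then have "set ds \<subseteq> {\<zero>}" using small[of ds] dsC cs' by (simp add: ds_def)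
      moreover have "ds \<noteq> []" using cs'ne(1) by (metis ds_def length_weighted_coeffs length_0_conv)
      ultimately have "last ds = \<zero>" using last_in_set by blast
      then have "add_pow R (length cs') l = \<zero>"
        using last_weighted_coeffs[OF cs'ne(1), of R 1] cs'ne(2) by (simp add: ds_def)
      then have "add_pow R (length cs') \<one> \<otimes> l = \<zero>" using l(3) by (simp add: add_pow_ldistr)
      moreover have "add_pow R (length cs') \<one> \<otimes> l \<notin> N"
        using prime[OF _ char l(3) CNz[OF l(1) l0]] cs'ne(1) by simp
      ultimately show False by simp
    qed
    then have "\<exists>t\<in>carrier R. t \<ominus> x \<in> N \<and> horner R cs t = \<zero>"
      using cs dsC CC(1) by (intro Newton_root[OF N one nil unit csR x _ _ _ dsd]) auto
    then obtain t where t: "t \<in> carrier R" "t \<ominus> x \<in> N" "horner R cs t = \<zero>" by auto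
    define n where "n = length cs0"
    have n: "0 < n" using ne0 by (simp add: n_def)
    have neg: "\<ominus> y \<in> horner_span C t n" if "y \<in> horner_span C t n" for y
    proof -
      have "y \<in> carrier R" using horner_span_carrier[OF CC(1) t(1)] that by auto
      then show ?thesis using horner_span_smult[OF subC t(1) _ that, of "\<ominus> \<one>"] CC(3,5)
        by (simp add: l_minus)
    qed
    \<comment> \<open>the relation solved for its leading term\<close>
    have tn: "t [^] n \<in> horner_span C t n"
    proof -
      obtain d where d: "d \<in> C" "l \<otimes> d = \<one>" using inverse[OF l(1) l0] by blast
      have h: "horner R cs0 t \<in> carrier R" "t [^] n \<in> carrier R" "d \<in> carrier R"
        using l t(1) d CC(1) by auto
      have "horner R cs0 t \<oplus> t [^] n \<otimes> l = \<zero>" 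
        using t(3) horner_append[OF l(4,3) t(1)] by (simp add: cs0 n_def)
      moreover have "t [^] n = t [^] n \<otimes> (l \<otimes> d)" using d h by simp
      moreover have "t [^] n \<otimes> (l \<otimes> d) = d \<otimes> (horner R cs0 t \<oplus> t [^] n \<otimes> l) \<oplus> \<ominus> (d \<otimes> horner R cs0 t)"
        using h l(3) by algebra
      ultimately have "t [^] n = \<ominus> (d \<otimes> horner R cs0 t)" using h by simp
      moreover have "horner R cs0 t \<in> horner_span C t n" using l(2) by (auto simp: horner_span_def n_def)
      ultimately show ?thesis using neg horner_span_smult[OF subC t(1) d(1)] by simp
    qed
    have shift: "t \<otimes> y \<in> horner_span C t n" if y: "y \<in> horner_span C t n" for y
    proof -
      obtain es where es: "set es \<subseteq> C" "length es \<le> n" "y = horner R es t"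
        using y by (auto simp: horner_span_def)
      show ?thesis
      proof (cases "length es < n")
        case True
        then have "y \<in> horner_span C t (length es)" using es by (auto simp: horner_span_def)
        then show ?thesis using horner_span_shift[OF subC t(1)] horner_span_mono[of "Suc (length es)" n C t] True
          by auto
      next
        case False
        then have len: "length es = n" using es by simp
        then obtain es0 m where es0: "es = es0 @ [m]" using n by (metis length_0_conv not_less0 rev_exhaust)
        have m: "m \<in> C" "set es0 \<subseteq> C" "m \<in> carrier R" "set es0 \<subseteq> carrier R" "length (\<zero> # es0) = n"
          using es es0 CC(1) len by auto
        have h: "horner R es0 t \<in> carrier R" "t [^] length es0 \<in> carrier R" using m t(1) by auto
        have "t \<otimes> y = t \<otimes> (horner R es0 t \<oplus> t [^] length es0 \<otimes> m)"
          using horner_append[OF m(4,3) t(1)] es(3) es0 by simp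
        also have "\<dots> = t \<otimes> horner R es0 t \<oplus> m \<otimes> (t [^] length es0 \<otimes> t)"
          using h t(1) m(3) by algebra
        also have "\<dots> = horner R (\<zero> # es0) t \<oplus> m \<otimes> t [^] n" using h t(1) m(5) by auto
        also have "\<dots> \<in> horner_span C t n"
        proof (rule horner_span_add[OF subC t(1)])
          show "horner R (\<zero> # es0) t \<in> horner_span C t n"
            using m CC(2) unfolding horner_span_def by (intro CollectI exI[of _ "\<zero> # es0"]) auto
          show "m \<otimes> t [^] n \<in> horner_span C t n" by (rule horner_span_smult[OF subC t(1) m(1) tn])
        qed
        finally show ?thesis .
      qed
    qed
    have all: "horner R es t \<in> horner_span C t n" if "set es \<subseteq> C" for es
      using that
    proof (induction es)
      case Nil
      show ?case using horner_span_const[OF subC t(1) CC(2) n] by simp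
    next
      case (Cons e es)
      have "e \<in> horner_span C t n" using horner_span_const[OF subC t(1) _ n] Cons.prems by simp
      then show ?case using horner_span_add[OF subC t(1)] shift Cons by simp
    qed
    have "adjoin C t \<inter> N \<subseteq> {\<zero>}"
    proof
      fix y assume y: "y \<in> adjoin C t \<inter> N"
      then obtain fs where "set fs \<subseteq> C" "y = horner R fs t" by (auto simp: adjoin_def)
      then have "y \<in> horner_span C t n" using all by simp
      then obtain es where es: "set es \<subseteq> C" "length es \<le> n" "y = horner R es t"
        by (auto simp: horner_span_def)
      have esR: "set es \<subseteq> carrier R" using es(1) CC(1) by blast
      have zN: "\<ominus> (t \<ominus> x) \<in> N" "\<ominus> (t \<ominus> x) \<in> carrier R" using t x by auto
      obtain r where r: "r \<in> carrier R" "horner R es (t \<oplus> \<ominus> (t \<ominus> x)) = horner R es t \<oplus> \<ominus> (t \<ominus> x) \<otimes> r"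
        using horner_shift[OF esR t(1) zN(2)] by blast
      have "t \<oplus> \<ominus> (t \<ominus> x) = x" using t(1) x by algebra
      then have "horner R es x \<in> N" using r y es(3) N.I_r_closed[OF zN(1) r(1)] by simp
      then have "set es \<subseteq> {\<zero>}" using small[OF es(1)] es(2) cs0 by (simp add: n_def)
      then show "y \<in> {\<zero>}" using horner_zeros t(1) es(3) by simp
    qed
    then have "adjoin C t \<in> \<A>" using subring_adjoin(1)[OF subC t(1)] by (auto simp: \<A>_def)
    then have "adjoin C t = C" using max[OF _ subring_adjoin(2)[OF subC t(1)]] by simp
    then have "t \<in> C" using subring_adjoin(3)[OF subC t(1)] by simp
    moreover have "x \<ominus> t = \<ominus> (t \<ominus> x)" using t(1) x by algebra
    then have "x \<ominus> t \<in> N" using t by simp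
    ultimately show ?thesis by blast
  qed
  show ?thesis using subC CN CC(2) inverse surj by (intro exI[of _ C]) auto
qed

end


section \<open>Triangular bases and traces\<close>

definition filtration_span :: "('a, 'b) ring_scheme \<Rightarrow> 'a set \<Rightarrow> (nat \<Rightarrow> 'a) \<Rightarrow> nat \<Rightarrow> 'a set" where
  "filtration_span R C e k = {\<Oplus>\<^bsub>R\<^esub>i\<in>{..<k}. c i \<otimes>\<^bsub>R\<^esub> e i | c. c \<in> {..<k} \<rightarrow> C}"

text \<open>\<open>C\<close> maps isomorphically onto the residue field \<open>R/N\<close>, and every ideal of \<open>R\<close> is a vector
  space over it. An ideal of \<open>R\<close> that is not killed by \<open>N\<close> is not a vector space over \<open>R/N\<close> by itself.\<close>

locale coefficient_subfield = cring R for R (structure) +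
  fixes C N
  assumes subring_C: "subring C R" and ideal_N: "ideal N R"
    and C_inter_N: "C \<inter> N = {\<zero>}"
    and C_inverse: "\<And>c. c \<in> C \<Longrightarrow> c \<noteq> \<zero> \<Longrightarrow> \<exists>d\<in>C. c \<otimes> d = \<one>"
    and C_plus_N: "\<And>x. x \<in> carrier R \<Longrightarrow> \<exists>c\<in>C. x \<ominus> c \<in> N"
begin

lemmas C_props = subringE[OF subring_C]

lemma C_carrier [simp]: "c \<in> C \<Longrightarrow> c \<in> carrier R"
  using C_props(1) by auto

lemma decompose:
  assumes "x \<in> carrier R"
  obtains c n where "c \<in> C" "n \<in> N" "n \<in> carrier R" "x = c \<oplus> n"
proof -
  obtain c where c: "c \<in> C" "x \<ominus> c \<in> N" using C_plus_N assms by blast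
  have "c \<in> carrier R" using c by simp
  then have "x = c \<oplus> (x \<ominus> c)" using assms by algebra
  then show thesis using that[of c "x \<ominus> c"] c assms \<open>c \<in> carrier R\<close> by simp
qed

abbreviation "tspan \<equiv> filtration_span R C"

lemma span_0 [simp]: "tspan e 0 = {\<zero>}"
  by (auto simp: filtration_span_def)

lemma span_Suc:
  assumes "e \<in> {..<Suc k} \<rightarrow> carrier R"
  shows "tspan e (Suc k) = {y \<oplus> c \<otimes> e k | y c. y \<in> tspan e k \<and> c \<in> C}"
proof -
  have *: "(\<Oplus>i\<in>{..<Suc k}. c i \<otimes> e i) = (\<Oplus>i\<in>{..<k}. c i \<otimes> e i) \<oplus> c k \<otimes> e k"
    if "c \<in> {..<Suc k} \<rightarrow> C" for c
    using that assms by (intro finsum_lessThan_Suc) (auto simp: Pi_iff)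
  show ?thesis
  proof (intro equalityI subsetI)
    fix y assume "y \<in> tspan e (Suc k)"
    then obtain c where c: "c \<in> {..<Suc k} \<rightarrow> C" "y = (\<Oplus>i\<in>{..<Suc k}. c i \<otimes> e i)"
      by (auto simp: filtration_span_def)
    then have "y = (\<Oplus>i\<in>{..<k}. c i \<otimes> e i) \<oplus> c k \<otimes> e k" "c k \<in> C" "c \<in> {..<k} \<rightarrow> C"
      using * by auto
    then show "y \<in> {y \<oplus> c \<otimes> e k | y c. y \<in> tspan e k \<and> c \<in> C}"
      by (auto simp: filtration_span_def)
  next
    fix x assume "x \<in> {y \<oplus> c \<otimes> e k | y c. y \<in> tspan e k \<and> c \<in> C}"
    then obtain c b where c: "c \<in> {..<k} \<rightarrow> C" "b \<in> C" "x = (\<Oplus>i\<in>{..<k}. c i \<otimes> e i) \<oplus> b \<otimes> e k"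
      by (auto simp: filtration_span_def)
    have "(\<Oplus>i\<in>{..<k}. c i \<otimes> e i) = (\<Oplus>i\<in>{..<k}. (c(k := b)) i \<otimes> e i)"
      using c assms by (intro finsum_cong') (auto simp: Pi_iff)
    moreover have "c(k := b) \<in> {..<Suc k} \<rightarrow> C" using c by (auto simp: less_Suc_eq)
    ultimately have "x = (\<Oplus>i\<in>{..<Suc k}. (c(k := b)) i \<otimes> e i)" using c *[of "c(k := b)"] by simp
    then show "x \<in> tspan e (Suc k)" using \<open>c(k := b) \<in> {..<Suc k} \<rightarrow> C\<close> 
      unfolding filtration_span_def by blast
  qed
qed

lemma span_carrier: "e \<in> {..<k} \<rightarrow> carrier R \<Longrightarrow> tspan e k \<subseteq> carrier R"
  unfolding filtration_span_def by (auto intro!: finsum_closed simp: Pi_iff)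

lemma span_cong: "(\<And>i. i < k \<Longrightarrow> e i = f i) \<Longrightarrow> f \<in> {..<k} \<rightarrow> carrier R \<Longrightarrow> tspan e k = tspan f k"
proof -
  assume a: "\<And>i. i < k \<Longrightarrow> e i = f i" "f \<in> {..<k} \<rightarrow> carrier R"
  have "(\<Oplus>i\<in>{..<k}. c i \<otimes> e i) = (\<Oplus>i\<in>{..<k}. c i \<otimes> f i)" if "c \<in> {..<k} \<rightarrow> C" for c
    using a that by (intro finsum_cong') (auto simp: Pi_iff)
  then show ?thesis unfolding filtration_span_def by (metis (no_types, lifting))
qed

lemma span_closed:
  assumes "e \<in> {..<k} \<rightarrow> carrier R"
  shows "\<zero> \<in> tspan e k"
    and "x \<in> tspan e k \<Longrightarrow> y \<in> tspan e k \<Longrightarrow> x \<oplus> y \<in> tspan e k"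
    and "c \<in> C \<Longrightarrow> y \<in> tspan e k \<Longrightarrow> c \<otimes> y \<in> tspan e k"
    and "y \<in> tspan e k \<Longrightarrow> \<ominus> y \<in> tspan e k"
proof -
  show "\<zero> \<in> tspan e k"
  proof -
    have "(\<Oplus>i\<in>{..<k}. \<zero> \<otimes> e i) = (\<Oplus>i\<in>{..<k}. \<zero>)" using assms by (intro finsum_cong') (auto simp: Pi_iff)
    then have "\<zero> = (\<Oplus>i\<in>{..<k}. \<zero> \<otimes> e i)" by simp
    then show ?thesis unfolding filtration_span_def
      using C_props(2) by (intro CollectI exI[of _ "\<lambda>_. \<zero>"]) auto
  qed
  show "x \<in> tspan e k \<Longrightarrow> y \<in> tspan e k \<Longrightarrow> x \<oplus> y \<in> tspan e k"
  proof -
    assume "x \<in> tspan e k" "y \<in> tspan e k"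
    then obtain a b where ab: "a \<in> {..<k} \<rightarrow> C" "b \<in> {..<k} \<rightarrow> C"
      "x = (\<Oplus>i\<in>{..<k}. a i \<otimes> e i)" "y = (\<Oplus>i\<in>{..<k}. b i \<otimes> e i)"
      by (auto simp: filtration_span_def)
    have "x \<oplus> y = (\<Oplus>i\<in>{..<k}. a i \<otimes> e i \<oplus> b i \<otimes> e i)"
      unfolding ab using ab assms by (intro finsum_addf[symmetric]) (auto simp: Pi_iff)
    also have "\<dots> = (\<Oplus>i\<in>{..<k}. (a i \<oplus> b i) \<otimes> e i)"
      using ab assms by (intro finsum_cong') (auto simp: Pi_iff l_distr)
    finally show ?thesis using ab C_props(7) unfolding filtration_span_def
      by (intro CollectI exI[of _ "\<lambda>i. a i \<oplus> b i"]) (auto simp: Pi_iff)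
  qed
  show sm: "c \<otimes> y \<in> tspan e k" if "c \<in> C" and y: "y \<in> tspan e k" for c y
  proof -
    obtain b where b: "b \<in> {..<k} \<rightarrow> C" "y = (\<Oplus>i\<in>{..<k}. b i \<otimes> e i)"
      using y by (auto simp: filtration_span_def)
    have "c \<otimes> y = (\<Oplus>i\<in>{..<k}. c \<otimes> (b i \<otimes> e i))"
      unfolding b using b assms that by (intro finsum_rdistr) (auto simp: Pi_iff)
    also have "\<dots> = (\<Oplus>i\<in>{..<k}. (c \<otimes> b i) \<otimes> e i)"
      using b assms that by (intro finsum_cong') (auto simp: Pi_iff m_assoc)
    finally show ?thesis using b that C_props(6) unfolding filtration_span_def
      by (intro CollectI exI[of _ "\<lambda>i. c \<otimes> b i"]) (auto simp: Pi_iff)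
  qed
  show "y \<in> tspan e k \<Longrightarrow> \<ominus> y \<in> tspan e k"
    using sm[of "\<ominus> \<one>" y] C_props(3,5) span_carrier[OF assms] by (auto simp: l_minus subset_iff)
qed

lemma span_mono:
  assumes "k \<le> l" "e \<in> {..<l} \<rightarrow> carrier R"
  shows "tspan e k \<subseteq> tspan e l"
  using assms
proof (induction l rule: dec_induct)
  case (step l)
  have l: "e \<in> {..<l} \<rightarrow> carrier R" "e l \<in> carrier R" using step.prems by auto
  have "y \<in> tspan e (Suc l)" if "y \<in> tspan e l" for y
  proof -
    have "y = y \<oplus> \<zero> \<otimes> e l" using that span_carrier[OF l(1)] l(2) by auto
    then show ?thesis unfolding span_Suc[OF step.prems] using that C_props(2) by blast
  qed
  then show ?case using step.IH[OF l(1)] by blast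
qed simp

lemma span_base:
  assumes "k < l" "e \<in> {..<l} \<rightarrow> carrier R"
  shows "e k \<in> tspan e l"
proof -
  have k: "e \<in> {..<Suc k} \<rightarrow> carrier R" "e k \<in> carrier R" "e \<in> {..<k} \<rightarrow> carrier R" using assms by auto
  then have "e k = \<zero> \<oplus> \<one> \<otimes> e k" by simp
  then have "e k \<in> tspan e (Suc k)" 
    unfolding span_Suc[OF k(1)] using span_closed(1)[OF k(3)] C_props(3) by blast
  then show ?thesis using span_mono[of "Suc k" l e] assms by auto
qed

text \<open>The spans of initial segments form a composition series: they are ideals
  (see \<open>triangular_ideal\<close>), and each quotient is a copy of the residue field, generated by \<open>e\<^sub>k\<close>.\<close>

definition triangular :: "(nat \<Rightarrow> 'a) \<Rightarrow> nat \<Rightarrow> bool" where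
  "triangular e d \<longleftrightarrow> e \<in> {..<d} \<rightarrow> carrier R \<and>
     (\<forall>k<d. e k \<notin> tspan e k \<and> (\<forall>n\<in>N. n \<otimes> e k \<in> tspan e k))"

lemma triangular_carrier:
  "triangular e d \<Longrightarrow> k \<le> d \<Longrightarrow> e \<in> {..<k} \<rightarrow> carrier R"
  by (auto simp: triangular_def)

text \<open>Split a scalar as \<open>b + n\<close> with \<open>b \<in> C\<close> and \<open>n \<in> N\<close>: multiplication by \<open>b\<close> preserves
  each line and \<open>n\<close> maps \<open>e\<^sub>k\<close> into the span of the earlier vectors.\<close>

lemma triangular_ideal:
  assumes "triangular e d" "k \<le> d"
  shows "ideal (tspan e k) R"
proof -
  note c = triangular_carrier[OF assms(1)]
  have mult: "x \<otimes> y \<in> tspan e k" if x: "x \<in> carrier R" and y: "y \<in> tspan e k" "k \<le> d" for x y k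
    using y
  proof (induction k arbitrary: y)
    case (Suc k)
    obtain z a where z: "z \<in> tspan e k" "a \<in> C" "y = z \<oplus> a \<otimes> e k"
      using Suc.prems span_Suc[OF c[of "Suc k"]] by auto
    have ek: "e k \<in> carrier R" "z \<in> carrier R" using c[of "Suc k"] Suc.prems span_carrier[OF c[of k]] z by auto
    obtain b n where bn: "b \<in> C" "n \<in> N" "n \<in> carrier R" "x = b \<oplus> n" using decompose[OF x] by blast
    have "n \<otimes> e k \<in> tspan e k" using assms(1) Suc.prems bn by (auto simp: triangular_def)
    then have "x \<otimes> z \<oplus> a \<otimes> (n \<otimes> e k) \<in> tspan e k"
      using Suc.IH[OF z(1)] Suc.prems z(2) span_closed(2,3)[OF c[of k]] by simp
    moreover have "x \<otimes> y = (x \<otimes> z \<oplus> a \<otimes> (n \<otimes> e k)) \<oplus> (a \<otimes> b) \<otimes> e k"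
      unfolding z(3) bn(4) using ek bn(1,3) z(2) C_carrier by algebra
    ultimately show ?case unfolding span_Suc[OF c[OF Suc.prems(2)]] 
      using z(2) bn(1) C_props(6) by blast
  qed (use x in simp)
  have ag: "subgroup (tspan e k) (add_monoid R)"
    using span_closed[OF c[OF assms(2)]] span_carrier[OF c[OF assms(2)]]
    by (intro add.subgroupI) auto
  show ?thesis
  proof (rule idealI)
    show "ring R" by (rule ring_axioms)
    show "subgroup (tspan e k) (add_monoid R)" by (rule ag)
    fix a x assume a: "a \<in> tspan e k" "x \<in> carrier R"
    then show "x \<otimes> a \<in> tspan e k" using mult assms(2) by simp
    moreover have "a \<in> carrier R" using a(1) span_carrier[OF c[OF assms(2)]] by auto
    ultimately show "a \<otimes> x \<in> tspan e k" using a by (simp add: m_comm)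
  qed
qed

text \<open>Append \<open>g\<close> at the end, unless it lies in the span already.\<close>

lemma triangular_extend:
  assumes tri: "triangular e d" and g: "g \<in> carrier R" "\<And>n. n \<in> N \<Longrightarrow> n \<otimes> g \<in> tspan e d"
  shows "\<exists>e' d'. triangular e' d' \<and> tspan e d \<subseteq> tspan e' d' \<and> g \<in> tspan e' d' \<and>
    e' ` {..<d'} \<subseteq> insert g (e ` {..<d})"
proof (cases "g \<in> tspan e d")
  case False
  note c = triangular_carrier[OF tri, of d, simplified]
  define f where "f = e(d := g)"
  have f: "f \<in> {..<Suc d} \<rightarrow> carrier R" using c g by (auto simp: f_def less_Suc_eq)
  have eq: "tspan f k = tspan e k" if "k \<le> d" for k
    using that c by (intro span_cong) (auto simp: f_def)
  have "triangular f (Suc d)"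
    unfolding triangular_def
  proof (intro conjI allI impI f)
    fix k assume "k < Suc d"
    then consider "k < d" | "k = d" by linarith
    then have "f k \<notin> tspan e k \<and> (\<forall>n\<in>N. n \<otimes> f k \<in> tspan e k)"
      by cases (use tri False g in \<open>auto simp: triangular_def f_def\<close>)
    then show "f k \<notin> tspan f k" "\<forall>n\<in>N. n \<otimes> f k \<in> tspan f k" using eq[of k] \<open>k < Suc d\<close> by auto
  qed
  moreover have "tspan e d \<subseteq> tspan f (Suc d)" using span_mono[OF _ f, of d] eq[of d] by simp
  moreover have "g \<in> tspan f (Suc d)" using span_base[OF _ f, of d] by (simp add: f_def)
  moreover have "f ` {..<Suc d} \<subseteq> insert g (e ` {..<d})" by (auto simp: f_def less_Suc_eq)
  ultimately show ?thesis by blast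
qed (use tri in blast)

lemma triangular_extend_finite:
  assumes tri: "triangular e d" and fin: "finite G" 
    and g: "\<And>g. g \<in> G \<Longrightarrow> g \<in> carrier R" "\<And>g n. g \<in> G \<Longrightarrow> n \<in> N \<Longrightarrow> n \<otimes> g \<in> tspan e d"
  shows "\<exists>e' d'. triangular e' d' \<and> tspan e d \<subseteq> tspan e' d' \<and> G \<subseteq> tspan e' d' \<and>
    e' ` {..<d'} \<subseteq> G \<union> e ` {..<d}"
  using fin g
proof (induction G rule: finite_induct)
  case empty
  then show ?case using tri by blast
next
  case (insert g G)
  obtain e1 d1 where 1: "triangular e1 d1" "tspan e d \<subseteq> tspan e1 d1" "G \<subseteq> tspan e1 d1"
    "e1 ` {..<d1} \<subseteq> G \<union> e ` {..<d}" using insert by blast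
  obtain e2 d2 where 2: "triangular e2 d2" "tspan e1 d1 \<subseteq> tspan e2 d2" "g \<in> tspan e2 d2"
    "e2 ` {..<d2} \<subseteq> insert g (e1 ` {..<d1})"
    using triangular_extend[OF 1(1), of g] insert.prems 1(2) by blast
  show ?case using 1 2 by (intro exI[of _ e2] exI[of _ d2] conjI) blast+
qed

text \<open>\<open>G j\<close> is meant to generate \<open>N\<^sup>j V\<close> for a module \<open>V\<close>, and \<open>gen\<close> says that \<open>N\<close> maps
  \<open>G j\<close> into any ideal containing \<open>G (j + 1)\<close>. Starting from \<open>G n = 0\<close>, the levels are added in the order of
  decreasing \<open>j\<close>; when \<open>G j\<close> is reached, the span already contains \<open>N g\<close> for \<open>g \<in> G j\<close>.\<close>

theorem triangular_exists:
  fixes G :: "nat \<Rightarrow> 'a set"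
  assumes fin: "\<And>j. finite (G j)" and G: "\<And>j. G j \<subseteq> carrier R" and top: "G n \<subseteq> {\<zero>}"
    and gen: "\<And>j V g x. ideal V R \<Longrightarrow> G (Suc j) \<subseteq> V \<Longrightarrow> g \<in> G j \<Longrightarrow> x \<in> N \<Longrightarrow> x \<otimes> g \<in> V"
  shows "\<exists>e d. triangular e d \<and> G 0 \<subseteq> tspan e d \<and> e ` {..<d} \<subseteq> (\<Union>j. G j)"
proof -
  have "\<exists>e d. triangular e d \<and> G (n - m) \<subseteq> tspan e d \<and> e ` {..<d} \<subseteq> (\<Union>j. G j)" if "m \<le> n" for m
    using that
  proof (induction m)
    case 0
    have "triangular (\<lambda>_. \<zero>) 0" by (auto simp: triangular_def)
    then show ?case using top by (intro exI[of _ "\<lambda>_. \<zero>"] exI[of _ 0]) auto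
  next
    case (Suc m)
    then obtain e d where e: "triangular e d" "G (n - m) \<subseteq> tspan e d" "e ` {..<d} \<subseteq> (\<Union>j. G j)"
      by auto
    have nm: "n - m = Suc (n - Suc m)" using Suc.prems by simp
    obtain e' d' where e': "triangular e' d'" "tspan e d \<subseteq> tspan e' d'" "G (n - Suc m) \<subseteq> tspan e' d'"
      "e' ` {..<d'} \<subseteq> G (n - Suc m) \<union> e ` {..<d}"
    proof -
      have "G (Suc (n - Suc m)) \<subseteq> tspan e d" using e(2) nm by simp
      then have "x \<otimes> g \<in> tspan e d" if "g \<in> G (n - Suc m)" "x \<in> N" for g x
        using gen[OF triangular_ideal[OF e(1) order_refl]] that by blast
      moreover have "g \<in> carrier R" if "g \<in> G (n - Suc m)" for g using G that by blast
      ultimately show thesis using triangular_extend_finite[OF e(1) fin[of "n - Suc m"]] that by metis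
    qed
    then show ?case using e(3) by (intro exI[of _ e'] exI[of _ d'] conjI) blast+
  qed
  from this[of n] show ?thesis by simp
qed

text \<open>In a nontrivial relation the last nonzero coefficient could be inverted in \<open>C\<close>,
  which would put \<open>e\<^sub>k\<close> into the span of the earlier vectors.\<close>

lemma triangular_independent:
  assumes tri: "triangular e d" and c: "c \<in> {..<k} \<rightarrow> C" and k: "k \<le> d"
    and sum: "(\<Oplus>i\<in>{..<k}. c i \<otimes> e i) = \<zero>" and i: "i < k"
  shows "c i = \<zero>"
  using c k sum i
proof (induction k)
  case (Suc k)
  note t = triangular_carrier[OF tri]
  have ek: "e k \<in> carrier R" "e \<in> {..<k} \<rightarrow> carrier R" "c k \<in> C" "c \<in> {..<k} \<rightarrow> C"
    using t[of "Suc k"] Suc.prems by auto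
  define y where "y = (\<Oplus>i\<in>{..<k}. c i \<otimes> e i)"
  have y: "y \<in> tspan e k" "y \<in> carrier R" using ek span_carrier[OF ek(2)] unfolding y_def filtration_span_def by auto
  have s: "y \<oplus> c k \<otimes> e k = \<zero>"
    using Suc.prems(3) finsum_lessThan_Suc[of "\<lambda>i. c i \<otimes> e i" k] ek Suc.prems(1) t[OF Suc.prems(2)]
    by (auto simp: y_def Pi_iff)
  have "c k = \<zero>"
  proof (rule ccontr)
    assume "c k \<noteq> \<zero>"
    then obtain b where b: "b \<in> C" "c k \<otimes> b = \<one>" using C_inverse ek by blast
    have "e k = (c k \<otimes> b) \<otimes> e k" using b ek by simp
    also have "\<dots> = b \<otimes> (y \<oplus> c k \<otimes> e k) \<oplus> \<ominus> (b \<otimes> y)" using ek(1) y(2) C_carrier[OF b(1)] C_carrier[OF ek(3)] by algebra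
    also have "\<dots> = \<ominus> (b \<otimes> y)" using s b(1) y by simp
    finally have "e k \<in> tspan e k" using span_closed(3,4)[OF ek(2)] b(1) y(1) by simp
    then show False using tri Suc.prems(2) by (auto simp: triangular_def)
  qed
  moreover have "y = \<zero>" using s y ek \<open>c k = \<zero>\<close> by simp
  ultimately show ?case using Suc.IH[OF ek(4)] Suc.prems(2,4) by (auto simp: y_def less_Suc_eq)
qed simp

text \<open>Coordinates are \<open>C\<close>-linear because they are unique. In general they are not \<open>R\<close>-linear.\<close>

lemma coordinates_exist:
  assumes tri: "triangular e d"
  obtains \<xi> :: "'a \<Rightarrow> nat \<Rightarrow> 'a" where "\<And>y i. y \<in> tspan e d \<Longrightarrow> i < d \<Longrightarrow> \<xi> y i \<in> C"
    and "\<And>y. y \<in> tspan e d \<Longrightarrow> y = (\<Oplus>i\<in>{..<d}. \<xi> y i \<otimes> e i)"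
    and "\<And>y z i. y \<in> tspan e d \<Longrightarrow> z \<in> tspan e d \<Longrightarrow> i < d \<Longrightarrow> \<xi> (y \<oplus> z) i = \<xi> y i \<oplus> \<xi> z i"
    and "\<And>c y i. c \<in> C \<Longrightarrow> y \<in> tspan e d \<Longrightarrow> i < d \<Longrightarrow> \<xi> (c \<otimes> y) i = c \<otimes> \<xi> y i"
    and "\<And>k y i. y \<in> tspan e k \<Longrightarrow> k \<le> i \<Longrightarrow> i < d \<Longrightarrow> \<xi> y i = \<zero>"
    and "\<And>i j. i < d \<Longrightarrow> j < d \<Longrightarrow> \<xi> (e i) j = (if j = i then \<one> else \<zero>)"
proof -
  note ec = triangular_carrier[OF tri order_refl]
  have "\<exists>c. \<forall>y\<in>tspan e d. c y \<in> {..<d} \<rightarrow> C \<and> y = (\<Oplus>i\<in>{..<d}. c y i \<otimes> e i)"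
    by (intro bchoice) (auto simp: filtration_span_def)
  then obtain \<xi> where \<xi>: "\<And>y. y \<in> tspan e d \<Longrightarrow> \<xi> y \<in> {..<d} \<rightarrow> C"
    "\<And>y. y \<in> tspan e d \<Longrightarrow> y = (\<Oplus>i\<in>{..<d}. \<xi> y i \<otimes> e i)" by blast
  have uniq: "\<xi> y i = c i" if c: "c \<in> {..<d} \<rightarrow> C" "y = (\<Oplus>i\<in>{..<d}. c i \<otimes> e i)" "i < d" for y c i
  proof -
    have y: "y \<in> tspan e d" using c unfolding filtration_span_def by blast
    have m: "\<xi> y i \<in> C" "c i \<in> C" if "i < d" for i using \<xi>(1)[OF y] c(1) that by auto
    have "(\<Oplus>i\<in>{..<d}. (\<xi> y i \<ominus> c i) \<otimes> e i) = (\<Oplus>i\<in>{..<d}. \<xi> y i \<otimes> e i \<oplus> (\<ominus> \<one>) \<otimes> (c i \<otimes> e i))"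
    proof (intro finsum_cong')
      fix i assume "i \<in> {..<d}"
      then have "\<xi> y i \<in> carrier R" "c i \<in> carrier R" "e i \<in> carrier R" using m ec by auto
      then show "(\<xi> y i \<ominus> c i) \<otimes> e i = \<xi> y i \<otimes> e i \<oplus> (\<ominus> \<one>) \<otimes> (c i \<otimes> e i)" by algebra
    qed (use m ec in \<open>auto simp: Pi_iff\<close>)
    also have "\<dots> = (\<Oplus>i\<in>{..<d}. \<xi> y i \<otimes> e i) \<oplus> (\<Oplus>i\<in>{..<d}. (\<ominus> \<one>) \<otimes> (c i \<otimes> e i))"
      using m ec by (intro finsum_addf) (auto simp: Pi_iff)
    also have "(\<Oplus>i\<in>{..<d}. (\<ominus> \<one>) \<otimes> (c i \<otimes> e i)) = (\<ominus> \<one>) \<otimes> (\<Oplus>i\<in>{..<d}. c i \<otimes> e i)"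
      using m ec by (intro finsum_rdistr[symmetric]) (auto simp: Pi_iff)
    also have "(\<Oplus>i\<in>{..<d}. \<xi> y i \<otimes> e i) \<oplus> \<dots> = y \<oplus> \<ominus> \<one> \<otimes> y" using \<xi>(2)[OF y] c(2) by simp
    also have "\<dots> = \<zero>" using y span_carrier[OF ec] by (auto simp: l_minus r_neg subset_iff)
    finally have "\<xi> y i \<ominus> c i = \<zero>"
      using triangular_independent[OF tri, of "\<lambda>i. \<xi> y i \<ominus> c i" d i] c(3) m C_props(5,7)
      by (auto simp: minus_eq)
    then show ?thesis using m[OF c(3)] by (simp add: r_right_minus_eq)
  qed
  show thesis
  proof (rule that)
    show "\<xi> y i \<in> C" if "y \<in> tspan e d" "i < d" for y i using \<xi> that by auto
    show "y = (\<Oplus>i\<in>{..<d}. \<xi> y i \<otimes> e i)" if "y \<in> tspan e d" for y by (rule \<xi>(2)[OF that])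
    show "\<xi> (y \<oplus> z) i = \<xi> y i \<oplus> \<xi> z i" if a: "y \<in> tspan e d" "z \<in> tspan e d" "i < d" for y z i
    proof (rule uniq[OF _ _ a(3)])
      show "(\<lambda>i. \<xi> y i \<oplus> \<xi> z i) \<in> {..<d} \<rightarrow> C" using \<xi>(1) a C_props(7) by (auto simp: Pi_iff)
      have "y \<oplus> z = (\<Oplus>i\<in>{..<d}. \<xi> y i \<otimes> e i) \<oplus> (\<Oplus>i\<in>{..<d}. \<xi> z i \<otimes> e i)"
        using \<xi>(2)[OF a(1)] \<xi>(2)[OF a(2)] by simp
      also have "\<dots> = (\<Oplus>i\<in>{..<d}. \<xi> y i \<otimes> e i \<oplus> \<xi> z i \<otimes> e i)"
        using \<xi>(1) a ec by (intro finsum_addf[symmetric]) (auto simp: Pi_iff)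
      also have "\<dots> = (\<Oplus>i\<in>{..<d}. (\<xi> y i \<oplus> \<xi> z i) \<otimes> e i)"
        using \<xi>(1) a ec by (intro finsum_cong') (auto simp: Pi_iff l_distr)
      finally show "y \<oplus> z = (\<Oplus>i\<in>{..<d}. (\<xi> y i \<oplus> \<xi> z i) \<otimes> e i)" .
    qed
    show "\<xi> (c \<otimes> y) i = c \<otimes> \<xi> y i" if a: "c \<in> C" "y \<in> tspan e d" "i < d" for c y i
    proof (rule uniq[OF _ _ a(3)])
      show "(\<lambda>i. c \<otimes> \<xi> y i) \<in> {..<d} \<rightarrow> C" using \<xi>(1) a C_props(6) by (auto simp: Pi_iff)
      have "c \<otimes> y = c \<otimes> (\<Oplus>i\<in>{..<d}. \<xi> y i \<otimes> e i)" using \<xi>(2)[OF a(2)] by simp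
      also have "\<dots> = (\<Oplus>i\<in>{..<d}. c \<otimes> (\<xi> y i \<otimes> e i))"
        using \<xi>(1) a ec by (intro finsum_rdistr) (auto simp: Pi_iff)
      also have "\<dots> = (\<Oplus>i\<in>{..<d}. (c \<otimes> \<xi> y i) \<otimes> e i)"
        using \<xi>(1) a ec by (intro finsum_cong') (auto simp: Pi_iff m_assoc)
      finally show "c \<otimes> y = (\<Oplus>i\<in>{..<d}. (c \<otimes> \<xi> y i) \<otimes> e i)" .
    qed
    show "\<xi> y i = \<zero>" if a: "y \<in> tspan e k" "k \<le> i" "i < d" for k y i
    proof -
      obtain c where c: "c \<in> {..<k} \<rightarrow> C" "y = (\<Oplus>i\<in>{..<k}. c i \<otimes> e i)"
        using a(1) by (auto simp: filtration_span_def)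
      define b where "b = (\<lambda>i. if i < k then c i else \<zero>)"
      have "y = (\<Oplus>i\<in>{..<d}. b i \<otimes> e i)" unfolding c(2)
        using c(1) a ec by (intro add.finprod_mono_neutral_cong_left) (auto simp: b_def Pi_iff)
      then have "\<xi> y i = b i" using c(1) a C_props(2) by (intro uniq) (auto simp: b_def)
      then show ?thesis using a(2) by (simp add: b_def)
    qed
    show "\<xi> (e i) k = (if k = i then \<one> else \<zero>)" if i: "i < d" and k: "k < d" for i k
    proof -
      have "(\<Oplus>j\<in>{..<d}. (if j = i then \<one> else \<zero>) \<otimes> e j) = (\<Oplus>j\<in>{..<d}. if j = i then e j else \<zero>)"
        using ec by (intro finsum_cong') (auto simp: Pi_iff)
      also have "\<dots> = e i" using ec i by (intro add.finprod_singleton_swap) auto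
      finally show ?thesis
        using k C_props(2,3) by (intro uniq[of "\<lambda>j. if j = i then \<one> else \<zero>"]) auto
    qed
  qed
qed

text \<open>Take the coordinate at \<open>e\<^sub>i\<close> of the \<open>i\<close>-th equation and sum over \<open>i\<close>. Coordinates
  are \<open>C\<close>-linear and \<open>A\<close> has entries in \<open>C\<close>, so the coordinate of \<open>\<Sum> A\<^sub>i\<^sub>j \<beta>\<^sub>j\<close> involves the
  coordinate matrix of \<open>\<beta>\<close> multiplied by \<open>A\<close> on one side, and that of \<open>a \<beta>\<^sub>i\<close> the same matrix
  multiplied by \<open>A\<close> on the other. The two sums are traces of \<open>XY\<close> and \<open>YX\<close> and cancel, as do those with \<open>B\<close> and \<open>\<alpha>\<close>.
  The vectors \<open>r\<^sub>i\<close> have no coordinate at \<open>e\<^sub>i\<close>, and \<open>v e\<^sub>i\<close> has as coordinate there the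
  residue of \<open>v\<close>. What remains is \<open>d\<close> times this residue.\<close>

theorem commutator_trace:
  assumes tri: "triangular e d" and a: "a \<in> carrier R" and b: "b \<in> carrier R" and v: "v \<in> carrier R"
    and A: "\<And>i j. i < d \<Longrightarrow> j < d \<Longrightarrow> A i j \<in> C" "\<And>i. i < d \<Longrightarrow> a \<otimes> e i = (\<Oplus>j\<in>{..<d}. A i j \<otimes> e j)"
    and B: "\<And>i j. i < d \<Longrightarrow> j < d \<Longrightarrow> B i j \<in> C" "\<And>i. i < d \<Longrightarrow> b \<otimes> e i = (\<Oplus>j\<in>{..<d}. B i j \<otimes> e j)"
    and \<alpha>: "\<And>i. i < d \<Longrightarrow> \<alpha> i \<in> tspan e d" and \<beta>: "\<And>i. i < d \<Longrightarrow> \<beta> i \<in> tspan e d"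
    and r: "\<And>i. i < d \<Longrightarrow> r i \<in> tspan e i"
    and eq: "\<And>i. i < d \<Longrightarrow> v \<otimes> e i \<oplus> ((\<Oplus>j\<in>{..<d}. A i j \<otimes> \<beta> j) \<oplus> b \<otimes> \<alpha> i) =
      r i \<oplus> ((\<Oplus>j\<in>{..<d}. B i j \<otimes> \<alpha> j) \<oplus> a \<otimes> \<beta> i)"
  shows "add_pow R d v \<in> N"
proof -
  interpret N: ideal N R by (rule ideal_N)
  interpret L: ideal "tspan e d" R by (rule triangular_ideal[OF tri order_refl])
  note ec = triangular_carrier[OF tri order_refl]
  obtain \<xi> where \<xi>C: "\<And>y i. y \<in> tspan e d \<Longrightarrow> i < d \<Longrightarrow> \<xi> y i \<in> C"
    and rep: "\<And>y. y \<in> tspan e d \<Longrightarrow> y = (\<Oplus>i\<in>{..<d}. \<xi> y i \<otimes> e i)"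
    and add: "\<And>y z i. y \<in> tspan e d \<Longrightarrow> z \<in> tspan e d \<Longrightarrow> i < d \<Longrightarrow> \<xi> (y \<oplus> z) i = \<xi> y i \<oplus> \<xi> z i"
    and smult: "\<And>c y i. c \<in> C \<Longrightarrow> y \<in> tspan e d \<Longrightarrow> i < d \<Longrightarrow> \<xi> (c \<otimes> y) i = c \<otimes> \<xi> y i"
    and low: "\<And>k y i. y \<in> tspan e k \<Longrightarrow> k \<le> i \<Longrightarrow> i < d \<Longrightarrow> \<xi> y i = \<zero>"
    and base: "\<And>i j. i < d \<Longrightarrow> j < d \<Longrightarrow> \<xi> (e i) j = (if j = i then \<one> else \<zero>)"
    by (rule coordinates_exist[OF tri]) iprover
  have \<xi>R: "\<xi> y i \<in> carrier R" if "y \<in> tspan e d" "i < d" for y i using \<xi>C that by simp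
  have eL: "e i \<in> tspan e d" if "i < d" for i using span_base[OF that ec] .
  have sum: "\<xi> (\<Oplus>j\<in>{..<d}. f j) i = (\<Oplus>j\<in>{..<d}. \<xi> (f j) i)" "(\<Oplus>j\<in>{..<d}. f j) \<in> tspan e d"
    if "\<And>j. j < d \<Longrightarrow> f j \<in> tspan e d" "i < d" for f i
  proof -
    have "(\<Oplus>j\<in>{..<d}. f j) \<in> tspan e d \<and> \<xi> (\<Oplus>j\<in>{..<d}. f j) i = (\<Oplus>j\<in>{..<d}. \<xi> (f j) i)"
    proof (rule finsum_hom[where g = "\<lambda>y. \<xi> y i"])
      have "\<zero> \<in> tspan e 0" by simp
      then show "\<xi> \<zero> i = \<zero>" using low[of \<zero> 0 i] that(2) by simp
    qed (use that add \<xi>R L.a_subset in \<open>auto intro: abelian_monoid_axioms\<close>)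
    then show "\<xi> (\<Oplus>j\<in>{..<d}. f j) i = (\<Oplus>j\<in>{..<d}. \<xi> (f j) i)" "(\<Oplus>j\<in>{..<d}. f j) \<in> tspan e d" by auto
  qed
  \<comment> \<open>\<open>tr(XY) = tr(YX)\<close> for \<open>M\<close> and the matrix of coordinates of \<open>\<gamma>\<close>\<close>
  have trace: "(\<Oplus>i\<in>{..<d}. \<xi> (x \<otimes> \<gamma> i) i) = (\<Oplus>i\<in>{..<d}. \<xi> (\<Oplus>j\<in>{..<d}. M i j \<otimes> \<gamma> j) i)"
    if x: "x \<in> carrier R" and M: "\<And>i j. i < d \<Longrightarrow> j < d \<Longrightarrow> M i j \<in> C"
      "\<And>i. i < d \<Longrightarrow> x \<otimes> e i = (\<Oplus>j\<in>{..<d}. M i j \<otimes> e j)"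
      and \<gamma>: "\<And>i. i < d \<Longrightarrow> \<gamma> i \<in> tspan e d" for x M \<gamma>
  proof -
    have entry: "\<xi> (x \<otimes> e j) i = M j i" if "j < d" "i < d" for i j
    proof -
      have "\<xi> (x \<otimes> e j) i = (\<Oplus>k\<in>{..<d}. \<xi> (M j k \<otimes> e k) i)"
        unfolding M(2)[OF that(1)] using that M(1) eL by (intro sum(1)) (auto intro: L.I_l_closed)
      also have "\<dots> = (\<Oplus>k\<in>{..<d}. if k = i then M j k else \<zero>)"
      proof (intro finsum_cong')
        fix k assume "k \<in> {..<d}"
        then have k: "k < d" by simp
        have "M j k \<in> carrier R" using M(1)[OF that(1) k] by simp
        then show "\<xi> (M j k \<otimes> e k) i = (if k = i then M j k else \<zero>)"
          using smult[OF M(1)[OF that(1) k] eL[OF k] that(2)] base[OF k that(2)] by auto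
      qed (use M that in \<open>auto simp: Pi_iff\<close>)
      also have "\<dots> = M j i" using M that by (intro add.finprod_singleton_swap) auto
      finally show ?thesis .
    qed
    have xeL: "x \<otimes> e j \<in> tspan e d" if "j < d" for j using L.I_l_closed eL that x by simp
    have l: "\<xi> (x \<otimes> \<gamma> i) i = (\<Oplus>j\<in>{..<d}. \<xi> (\<gamma> i) j \<otimes> M j i)" if i: "i < d" for i
    proof -
      have g: "\<xi> (\<gamma> i) j \<in> C" "\<xi> (\<gamma> i) j \<in> carrier R" if "j < d" for j using \<xi>C \<gamma> i that by auto
      have "x \<otimes> \<gamma> i = x \<otimes> (\<Oplus>j\<in>{..<d}. \<xi> (\<gamma> i) j \<otimes> e j)" using rep[OF \<gamma>[OF i]] by simp
      also have "\<dots> = (\<Oplus>j\<in>{..<d}. x \<otimes> (\<xi> (\<gamma> i) j \<otimes> e j))"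
        using x g ec by (intro finsum_rdistr) (auto simp: Pi_iff)
      also have "\<dots> = (\<Oplus>j\<in>{..<d}. \<xi> (\<gamma> i) j \<otimes> (x \<otimes> e j))"
        using x g ec by (intro finsum_cong') (auto simp: Pi_iff m_lcomm)
      finally have "\<xi> (x \<otimes> \<gamma> i) i = (\<Oplus>j\<in>{..<d}. \<xi> (\<xi> (\<gamma> i) j \<otimes> (x \<otimes> e j)) i)"
        using sum(1)[of "\<lambda>j. \<xi> (\<gamma> i) j \<otimes> (x \<otimes> e j)" i] i L.I_l_closed[OF xeL g(2)] by simp
      also have "\<dots> = (\<Oplus>j\<in>{..<d}. \<xi> (\<gamma> i) j \<otimes> M j i)"
        using i xeL g entry M(1) smult by (intro finsum_cong') (auto simp: Pi_iff)
      finally show ?thesis .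
    qed
    have rr: "\<xi> (\<Oplus>j\<in>{..<d}. M i j \<otimes> \<gamma> j) i = (\<Oplus>j\<in>{..<d}. \<xi> (\<gamma> j) i \<otimes> M i j)" if i: "i < d" for i
    proof -
      have "\<xi> (\<Oplus>j\<in>{..<d}. M i j \<otimes> \<gamma> j) i = (\<Oplus>j\<in>{..<d}. \<xi> (M i j \<otimes> \<gamma> j) i)"
        using i M(1) \<gamma> by (intro sum(1)) (auto intro: L.I_l_closed)
      also have "\<dots> = (\<Oplus>j\<in>{..<d}. \<xi> (\<gamma> j) i \<otimes> M i j)"
      proof (intro finsum_cong')
        fix j assume "j \<in> {..<d}"
        then show "\<xi> (M i j \<otimes> \<gamma> j) i = \<xi> (\<gamma> j) i \<otimes> M i j"
          using smult[OF M(1) \<gamma>, of i j j i] i M(1)[OF i, of j] \<xi>R[OF \<gamma>, of j i] by (simp add: m_comm)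
      qed (use i M(1) \<gamma> \<xi>R in auto)
      finally show ?thesis .
    qed
    have "(\<Oplus>i\<in>{..<d}. \<xi> (x \<otimes> \<gamma> i) i) = (\<Oplus>i\<in>{..<d}. \<Oplus>j\<in>{..<d}. \<xi> (\<gamma> i) j \<otimes> M j i)"
      using l M(1) \<xi>R \<gamma> by (intro finsum_cong') (auto intro!: finsum_closed simp: Pi_iff)
    also have "\<dots> = (\<Oplus>j\<in>{..<d}. \<Oplus>i\<in>{..<d}. \<xi> (\<gamma> i) j \<otimes> M j i)"
      using M(1) \<xi>R \<gamma> by (intro finsum_swap) auto
    also have "\<dots> = (\<Oplus>i\<in>{..<d}. \<xi> (\<Oplus>j\<in>{..<d}. M i j \<otimes> \<gamma> j) i)"
      using rr M(1) \<xi>R \<gamma> by (intro finsum_cong') (auto intro!: sum(2) L.I_l_closed \<xi>R simp: Pi_iff)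
    finally show ?thesis .
  qed
  obtain c n where cn: "c \<in> C" "n \<in> N" "n \<in> carrier R" "v = c \<oplus> n" using decompose[OF v] by blast
  have cR: "c \<in> carrier R" using cn by simp
  define P where "P i = (\<Oplus>j\<in>{..<d}. A i j \<otimes> \<beta> j)" for i
  define Q where "Q i = (\<Oplus>j\<in>{..<d}. B i j \<otimes> \<alpha> j)" for i
  have PQ: "P i \<in> tspan e d" "Q i \<in> tspan e d" if "i < d" for i
    unfolding P_def Q_def using that A(1) B(1) \<alpha> \<beta> by (auto intro!: sum(2)[of _ i] L.I_l_closed)
  have ab: "b \<otimes> \<alpha> i \<in> tspan e d" "a \<otimes> \<beta> i \<in> tspan e d" if "i < d" for i
    using that a b \<alpha> \<beta> by (auto intro: L.I_l_closed)
  have coord: "c \<oplus> (\<xi> (P i) i \<oplus> \<xi> (b \<otimes> \<alpha> i) i) = \<xi> (Q i) i \<oplus> \<xi> (a \<otimes> \<beta> i) i" if i: "i < d" for i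
  proof -
    have ve: "v \<otimes> e i = c \<otimes> e i \<oplus> n \<otimes> e i" using cn cR ec i by (auto simp: l_distr Pi_iff)
    have ne: "n \<otimes> e i \<in> tspan e i" using tri i cn by (auto simp: triangular_def)
    have ne': "n \<otimes> e i \<in> tspan e d" "r i \<in> tspan e d" using ne r[OF i] span_mono[OF _ ec, of i] i by auto
    have ce: "c \<otimes> e i \<in> tspan e d" using L.I_l_closed[OF eL[OF i] cR] .
    have "\<xi> (v \<otimes> e i) i = c" using ve add[OF ce ne'(1) i] smult[OF cn(1) eL[OF i] i] base[OF i i] low[OF ne order_refl i] cR
      by simp
    moreover have "v \<otimes> e i \<in> tspan e d" using ve ce ne' by simp
    moreover have "\<xi> (r i) i = \<zero>" using low[OF r[OF i] order_refl i] .
    ultimately show ?thesis using arg_cong[OF eq[OF i], of "\<lambda>y. \<xi> y i"] PQ[OF i] ab[OF i] ne'(2) i \<xi>R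
      unfolding P_def[symmetric] Q_def[symmetric] by (simp add: add)
  qed
  have R: "\<xi> (P i) i \<in> carrier R" "\<xi> (Q i) i \<in> carrier R" "\<xi> (b \<otimes> \<alpha> i) i \<in> carrier R" "\<xi> (a \<otimes> \<beta> i) i \<in> carrier R"
    if "i < d" for i using PQ ab \<xi>R that by auto
  have "(\<Oplus>i\<in>{..<d}. c \<oplus> (\<xi> (P i) i \<oplus> \<xi> (b \<otimes> \<alpha> i) i)) = (\<Oplus>i\<in>{..<d}. \<xi> (Q i) i \<oplus> \<xi> (a \<otimes> \<beta> i) i)"
    using coord R cR by (intro finsum_cong') (auto simp: Pi_iff)
  then have "(\<Oplus>i\<in>{..<d}. c) \<oplus> ((\<Oplus>i\<in>{..<d}. \<xi> (P i) i) \<oplus> (\<Oplus>i\<in>{..<d}. \<xi> (b \<otimes> \<alpha> i) i))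
      = (\<Oplus>i\<in>{..<d}. \<xi> (Q i) i) \<oplus> (\<Oplus>i\<in>{..<d}. \<xi> (a \<otimes> \<beta> i) i)"
    using R cR by (simp add: finsum_addf Pi_iff)
  moreover have "(\<Oplus>i\<in>{..<d}. \<xi> (b \<otimes> \<alpha> i) i) = (\<Oplus>i\<in>{..<d}. \<xi> (Q i) i)"
    unfolding Q_def by (rule trace[OF b B \<alpha>])
  moreover have "(\<Oplus>i\<in>{..<d}. \<xi> (a \<otimes> \<beta> i) i) = (\<Oplus>i\<in>{..<d}. \<xi> (P i) i)"
    unfolding P_def by (rule trace[OF a A \<beta>])
  moreover have "(\<Oplus>i\<in>{..<d}. c) = add_pow R d c" using add.finprod_const[OF cR, of "{..<d}"] by simp
  moreover define p q where "p = (\<Oplus>i\<in>{..<d}. \<xi> (P i) i)" and "q = (\<Oplus>i\<in>{..<d}. \<xi> (Q i) i)"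
  moreover have "p \<in> carrier R" "q \<in> carrier R" unfolding p_def q_def using R by (auto intro!: finsum_closed)
  ultimately have "add_pow R d c \<oplus> (p \<oplus> q) = p \<oplus> q" "p \<oplus> q \<in> carrier R" by (auto simp: a_comm)
  then have dc: "add_pow R d c = \<zero>" using add.nat_pow_closed[OF cR, of d] 
    by (metis add.r_cancel_one')
  have "add_pow R d n \<in> N" using cn(2) by (induction d) auto
  moreover have "add_pow R d v = add_pow R d c \<oplus> add_pow R d n"
    unfolding cn(4) using cR cn(3) by (rule add.nat_pow_distrib)
  ultimately show ?thesis using dc cn(3) by simp
qed

end

lemma (in coefficient_subfield) triangular_matrix:
  assumes tri: "triangular e d" and z: "z \<in> N"
  shows "\<exists>f. (\<forall>i j. f i j \<in> C) \<and> (\<forall>i j. i \<le> j \<or> d \<le> i \<longrightarrow> f i j = \<zero>) \<and>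
    (\<forall>i<d. z \<otimes> e i = (\<Oplus>j\<in>{..<d}. f i j \<otimes> e j))"
proof -
  note ec = triangular_carrier[OF tri order_refl]
  have "\<exists>g. (\<forall>j. g j \<in> C) \<and> (\<forall>j. i \<le> j \<or> d \<le> i \<longrightarrow> g j = \<zero>) \<and> (i < d \<longrightarrow> z \<otimes> e i = (\<Oplus>j\<in>{..<d}. g j \<otimes> e j))" for i
  proof (cases "i < d")
    case True
    then have "z \<otimes> e i \<in> tspan e i" using tri z by (auto simp: triangular_def)
    then obtain c where c: "c \<in> {..<i} \<rightarrow> C" "z \<otimes> e i = (\<Oplus>j\<in>{..<i}. c j \<otimes> e j)" by (auto simp: filtration_span_def)
    define g where "g j = (if j < i then c j else \<zero>)" for j
    have "(\<Oplus>j\<in>{..<i}. c j \<otimes> e j) = (\<Oplus>j\<in>{..<d}. g j \<otimes> e j)"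
      using c(1) ec True by (intro add.finprod_mono_neutral_cong_left) (auto simp: g_def Pi_iff)
    then show ?thesis using c True C_props(2) by (intro exI[of _ g]) (auto simp: g_def)
  next
    case False
    then show ?thesis using C_props(2) by (intro exI[of _ "\<lambda>_. \<zero>"]) auto
  qed
  then have "\<forall>i. \<exists>g. (\<forall>j. g j \<in> C) \<and> (\<forall>j. i \<le> j \<or> d \<le> i \<longrightarrow> g j = \<zero>) \<and> (i < d \<longrightarrow> z \<otimes> e i = (\<Oplus>j\<in>{..<d}. g j \<otimes> e j))"
    by blast
  from choice[OF this] show ?thesis by blast
qed

text \<open>Both sides are the coordinates of \<open>z w e\<^sub>i = w z e\<^sub>i\<close> at \<open>e\<^sub>k\<close>. As rows
  hold the expansions of images of basis vectors, \<open>z w\<close> has the matrix \<open>gf\<close> and \<open>w z\<close> the matrix \<open>fg\<close>.\<close>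

lemma (in coefficient_subfield) matrices_commute:
  assumes tri: "triangular e d" and zw: "z \<in> carrier R" "w \<in> carrier R"
    and f: "\<And>i j. f i j \<in> C" "\<And>i. i < d \<Longrightarrow> z \<otimes> e i = (\<Oplus>j\<in>{..<d}. f i j \<otimes> e j)"
    and g: "\<And>i j. g i j \<in> C" "\<And>i. i < d \<Longrightarrow> w \<otimes> e i = (\<Oplus>j\<in>{..<d}. g i j \<otimes> e j)"
    and ik: "i < d" "k < d"
  shows "(\<Oplus>j\<in>{..<d}. g i j \<otimes> f j k) = (\<Oplus>j\<in>{..<d}. f i j \<otimes> g j k)"
proof -
  note ec = triangular_carrier[OF tri order_refl]
  have sumC: "(\<Oplus>j\<in>{..<d}. g i j \<otimes> f j k) \<in> C" if "\<And>i j. f i j \<in> C" "\<And>i j. g i j \<in> C" for f g i k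
    using finsum_hom[OF abelian_monoid_axioms abelian_monoid_axioms, of "{..<d}" "\<lambda>j. g i j \<otimes> f j k" C "\<lambda>x. x"]
      that C_props(1,2,6,7) by auto
  have prod: "z \<otimes> (w \<otimes> e i) = (\<Oplus>k\<in>{..<d}. (\<Oplus>j\<in>{..<d}. g i j \<otimes> f j k) \<otimes> e k)"
    if z: "z \<in> carrier R" and f: "\<And>i j. f i j \<in> C" "\<And>i. i < d \<Longrightarrow> z \<otimes> e i = (\<Oplus>j\<in>{..<d}. f i j \<otimes> e j)"
      and g: "\<And>i j. g i j \<in> C" "\<And>i. i < d \<Longrightarrow> w \<otimes> e i = (\<Oplus>j\<in>{..<d}. g i j \<otimes> e j)" for z w f g
  proof -
    have fR: "f i j \<in> carrier R" "g i j \<in> carrier R" for i j using f(1) g(1) by auto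
    have "z \<otimes> (w \<otimes> e i) = (\<Oplus>j\<in>{..<d}. z \<otimes> (g i j \<otimes> e j))"
      unfolding g(2)[OF ik(1)] using z fR ec by (intro finsum_rdistr) (auto simp: Pi_iff)
    also have "\<dots> = (\<Oplus>j\<in>{..<d}. \<Oplus>k\<in>{..<d}. (g i j \<otimes> f j k) \<otimes> e k)"
    proof (intro finsum_cong' refl)
      fix j assume "j \<in> {..<d}"
      then have j: "j < d" "e j \<in> carrier R" using ec by auto
      have "z \<otimes> (g i j \<otimes> e j) = g i j \<otimes> (\<Oplus>k\<in>{..<d}. f j k \<otimes> e k)"
        using m_lcomm[OF z fR(2)[of i j] j(2)] f(2)[OF j(1)] by simp
      also have "\<dots> = (\<Oplus>k\<in>{..<d}. g i j \<otimes> (f j k \<otimes> e k))" using fR ec by (intro finsum_rdistr) (auto simp: Pi_iff)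
      also have "\<dots> = (\<Oplus>k\<in>{..<d}. (g i j \<otimes> f j k) \<otimes> e k)" using fR ec by (intro finsum_cong') (auto simp: Pi_iff m_assoc)
      finally show "z \<otimes> (g i j \<otimes> e j) = (\<Oplus>k\<in>{..<d}. (g i j \<otimes> f j k) \<otimes> e k)" .
    qed (use fR ec in \<open>auto intro!: finsum_closed simp: Pi_iff\<close>)
    also have "\<dots> = (\<Oplus>k\<in>{..<d}. \<Oplus>j\<in>{..<d}. (g i j \<otimes> f j k) \<otimes> e k)"
      using fR ec by (intro finsum_swap) (auto simp: Pi_iff)
    also have "\<dots> = (\<Oplus>k\<in>{..<d}. (\<Oplus>j\<in>{..<d}. g i j \<otimes> f j k) \<otimes> e k)"
      using fR ec by (intro finsum_cong') (auto intro!: finsum_ldistr[symmetric] finsum_closed simp: Pi_iff)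
    finally show ?thesis .
  qed
  have eR: "e i \<in> carrier R" using ec ik by auto
  define S1 where "S1 k = (\<Oplus>j\<in>{..<d}. g i j \<otimes> f j k)" for k
  define S2 where "S2 k = (\<Oplus>j\<in>{..<d}. f i j \<otimes> g j k)" for k
  have S: "S1 k \<in> C" "S2 k \<in> C" for k unfolding S1_def S2_def by (intro sumC f(1) g(1))+
  then have SR: "S1 k \<in> carrier R" "S2 k \<in> carrier R" for k by auto
  have m: "S2 k \<ominus> S1 k \<in> C" for k using S C_props(5,7) by (simp add: minus_eq)
  have "(\<Oplus>k\<in>{..<d}. S1 k \<otimes> e k) \<oplus> (\<Oplus>k\<in>{..<d}. (S2 k \<ominus> S1 k) \<otimes> e k) = (\<Oplus>k\<in>{..<d}. S1 k \<otimes> e k \<oplus> (S2 k \<ominus> S1 k) \<otimes> e k)"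
    using SR ec by (intro finsum_addf[symmetric]) (auto simp: Pi_iff)
  also have "\<dots> = (\<Oplus>k\<in>{..<d}. S2 k \<otimes> e k)"
  proof (intro finsum_cong' refl)
    fix k assume "k \<in> {..<d}"
    then have "e k \<in> carrier R" using ec by auto
    then show "S1 k \<otimes> e k \<oplus> (S2 k \<ominus> S1 k) \<otimes> e k = S2 k \<otimes> e k" using SR[of k] by algebra
  qed (use SR ec in \<open>auto simp: Pi_iff\<close>)
  also have "\<dots> = (\<Oplus>k\<in>{..<d}. S1 k \<otimes> e k)"
    using prod[OF zw(1) f g] prod[OF zw(2) g f] zw eR by (simp add: S1_def S2_def m_lcomm)
  finally have "(\<Oplus>k\<in>{..<d}. S1 k \<otimes> e k) \<oplus> (\<Oplus>k\<in>{..<d}. (S2 k \<ominus> S1 k) \<otimes> e k) = (\<Oplus>k\<in>{..<d}. S1 k \<otimes> e k)" .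
  moreover have "(\<Oplus>k\<in>{..<d}. S1 k \<otimes> e k) \<in> carrier R" "(\<Oplus>k\<in>{..<d}. (S2 k \<ominus> S1 k) \<otimes> e k) \<in> carrier R"
    using SR ec by (auto intro!: finsum_closed simp: Pi_iff)
  ultimately have "(\<Oplus>k\<in>{..<d}. (S2 k \<ominus> S1 k) \<otimes> e k) = \<zero>" by simp
  then have "S2 k \<ominus> S1 k = \<zero>" using triangular_independent[OF tri, of "\<lambda>k. S2 k \<ominus> S1 k" d k] m ik(2) by auto
  then show ?thesis using SR[of k] by (simp add: S1_def[symmetric] S2_def[symmetric])
qed


section \<open>Square-zero lifts of a ring and of a module\<close>

context left_module
begin

lemma lm_smult_zero_right [simp]: "a \<in> carrier R \<Longrightarrow> a \<odot>\<^bsub>M\<^esub> \<zero>\<^bsub>M\<^esub> = \<zero>\<^bsub>M\<^esub>"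
  using smult_r_distr[of a "\<zero>\<^bsub>M\<^esub>" "\<zero>\<^bsub>M\<^esub>"] smult_closed[of a "\<zero>\<^bsub>M\<^esub>"]
  by (metis M.add.r_cancel_one' M.r_zero M.zero_closed)

lemma lm_smult_zero_left [simp]: "x \<in> carrier M \<Longrightarrow> \<zero> \<odot>\<^bsub>M\<^esub> x = \<zero>\<^bsub>M\<^esub>"
  using smult_l_distr[of \<zero> \<zero> x] smult_closed[of \<zero> x]
  by (metis M.add.r_cancel_one' R.r_zero R.zero_closed)

lemma lm_smult_minus_right:
  "a \<in> carrier R \<Longrightarrow> x \<in> carrier M \<Longrightarrow> a \<odot>\<^bsub>M\<^esub> (\<ominus>\<^bsub>M\<^esub> x) = \<ominus>\<^bsub>M\<^esub> (a \<odot>\<^bsub>M\<^esub> x)"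
  using smult_r_distr[of a "\<ominus>\<^bsub>M\<^esub> x" x] smult_closed[of a x] smult_closed[of a "\<ominus>\<^bsub>M\<^esub> x"]
  by (simp add: M.l_neg M.minus_equality)

lemma lm_smult_finsum_right:
  assumes "finite I" "a \<in> carrier R" "f \<in> I \<rightarrow> carrier M"
  shows "a \<odot>\<^bsub>M\<^esub> (\<Oplus>\<^bsub>M\<^esub>i\<in>I. f i) = (\<Oplus>\<^bsub>M\<^esub>i\<in>I. a \<odot>\<^bsub>M\<^esub> f i)"
  using finsum_hom[OF M.abelian_monoid_axioms M.abelian_monoid_axioms assms(1,3) order_refl,
      of "\<lambda>x. a \<odot>\<^bsub>M\<^esub> x"] assms(2) by (auto simp: smult_closed smult_r_distr)

lemma lm_smult_finsum_left:
  assumes "finite I" "f \<in> I \<rightarrow> carrier R" "x \<in> carrier M"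
  shows "(\<Oplus>i\<in>I. f i) \<odot>\<^bsub>M\<^esub> x = (\<Oplus>\<^bsub>M\<^esub>i\<in>I. f i \<odot>\<^bsub>M\<^esub> x)"
  using finsum_hom[OF R.abelian_monoid_axioms M.abelian_monoid_axioms assms(1,2) order_refl,
      of "\<lambda>a. a \<odot>\<^bsub>M\<^esub> x"] assms(3) by (auto simp: smult_closed smult_l_distr)

end

definition annihilator :: "('r, 'x) ring_scheme \<Rightarrow> ('r, 'm, 'y) module_scheme \<Rightarrow> 'r set" where
  "annihilator R M = {a \<in> carrier R. \<forall>x\<in>carrier M. a \<odot>\<^bsub>M\<^esub> x = \<zero>\<^bsub>M\<^esub>}"

lemma (in module) annihilator_ideal: "ideal (annihilator R M) R"
proof (rule idealI)
  show "ring R" by (rule R.ring_axioms)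
  show "subgroup (annihilator R M) (add_monoid R)"
  proof (rule R.add.subgroupI)
    have "\<zero> \<in> annihilator R M" by (simp add: annihilator_def)
    then show "annihilator R M \<noteq> {}" by blast
    show "\<ominus> a \<in> annihilator R M" if "a \<in> annihilator R M" for a
      using that by (simp add: annihilator_def smult_l_minus)
    show "a \<oplus> b \<in> annihilator R M" if "a \<in> annihilator R M" "b \<in> annihilator R M" for a b
      using that by (simp add: annihilator_def smult_l_distr)
  qed (auto simp: annihilator_def)
  fix a x assume a: "a \<in> annihilator R M" "x \<in> carrier R"
  then show "x \<otimes> a \<in> annihilator R M" by (simp add: annihilator_def smult_assoc1)
  then show "a \<otimes> x \<in> annihilator R M" using a by (simp add: annihilator_def R.m_comm)
qed

text \<open>A ring \<open>B\<close> and a left \<open>B\<close>-module \<open>L\<close> that deform \<open>A\<close> and \<open>M\<close> to first order, with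
  \<open>h\<close> regarded as a central element of \<open>B\<close>: \<open>\<pi>\<close> is the reduction \<open>B \<rightarrow> B/hB = A\<close> and \<open>\<rho>\<close> the reduction
  \<open>L \<rightarrow> L/hL = M\<close>. The two torsion conditions are what flatness over the dual numbers provides;
  they say that \<open>h b\<close> and \<open>h x\<close> determine \<open>\<pi> b\<close> and \<open>\<rho> x\<close>.\<close>

locale square_zero_lift =
  A: cring A + B: ring B + M: module A M + L: left_module B L
  for A :: "('a, 'x) ring_scheme" and B :: "('b, 'y) ring_scheme"
    and M :: "('a, 'm, 'u) module_scheme" and L :: "('b, 'l, 'v) module_scheme" +
  fixes h :: 'b and \<pi> :: "'b \<Rightarrow> 'a" and \<rho> :: "'l \<Rightarrow> 'm"
  assumes h_closed [simp]: "h \<in> carrier B"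
    and h_central: "b \<in> carrier B \<Longrightarrow> b \<otimes>\<^bsub>B\<^esub> h = h \<otimes>\<^bsub>B\<^esub> b"
    and h_square: "h \<otimes>\<^bsub>B\<^esub> h = \<zero>\<^bsub>B\<^esub>"
    and \<pi>_hom: "\<pi> \<in> ring_hom B A"
    and \<pi>_surj: "a \<in> carrier A \<Longrightarrow> \<exists>b\<in>carrier B. \<pi> b = a"
    and \<pi>_kernel: "b \<in> carrier B \<Longrightarrow> \<pi> b = \<zero>\<^bsub>A\<^esub> \<Longrightarrow> \<exists>c\<in>carrier B. b = h \<otimes>\<^bsub>B\<^esub> c"
    and \<pi>_torsion: "b \<in> carrier B \<Longrightarrow> h \<otimes>\<^bsub>B\<^esub> b = \<zero>\<^bsub>B\<^esub> \<longleftrightarrow> \<pi> b = \<zero>\<^bsub>A\<^esub>"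
    and \<rho>_closed [simp]: "x \<in> carrier L \<Longrightarrow> \<rho> x \<in> carrier M"
    and \<rho>_add: "x \<in> carrier L \<Longrightarrow> y \<in> carrier L \<Longrightarrow> \<rho> (x \<oplus>\<^bsub>L\<^esub> y) = \<rho> x \<oplus>\<^bsub>M\<^esub> \<rho> y"
    and \<rho>_smult: "b \<in> carrier B \<Longrightarrow> x \<in> carrier L \<Longrightarrow> \<rho> (b \<odot>\<^bsub>L\<^esub> x) = \<pi> b \<odot>\<^bsub>M\<^esub> \<rho> x"
    and \<rho>_surj: "z \<in> carrier M \<Longrightarrow> \<exists>x\<in>carrier L. \<rho> x = z"
    and \<rho>_kernel: "x \<in> carrier L \<Longrightarrow> \<rho> x = \<zero>\<^bsub>M\<^esub> \<Longrightarrow> \<exists>y\<in>carrier L. x = h \<odot>\<^bsub>L\<^esub> y"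
    and \<rho>_torsion: "x \<in> carrier L \<Longrightarrow> h \<odot>\<^bsub>L\<^esub> x = \<zero>\<^bsub>L\<^esub> \<Longrightarrow> \<rho> x = \<zero>\<^bsub>M\<^esub>"
begin

lemma \<pi>_closed [simp]: "b \<in> carrier B \<Longrightarrow> \<pi> b \<in> carrier A"
  and \<pi>_mult: "b \<in> carrier B \<Longrightarrow> c \<in> carrier B \<Longrightarrow> \<pi> (b \<otimes>\<^bsub>B\<^esub> c) = \<pi> b \<otimes>\<^bsub>A\<^esub> \<pi> c"
  and \<pi>_add: "b \<in> carrier B \<Longrightarrow> c \<in> carrier B \<Longrightarrow> \<pi> (b \<oplus>\<^bsub>B\<^esub> c) = \<pi> b \<oplus>\<^bsub>A\<^esub> \<pi> c"
  and \<pi>_one: "\<pi> \<one>\<^bsub>B\<^esub> = \<one>\<^bsub>A\<^esub>"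
  using \<pi>_hom by (auto simp: ring_hom_def)

lemma \<pi>_zero [simp]: "\<pi> \<zero>\<^bsub>B\<^esub> = \<zero>\<^bsub>A\<^esub>"
  using \<pi>_torsion[of "\<zero>\<^bsub>B\<^esub>"] by simp

lemma \<pi>_minus: "b \<in> carrier B \<Longrightarrow> c \<in> carrier B \<Longrightarrow> \<pi> (b \<ominus>\<^bsub>B\<^esub> c) = \<pi> b \<ominus>\<^bsub>A\<^esub> \<pi> c"
proof -
  assume bc: "b \<in> carrier B" "c \<in> carrier B"
  have "b = (b \<ominus>\<^bsub>B\<^esub> c) \<oplus>\<^bsub>B\<^esub> c" using bc by (simp add: B.minus_eq B.add.m_assoc B.l_neg)
  then have "\<pi> b = \<pi> (b \<ominus>\<^bsub>B\<^esub> c) \<oplus>\<^bsub>A\<^esub> \<pi> c" using \<pi>_add[of "b \<ominus>\<^bsub>B\<^esub> c" c] bc by simp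
  moreover have "\<pi> (b \<ominus>\<^bsub>B\<^esub> c) \<in> carrier A" "\<pi> c \<in> carrier A" using bc by auto
  ultimately show ?thesis by (simp add: A.minus_eq A.add.m_assoc A.r_neg)
qed

lemma \<rho>_zero [simp]: "\<rho> \<zero>\<^bsub>L\<^esub> = \<zero>\<^bsub>M\<^esub>"
  using \<rho>_torsion[of "\<zero>\<^bsub>L\<^esub>"] by simp

lemma \<rho>_finsum:
  assumes "finite I" "f \<in> I \<rightarrow> carrier L"
  shows "\<rho> (\<Oplus>\<^bsub>L\<^esub>i\<in>I. f i) = (\<Oplus>\<^bsub>M\<^esub>i\<in>I. \<rho> (f i))"
  using finsum_hom[OF L.M.abelian_monoid_axioms M.abelian_monoid_axioms assms order_refl, of \<rho>] \<rho>_add by auto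

lemma h_smult_square [simp]: "x \<in> carrier L \<Longrightarrow> h \<odot>\<^bsub>L\<^esub> (h \<odot>\<^bsub>L\<^esub> x) = \<zero>\<^bsub>L\<^esub>"
  using L.smult_assoc[of h h x] by (simp add: h_square)

lemma h_smult_commute:
  "b \<in> carrier B \<Longrightarrow> x \<in> carrier L \<Longrightarrow> b \<odot>\<^bsub>L\<^esub> (h \<odot>\<^bsub>L\<^esub> x) = h \<odot>\<^bsub>L\<^esub> (b \<odot>\<^bsub>L\<^esub> x)"
  using L.smult_assoc[of b h x] L.smult_assoc[of h b x] h_central[of b] by simp

text \<open>The bracket of \<open>\<pi> a\<close> and \<open>\<pi> b\<close> is \<open>\<pi> c\<close>.\<close>

lemma commutator_lift:
  assumes "a \<in> carrier B" "b \<in> carrier B"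
  obtains c where "c \<in> carrier B" "a \<otimes>\<^bsub>B\<^esub> b = b \<otimes>\<^bsub>B\<^esub> a \<oplus>\<^bsub>B\<^esub> h \<otimes>\<^bsub>B\<^esub> c"
proof -
  have "\<pi> (a \<otimes>\<^bsub>B\<^esub> b \<ominus>\<^bsub>B\<^esub> b \<otimes>\<^bsub>B\<^esub> a) = \<zero>\<^bsub>A\<^esub>"
    using assms by (simp add: \<pi>_minus \<pi>_mult A.m_comm A.r_neg A.minus_eq)
  then obtain c where c: "c \<in> carrier B" "a \<otimes>\<^bsub>B\<^esub> b \<ominus>\<^bsub>B\<^esub> b \<otimes>\<^bsub>B\<^esub> a = h \<otimes>\<^bsub>B\<^esub> c"
    using \<pi>_kernel assms by (metis B.m_closed B.minus_closed)
  have "a \<otimes>\<^bsub>B\<^esub> b = b \<otimes>\<^bsub>B\<^esub> a \<oplus>\<^bsub>B\<^esub> (a \<otimes>\<^bsub>B\<^esub> b \<ominus>\<^bsub>B\<^esub> b \<otimes>\<^bsub>B\<^esub> a)"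
    using assms by (simp add: B.minus_eq B.a_lcomm B.r_neg)
  then show thesis using that[of c] c by simp
qed

lemma h_cancel:
  assumes "x \<in> carrier L" "y \<in> carrier L" "h \<odot>\<^bsub>L\<^esub> x = h \<odot>\<^bsub>L\<^esub> y"
  shows "\<rho> x = \<rho> y"
proof -
  have "h \<odot>\<^bsub>L\<^esub> (x \<ominus>\<^bsub>L\<^esub> y) = \<zero>\<^bsub>L\<^esub>"
    using assms by (simp add: L.M.minus_eq L.smult_r_distr L.lm_smult_minus_right L.smult_closed L.M.r_neg)
  then have "\<rho> (x \<ominus>\<^bsub>L\<^esub> y) = \<zero>\<^bsub>M\<^esub>" using \<rho>_torsion assms by simp
  moreover have "x = (x \<ominus>\<^bsub>L\<^esub> y) \<oplus>\<^bsub>L\<^esub> y" using assms by (simp add: L.M.minus_eq L.M.add.m_assoc L.M.l_neg)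
  then have "\<rho> x = \<rho> (x \<ominus>\<^bsub>L\<^esub> y) \<oplus>\<^bsub>M\<^esub> \<rho> y" using \<rho>_add[of "x \<ominus>\<^bsub>L\<^esub> y" y] assms by simp
  ultimately show ?thesis using assms by simp
qed

abbreviation "Ann \<equiv> annihilator A M"

text \<open>For \<open>i\<close> and \<open>j\<close> in the annihilator, a lifting \<open>j'\<close> of \<open>j\<close> maps \<open>L\<close> into \<open>hL\<close> and a lifting
  \<open>i'\<close> of \<open>i\<close> maps \<open>hL\<close> into \<open>h\<^sup>2L = 0\<close>, so the lifting \<open>i' j'\<close> of \<open>i j\<close> acts as zero. Any other
  lifting differs from it by some \<open>h w\<close>. A lifting of a single element of the annihilator would act as
  \<open>h\<close> times a map that need not come from \<open>B\<close>.\<close>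

lemma annihilator_square_lift:
  assumes "t \<in> carrier B" "\<pi> t \<in> ideal_prod A Ann Ann"
  shows "\<exists>w\<in>carrier B. \<forall>x\<in>carrier L. t \<odot>\<^bsub>L\<^esub> x = h \<odot>\<^bsub>L\<^esub> (w \<odot>\<^bsub>L\<^esub> x)"
proof -
  have "\<exists>w\<in>carrier B. \<forall>x\<in>carrier L. t \<odot>\<^bsub>L\<^esub> x = h \<odot>\<^bsub>L\<^esub> (w \<odot>\<^bsub>L\<^esub> x)"
    if "s \<in> ideal_prod A Ann Ann" "t \<in> carrier B" "\<pi> t = s" for s t
    using that
  proof (induction s arbitrary: t rule: ideal_prod.induct)
    case (prod i j)
    have ij: "i \<in> carrier A" "j \<in> carrier A" 
      "\<And>y. y \<in> carrier M \<Longrightarrow> i \<odot>\<^bsub>M\<^esub> y = \<zero>\<^bsub>M\<^esub>" "\<And>y. y \<in> carrier M \<Longrightarrow> j \<odot>\<^bsub>M\<^esub> y = \<zero>\<^bsub>M\<^esub>"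
      using prod by (auto simp: annihilator_def)
    obtain i' j' where l: "i' \<in> carrier B" "\<pi> i' = i" "j' \<in> carrier B" "\<pi> j' = j"
      using \<pi>_surj ij by metis
    have "\<pi> (t \<ominus>\<^bsub>B\<^esub> i' \<otimes>\<^bsub>B\<^esub> j') = \<zero>\<^bsub>A\<^esub>"
      using l prod ij by (simp add: \<pi>_minus \<pi>_mult A.minus_eq A.r_neg)
    then obtain w where w: "w \<in> carrier B" "t \<ominus>\<^bsub>B\<^esub> i' \<otimes>\<^bsub>B\<^esub> j' = h \<otimes>\<^bsub>B\<^esub> w"
      using \<pi>_kernel l prod by (metis B.m_closed B.minus_closed)
    have "t = (t \<ominus>\<^bsub>B\<^esub> i' \<otimes>\<^bsub>B\<^esub> j') \<oplus>\<^bsub>B\<^esub> i' \<otimes>\<^bsub>B\<^esub> j'" 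
      using l prod by (simp add: B.minus_eq B.add.m_assoc B.l_neg)
    then have t: "t = h \<otimes>\<^bsub>B\<^esub> w \<oplus>\<^bsub>B\<^esub> i' \<otimes>\<^bsub>B\<^esub> j'" using w by simp
    have "t \<odot>\<^bsub>L\<^esub> x = h \<odot>\<^bsub>L\<^esub> (w \<odot>\<^bsub>L\<^esub> x)" if x: "x \<in> carrier L" for x
    proof -
      have "\<rho> (j' \<odot>\<^bsub>L\<^esub> x) = \<zero>\<^bsub>M\<^esub>" using \<rho>_smult l ij x by simp
      then obtain y where y: "y \<in> carrier L" "j' \<odot>\<^bsub>L\<^esub> x = h \<odot>\<^bsub>L\<^esub> y" using \<rho>_kernel L.smult_closed l x by metis
      have "\<rho> (i' \<odot>\<^bsub>L\<^esub> y) = \<zero>\<^bsub>M\<^esub>" using \<rho>_smult l ij y by simp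
      then obtain z where z: "z \<in> carrier L" "i' \<odot>\<^bsub>L\<^esub> y = h \<odot>\<^bsub>L\<^esub> z" using \<rho>_kernel L.smult_closed l y by metis
      have "(i' \<otimes>\<^bsub>B\<^esub> j') \<odot>\<^bsub>L\<^esub> x = \<zero>\<^bsub>L\<^esub>"
        using L.smult_assoc[OF l(1,3) x] h_smult_commute[OF l(1) y(1)] y(2) z by simp
      then show ?thesis unfolding t using l w x by (simp add: L.smult_l_distr L.smult_assoc L.smult_closed)
    qed
    then show ?case using w by blast
  next
    case (sum s1 s2)
    have I: "Ann \<subseteq> carrier A" by (auto simp: annihilator_def)
    have ic: "s \<in> carrier A" if "s \<in> ideal_prod A Ann Ann" for s
      using that I by (induction s rule: ideal_prod.induct) auto
    have c: "s1 \<in> carrier A" "s2 \<in> carrier A" using sum.hyps ic by auto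
    obtain t1 where t1: "t1 \<in> carrier B" "\<pi> t1 = s1" using \<pi>_surj c by blast
    have "\<pi> (t \<ominus>\<^bsub>B\<^esub> t1) = (s1 \<oplus>\<^bsub>A\<^esub> s2) \<ominus>\<^bsub>A\<^esub> s1" using t1 sum.prems by (simp add: \<pi>_minus)
    also have "\<dots> = s2" using c by algebra
    finally have t2: "\<pi> (t \<ominus>\<^bsub>B\<^esub> t1) = s2" "t \<ominus>\<^bsub>B\<^esub> t1 \<in> carrier B" using t1 sum.prems by auto
    obtain w1 where w1: "w1 \<in> carrier B" "\<forall>x\<in>carrier L. t1 \<odot>\<^bsub>L\<^esub> x = h \<odot>\<^bsub>L\<^esub> (w1 \<odot>\<^bsub>L\<^esub> x)"
      using sum.IH(1)[OF t1] by (rule bexE)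
    obtain w2 where w2: "w2 \<in> carrier B" "\<forall>x\<in>carrier L. (t \<ominus>\<^bsub>B\<^esub> t1) \<odot>\<^bsub>L\<^esub> x = h \<odot>\<^bsub>L\<^esub> (w2 \<odot>\<^bsub>L\<^esub> x)"
      using sum.IH(2)[OF t2(2,1)] by (rule bexE)
    note w = w1 w2
    have t: "t = (t \<ominus>\<^bsub>B\<^esub> t1) \<oplus>\<^bsub>B\<^esub> t1" 
      using t1 sum.prems by (simp add: B.minus_eq B.add.m_assoc B.l_neg)
    have "t \<odot>\<^bsub>L\<^esub> x = h \<odot>\<^bsub>L\<^esub> ((w2 \<oplus>\<^bsub>B\<^esub> w1) \<odot>\<^bsub>L\<^esub> x)" if x: "x \<in> carrier L" for x
    proof -
      have "t \<odot>\<^bsub>L\<^esub> x = (t \<ominus>\<^bsub>B\<^esub> t1) \<odot>\<^bsub>L\<^esub> x \<oplus>\<^bsub>L\<^esub> t1 \<odot>\<^bsub>L\<^esub> x"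
        using L.smult_l_distr[OF t2(2) t1(1) x] t by simp
      then show ?thesis using w x by (simp add: L.smult_l_distr L.smult_r_distr L.smult_closed)
    qed
    then show ?case using w by blast
  qed
  then show ?thesis using assms by blast
qed

text \<open>Expand \<open>b \<epsilon>\<^sub>i\<close> and move \<open>a\<close> past the coefficients \<open>q i j\<close>. The commutators
  that arise are \<open>h (g i j)\<close>, and \<open>g\<close> is strictly triangular along with \<open>q\<close>.\<close>

lemma lifted_product:
  fixes p q :: "nat \<Rightarrow> nat \<Rightarrow> 'b"
  assumes \<epsilon>: "\<And>i. i < d \<Longrightarrow> \<epsilon> i \<in> carrier L" and a: "a \<in> carrier B" and b: "b \<in> carrier B"
    and p: "\<And>i j. p i j \<in> carrier B" and q: "\<And>i j. q i j \<in> carrier B" "\<And>i j. i \<le> j \<Longrightarrow> q i j = \<zero>\<^bsub>B\<^esub>"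
    and \<alpha>: "\<And>i. i < d \<Longrightarrow> \<alpha> i \<in> carrier L" and \<beta>: "\<And>i. i < d \<Longrightarrow> \<beta> i \<in> carrier L"
    and ae: "\<And>i. i < d \<Longrightarrow> a \<odot>\<^bsub>L\<^esub> \<epsilon> i = (\<Oplus>\<^bsub>L\<^esub>j\<in>{..<d}. p i j \<odot>\<^bsub>L\<^esub> \<epsilon> j) \<oplus>\<^bsub>L\<^esub> h \<odot>\<^bsub>L\<^esub> \<alpha> i"
    and be: "\<And>i. i < d \<Longrightarrow> b \<odot>\<^bsub>L\<^esub> \<epsilon> i = (\<Oplus>\<^bsub>L\<^esub>j\<in>{..<d}. q i j \<odot>\<^bsub>L\<^esub> \<epsilon> j) \<oplus>\<^bsub>L\<^esub> h \<odot>\<^bsub>L\<^esub> \<beta> i"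
  shows "\<exists>g. (\<forall>i j. g i j \<in> carrier B) \<and> (\<forall>i j. i \<le> j \<longrightarrow> g i j = \<zero>\<^bsub>B\<^esub>) \<and>
    (\<forall>i<d. (a \<otimes>\<^bsub>B\<^esub> b) \<odot>\<^bsub>L\<^esub> \<epsilon> i =
      (\<Oplus>\<^bsub>L\<^esub>k\<in>{..<d}. (\<Oplus>\<^bsub>B\<^esub>j\<in>{..<d}. q i j \<otimes>\<^bsub>B\<^esub> p j k) \<odot>\<^bsub>L\<^esub> \<epsilon> k) \<oplus>\<^bsub>L\<^esub>
      h \<odot>\<^bsub>L\<^esub> ((\<Oplus>\<^bsub>L\<^esub>j\<in>{..<d}. q i j \<odot>\<^bsub>L\<^esub> \<alpha> j) \<oplus>\<^bsub>L\<^esub> (\<Oplus>\<^bsub>L\<^esub>j\<in>{..<d}. g i j \<odot>\<^bsub>L\<^esub> \<epsilon> j) \<oplus>\<^bsub>L\<^esub> a \<odot>\<^bsub>L\<^esub> \<beta> i))"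
proof -
  \<comment> \<open>where \<open>q i j\<close> vanishes, the correction is chosen to be zero; this keeps it triangular\<close>
  define P where "P i j c \<longleftrightarrow> c \<in> carrier B \<and> (i \<le> j \<longrightarrow> c = \<zero>\<^bsub>B\<^esub>) \<and>
    a \<otimes>\<^bsub>B\<^esub> q i j = q i j \<otimes>\<^bsub>B\<^esub> a \<oplus>\<^bsub>B\<^esub> h \<otimes>\<^bsub>B\<^esub> c" for i j c
  have ex: "\<exists>c. P i j c" for i j
  proof (cases "i \<le> j")
    case True
    then show ?thesis using q(2) a by (intro exI[of _ "\<zero>\<^bsub>B\<^esub>"]) (simp add: P_def)
  next
    case False
    obtain c where "c \<in> carrier B" "a \<otimes>\<^bsub>B\<^esub> q i j = q i j \<otimes>\<^bsub>B\<^esub> a \<oplus>\<^bsub>B\<^esub> h \<otimes>\<^bsub>B\<^esub> c"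
      by (rule commutator_lift[OF a q(1)[of i j]])
    then show ?thesis using False by (intro exI[of _ c]) (simp add: P_def)
  qed
  define g where "g i j = (SOME c. P i j c)" for i j
  have "P i j (g i j)" for i j unfolding g_def by (rule someI_ex[OF ex])
  then have g: "\<And>i j. g i j \<in> carrier B" "\<And>i j. i \<le> j \<Longrightarrow> g i j = \<zero>\<^bsub>B\<^esub>"
    "\<And>i j. a \<otimes>\<^bsub>B\<^esub> q i j = q i j \<otimes>\<^bsub>B\<^esub> a \<oplus>\<^bsub>B\<^esub> h \<otimes>\<^bsub>B\<^esub> g i j" by (auto simp: P_def)
  note sc = L.smult_closed
  have "(a \<otimes>\<^bsub>B\<^esub> b) \<odot>\<^bsub>L\<^esub> \<epsilon> i =
      (\<Oplus>\<^bsub>L\<^esub>k\<in>{..<d}. (\<Oplus>\<^bsub>B\<^esub>j\<in>{..<d}. q i j \<otimes>\<^bsub>B\<^esub> p j k) \<odot>\<^bsub>L\<^esub> \<epsilon> k) \<oplus>\<^bsub>L\<^esub>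
      h \<odot>\<^bsub>L\<^esub> ((\<Oplus>\<^bsub>L\<^esub>j\<in>{..<d}. q i j \<odot>\<^bsub>L\<^esub> \<alpha> j) \<oplus>\<^bsub>L\<^esub> (\<Oplus>\<^bsub>L\<^esub>j\<in>{..<d}. g i j \<odot>\<^bsub>L\<^esub> \<epsilon> j) \<oplus>\<^bsub>L\<^esub> a \<odot>\<^bsub>L\<^esub> \<beta> i)"
    if i: "i < d" for i
  proof -
    have step: "a \<odot>\<^bsub>L\<^esub> (q i j \<odot>\<^bsub>L\<^esub> \<epsilon> j) = (\<Oplus>\<^bsub>L\<^esub>k\<in>{..<d}. (q i j \<otimes>\<^bsub>B\<^esub> p j k) \<odot>\<^bsub>L\<^esub> \<epsilon> k) \<oplus>\<^bsub>L\<^esub>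
        (h \<odot>\<^bsub>L\<^esub> (q i j \<odot>\<^bsub>L\<^esub> \<alpha> j) \<oplus>\<^bsub>L\<^esub> h \<odot>\<^bsub>L\<^esub> (g i j \<odot>\<^bsub>L\<^esub> \<epsilon> j))" if j: "j < d" for j
    proof -
      have s: "(\<Oplus>\<^bsub>L\<^esub>k\<in>{..<d}. p j k \<odot>\<^bsub>L\<^esub> \<epsilon> k) \<in> carrier L" 
        using p \<epsilon> sc by (intro L.M.finsum_closed) auto
      have "a \<odot>\<^bsub>L\<^esub> (q i j \<odot>\<^bsub>L\<^esub> \<epsilon> j) = (q i j \<otimes>\<^bsub>B\<^esub> a \<oplus>\<^bsub>B\<^esub> h \<otimes>\<^bsub>B\<^esub> g i j) \<odot>\<^bsub>L\<^esub> \<epsilon> j"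
        using g(3)[of i j] a q(1) \<epsilon>[OF j] by (simp add: L.smult_assoc[symmetric])
      also have "\<dots> = q i j \<odot>\<^bsub>L\<^esub> (a \<odot>\<^bsub>L\<^esub> \<epsilon> j) \<oplus>\<^bsub>L\<^esub> h \<odot>\<^bsub>L\<^esub> (g i j \<odot>\<^bsub>L\<^esub> \<epsilon> j)"
        using a q(1) g(1) \<epsilon>[OF j] by (simp add: L.smult_l_distr L.smult_assoc)
      also have "q i j \<odot>\<^bsub>L\<^esub> (a \<odot>\<^bsub>L\<^esub> \<epsilon> j) = q i j \<odot>\<^bsub>L\<^esub> (\<Oplus>\<^bsub>L\<^esub>k\<in>{..<d}. p j k \<odot>\<^bsub>L\<^esub> \<epsilon> k) \<oplus>\<^bsub>L\<^esub> h \<odot>\<^bsub>L\<^esub> (q i j \<odot>\<^bsub>L\<^esub> \<alpha> j)"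
        using ae[OF j] s q(1) \<alpha>[OF j] sc by (simp add: L.smult_r_distr h_smult_commute)
      also have "q i j \<odot>\<^bsub>L\<^esub> (\<Oplus>\<^bsub>L\<^esub>k\<in>{..<d}. p j k \<odot>\<^bsub>L\<^esub> \<epsilon> k) = (\<Oplus>\<^bsub>L\<^esub>k\<in>{..<d}. q i j \<odot>\<^bsub>L\<^esub> (p j k \<odot>\<^bsub>L\<^esub> \<epsilon> k))"
        using q(1) p \<epsilon> sc by (intro L.lm_smult_finsum_right) auto
      also have "\<dots> = (\<Oplus>\<^bsub>L\<^esub>k\<in>{..<d}. (q i j \<otimes>\<^bsub>B\<^esub> p j k) \<odot>\<^bsub>L\<^esub> \<epsilon> k)"
        using q(1) p \<epsilon> sc by (intro L.M.finsum_cong') (auto simp: L.smult_assoc)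
      finally show ?thesis using q(1) p \<epsilon> j \<alpha> g(1) sc 
        by (subst L.M.a_assoc[symmetric]) (auto intro!: L.M.finsum_closed)
    qed
    have c1: "(q i j \<otimes>\<^bsub>B\<^esub> p j k) \<odot>\<^bsub>L\<^esub> \<epsilon> k \<in> carrier L" if "k < d" for j k using q(1) p \<epsilon> that sc by simp
    have c2: "q i j \<odot>\<^bsub>L\<^esub> \<alpha> j \<in> carrier L" "g i j \<odot>\<^bsub>L\<^esub> \<epsilon> j \<in> carrier L" "q i j \<odot>\<^bsub>L\<^esub> \<epsilon> j \<in> carrier L" if "j < d" for j 
      using q(1) \<alpha> g(1) \<epsilon> that sc by auto
    have "(a \<otimes>\<^bsub>B\<^esub> b) \<odot>\<^bsub>L\<^esub> \<epsilon> i = a \<odot>\<^bsub>L\<^esub> ((\<Oplus>\<^bsub>L\<^esub>j\<in>{..<d}. q i j \<odot>\<^bsub>L\<^esub> \<epsilon> j) \<oplus>\<^bsub>L\<^esub> h \<odot>\<^bsub>L\<^esub> \<beta> i)"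
      using be[OF i] a b \<epsilon>[OF i] by (simp add: L.smult_assoc)
    also have "\<dots> = a \<odot>\<^bsub>L\<^esub> (\<Oplus>\<^bsub>L\<^esub>j\<in>{..<d}. q i j \<odot>\<^bsub>L\<^esub> \<epsilon> j) \<oplus>\<^bsub>L\<^esub> h \<odot>\<^bsub>L\<^esub> (a \<odot>\<^bsub>L\<^esub> \<beta> i)"
      using a c2 \<beta>[OF i] sc by (subst L.smult_r_distr) (auto intro!: L.M.finsum_closed simp: h_smult_commute)
    also have "a \<odot>\<^bsub>L\<^esub> (\<Oplus>\<^bsub>L\<^esub>j\<in>{..<d}. q i j \<odot>\<^bsub>L\<^esub> \<epsilon> j) = (\<Oplus>\<^bsub>L\<^esub>j\<in>{..<d}. a \<odot>\<^bsub>L\<^esub> (q i j \<odot>\<^bsub>L\<^esub> \<epsilon> j))"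
      using a c2 by (intro L.lm_smult_finsum_right) auto
    also have "\<dots> = (\<Oplus>\<^bsub>L\<^esub>j\<in>{..<d}. (\<Oplus>\<^bsub>L\<^esub>k\<in>{..<d}. (q i j \<otimes>\<^bsub>B\<^esub> p j k) \<odot>\<^bsub>L\<^esub> \<epsilon> k) \<oplus>\<^bsub>L\<^esub>
        (h \<odot>\<^bsub>L\<^esub> (q i j \<odot>\<^bsub>L\<^esub> \<alpha> j) \<oplus>\<^bsub>L\<^esub> h \<odot>\<^bsub>L\<^esub> (g i j \<odot>\<^bsub>L\<^esub> \<epsilon> j)))"
      using step c1 c2 sc by (intro L.M.finsum_cong') (auto intro!: L.M.finsum_closed)
    also have "\<dots> = (\<Oplus>\<^bsub>L\<^esub>j\<in>{..<d}. \<Oplus>\<^bsub>L\<^esub>k\<in>{..<d}. (q i j \<otimes>\<^bsub>B\<^esub> p j k) \<odot>\<^bsub>L\<^esub> \<epsilon> k) \<oplus>\<^bsub>L\<^esub>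
        ((\<Oplus>\<^bsub>L\<^esub>j\<in>{..<d}. h \<odot>\<^bsub>L\<^esub> (q i j \<odot>\<^bsub>L\<^esub> \<alpha> j)) \<oplus>\<^bsub>L\<^esub> (\<Oplus>\<^bsub>L\<^esub>j\<in>{..<d}. h \<odot>\<^bsub>L\<^esub> (g i j \<odot>\<^bsub>L\<^esub> \<epsilon> j)))"
      using c1 c2 sc by (subst L.M.finsum_addf; (subst L.M.finsum_addf)?) (auto intro!: L.M.finsum_closed)
    also have "(\<Oplus>\<^bsub>L\<^esub>j\<in>{..<d}. h \<odot>\<^bsub>L\<^esub> (q i j \<odot>\<^bsub>L\<^esub> \<alpha> j)) = h \<odot>\<^bsub>L\<^esub> (\<Oplus>\<^bsub>L\<^esub>j\<in>{..<d}. q i j \<odot>\<^bsub>L\<^esub> \<alpha> j)"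
      using c2 by (intro L.lm_smult_finsum_right[symmetric]) auto
    also have "(\<Oplus>\<^bsub>L\<^esub>j\<in>{..<d}. h \<odot>\<^bsub>L\<^esub> (g i j \<odot>\<^bsub>L\<^esub> \<epsilon> j)) = h \<odot>\<^bsub>L\<^esub> (\<Oplus>\<^bsub>L\<^esub>j\<in>{..<d}. g i j \<odot>\<^bsub>L\<^esub> \<epsilon> j)"
      using c2 by (intro L.lm_smult_finsum_right[symmetric]) auto
    also have "(\<Oplus>\<^bsub>L\<^esub>j\<in>{..<d}. \<Oplus>\<^bsub>L\<^esub>k\<in>{..<d}. (q i j \<otimes>\<^bsub>B\<^esub> p j k) \<odot>\<^bsub>L\<^esub> \<epsilon> k) =
        (\<Oplus>\<^bsub>L\<^esub>k\<in>{..<d}. \<Oplus>\<^bsub>L\<^esub>j\<in>{..<d}. (q i j \<otimes>\<^bsub>B\<^esub> p j k) \<odot>\<^bsub>L\<^esub> \<epsilon> k)"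
      using c1 by (intro L.M.finsum_swap) auto
    also have "\<dots> = (\<Oplus>\<^bsub>L\<^esub>k\<in>{..<d}. (\<Oplus>\<^bsub>B\<^esub>j\<in>{..<d}. q i j \<otimes>\<^bsub>B\<^esub> p j k) \<odot>\<^bsub>L\<^esub> \<epsilon> k)"
      using p q(1) \<epsilon> sc by (intro L.M.finsum_cong') (auto intro!: L.lm_smult_finsum_left[symmetric] sc B.finsum_closed)
    finally have e: "(a \<otimes>\<^bsub>B\<^esub> b) \<odot>\<^bsub>L\<^esub> \<epsilon> i = (\<Oplus>\<^bsub>L\<^esub>k\<in>{..<d}. (\<Oplus>\<^bsub>B\<^esub>j\<in>{..<d}. q i j \<otimes>\<^bsub>B\<^esub> p j k) \<odot>\<^bsub>L\<^esub> \<epsilon> k) \<oplus>\<^bsub>L\<^esub>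
      (h \<odot>\<^bsub>L\<^esub> (\<Oplus>\<^bsub>L\<^esub>j\<in>{..<d}. q i j \<odot>\<^bsub>L\<^esub> \<alpha> j) \<oplus>\<^bsub>L\<^esub> h \<odot>\<^bsub>L\<^esub> (\<Oplus>\<^bsub>L\<^esub>j\<in>{..<d}. g i j \<odot>\<^bsub>L\<^esub> \<epsilon> j)) \<oplus>\<^bsub>L\<^esub> h \<odot>\<^bsub>L\<^esub> (a \<odot>\<^bsub>L\<^esub> \<beta> i)" .
    have cl: "(\<Oplus>\<^bsub>L\<^esub>k\<in>{..<d}. (\<Oplus>\<^bsub>B\<^esub>j\<in>{..<d}. q i j \<otimes>\<^bsub>B\<^esub> p j k) \<odot>\<^bsub>L\<^esub> \<epsilon> k) \<in> carrier L"
      "(\<Oplus>\<^bsub>L\<^esub>j\<in>{..<d}. q i j \<odot>\<^bsub>L\<^esub> \<alpha> j) \<in> carrier L" "(\<Oplus>\<^bsub>L\<^esub>j\<in>{..<d}. g i j \<odot>\<^bsub>L\<^esub> \<epsilon> j) \<in> carrier L"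
      "a \<odot>\<^bsub>L\<^esub> \<beta> i \<in> carrier L"
      using p q(1) \<epsilon> c2 a \<beta>[OF i] by (auto intro!: L.M.finsum_closed sc B.finsum_closed)
    show ?thesis unfolding e using cl sc by (simp add: L.smult_r_distr L.M.a_assoc)
  qed
  then show ?thesis using g by blast
qed


text \<open>Subtract the expansions of \<open>a b \<epsilon>\<^sub>i\<close> and \<open>b a \<epsilon>\<^sub>i\<close> given by \<open>lifted_product\<close>,
  multiply by \<open>\<tau>\<close> and cancel \<open>h\<close>. The difference of the matrix products \<open>qp\<close> and \<open>pq\<close> is strictly
  triangular, and after multiplication by \<open>\<tau>\<close> its entries are liftings of elements of the square of
  the annihilator, so they act as multiples of \<open>h\<close> in \<open>B\<close>. Together with the commutators from \<open>lifted_product\<close>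
  they make up the strictly triangular matrix \<open>y\<close>.\<close>

theorem lifted_commutator:
  fixes p q :: "nat \<Rightarrow> nat \<Rightarrow> 'b"
  assumes \<epsilon>: "\<And>i. i < d \<Longrightarrow> \<epsilon> i \<in> carrier L" and a: "a \<in> carrier B" and b: "b \<in> carrier B"
    and p: "\<And>i j. p i j \<in> carrier B" "\<And>i j. i \<le> j \<Longrightarrow> p i j = \<zero>\<^bsub>B\<^esub>" 
    and q: "\<And>i j. q i j \<in> carrier B" "\<And>i j. i \<le> j \<Longrightarrow> q i j = \<zero>\<^bsub>B\<^esub>"
    and \<alpha>: "\<And>i. i < d \<Longrightarrow> \<alpha> i \<in> carrier L" and \<beta>: "\<And>i. i < d \<Longrightarrow> \<beta> i \<in> carrier L"
    and ae: "\<And>i. i < d \<Longrightarrow> a \<odot>\<^bsub>L\<^esub> \<epsilon> i = (\<Oplus>\<^bsub>L\<^esub>j\<in>{..<d}. p i j \<odot>\<^bsub>L\<^esub> \<epsilon> j) \<oplus>\<^bsub>L\<^esub> h \<odot>\<^bsub>L\<^esub> \<alpha> i"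
    and be: "\<And>i. i < d \<Longrightarrow> b \<odot>\<^bsub>L\<^esub> \<epsilon> i = (\<Oplus>\<^bsub>L\<^esub>j\<in>{..<d}. q i j \<odot>\<^bsub>L\<^esub> \<epsilon> j) \<oplus>\<^bsub>L\<^esub> h \<odot>\<^bsub>L\<^esub> \<beta> i"
    and w: "w \<in> carrier B" "a \<otimes>\<^bsub>B\<^esub> b = b \<otimes>\<^bsub>B\<^esub> a \<oplus>\<^bsub>B\<^esub> h \<otimes>\<^bsub>B\<^esub> w"
    and \<tau>: "\<tau> \<in> carrier B"
    and T: "\<And>i k. i < d \<Longrightarrow> k < d \<Longrightarrow>
      \<pi> \<tau> \<otimes>\<^bsub>A\<^esub> \<pi> ((\<Oplus>\<^bsub>B\<^esub>j\<in>{..<d}. q i j \<otimes>\<^bsub>B\<^esub> p j k) \<ominus>\<^bsub>B\<^esub> (\<Oplus>\<^bsub>B\<^esub>j\<in>{..<d}. p i j \<otimes>\<^bsub>B\<^esub> q j k))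
        \<in> ideal_prod A Ann Ann"
  shows "\<exists>y. (\<forall>i j. y i j \<in> carrier A) \<and> (\<forall>i j. i \<le> j \<longrightarrow> y i j = \<zero>\<^bsub>A\<^esub>) \<and>
    (\<forall>i<d. (\<pi> \<tau> \<otimes>\<^bsub>A\<^esub> \<pi> w) \<odot>\<^bsub>M\<^esub> \<rho> (\<epsilon> i) \<oplus>\<^bsub>M\<^esub>
        \<pi> \<tau> \<odot>\<^bsub>M\<^esub> ((\<Oplus>\<^bsub>M\<^esub>j\<in>{..<d}. \<pi> (p i j) \<odot>\<^bsub>M\<^esub> \<rho> (\<beta> j)) \<oplus>\<^bsub>M\<^esub> \<pi> b \<odot>\<^bsub>M\<^esub> \<rho> (\<alpha> i)) =
      (\<Oplus>\<^bsub>M\<^esub>k\<in>{..<d}. y i k \<odot>\<^bsub>M\<^esub> \<rho> (\<epsilon> k)) \<oplus>\<^bsub>M\<^esub>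
        \<pi> \<tau> \<odot>\<^bsub>M\<^esub> ((\<Oplus>\<^bsub>M\<^esub>j\<in>{..<d}. \<pi> (q i j) \<odot>\<^bsub>M\<^esub> \<rho> (\<alpha> j)) \<oplus>\<^bsub>M\<^esub> \<pi> a \<odot>\<^bsub>M\<^esub> \<rho> (\<beta> i)))"
proof -
  note sc = L.smult_closed and msc = M.smult_closed
  define S where "S i k = (\<Oplus>\<^bsub>B\<^esub>j\<in>{..<d}. q i j \<otimes>\<^bsub>B\<^esub> p j k)" for i k
  define S' where "S' i k = (\<Oplus>\<^bsub>B\<^esub>j\<in>{..<d}. p i j \<otimes>\<^bsub>B\<^esub> q j k)" for i k
  have SB: "S i k \<in> carrier B" "S' i k \<in> carrier B" for i k
    unfolding S_def S'_def using p q by (auto intro!: B.finsum_closed)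
  obtain g where g: "\<And>i j. g i j \<in> carrier B" "\<And>i j. i \<le> j \<Longrightarrow> g i j = \<zero>\<^bsub>B\<^esub>"
    and abe: "\<And>i. i < d \<Longrightarrow> (a \<otimes>\<^bsub>B\<^esub> b) \<odot>\<^bsub>L\<^esub> \<epsilon> i = (\<Oplus>\<^bsub>L\<^esub>k\<in>{..<d}. S i k \<odot>\<^bsub>L\<^esub> \<epsilon> k) \<oplus>\<^bsub>L\<^esub>
      h \<odot>\<^bsub>L\<^esub> ((\<Oplus>\<^bsub>L\<^esub>j\<in>{..<d}. q i j \<odot>\<^bsub>L\<^esub> \<alpha> j) \<oplus>\<^bsub>L\<^esub> (\<Oplus>\<^bsub>L\<^esub>j\<in>{..<d}. g i j \<odot>\<^bsub>L\<^esub> \<epsilon> j) \<oplus>\<^bsub>L\<^esub> a \<odot>\<^bsub>L\<^esub> \<beta> i)"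
    using lifted_product[OF \<epsilon> a b p(1) q \<alpha> \<beta> ae be] unfolding S_def[symmetric] by auto
  obtain f where f: "\<And>i j. f i j \<in> carrier B" "\<And>i j. i \<le> j \<Longrightarrow> f i j = \<zero>\<^bsub>B\<^esub>"
    and bae: "\<And>i. i < d \<Longrightarrow> (b \<otimes>\<^bsub>B\<^esub> a) \<odot>\<^bsub>L\<^esub> \<epsilon> i = (\<Oplus>\<^bsub>L\<^esub>k\<in>{..<d}. S' i k \<odot>\<^bsub>L\<^esub> \<epsilon> k) \<oplus>\<^bsub>L\<^esub>
      h \<odot>\<^bsub>L\<^esub> ((\<Oplus>\<^bsub>L\<^esub>j\<in>{..<d}. p i j \<odot>\<^bsub>L\<^esub> \<beta> j) \<oplus>\<^bsub>L\<^esub> (\<Oplus>\<^bsub>L\<^esub>j\<in>{..<d}. f i j \<odot>\<^bsub>L\<^esub> \<epsilon> j) \<oplus>\<^bsub>L\<^esub> b \<odot>\<^bsub>L\<^esub> \<alpha> i)"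
    using lifted_product[OF \<epsilon> b a q(1) p \<beta> \<alpha> be ae] unfolding S'_def[symmetric] by auto
  have Sz: "S i k = \<zero>\<^bsub>B\<^esub>" "S' i k = \<zero>\<^bsub>B\<^esub>" if "i \<le> k" for i k
  proof -
    have "q i j \<otimes>\<^bsub>B\<^esub> p j k = \<zero>\<^bsub>B\<^esub>" "p i j \<otimes>\<^bsub>B\<^esub> q j k = \<zero>\<^bsub>B\<^esub>" for j
      using that p q by (cases "i \<le> j"; simp)+
    then show "S i k = \<zero>\<^bsub>B\<^esub>" "S' i k = \<zero>\<^bsub>B\<^esub>" by (simp_all add: S_def S'_def)
  qed
  define P where "P i k c \<longleftrightarrow> c \<in> carrier B \<and> (i \<le> k \<longrightarrow> c = \<zero>\<^bsub>B\<^esub>) \<and> (i < d \<longrightarrow> k < d \<longrightarrow>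
      \<tau> \<odot>\<^bsub>L\<^esub> (S i k \<odot>\<^bsub>L\<^esub> \<epsilon> k) = \<tau> \<odot>\<^bsub>L\<^esub> (S' i k \<odot>\<^bsub>L\<^esub> \<epsilon> k) \<oplus>\<^bsub>L\<^esub> h \<odot>\<^bsub>L\<^esub> (c \<odot>\<^bsub>L\<^esub> \<epsilon> k))" for i k c
  have ex: "\<exists>c. P i k c" for i k
  proof (cases "i \<le> k \<or> \<not> (i < d \<and> k < d)")
    case True
    then show ?thesis
      using Sz[of i k] \<tau> \<epsilon>[of k] by (intro exI[of _ "\<zero>\<^bsub>B\<^esub>"]) (auto simp: P_def)
  next
    case False
    then have ik: "i < d" "k < d" "\<not> i \<le> k" by auto
    have "\<tau> \<otimes>\<^bsub>B\<^esub> (S i k \<ominus>\<^bsub>B\<^esub> S' i k) \<in> carrier B" "\<pi> (\<tau> \<otimes>\<^bsub>B\<^esub> (S i k \<ominus>\<^bsub>B\<^esub> S' i k)) \<in> ideal_prod A Ann Ann"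
      using T[OF ik(1,2)] SB \<tau> unfolding S_def[symmetric] S'_def[symmetric] by (auto simp: \<pi>_mult)
    then obtain c where c: "c \<in> carrier B"
      "\<forall>x\<in>carrier L. (\<tau> \<otimes>\<^bsub>B\<^esub> (S i k \<ominus>\<^bsub>B\<^esub> S' i k)) \<odot>\<^bsub>L\<^esub> x = h \<odot>\<^bsub>L\<^esub> (c \<odot>\<^bsub>L\<^esub> x)"
      by (rule bexE[OF annihilator_square_lift])
    have "S i k = S' i k \<oplus>\<^bsub>B\<^esub> (S i k \<ominus>\<^bsub>B\<^esub> S' i k)" using SB[of i k] by (simp add: B.minus_eq B.a_lcomm[of "S' i k"] B.r_neg)
    then have "S i k \<odot>\<^bsub>L\<^esub> \<epsilon> k = S' i k \<odot>\<^bsub>L\<^esub> \<epsilon> k \<oplus>\<^bsub>L\<^esub> (S i k \<ominus>\<^bsub>B\<^esub> S' i k) \<odot>\<^bsub>L\<^esub> \<epsilon> k"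
      using L.smult_l_distr[of "S' i k" "S i k \<ominus>\<^bsub>B\<^esub> S' i k" "\<epsilon> k"] SB \<epsilon>[OF ik(2)] by simp
    then have "\<tau> \<odot>\<^bsub>L\<^esub> (S i k \<odot>\<^bsub>L\<^esub> \<epsilon> k) = \<tau> \<odot>\<^bsub>L\<^esub> (S' i k \<odot>\<^bsub>L\<^esub> \<epsilon> k) \<oplus>\<^bsub>L\<^esub> h \<odot>\<^bsub>L\<^esub> (c \<odot>\<^bsub>L\<^esub> \<epsilon> k)"
      using c(2)[rule_format, OF \<epsilon>[OF ik(2)]] SB \<epsilon>[OF ik(2)] \<tau> 
      by (simp add: L.smult_r_distr L.smult_assoc sc)
    then show ?thesis using c(1) ik by (intro exI[of _ c]) (simp add: P_def)
  qed
  define u where "u i k = (SOME c. P i k c)" for i k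
  have "P i k (u i k)" for i k unfolding u_def by (rule someI_ex[OF ex])
  then have u: "\<And>i k. u i k \<in> carrier B" "\<And>i k. i \<le> k \<Longrightarrow> u i k = \<zero>\<^bsub>B\<^esub>"
    "\<And>i k. i < d \<Longrightarrow> k < d \<Longrightarrow>
      \<tau> \<odot>\<^bsub>L\<^esub> (S i k \<odot>\<^bsub>L\<^esub> \<epsilon> k) = \<tau> \<odot>\<^bsub>L\<^esub> (S' i k \<odot>\<^bsub>L\<^esub> \<epsilon> k) \<oplus>\<^bsub>L\<^esub> h \<odot>\<^bsub>L\<^esub> (u i k \<odot>\<^bsub>L\<^esub> \<epsilon> k)" by (auto simp: P_def)
  define y where "y i k = \<pi> (u i k) \<oplus>\<^bsub>A\<^esub> \<pi> \<tau> \<otimes>\<^bsub>A\<^esub> (\<pi> (g i k) \<ominus>\<^bsub>A\<^esub> \<pi> (f i k))" for i k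
  show ?thesis
  proof (intro exI[of _ y] conjI allI impI)
    show "y i j \<in> carrier A" for i j using u(1) g(1) f(1) \<tau> by (simp add: y_def)
    show "y i j = \<zero>\<^bsub>A\<^esub>" if "i \<le> j" for i j
      using u(2) g(2) f(2) \<tau> that by (simp add: y_def A.minus_eq)
    fix i assume i: "i < d"
    have cl: "S i k \<odot>\<^bsub>L\<^esub> \<epsilon> k \<in> carrier L" "S' i k \<odot>\<^bsub>L\<^esub> \<epsilon> k \<in> carrier L" "u i k \<odot>\<^bsub>L\<^esub> \<epsilon> k \<in> carrier L"
       "q i k \<odot>\<^bsub>L\<^esub> \<alpha> k \<in> carrier L" "g i k \<odot>\<^bsub>L\<^esub> \<epsilon> k \<in> carrier L"
       "p i k \<odot>\<^bsub>L\<^esub> \<beta> k \<in> carrier L" "f i k \<odot>\<^bsub>L\<^esub> \<epsilon> k \<in> carrier L"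
      if "k < d" for k using SB u(1) \<epsilon> q p \<alpha> \<beta> g f that sc by auto
    define s s' su sq sg sp sf where defs:
      "s = (\<Oplus>\<^bsub>L\<^esub>k\<in>{..<d}. S i k \<odot>\<^bsub>L\<^esub> \<epsilon> k)" "s' = (\<Oplus>\<^bsub>L\<^esub>k\<in>{..<d}. S' i k \<odot>\<^bsub>L\<^esub> \<epsilon> k)"
      "su = (\<Oplus>\<^bsub>L\<^esub>k\<in>{..<d}. u i k \<odot>\<^bsub>L\<^esub> \<epsilon> k)" "sq = (\<Oplus>\<^bsub>L\<^esub>j\<in>{..<d}. q i j \<odot>\<^bsub>L\<^esub> \<alpha> j)"
      "sg = (\<Oplus>\<^bsub>L\<^esub>j\<in>{..<d}. g i j \<odot>\<^bsub>L\<^esub> \<epsilon> j)" "sp = (\<Oplus>\<^bsub>L\<^esub>j\<in>{..<d}. p i j \<odot>\<^bsub>L\<^esub> \<beta> j)"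
      "sf = (\<Oplus>\<^bsub>L\<^esub>j\<in>{..<d}. f i j \<odot>\<^bsub>L\<^esub> \<epsilon> j)"
    have scl: "s \<in> carrier L" "s' \<in> carrier L" "su \<in> carrier L" "sq \<in> carrier L" "sg \<in> carrier L"
      "sp \<in> carrier L" "sf \<in> carrier L"
      unfolding defs using cl by (auto intro!: L.M.finsum_closed)
    have ab: "a \<odot>\<^bsub>L\<^esub> \<beta> i \<in> carrier L" "b \<odot>\<^bsub>L\<^esub> \<alpha> i \<in> carrier L" "w \<odot>\<^bsub>L\<^esub> \<epsilon> i \<in> carrier L" "\<epsilon> i \<in> carrier L"
      using a b w \<alpha> \<beta> \<epsilon> i sc by auto
    define U V where UV: "U = sq \<oplus>\<^bsub>L\<^esub> sg \<oplus>\<^bsub>L\<^esub> a \<odot>\<^bsub>L\<^esub> \<beta> i" "V = sp \<oplus>\<^bsub>L\<^esub> sf \<oplus>\<^bsub>L\<^esub> b \<odot>\<^bsub>L\<^esub> \<alpha> i"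
    have UVc: "U \<in> carrier L" "V \<in> carrier L" unfolding UV using scl ab by auto
    have "\<tau> \<odot>\<^bsub>L\<^esub> s = (\<Oplus>\<^bsub>L\<^esub>k\<in>{..<d}. \<tau> \<odot>\<^bsub>L\<^esub> (S i k \<odot>\<^bsub>L\<^esub> \<epsilon> k))"
      unfolding defs using \<tau> cl by (intro L.lm_smult_finsum_right) auto
    also have "\<dots> = (\<Oplus>\<^bsub>L\<^esub>k\<in>{..<d}. \<tau> \<odot>\<^bsub>L\<^esub> (S' i k \<odot>\<^bsub>L\<^esub> \<epsilon> k) \<oplus>\<^bsub>L\<^esub> h \<odot>\<^bsub>L\<^esub> (u i k \<odot>\<^bsub>L\<^esub> \<epsilon> k))"
      using u(3)[OF i] \<tau> cl sc by (intro L.M.finsum_cong') auto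
    also have "\<dots> = (\<Oplus>\<^bsub>L\<^esub>k\<in>{..<d}. \<tau> \<odot>\<^bsub>L\<^esub> (S' i k \<odot>\<^bsub>L\<^esub> \<epsilon> k)) \<oplus>\<^bsub>L\<^esub> (\<Oplus>\<^bsub>L\<^esub>k\<in>{..<d}. h \<odot>\<^bsub>L\<^esub> (u i k \<odot>\<^bsub>L\<^esub> \<epsilon> k))"
      using \<tau> cl sc by (intro L.M.finsum_addf) auto
    also have "(\<Oplus>\<^bsub>L\<^esub>k\<in>{..<d}. \<tau> \<odot>\<^bsub>L\<^esub> (S' i k \<odot>\<^bsub>L\<^esub> \<epsilon> k)) = \<tau> \<odot>\<^bsub>L\<^esub> s'"
      unfolding defs using \<tau> cl by (intro L.lm_smult_finsum_right[symmetric]) auto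
    also have "(\<Oplus>\<^bsub>L\<^esub>k\<in>{..<d}. h \<odot>\<^bsub>L\<^esub> (u i k \<odot>\<^bsub>L\<^esub> \<epsilon> k)) = h \<odot>\<^bsub>L\<^esub> su"
      unfolding defs using cl by (intro L.lm_smult_finsum_right[symmetric]) auto
    finally have ts: "\<tau> \<odot>\<^bsub>L\<^esub> s = \<tau> \<odot>\<^bsub>L\<^esub> s' \<oplus>\<^bsub>L\<^esub> h \<odot>\<^bsub>L\<^esub> su" .
    have "s \<oplus>\<^bsub>L\<^esub> h \<odot>\<^bsub>L\<^esub> U = (a \<otimes>\<^bsub>B\<^esub> b) \<odot>\<^bsub>L\<^esub> \<epsilon> i" using abe[OF i] by (simp add: defs UV)
    also have "\<dots> = (b \<otimes>\<^bsub>B\<^esub> a) \<odot>\<^bsub>L\<^esub> \<epsilon> i \<oplus>\<^bsub>L\<^esub> h \<odot>\<^bsub>L\<^esub> (w \<odot>\<^bsub>L\<^esub> \<epsilon> i)"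
      using w a b ab(4) by (simp add: L.smult_l_distr L.smult_assoc)
    also have "\<dots> = s' \<oplus>\<^bsub>L\<^esub> h \<odot>\<^bsub>L\<^esub> (V \<oplus>\<^bsub>L\<^esub> w \<odot>\<^bsub>L\<^esub> \<epsilon> i)"
      using bae[OF i] scl UVc ab sc by (simp add: defs UV L.smult_r_distr L.M.a_assoc)
    finally have "\<tau> \<odot>\<^bsub>L\<^esub> (s \<oplus>\<^bsub>L\<^esub> h \<odot>\<^bsub>L\<^esub> U) = \<tau> \<odot>\<^bsub>L\<^esub> (s' \<oplus>\<^bsub>L\<^esub> h \<odot>\<^bsub>L\<^esub> (V \<oplus>\<^bsub>L\<^esub> w \<odot>\<^bsub>L\<^esub> \<epsilon> i))" by simp
    then have "\<tau> \<odot>\<^bsub>L\<^esub> s' \<oplus>\<^bsub>L\<^esub> (h \<odot>\<^bsub>L\<^esub> (su \<oplus>\<^bsub>L\<^esub> \<tau> \<odot>\<^bsub>L\<^esub> U)) = \<tau> \<odot>\<^bsub>L\<^esub> s' \<oplus>\<^bsub>L\<^esub> (h \<odot>\<^bsub>L\<^esub> (\<tau> \<odot>\<^bsub>L\<^esub> (V \<oplus>\<^bsub>L\<^esub> w \<odot>\<^bsub>L\<^esub> \<epsilon> i)))"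
      using ts \<tau> scl UVc ab sc by (simp add: L.smult_r_distr h_smult_commute L.M.a_assoc)
    then have "h \<odot>\<^bsub>L\<^esub> (su \<oplus>\<^bsub>L\<^esub> \<tau> \<odot>\<^bsub>L\<^esub> U) = h \<odot>\<^bsub>L\<^esub> (\<tau> \<odot>\<^bsub>L\<^esub> (V \<oplus>\<^bsub>L\<^esub> w \<odot>\<^bsub>L\<^esub> \<epsilon> i))"
      by (rule L.M.add_left_imp_eq[rotated 3]) (use \<tau> scl UVc ab sc in auto)
    then have "\<rho> (su \<oplus>\<^bsub>L\<^esub> \<tau> \<odot>\<^bsub>L\<^esub> U) = \<rho> (\<tau> \<odot>\<^bsub>L\<^esub> (V \<oplus>\<^bsub>L\<^esub> w \<odot>\<^bsub>L\<^esub> \<epsilon> i))"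
      using \<tau> scl UVc ab sc by (intro h_cancel) auto
    then have E: "\<rho> su \<oplus>\<^bsub>M\<^esub> \<pi> \<tau> \<odot>\<^bsub>M\<^esub> (\<rho> sq \<oplus>\<^bsub>M\<^esub> \<rho> sg \<oplus>\<^bsub>M\<^esub> \<pi> a \<odot>\<^bsub>M\<^esub> \<rho> (\<beta> i)) =
      \<pi> \<tau> \<odot>\<^bsub>M\<^esub> (\<rho> sp \<oplus>\<^bsub>M\<^esub> \<rho> sf \<oplus>\<^bsub>M\<^esub> \<pi> b \<odot>\<^bsub>M\<^esub> \<rho> (\<alpha> i) \<oplus>\<^bsub>M\<^esub> \<pi> w \<odot>\<^bsub>M\<^esub> \<rho> (\<epsilon> i))"
      using \<tau> scl UVc ab sc a b w \<alpha> \<beta> \<epsilon> i unfolding UV by (simp add: \<rho>_add \<rho>_smult)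
    have rs: "\<rho> sq = (\<Oplus>\<^bsub>M\<^esub>j\<in>{..<d}. \<pi> (q i j) \<odot>\<^bsub>M\<^esub> \<rho> (\<alpha> j))" "\<rho> sp = (\<Oplus>\<^bsub>M\<^esub>j\<in>{..<d}. \<pi> (p i j) \<odot>\<^bsub>M\<^esub> \<rho> (\<beta> j))"
      "\<rho> su = (\<Oplus>\<^bsub>M\<^esub>k\<in>{..<d}. \<pi> (u i k) \<odot>\<^bsub>M\<^esub> \<rho> (\<epsilon> k))"
      "\<rho> sg = (\<Oplus>\<^bsub>M\<^esub>k\<in>{..<d}. \<pi> (g i k) \<odot>\<^bsub>M\<^esub> \<rho> (\<epsilon> k))" "\<rho> sf = (\<Oplus>\<^bsub>M\<^esub>k\<in>{..<d}. \<pi> (f i k) \<odot>\<^bsub>M\<^esub> \<rho> (\<epsilon> k))"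
      unfolding defs using cl \<epsilon> \<alpha> \<beta> p q g f u
      by (subst \<rho>_finsum; auto intro!: M.finsum_cong' msc simp: \<rho>_smult)+
    have yE: "(\<Oplus>\<^bsub>M\<^esub>k\<in>{..<d}. y i k \<odot>\<^bsub>M\<^esub> \<rho> (\<epsilon> k)) \<oplus>\<^bsub>M\<^esub> \<pi> \<tau> \<odot>\<^bsub>M\<^esub> \<rho> sf = \<rho> su \<oplus>\<^bsub>M\<^esub> \<pi> \<tau> \<odot>\<^bsub>M\<^esub> \<rho> sg"
    proof -
      have m: "\<pi> (u i k) \<in> carrier A" "\<pi> (g i k) \<in> carrier A" "\<pi> (f i k) \<in> carrier A" "\<pi> \<tau> \<in> carrier A" for k
        using u g f \<tau> by auto
      have yA: "y i k \<in> carrier A" for k using m by (simp add: y_def)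
      have e: "\<rho> (\<epsilon> k) \<in> carrier M" if "k < d" for k using \<epsilon> that by simp
      have "(\<Oplus>\<^bsub>M\<^esub>k\<in>{..<d}. y i k \<odot>\<^bsub>M\<^esub> \<rho> (\<epsilon> k)) \<oplus>\<^bsub>M\<^esub> \<pi> \<tau> \<odot>\<^bsub>M\<^esub> \<rho> sf
        = (\<Oplus>\<^bsub>M\<^esub>k\<in>{..<d}. y i k \<odot>\<^bsub>M\<^esub> \<rho> (\<epsilon> k)) \<oplus>\<^bsub>M\<^esub> (\<Oplus>\<^bsub>M\<^esub>k\<in>{..<d}. \<pi> \<tau> \<odot>\<^bsub>M\<^esub> (\<pi> (f i k) \<odot>\<^bsub>M\<^esub> \<rho> (\<epsilon> k)))"
        unfolding rs using m e msc by (subst M.finsum_smult_ldistr) auto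
      also have "\<dots> = (\<Oplus>\<^bsub>M\<^esub>k\<in>{..<d}. y i k \<odot>\<^bsub>M\<^esub> \<rho> (\<epsilon> k) \<oplus>\<^bsub>M\<^esub> \<pi> \<tau> \<odot>\<^bsub>M\<^esub> (\<pi> (f i k) \<odot>\<^bsub>M\<^esub> \<rho> (\<epsilon> k)))"
        using m yA e msc by (intro M.finsum_addf[symmetric]) auto
      also have "\<dots> = (\<Oplus>\<^bsub>M\<^esub>k\<in>{..<d}. \<pi> (u i k) \<odot>\<^bsub>M\<^esub> \<rho> (\<epsilon> k) \<oplus>\<^bsub>M\<^esub> \<pi> \<tau> \<odot>\<^bsub>M\<^esub> (\<pi> (g i k) \<odot>\<^bsub>M\<^esub> \<rho> (\<epsilon> k)))"
      proof (intro M.finsum_cong' refl)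
        fix k assume "k \<in> {..<d}"
        then have k: "\<rho> (\<epsilon> k) \<in> carrier M" using e by simp
        have "y i k \<oplus>\<^bsub>A\<^esub> \<pi> \<tau> \<otimes>\<^bsub>A\<^esub> \<pi> (f i k) = \<pi> (u i k) \<oplus>\<^bsub>A\<^esub> \<pi> \<tau> \<otimes>\<^bsub>A\<^esub> \<pi> (g i k)"
          unfolding y_def using m(1-3)[of k] m(4) by algebra
        then have "(y i k \<oplus>\<^bsub>A\<^esub> \<pi> \<tau> \<otimes>\<^bsub>A\<^esub> \<pi> (f i k)) \<odot>\<^bsub>M\<^esub> \<rho> (\<epsilon> k) = (\<pi> (u i k) \<oplus>\<^bsub>A\<^esub> \<pi> \<tau> \<otimes>\<^bsub>A\<^esub> \<pi> (g i k)) \<odot>\<^bsub>M\<^esub> \<rho> (\<epsilon> k)" by simp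
        then show "y i k \<odot>\<^bsub>M\<^esub> \<rho> (\<epsilon> k) \<oplus>\<^bsub>M\<^esub> \<pi> \<tau> \<odot>\<^bsub>M\<^esub> (\<pi> (f i k) \<odot>\<^bsub>M\<^esub> \<rho> (\<epsilon> k)) =
          \<pi> (u i k) \<odot>\<^bsub>M\<^esub> \<rho> (\<epsilon> k) \<oplus>\<^bsub>M\<^esub> \<pi> \<tau> \<odot>\<^bsub>M\<^esub> (\<pi> (g i k) \<odot>\<^bsub>M\<^esub> \<rho> (\<epsilon> k))"
          using m k yA by (simp add: M.smult_l_distr M.smult_assoc1)
      qed (use m e msc in auto)
      also have "\<dots> = \<rho> su \<oplus>\<^bsub>M\<^esub> (\<Oplus>\<^bsub>M\<^esub>k\<in>{..<d}. \<pi> \<tau> \<odot>\<^bsub>M\<^esub> (\<pi> (g i k) \<odot>\<^bsub>M\<^esub> \<rho> (\<epsilon> k)))"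
        unfolding rs using m e msc by (intro M.finsum_addf) auto
      also have "\<dots> = \<rho> su \<oplus>\<^bsub>M\<^esub> \<pi> \<tau> \<odot>\<^bsub>M\<^esub> \<rho> sg"
        unfolding rs using m e msc by (subst M.finsum_smult_ldistr) auto
      finally show ?thesis .
    qed
    define Y where "Y = (\<Oplus>\<^bsub>M\<^esub>k\<in>{..<d}. y i k \<odot>\<^bsub>M\<^esub> \<rho> (\<epsilon> k))"
    have Yc: "Y \<in> carrier M" unfolding Y_def using \<epsilon> u g f \<tau> msc by (auto intro!: M.finsum_closed simp: y_def)
    have m: "\<pi> \<tau> \<in> carrier A" "\<pi> a \<in> carrier A" "\<pi> b \<in> carrier A" "\<pi> w \<in> carrier A"
      "\<rho> (\<alpha> i) \<in> carrier M" "\<rho> (\<beta> i) \<in> carrier M" "\<rho> (\<epsilon> i) \<in> carrier M"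
      "\<rho> sp \<in> carrier M" "\<rho> sq \<in> carrier M" "\<rho> sf \<in> carrier M" "\<rho> sg \<in> carrier M" "\<rho> su \<in> carrier M"
      using \<tau> a b w \<alpha> \<beta> \<epsilon> i scl by auto
    define t where "t z = \<pi> \<tau> \<odot>\<^bsub>M\<^esub> z" for z
    have t: "t (x \<oplus>\<^bsub>M\<^esub> z) = t x \<oplus>\<^bsub>M\<^esub> t z" "t x \<in> carrier M" if "x \<in> carrier M" "z \<in> carrier M" for x z
      using that m msc by (auto simp: t_def M.smult_r_distr)
    have E': "\<rho> su \<oplus>\<^bsub>M\<^esub> (t (\<rho> sq) \<oplus>\<^bsub>M\<^esub> t (\<rho> sg) \<oplus>\<^bsub>M\<^esub> t (\<pi> a \<odot>\<^bsub>M\<^esub> \<rho> (\<beta> i))) =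
      t (\<rho> sp) \<oplus>\<^bsub>M\<^esub> t (\<rho> sf) \<oplus>\<^bsub>M\<^esub> t (\<pi> b \<odot>\<^bsub>M\<^esub> \<rho> (\<alpha> i)) \<oplus>\<^bsub>M\<^esub> t (\<pi> w \<odot>\<^bsub>M\<^esub> \<rho> (\<epsilon> i))"
      using E m msc unfolding t_def[symmetric] by (simp add: t)
    have yE': "Y \<oplus>\<^bsub>M\<^esub> t (\<rho> sf) = \<rho> su \<oplus>\<^bsub>M\<^esub> t (\<rho> sg)" using yE unfolding t_def[symmetric] Y_def[symmetric] .
    have tc: "t (\<rho> sq) \<in> carrier M" "t (\<rho> sg) \<in> carrier M" "t (\<pi> a \<odot>\<^bsub>M\<^esub> \<rho> (\<beta> i)) \<in> carrier M"
      "t (\<rho> sp) \<in> carrier M" "t (\<rho> sf) \<in> carrier M" "t (\<pi> b \<odot>\<^bsub>M\<^esub> \<rho> (\<alpha> i)) \<in> carrier M" "t (\<pi> w \<odot>\<^bsub>M\<^esub> \<rho> (\<epsilon> i)) \<in> carrier M"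
      using m msc by (auto simp: t_def)
    have "t (\<rho> sf) \<oplus>\<^bsub>M\<^esub> (t (\<pi> w \<odot>\<^bsub>M\<^esub> \<rho> (\<epsilon> i)) \<oplus>\<^bsub>M\<^esub> (t (\<rho> sp) \<oplus>\<^bsub>M\<^esub> t (\<pi> b \<odot>\<^bsub>M\<^esub> \<rho> (\<alpha> i))))
      = t (\<rho> sp) \<oplus>\<^bsub>M\<^esub> t (\<rho> sf) \<oplus>\<^bsub>M\<^esub> t (\<pi> b \<odot>\<^bsub>M\<^esub> \<rho> (\<alpha> i)) \<oplus>\<^bsub>M\<^esub> t (\<pi> w \<odot>\<^bsub>M\<^esub> \<rho> (\<epsilon> i))"
      using tc by (simp add: M.a_ac)
    also have "\<dots> = (\<rho> su \<oplus>\<^bsub>M\<^esub> t (\<rho> sg)) \<oplus>\<^bsub>M\<^esub> (t (\<rho> sq) \<oplus>\<^bsub>M\<^esub> t (\<pi> a \<odot>\<^bsub>M\<^esub> \<rho> (\<beta> i)))"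
      unfolding E'[symmetric] using tc m by (simp add: M.a_ac)
    also have "\<dots> = t (\<rho> sf) \<oplus>\<^bsub>M\<^esub> (Y \<oplus>\<^bsub>M\<^esub> (t (\<rho> sq) \<oplus>\<^bsub>M\<^esub> t (\<pi> a \<odot>\<^bsub>M\<^esub> \<rho> (\<beta> i))))"
      unfolding yE'[symmetric] using tc Yc by (simp add: M.a_ac)
    finally have "t (\<pi> w \<odot>\<^bsub>M\<^esub> \<rho> (\<epsilon> i)) \<oplus>\<^bsub>M\<^esub> (t (\<rho> sp) \<oplus>\<^bsub>M\<^esub> t (\<pi> b \<odot>\<^bsub>M\<^esub> \<rho> (\<alpha> i)))
      = Y \<oplus>\<^bsub>M\<^esub> (t (\<rho> sq) \<oplus>\<^bsub>M\<^esub> t (\<pi> a \<odot>\<^bsub>M\<^esub> \<rho> (\<beta> i)))"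
      by (rule M.add_left_imp_eq[rotated 3]) (use tc Yc in auto)
    then show "(\<pi> \<tau> \<otimes>\<^bsub>A\<^esub> \<pi> w) \<odot>\<^bsub>M\<^esub> \<rho> (\<epsilon> i) \<oplus>\<^bsub>M\<^esub>
        \<pi> \<tau> \<odot>\<^bsub>M\<^esub> ((\<Oplus>\<^bsub>M\<^esub>j\<in>{..<d}. \<pi> (p i j) \<odot>\<^bsub>M\<^esub> \<rho> (\<beta> j)) \<oplus>\<^bsub>M\<^esub> \<pi> b \<odot>\<^bsub>M\<^esub> \<rho> (\<alpha> i)) =
      (\<Oplus>\<^bsub>M\<^esub>k\<in>{..<d}. y i k \<odot>\<^bsub>M\<^esub> \<rho> (\<epsilon> k)) \<oplus>\<^bsub>M\<^esub>
        \<pi> \<tau> \<odot>\<^bsub>M\<^esub> ((\<Oplus>\<^bsub>M\<^esub>j\<in>{..<d}. \<pi> (q i j) \<odot>\<^bsub>M\<^esub> \<rho> (\<alpha> j)) \<oplus>\<^bsub>M\<^esub> \<pi> a \<odot>\<^bsub>M\<^esub> \<rho> (\<beta> i))"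
      unfolding rs(1,2)[symmetric] Y_def[symmetric] using m msc
      by (simp add: M.smult_assoc1 M.smult_r_distr t_def)
  qed
qed


lemma h_mult_eqI:
  assumes "p \<in> carrier B" "q \<in> carrier B" "\<pi> p = \<pi> q"
  shows "h \<otimes>\<^bsub>B\<^esub> p = h \<otimes>\<^bsub>B\<^esub> q"
proof -
  have "\<pi> (p \<ominus>\<^bsub>B\<^esub> q) = \<zero>\<^bsub>A\<^esub>" using assms by (simp add: \<pi>_minus A.minus_eq A.r_neg)
  then have "h \<otimes>\<^bsub>B\<^esub> (p \<ominus>\<^bsub>B\<^esub> q) = \<zero>\<^bsub>B\<^esub>" using \<pi>_torsion assms by simp
  moreover have "p = (p \<ominus>\<^bsub>B\<^esub> q) \<oplus>\<^bsub>B\<^esub> q" using assms by (simp add: B.minus_eq B.a_assoc B.l_neg)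
  then have "h \<otimes>\<^bsub>B\<^esub> p = h \<otimes>\<^bsub>B\<^esub> (p \<ominus>\<^bsub>B\<^esub> q) \<oplus>\<^bsub>B\<^esub> h \<otimes>\<^bsub>B\<^esub> q"
    using B.r_distr[of "p \<ominus>\<^bsub>B\<^esub> q" q h] assms by simp
  ultimately show ?thesis using assms by simp
qed

lemma h_mult_eqD:
  assumes "p \<in> carrier B" "q \<in> carrier B" "h \<otimes>\<^bsub>B\<^esub> p = h \<otimes>\<^bsub>B\<^esub> q"
  shows "\<pi> p = \<pi> q"
proof -
  have "h \<otimes>\<^bsub>B\<^esub> (p \<ominus>\<^bsub>B\<^esub> q) = \<zero>\<^bsub>B\<^esub>" using assms by (simp add: B.minus_eq B.r_distr B.r_minus B.r_neg)
  then have "\<pi> p \<ominus>\<^bsub>A\<^esub> \<pi> q = \<zero>\<^bsub>A\<^esub>" using assms \<pi>_torsion[of "p \<ominus>\<^bsub>B\<^esub> q"] \<pi>_minus by simp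
  then show ?thesis using assms by (simp add: A.r_right_minus_eq)
qed

lemma same_image_shift:
  assumes "p \<in> carrier B" "q \<in> carrier B" "\<pi> p = \<pi> q"
  obtains x where "x \<in> carrier B" "p = q \<oplus>\<^bsub>B\<^esub> h \<otimes>\<^bsub>B\<^esub> x"
proof -
  have "\<pi> (p \<ominus>\<^bsub>B\<^esub> q) = \<zero>\<^bsub>A\<^esub>" using assms by (simp add: \<pi>_minus A.minus_eq A.r_neg)
  then obtain x where "x \<in> carrier B" "p \<ominus>\<^bsub>B\<^esub> q = h \<otimes>\<^bsub>B\<^esub> x" using \<pi>_kernel[of "p \<ominus>\<^bsub>B\<^esub> q"] assms by auto
  moreover have "p = q \<oplus>\<^bsub>B\<^esub> (p \<ominus>\<^bsub>B\<^esub> q)" using assms by (simp add: B.minus_eq B.a_lcomm[of q] B.r_neg)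
  ultimately show thesis using that[of x] by simp
qed

text \<open>The bracket does not depend on the liftings: replacing \<open>a\<close> by \<open>a + h x\<close> changes the
  commutator by \<open>h\<close> times a commutator of elements that commute modulo \<open>h\<close>.\<close>

lemma commutator_independent:
  assumes c: "a \<in> carrier B" "b \<in> carrier B" "a2 \<in> carrier B" "b2 \<in> carrier B" "c \<in> carrier B"
    and eq: "\<pi> a2 = \<pi> a" "\<pi> b2 = \<pi> b" and ab: "a \<otimes>\<^bsub>B\<^esub> b = b \<otimes>\<^bsub>B\<^esub> a \<oplus>\<^bsub>B\<^esub> h \<otimes>\<^bsub>B\<^esub> c"
  shows "a2 \<otimes>\<^bsub>B\<^esub> b2 = b2 \<otimes>\<^bsub>B\<^esub> a2 \<oplus>\<^bsub>B\<^esub> h \<otimes>\<^bsub>B\<^esub> c"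
proof -
  obtain x where x: "x \<in> carrier B" "a2 = a \<oplus>\<^bsub>B\<^esub> h \<otimes>\<^bsub>B\<^esub> x" by (rule same_image_shift[OF c(3,1) eq(1)])
  obtain y where y: "y \<in> carrier B" "b2 = b \<oplus>\<^bsub>B\<^esub> h \<otimes>\<^bsub>B\<^esub> y" by (rule same_image_shift[OF c(4,2) eq(2)])
  have prod: "(p \<oplus>\<^bsub>B\<^esub> h \<otimes>\<^bsub>B\<^esub> u) \<otimes>\<^bsub>B\<^esub> (q \<oplus>\<^bsub>B\<^esub> h \<otimes>\<^bsub>B\<^esub> v) = p \<otimes>\<^bsub>B\<^esub> q \<oplus>\<^bsub>B\<^esub> h \<otimes>\<^bsub>B\<^esub> (p \<otimes>\<^bsub>B\<^esub> v \<oplus>\<^bsub>B\<^esub> u \<otimes>\<^bsub>B\<^esub> q)"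
    if m: "p \<in> carrier B" "q \<in> carrier B" "u \<in> carrier B" "v \<in> carrier B" for p q u v
  proof -
    have ph: "p \<otimes>\<^bsub>B\<^esub> (h \<otimes>\<^bsub>B\<^esub> v) = h \<otimes>\<^bsub>B\<^esub> (p \<otimes>\<^bsub>B\<^esub> v)"
      using h_central[OF m(1)] m by (simp add: B.m_assoc[symmetric])
    have "(h \<otimes>\<^bsub>B\<^esub> u) \<otimes>\<^bsub>B\<^esub> (h \<otimes>\<^bsub>B\<^esub> v) = h \<otimes>\<^bsub>B\<^esub> (u \<otimes>\<^bsub>B\<^esub> h) \<otimes>\<^bsub>B\<^esub> v" using m by (simp add: B.m_assoc)
    also have "\<dots> = (h \<otimes>\<^bsub>B\<^esub> h) \<otimes>\<^bsub>B\<^esub> (u \<otimes>\<^bsub>B\<^esub> v)" unfolding h_central[OF m(3)] using m by (simp add: B.m_assoc)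
    finally have hh: "(h \<otimes>\<^bsub>B\<^esub> u) \<otimes>\<^bsub>B\<^esub> (h \<otimes>\<^bsub>B\<^esub> v) = \<zero>\<^bsub>B\<^esub>" using m by (simp add: h_square)
    have "(p \<oplus>\<^bsub>B\<^esub> h \<otimes>\<^bsub>B\<^esub> u) \<otimes>\<^bsub>B\<^esub> (q \<oplus>\<^bsub>B\<^esub> h \<otimes>\<^bsub>B\<^esub> v)
      = (p \<otimes>\<^bsub>B\<^esub> q \<oplus>\<^bsub>B\<^esub> h \<otimes>\<^bsub>B\<^esub> u \<otimes>\<^bsub>B\<^esub> q) \<oplus>\<^bsub>B\<^esub> (p \<otimes>\<^bsub>B\<^esub> (h \<otimes>\<^bsub>B\<^esub> v) \<oplus>\<^bsub>B\<^esub> (h \<otimes>\<^bsub>B\<^esub> u) \<otimes>\<^bsub>B\<^esub> (h \<otimes>\<^bsub>B\<^esub> v))"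
      using m by (simp add: B.l_distr B.r_distr)
    then show ?thesis unfolding ph hh using m by (simp add: B.r_distr B.m_assoc B.a_ac)
  qed
  have "h \<otimes>\<^bsub>B\<^esub> (a \<otimes>\<^bsub>B\<^esub> y \<oplus>\<^bsub>B\<^esub> x \<otimes>\<^bsub>B\<^esub> b) = h \<otimes>\<^bsub>B\<^esub> (b \<otimes>\<^bsub>B\<^esub> x \<oplus>\<^bsub>B\<^esub> y \<otimes>\<^bsub>B\<^esub> a)"
    using c x y by (intro h_mult_eqI) (auto simp: \<pi>_add \<pi>_mult A.m_comm A.a_comm)
  then show ?thesis unfolding x(2) y(2) using c x(1) y(1)
    by (simp add: prod ab B.a_assoc B.a_comm[of "h \<otimes>\<^bsub>B\<^esub> c"])
qed

end

lemma (in square_zero_lift) same_image_lift: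
  assumes "x \<in> carrier L" "y \<in> carrier L" "\<rho> x = \<rho> y"
  shows "\<exists>z\<in>carrier L. x = y \<oplus>\<^bsub>L\<^esub> h \<odot>\<^bsub>L\<^esub> z"
proof -
  have x: "x = y \<oplus>\<^bsub>L\<^esub> (x \<ominus>\<^bsub>L\<^esub> y)" using assms by (simp add: L.M.minus_eq L.M.a_lcomm[of y] L.M.r_neg)
  then have "\<rho> x = \<rho> y \<oplus>\<^bsub>M\<^esub> \<rho> (x \<ominus>\<^bsub>L\<^esub> y)" using \<rho>_add[of y "x \<ominus>\<^bsub>L\<^esub> y"] assms by simp
  then have "\<rho> y \<oplus>\<^bsub>M\<^esub> \<rho> (x \<ominus>\<^bsub>L\<^esub> y) = \<rho> y \<oplus>\<^bsub>M\<^esub> \<zero>\<^bsub>M\<^esub>" using assms by simp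
  then have "\<rho> (x \<ominus>\<^bsub>L\<^esub> y) = \<zero>\<^bsub>M\<^esub>" by (rule M.add_left_imp_eq[rotated 3]) (use assms in auto)
  then obtain z where "z \<in> carrier L" "x \<ominus>\<^bsub>L\<^esub> y = h \<odot>\<^bsub>L\<^esub> z" using \<rho>_kernel[of "x \<ominus>\<^bsub>L\<^esub> y"] assms by auto
  then show ?thesis using x by (intro bexI[of _ z]) simp
qed

text \<open>By the Leibniz rule \<open>{sa, sb} = s\<^sup>2{a,b} + s{a,s}b + s{s,b}a\<close>, and the last two terms
  are multiples of \<open>b\<close> and \<open>a\<close>.\<close>

lemma (in square_zero_lift) scaled_commutator:
  assumes c: "a \<in> carrier B" "b \<in> carrier B" "s \<in> carrier B" "c \<in> carrier B" "w \<in> carrier B"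
    and ab: "a \<otimes>\<^bsub>B\<^esub> b = b \<otimes>\<^bsub>B\<^esub> a \<oplus>\<^bsub>B\<^esub> h \<otimes>\<^bsub>B\<^esub> c"
    and w: "(s \<otimes>\<^bsub>B\<^esub> a) \<otimes>\<^bsub>B\<^esub> (s \<otimes>\<^bsub>B\<^esub> b) = (s \<otimes>\<^bsub>B\<^esub> b) \<otimes>\<^bsub>B\<^esub> (s \<otimes>\<^bsub>B\<^esub> a) \<oplus>\<^bsub>B\<^esub> h \<otimes>\<^bsub>B\<^esub> w"
  shows "\<exists>f\<in>carrier A. \<exists>g\<in>carrier A. \<pi> s \<otimes>\<^bsub>A\<^esub> \<pi> s \<otimes>\<^bsub>A\<^esub> \<pi> c = \<pi> w \<oplus>\<^bsub>A\<^esub> f \<otimes>\<^bsub>A\<^esub> \<pi> a \<oplus>\<^bsub>A\<^esub> g \<otimes>\<^bsub>A\<^esub> \<pi> b"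
proof -
  obtain g where g: "g \<in> carrier B" "a \<otimes>\<^bsub>B\<^esub> s = s \<otimes>\<^bsub>B\<^esub> a \<oplus>\<^bsub>B\<^esub> h \<otimes>\<^bsub>B\<^esub> g" by (rule commutator_lift[OF c(1,3)])
  obtain f where f: "f \<in> carrier B" "b \<otimes>\<^bsub>B\<^esub> s = s \<otimes>\<^bsub>B\<^esub> b \<oplus>\<^bsub>B\<^esub> h \<otimes>\<^bsub>B\<^esub> f" by (rule commutator_lift[OF c(2,3)])
  note hc = h_central
  have sh: "s \<otimes>\<^bsub>B\<^esub> (h \<otimes>\<^bsub>B\<^esub> x) = h \<otimes>\<^bsub>B\<^esub> (s \<otimes>\<^bsub>B\<^esub> x)" if "x \<in> carrier B" for x
    using hc[OF c(3)] c(3) that by (simp add: B.m_assoc[symmetric])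
  have swap: "(s \<otimes>\<^bsub>B\<^esub> x) \<otimes>\<^bsub>B\<^esub> (s \<otimes>\<^bsub>B\<^esub> y) = s \<otimes>\<^bsub>B\<^esub> s \<otimes>\<^bsub>B\<^esub> (x \<otimes>\<^bsub>B\<^esub> y) \<oplus>\<^bsub>B\<^esub> h \<otimes>\<^bsub>B\<^esub> (s \<otimes>\<^bsub>B\<^esub> r \<otimes>\<^bsub>B\<^esub> y)"
    if "x \<in> carrier B" "y \<in> carrier B" "r \<in> carrier B" "x \<otimes>\<^bsub>B\<^esub> s = s \<otimes>\<^bsub>B\<^esub> x \<oplus>\<^bsub>B\<^esub> h \<otimes>\<^bsub>B\<^esub> r" for x y r
  proof -
    have "(s \<otimes>\<^bsub>B\<^esub> x) \<otimes>\<^bsub>B\<^esub> (s \<otimes>\<^bsub>B\<^esub> y) = s \<otimes>\<^bsub>B\<^esub> ((x \<otimes>\<^bsub>B\<^esub> s) \<otimes>\<^bsub>B\<^esub> y)" using c(3) that(1,2) by (simp add: B.m_assoc)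
    also have "\<dots> = s \<otimes>\<^bsub>B\<^esub> (s \<otimes>\<^bsub>B\<^esub> (x \<otimes>\<^bsub>B\<^esub> y)) \<oplus>\<^bsub>B\<^esub> s \<otimes>\<^bsub>B\<^esub> (h \<otimes>\<^bsub>B\<^esub> (r \<otimes>\<^bsub>B\<^esub> y))"
      unfolding that(4) using c(3) that(1-3) by (simp add: B.l_distr B.r_distr B.m_assoc)
    finally show ?thesis using sh[of "r \<otimes>\<^bsub>B\<^esub> y"] c(3) that(1-3) by (simp add: B.m_assoc)
  qed
  define X1 where "X1 = s \<otimes>\<^bsub>B\<^esub> s \<otimes>\<^bsub>B\<^esub> (b \<otimes>\<^bsub>B\<^esub> a)"
  have X1: "X1 \<in> carrier B" using c by (simp add: X1_def)
  have "s \<otimes>\<^bsub>B\<^esub> s \<otimes>\<^bsub>B\<^esub> (a \<otimes>\<^bsub>B\<^esub> b) = X1 \<oplus>\<^bsub>B\<^esub> s \<otimes>\<^bsub>B\<^esub> s \<otimes>\<^bsub>B\<^esub> (h \<otimes>\<^bsub>B\<^esub> c)"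
    unfolding ab X1_def using c by (simp add: B.r_distr)
  also have "s \<otimes>\<^bsub>B\<^esub> s \<otimes>\<^bsub>B\<^esub> (h \<otimes>\<^bsub>B\<^esub> c) = h \<otimes>\<^bsub>B\<^esub> (s \<otimes>\<^bsub>B\<^esub> s \<otimes>\<^bsub>B\<^esub> c)"
    using sh[OF c(4)] sh[of "s \<otimes>\<^bsub>B\<^esub> c"] c by (simp add: B.m_assoc)
  finally have e: "s \<otimes>\<^bsub>B\<^esub> s \<otimes>\<^bsub>B\<^esub> (a \<otimes>\<^bsub>B\<^esub> b) = X1 \<oplus>\<^bsub>B\<^esub> h \<otimes>\<^bsub>B\<^esub> (s \<otimes>\<^bsub>B\<^esub> s \<otimes>\<^bsub>B\<^esub> c)" .
  have "X1 \<oplus>\<^bsub>B\<^esub> h \<otimes>\<^bsub>B\<^esub> (s \<otimes>\<^bsub>B\<^esub> s \<otimes>\<^bsub>B\<^esub> c \<oplus>\<^bsub>B\<^esub> s \<otimes>\<^bsub>B\<^esub> g \<otimes>\<^bsub>B\<^esub> b) = X1 \<oplus>\<^bsub>B\<^esub> h \<otimes>\<^bsub>B\<^esub> (s \<otimes>\<^bsub>B\<^esub> f \<otimes>\<^bsub>B\<^esub> a \<oplus>\<^bsub>B\<^esub> w)"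
    using w swap[OF c(1,2) g] swap[OF c(2,1) f] e c f g X1 unfolding X1_def[symmetric]
    by (simp add: B.r_distr B.a_assoc)
  then have "h \<otimes>\<^bsub>B\<^esub> (s \<otimes>\<^bsub>B\<^esub> s \<otimes>\<^bsub>B\<^esub> c \<oplus>\<^bsub>B\<^esub> s \<otimes>\<^bsub>B\<^esub> g \<otimes>\<^bsub>B\<^esub> b) = h \<otimes>\<^bsub>B\<^esub> (s \<otimes>\<^bsub>B\<^esub> f \<otimes>\<^bsub>B\<^esub> a \<oplus>\<^bsub>B\<^esub> w)"
    by (rule B.add_left_imp_eq[rotated 3]) (use c f g X1 in auto)
  define P1 where "P1 = s \<otimes>\<^bsub>B\<^esub> s \<otimes>\<^bsub>B\<^esub> c \<oplus>\<^bsub>B\<^esub> s \<otimes>\<^bsub>B\<^esub> g \<otimes>\<^bsub>B\<^esub> b"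
  define P2 where "P2 = s \<otimes>\<^bsub>B\<^esub> f \<otimes>\<^bsub>B\<^esub> a \<oplus>\<^bsub>B\<^esub> w"
  have P: "P1 \<in> carrier B" "P2 \<in> carrier B" "h \<otimes>\<^bsub>B\<^esub> P1 = h \<otimes>\<^bsub>B\<^esub> P2"
    using c f g \<open>h \<otimes>\<^bsub>B\<^esub> _ = h \<otimes>\<^bsub>B\<^esub> _\<close> by (auto simp: P1_def P2_def)
  have "\<pi> P1 = \<pi> P2" by (rule h_mult_eqD[OF P])
  then have eq: "\<pi> s \<otimes>\<^bsub>A\<^esub> \<pi> s \<otimes>\<^bsub>A\<^esub> \<pi> c \<oplus>\<^bsub>A\<^esub> \<pi> s \<otimes>\<^bsub>A\<^esub> \<pi> g \<otimes>\<^bsub>A\<^esub> \<pi> b = \<pi> s \<otimes>\<^bsub>A\<^esub> \<pi> f \<otimes>\<^bsub>A\<^esub> \<pi> a \<oplus>\<^bsub>A\<^esub> \<pi> w"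
    using c f g by (simp add: P1_def P2_def \<pi>_add \<pi>_mult)
  have m: "\<pi> s \<in> carrier A" "\<pi> c \<in> carrier A" "\<pi> g \<in> carrier A" "\<pi> f \<in> carrier A" "\<pi> a \<in> carrier A" "\<pi> b \<in> carrier A" "\<pi> w \<in> carrier A"
    using c f g by auto
  have "\<pi> s \<otimes>\<^bsub>A\<^esub> \<pi> s \<otimes>\<^bsub>A\<^esub> \<pi> c = (\<pi> s \<otimes>\<^bsub>A\<^esub> \<pi> s \<otimes>\<^bsub>A\<^esub> \<pi> c \<oplus>\<^bsub>A\<^esub> \<pi> s \<otimes>\<^bsub>A\<^esub> \<pi> g \<otimes>\<^bsub>A\<^esub> \<pi> b) \<ominus>\<^bsub>A\<^esub> \<pi> s \<otimes>\<^bsub>A\<^esub> \<pi> g \<otimes>\<^bsub>A\<^esub> \<pi> b"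
    using m by algebra
  also have "\<dots> = \<pi> w \<oplus>\<^bsub>A\<^esub> (\<pi> s \<otimes>\<^bsub>A\<^esub> \<pi> f) \<otimes>\<^bsub>A\<^esub> \<pi> a \<oplus>\<^bsub>A\<^esub> (\<ominus>\<^bsub>A\<^esub> (\<pi> s \<otimes>\<^bsub>A\<^esub> \<pi> g)) \<otimes>\<^bsub>A\<^esub> \<pi> b"
    unfolding eq using m by algebra
  finally show ?thesis using m by (intro bexI[of _ "\<pi> s \<otimes>\<^bsub>A\<^esub> \<pi> f"] bexI[of _ "\<ominus>\<^bsub>A\<^esub> (\<pi> s \<otimes>\<^bsub>A\<^esub> \<pi> g)"]) auto
qed


section \<open>Localization of a module at a prime ideal\<close>

text \<open>\<open>Q\<close> is a ring of fractions of the idealization \<open>A \<oplus> M\<close> with denominators outside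
  \<open>\<mm>\<close>, after dividing the first component by the square of the annihilator \<open>I\<close> of \<open>M\<close>. Dividing by a power of
  \<open>I\<close> makes \<open>\<mm>\<close> nil. The square is what \<open>annihilator_square_lift\<close> can handle when
  equations in \<open>Q\<close> are transferred back to \<open>A\<close> and lifted.\<close>

locale localized_extension =
  A: cring A + M: module A M + Q: cring Q + P: primeideal \<mm> A
  for A :: "('a, 'x) ring_scheme" and M :: "('a, 'm, 'u) module_scheme"
    and Q :: "('q, 'z) ring_scheme" and \<mm> :: "'a set" +
  fixes \<theta> :: "'a \<times> 'm \<Rightarrow> 'q"
  assumes \<theta>_hom: "\<theta> \<in> ring_hom (idealization A M) Q"
    and \<theta>_unit: "s \<in> carrier A - \<mm> \<Longrightarrow> \<theta> (s, \<zero>\<^bsub>M\<^esub>) \<in> Units Q"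
    and \<theta>_fraction: "q \<in> carrier Q \<Longrightarrow>
      \<exists>s\<in>carrier A - \<mm>. \<exists>a\<in>carrier A. \<exists>x\<in>carrier M. q \<otimes>\<^bsub>Q\<^esub> \<theta> (s, \<zero>\<^bsub>M\<^esub>) = \<theta> (a, x)"
    and \<theta>_kernel: "a \<in> carrier A \<Longrightarrow> x \<in> carrier M \<Longrightarrow> \<theta> (a, x) = \<zero>\<^bsub>Q\<^esub> \<longleftrightarrow>
      (\<exists>u\<in>carrier A - \<mm>. u \<otimes>\<^bsub>A\<^esub> a \<in> ideal_prod A (annihilator A M) (annihilator A M) \<and> u \<odot>\<^bsub>M\<^esub> x = \<zero>\<^bsub>M\<^esub>)"
    and annihilator_subset: "annihilator A M \<subseteq> \<mm>"
    and nilpotent: "a \<in> \<mm> \<Longrightarrow> \<exists>n::nat. a [^]\<^bsub>A\<^esub> n \<in> annihilator A M"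
    and characteristic: "n > 0 \<Longrightarrow> add_pow A (n::nat) \<one>\<^bsub>A\<^esub> \<notin> \<mm>"
begin

definition \<iota> :: "'a \<Rightarrow> 'q" where "\<iota> a = \<theta> (a, \<zero>\<^bsub>M\<^esub>)"
definition \<mu> :: "'m \<Rightarrow> 'q" where "\<mu> x = \<theta> (\<zero>\<^bsub>A\<^esub>, x)"

abbreviation "S \<equiv> carrier A - \<mm>"

lemma S_mult: "s \<in> S \<Longrightarrow> t \<in> S \<Longrightarrow> s \<otimes>\<^bsub>A\<^esub> t \<in> S"
  using P.I_prime by blast

lemma S_one: "\<one>\<^bsub>A\<^esub> \<in> S"
  using P.I_notcarr P.one_imp_carrier by auto

lemma m_carrier: "a \<in> \<mm> \<Longrightarrow> a \<in> carrier A"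
  by (rule P.Icarr)

lemma \<theta>_closed [simp]: "a \<in> carrier A \<Longrightarrow> x \<in> carrier M \<Longrightarrow> \<theta> (a, x) \<in> carrier Q"
  using \<theta>_hom ring_hom_closed[of \<theta> "idealization A M" Q "(a, x)"] by simp

lemma \<theta>_add: "a \<in> carrier A \<Longrightarrow> x \<in> carrier M \<Longrightarrow> b \<in> carrier A \<Longrightarrow> y \<in> carrier M \<Longrightarrow>
    \<theta> (a \<oplus>\<^bsub>A\<^esub> b, x \<oplus>\<^bsub>M\<^esub> y) = \<theta> (a, x) \<oplus>\<^bsub>Q\<^esub> \<theta> (b, y)"
  using ring_hom_add[OF \<theta>_hom, of "(a, x)" "(b, y)"] by simp

lemma \<theta>_mult: "a \<in> carrier A \<Longrightarrow> x \<in> carrier M \<Longrightarrow> b \<in> carrier A \<Longrightarrow> y \<in> carrier M \<Longrightarrow>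
    \<theta> (a \<otimes>\<^bsub>A\<^esub> b, a \<odot>\<^bsub>M\<^esub> y \<oplus>\<^bsub>M\<^esub> b \<odot>\<^bsub>M\<^esub> x) = \<theta> (a, x) \<otimes>\<^bsub>Q\<^esub> \<theta> (b, y)"
  using ring_hom_mult[OF \<theta>_hom, of "(a, x)" "(b, y)"] by simp

lemma \<iota>_closed [simp]: "a \<in> carrier A \<Longrightarrow> \<iota> a \<in> carrier Q"
  and \<mu>_closed [simp]: "x \<in> carrier M \<Longrightarrow> \<mu> x \<in> carrier Q"
  by (simp_all add: \<iota>_def \<mu>_def)

lemma \<theta>_split: "a \<in> carrier A \<Longrightarrow> x \<in> carrier M \<Longrightarrow> \<theta> (a, x) = \<iota> a \<oplus>\<^bsub>Q\<^esub> \<mu> x"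
  using \<theta>_add[of a "\<zero>\<^bsub>M\<^esub>" "\<zero>\<^bsub>A\<^esub>" x] by (simp add: \<iota>_def \<mu>_def)

lemma \<iota>_add: "a \<in> carrier A \<Longrightarrow> b \<in> carrier A \<Longrightarrow> \<iota> (a \<oplus>\<^bsub>A\<^esub> b) = \<iota> a \<oplus>\<^bsub>Q\<^esub> \<iota> b"
  using \<theta>_add[of a "\<zero>\<^bsub>M\<^esub>" b "\<zero>\<^bsub>M\<^esub>"] by (simp add: \<iota>_def)

lemma \<iota>_mult: "a \<in> carrier A \<Longrightarrow> b \<in> carrier A \<Longrightarrow> \<iota> (a \<otimes>\<^bsub>A\<^esub> b) = \<iota> a \<otimes>\<^bsub>Q\<^esub> \<iota> b"
  using \<theta>_mult[of a "\<zero>\<^bsub>M\<^esub>" b "\<zero>\<^bsub>M\<^esub>"] by (simp add: \<iota>_def)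

lemma \<iota>_one [simp]: "\<iota> \<one>\<^bsub>A\<^esub> = \<one>\<^bsub>Q\<^esub>"
  using ring_hom_one[OF \<theta>_hom] by (simp add: \<iota>_def)

lemma \<iota>_hom: "\<iota> \<in> ring_hom A Q"
  by (intro ring_hom_memI) (auto simp: \<iota>_add \<iota>_mult)

sublocale \<iota>: ring_hom_cring A Q \<iota>
  by unfold_locales (rule \<iota>_hom)

lemma \<mu>_add: "x \<in> carrier M \<Longrightarrow> y \<in> carrier M \<Longrightarrow> \<mu> (x \<oplus>\<^bsub>M\<^esub> y) = \<mu> x \<oplus>\<^bsub>Q\<^esub> \<mu> y"
  using \<theta>_add[of "\<zero>\<^bsub>A\<^esub>" x "\<zero>\<^bsub>A\<^esub>" y] by (simp add: \<mu>_def)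

lemma \<mu>_zero [simp]: "\<mu> \<zero>\<^bsub>M\<^esub> = \<zero>\<^bsub>Q\<^esub>"
  using \<iota>.hom_zero by (simp add: \<mu>_def \<iota>_def)

lemma \<mu>_smult: "a \<in> carrier A \<Longrightarrow> x \<in> carrier M \<Longrightarrow> \<mu> (a \<odot>\<^bsub>M\<^esub> x) = \<iota> a \<otimes>\<^bsub>Q\<^esub> \<mu> x"
  using \<theta>_mult[of a "\<zero>\<^bsub>M\<^esub>" "\<zero>\<^bsub>A\<^esub>" x] by (simp add: \<mu>_def \<iota>_def M.smult_closed)

lemma \<mu>_mult: "x \<in> carrier M \<Longrightarrow> y \<in> carrier M \<Longrightarrow> \<mu> x \<otimes>\<^bsub>Q\<^esub> \<mu> y = \<zero>\<^bsub>Q\<^esub>"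
  using \<theta>_mult[of "\<zero>\<^bsub>A\<^esub>" x "\<zero>\<^bsub>A\<^esub>" y] \<mu>_zero by (simp add: \<mu>_def)

lemma \<mu>_minus: "x \<in> carrier M \<Longrightarrow> \<mu> (\<ominus>\<^bsub>M\<^esub> x) = \<ominus>\<^bsub>Q\<^esub> \<mu> x"
  using \<mu>_add[of "\<ominus>\<^bsub>M\<^esub> x" x] by (simp add: M.M.l_neg Q.minus_equality)

lemma \<mu>_finsum:
  assumes "finite I" "f \<in> I \<rightarrow> carrier M"
  shows "\<mu> (\<Oplus>\<^bsub>M\<^esub>i\<in>I. f i) = (\<Oplus>\<^bsub>Q\<^esub>i\<in>I. \<mu> (f i))"
  using finsum_hom[OF M.abelian_monoid_axioms Q.abelian_monoid_axioms assms order_refl, of \<mu>] \<mu>_add by auto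

lemma \<mu>_kernel: "x \<in> carrier M \<Longrightarrow> \<mu> x = \<zero>\<^bsub>Q\<^esub> \<longleftrightarrow> (\<exists>u\<in>S. u \<odot>\<^bsub>M\<^esub> x = \<zero>\<^bsub>M\<^esub>)"
proof -
  have "\<zero>\<^bsub>A\<^esub> \<in> annihilator A M" by (simp add: annihilator_def)
  then have "\<zero>\<^bsub>A\<^esub> \<otimes>\<^bsub>A\<^esub> \<zero>\<^bsub>A\<^esub> \<in> ideal_prod A (annihilator A M) (annihilator A M)" by (intro ideal_prod.prod)
  then show "x \<in> carrier M \<Longrightarrow> ?thesis" unfolding \<mu>_def by (subst \<theta>_kernel) auto
qed

lemma unit_cancel:
  assumes "s \<in> S"
  obtains t where "t \<in> carrier Q" "\<iota> s \<otimes>\<^bsub>Q\<^esub> t = \<one>\<^bsub>Q\<^esub>"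
proof -
  have "\<iota> s \<in> Units Q" using \<theta>_unit[OF assms] by (simp add: \<iota>_def)
  then show thesis using that[of "inv\<^bsub>Q\<^esub> \<iota> s"] by auto
qed

lemma ideal_prod_annihilator:
  "ideal (annihilator A M) A" "ideal (ideal_prod A (annihilator A M) (annihilator A M)) A"
  "ideal_prod A (annihilator A M) (annihilator A M) \<subseteq> annihilator A M"
proof -
  show I: "ideal (annihilator A M) A" by (rule M.annihilator_ideal)
  show "ideal (ideal_prod A (annihilator A M) (annihilator A M)) A" by (rule A.ideal_prod_is_ideal[OF I I])
  show "ideal_prod A (annihilator A M) (annihilator A M) \<subseteq> annihilator A M" using A.ideal_prod_inter[OF I I] by auto
qed

text \<open>The elements with a numerator whose first component lies in \<open>\<mm>\<close>. They form the only
  maximal ideal of \<open>Q\<close>, which contains the image of \<open>M\<close>.\<close>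

definition N :: "'q set" where
  "N = {q \<in> carrier Q. \<exists>s\<in>S. \<exists>a\<in>\<mm>. \<exists>x\<in>carrier M. q \<otimes>\<^bsub>Q\<^esub> \<iota> s = \<theta> (a, x)}"

lemma N_I: "q \<in> carrier Q \<Longrightarrow> s \<in> S \<Longrightarrow> a \<in> \<mm> \<Longrightarrow> x \<in> carrier M \<Longrightarrow> q \<otimes>\<^bsub>Q\<^esub> \<iota> s = \<theta> (a, x) \<Longrightarrow> q \<in> N"
  by (auto simp: N_def)

lemma N_E:
  assumes "q \<in> N"
  obtains s a x where "q \<in> carrier Q" "s \<in> S" "a \<in> \<mm>" "x \<in> carrier M" "q \<otimes>\<^bsub>Q\<^esub> \<iota> s = \<theta> (a, x)"
  using assms by (auto simp: N_def)

lemma fraction_E: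
  assumes "q \<in> carrier Q"
  obtains s a x where "s \<in> S" "a \<in> carrier A" "x \<in> carrier M" "q \<otimes>\<^bsub>Q\<^esub> \<iota> s = \<theta> (a, x)"
  using \<theta>_fraction[OF assms] by (auto simp: \<iota>_def)

lemma \<iota>_in_N: "a \<in> \<mm> \<Longrightarrow> \<iota> a \<in> N"
  using S_one m_carrier by (intro N_I[of _ "\<one>\<^bsub>A\<^esub>" a "\<zero>\<^bsub>M\<^esub>"]) (auto simp: \<iota>_def[symmetric])

text \<open>If \<open>b s\<close> and \<open>a \<in> \<mm>\<close> have the same image up to the image of \<open>M\<close>, then
  \<open>u (b s - a)\<close> annihilates \<open>M\<close> for some \<open>u \<notin> \<mm>\<close>, and annihilating elements lie in the prime ideal \<open>\<mm>\<close>.\<close>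

lemma \<iota>_in_N_D:
  assumes "b \<in> carrier A" "\<iota> b \<in> N"
  shows "b \<in> \<mm>"
proof -
  obtain s a x where s: "s \<in> S" "a \<in> \<mm>" "x \<in> carrier M" "\<iota> b \<otimes>\<^bsub>Q\<^esub> \<iota> s = \<theta> (a, x)"
    using assms(2) by (rule N_E)
  have c: "a \<in> carrier A" "s \<in> carrier A" using s m_carrier by auto
  have "\<theta> (b \<otimes>\<^bsub>A\<^esub> s \<ominus>\<^bsub>A\<^esub> a, \<ominus>\<^bsub>M\<^esub> x) = \<iota> (b \<otimes>\<^bsub>A\<^esub> s) \<oplus>\<^bsub>Q\<^esub> \<ominus>\<^bsub>Q\<^esub> (\<iota> a \<oplus>\<^bsub>Q\<^esub> \<mu> x)"
    using c s(3) assms(1) by (simp add: \<theta>_split A.minus_eq \<iota>_add \<mu>_minus Q.minus_add Q.a_assoc)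
  also have "\<dots> = \<zero>\<^bsub>Q\<^esub>" using c s(3,4) assms(1) by (simp add: \<theta>_split[symmetric] Q.r_neg)
  finally obtain u where u: "u \<in> S" "u \<otimes>\<^bsub>A\<^esub> (b \<otimes>\<^bsub>A\<^esub> s \<ominus>\<^bsub>A\<^esub> a) \<in> annihilator A M"
    using \<theta>_kernel[of "b \<otimes>\<^bsub>A\<^esub> s \<ominus>\<^bsub>A\<^esub> a" "\<ominus>\<^bsub>M\<^esub> x"] c s(3) assms(1) ideal_prod_annihilator(3) by auto
  then have "b \<otimes>\<^bsub>A\<^esub> s \<ominus>\<^bsub>A\<^esub> a \<in> \<mm>" 
    using P.I_prime[of u "b \<otimes>\<^bsub>A\<^esub> s \<ominus>\<^bsub>A\<^esub> a"] annihilator_subset c assms(1) by auto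
  then have "(b \<otimes>\<^bsub>A\<^esub> s \<ominus>\<^bsub>A\<^esub> a) \<oplus>\<^bsub>A\<^esub> a \<in> \<mm>" using s(2) by (rule P.a_closed)
  moreover have "(b \<otimes>\<^bsub>A\<^esub> s \<ominus>\<^bsub>A\<^esub> a) \<oplus>\<^bsub>A\<^esub> a = b \<otimes>\<^bsub>A\<^esub> s" 
    using c assms(1) by (simp add: A.minus_eq A.a_assoc A.l_neg)
  ultimately show ?thesis using P.I_prime[of b s] assms(1) c s(1) by auto
qed

lemma ideal_N: "ideal N Q"
proof -
  have add: "p \<oplus>\<^bsub>Q\<^esub> q \<in> N" if pq: "p \<in> N" "q \<in> N" for p q
  proof -
    obtain s a x where s: "p \<in> carrier Q" "s \<in> S" "a \<in> \<mm>" "x \<in> carrier M" "p \<otimes>\<^bsub>Q\<^esub> \<iota> s = \<theta> (a, x)"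
      using pq(1) by (rule N_E)
    obtain t b y where t: "q \<in> carrier Q" "t \<in> S" "b \<in> \<mm>" "y \<in> carrier M" "q \<otimes>\<^bsub>Q\<^esub> \<iota> t = \<theta> (b, y)"
      using pq(2) by (rule N_E)
    have c: "a \<in> carrier A" "s \<in> carrier A" "b \<in> carrier A" "t \<in> carrier A" using s t m_carrier by auto
    have i: "\<iota> s \<in> carrier Q" "\<iota> t \<in> carrier Q" using c by auto
    have "(p \<oplus>\<^bsub>Q\<^esub> q) \<otimes>\<^bsub>Q\<^esub> \<iota> (s \<otimes>\<^bsub>A\<^esub> t) = \<iota> t \<otimes>\<^bsub>Q\<^esub> (p \<otimes>\<^bsub>Q\<^esub> \<iota> s) \<oplus>\<^bsub>Q\<^esub> \<iota> s \<otimes>\<^bsub>Q\<^esub> (q \<otimes>\<^bsub>Q\<^esub> \<iota> t)"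
      unfolding \<iota>_mult[OF c(2,4)] using i s(1) t(1) by algebra
    also have "\<dots> = \<theta> (t \<otimes>\<^bsub>A\<^esub> a \<oplus>\<^bsub>A\<^esub> s \<otimes>\<^bsub>A\<^esub> b, t \<odot>\<^bsub>M\<^esub> x \<oplus>\<^bsub>M\<^esub> s \<odot>\<^bsub>M\<^esub> y)"
      unfolding s(5) t(5) using c s(4) t(4)
      by (simp add: \<theta>_split \<iota>_add \<iota>_mult \<mu>_add \<mu>_smult M.smult_closed Q.r_distr Q.a_ac)
    finally show ?thesis using s t c S_mult P.I_l_closed M.smult_closed
      by (intro N_I[of _ "s \<otimes>\<^bsub>A\<^esub> t" "t \<otimes>\<^bsub>A\<^esub> a \<oplus>\<^bsub>A\<^esub> s \<otimes>\<^bsub>A\<^esub> b" "t \<odot>\<^bsub>M\<^esub> x \<oplus>\<^bsub>M\<^esub> s \<odot>\<^bsub>M\<^esub> y"]) auto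
  qed
  have mult: "r \<otimes>\<^bsub>Q\<^esub> q \<in> N" if rq: "r \<in> carrier Q" "q \<in> N" for r q
  proof -
    obtain s a x where s: "q \<in> carrier Q" "s \<in> S" "a \<in> \<mm>" "x \<in> carrier M" "q \<otimes>\<^bsub>Q\<^esub> \<iota> s = \<theta> (a, x)"
      using rq(2) by (rule N_E)
    obtain t b y where t: "t \<in> S" "b \<in> carrier A" "y \<in> carrier M" "r \<otimes>\<^bsub>Q\<^esub> \<iota> t = \<theta> (b, y)"
      using rq(1) by (rule fraction_E)
    have c: "a \<in> carrier A" "s \<in> carrier A" "t \<in> carrier A" using s t m_carrier by auto
    have i: "\<iota> s \<in> carrier Q" "\<iota> t \<in> carrier Q" using c by auto
    have "(r \<otimes>\<^bsub>Q\<^esub> q) \<otimes>\<^bsub>Q\<^esub> \<iota> (t \<otimes>\<^bsub>A\<^esub> s) = (r \<otimes>\<^bsub>Q\<^esub> \<iota> t) \<otimes>\<^bsub>Q\<^esub> (q \<otimes>\<^bsub>Q\<^esub> \<iota> s)"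
      unfolding \<iota>_mult[OF c(3,2)] using i s(1) rq(1) by algebra
    also have "\<dots> = \<theta> (b \<otimes>\<^bsub>A\<^esub> a, b \<odot>\<^bsub>M\<^esub> x \<oplus>\<^bsub>M\<^esub> a \<odot>\<^bsub>M\<^esub> y)"
      unfolding s(5) t(4) using \<theta>_mult[OF t(2,3) c(1) s(4)] by simp
    finally show ?thesis using s t c S_mult P.I_l_closed M.smult_closed rq(1)
      by (intro N_I[of _ "t \<otimes>\<^bsub>A\<^esub> s" "b \<otimes>\<^bsub>A\<^esub> a" "b \<odot>\<^bsub>M\<^esub> x \<oplus>\<^bsub>M\<^esub> a \<odot>\<^bsub>M\<^esub> y"]) auto
  qed
  have NQ: "N \<subseteq> carrier Q" by (auto simp: N_def)
  show ?thesis
  proof (rule idealI)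
    show "ring Q" by (rule Q.ring_axioms)
    show "subgroup N (add_monoid Q)"
    proof (rule Q.add.subgroupI)
      show "N \<noteq> {}" using \<iota>_in_N P.zero_closed by blast
      show "\<ominus>\<^bsub>Q\<^esub> q \<in> N" if "q \<in> N" for q
      proof -
        have "\<ominus>\<^bsub>Q\<^esub> \<one>\<^bsub>Q\<^esub> \<otimes>\<^bsub>Q\<^esub> q \<in> N" using that by (intro mult) auto
        then show ?thesis using that NQ by (auto simp: Q.l_minus)
      qed
    qed (use NQ add in auto)
    show "a \<otimes>\<^bsub>Q\<^esub> x \<in> N" if "a \<in> N" "x \<in> carrier Q" for a x
      using mult[OF that(2,1)] that NQ by (auto simp: Q.m_comm)
  qed (rule mult)
qed

lemma one_notin_N: "\<one>\<^bsub>Q\<^esub> \<notin> N"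
  using \<iota>_in_N_D[of "\<one>\<^bsub>A\<^esub>"] S_one by auto

text \<open>Up to a denominator the element is \<open>a + x\<close> with \<open>a\<close> a unit and \<open>x\<^sup>2 = 0\<close>, and its
  inverse is \<open>(a - x) / a\<^sup>2\<close>.\<close>

lemma unit_outside_N:
  assumes "q \<in> carrier Q - N"
  shows "q \<in> Units Q"
proof -
  obtain s a x where s: "s \<in> S" "a \<in> carrier A" "x \<in> carrier M" "q \<otimes>\<^bsub>Q\<^esub> \<iota> s = \<theta> (a, x)"
    using assms fraction_E[of q] by auto
  have "a \<notin> \<mm>" using N_I[of q s a x] s assms by auto
  then obtain t where t: "t \<in> carrier Q" "\<iota> a \<otimes>\<^bsub>Q\<^esub> t = \<one>\<^bsub>Q\<^esub>" using unit_cancel[of a] s by auto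
  have c: "q \<in> carrier Q" "\<iota> s \<in> carrier Q" "\<iota> a \<in> carrier Q" "\<mu> x \<in> carrier Q" using s assms by auto
  have "q \<otimes>\<^bsub>Q\<^esub> (\<iota> s \<otimes>\<^bsub>Q\<^esub> ((\<iota> a \<ominus>\<^bsub>Q\<^esub> \<mu> x) \<otimes>\<^bsub>Q\<^esub> (t \<otimes>\<^bsub>Q\<^esub> t))) = (q \<otimes>\<^bsub>Q\<^esub> \<iota> s) \<otimes>\<^bsub>Q\<^esub> (\<iota> a \<ominus>\<^bsub>Q\<^esub> \<mu> x) \<otimes>\<^bsub>Q\<^esub> (t \<otimes>\<^bsub>Q\<^esub> t)"
    using c t(1) by algebra
  also have "\<dots> = (\<iota> a \<oplus>\<^bsub>Q\<^esub> \<mu> x) \<otimes>\<^bsub>Q\<^esub> (\<iota> a \<ominus>\<^bsub>Q\<^esub> \<mu> x) \<otimes>\<^bsub>Q\<^esub> (t \<otimes>\<^bsub>Q\<^esub> t)" using s by (simp add: \<theta>_split)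
  also have "\<dots> = (\<iota> a \<otimes>\<^bsub>Q\<^esub> t) \<otimes>\<^bsub>Q\<^esub> (\<iota> a \<otimes>\<^bsub>Q\<^esub> t) \<ominus>\<^bsub>Q\<^esub> (\<mu> x \<otimes>\<^bsub>Q\<^esub> \<mu> x) \<otimes>\<^bsub>Q\<^esub> (t \<otimes>\<^bsub>Q\<^esub> t)"
    using c t(1) by algebra
  also have "\<dots> = \<one>\<^bsub>Q\<^esub>" using t s \<mu>_mult[of x x] by (simp add: Q.minus_eq)
  finally have e: "q \<otimes>\<^bsub>Q\<^esub> (\<iota> s \<otimes>\<^bsub>Q\<^esub> ((\<iota> a \<ominus>\<^bsub>Q\<^esub> \<mu> x) \<otimes>\<^bsub>Q\<^esub> (t \<otimes>\<^bsub>Q\<^esub> t))) = \<one>\<^bsub>Q\<^esub>" .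
  define w where "w = \<iota> s \<otimes>\<^bsub>Q\<^esub> ((\<iota> a \<ominus>\<^bsub>Q\<^esub> \<mu> x) \<otimes>\<^bsub>Q\<^esub> (t \<otimes>\<^bsub>Q\<^esub> t))"
  have w: "w \<in> carrier Q" "q \<otimes>\<^bsub>Q\<^esub> w = \<one>\<^bsub>Q\<^esub>" using e c t by (auto simp: w_def)
  then show ?thesis using c(1) Q.m_comm[of q w] unfolding Units_def by auto
qed

text \<open>Up to a denominator the element is \<open>a + x\<close> with \<open>a \<in> \<mm>\<close> and \<open>x\<^sup>2 = 0\<close>, so its
  square is a multiple of \<open>a\<close>. A power \<open>a\<^sup>n\<close> annihilates \<open>M\<close>, and \<open>a\<^sup>2\<^sup>n\<close> lies in the ideal
  that is divided out.\<close>

lemma nilpotent_in_N: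
  assumes "q \<in> N"
  shows "\<exists>n::nat. q [^]\<^bsub>Q\<^esub> n = \<zero>\<^bsub>Q\<^esub>"
proof -
  obtain s a x where s: "q \<in> carrier Q" "s \<in> S" "a \<in> \<mm>" "x \<in> carrier M" "q \<otimes>\<^bsub>Q\<^esub> \<iota> s = \<theta> (a, x)"
    using assms by (rule N_E)
  have a: "a \<in> carrier A" using s m_carrier by auto
  obtain n :: nat where n: "a [^]\<^bsub>A\<^esub> n \<in> annihilator A M" using nilpotent[OF s(3)] by blast
  have "a [^]\<^bsub>A\<^esub> (n + n) = a [^]\<^bsub>A\<^esub> n \<otimes>\<^bsub>A\<^esub> a [^]\<^bsub>A\<^esub> n" using a by (simp add: A.nat_pow_mult)
  then have "\<one>\<^bsub>A\<^esub> \<otimes>\<^bsub>A\<^esub> a [^]\<^bsub>A\<^esub> (n + n) \<in> ideal_prod A (annihilator A M) (annihilator A M)"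
    using n a ideal_prod.prod[of "a [^]\<^bsub>A\<^esub> n" _ "a [^]\<^bsub>A\<^esub> n" _ A] by simp
  then have z: "\<iota> (a [^]\<^bsub>A\<^esub> (n + n)) = \<zero>\<^bsub>Q\<^esub>"
    unfolding \<iota>_def using a S_one by (subst \<theta>_kernel) (auto intro!: bexI[of _ "\<one>\<^bsub>A\<^esub>"])
  define y where "y = \<theta> (a, x)"
  have y: "y \<in> carrier Q" using a s by (simp add: y_def)
  define w where "w = \<iota> a \<oplus>\<^bsub>Q\<^esub> \<mu> x \<oplus>\<^bsub>Q\<^esub> \<mu> x"
  have w: "w \<in> carrier Q" using a s by (simp add: w_def)
  have i: "\<iota> a \<in> carrier Q" "\<mu> x \<in> carrier Q" using a s by auto
  have "y \<otimes>\<^bsub>Q\<^esub> y = \<iota> a \<otimes>\<^bsub>Q\<^esub> w \<oplus>\<^bsub>Q\<^esub> \<mu> x \<otimes>\<^bsub>Q\<^esub> \<mu> x"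
    unfolding y_def \<theta>_split[OF a s(4)] w_def using i by algebra
  then have yy: "y \<otimes>\<^bsub>Q\<^esub> y = \<iota> a \<otimes>\<^bsub>Q\<^esub> w" using \<mu>_mult[OF s(4) s(4)] i w by simp
  have "(y \<otimes>\<^bsub>Q\<^esub> y) [^]\<^bsub>Q\<^esub> (n + n) = \<iota> a [^]\<^bsub>Q\<^esub> (n + n) \<otimes>\<^bsub>Q\<^esub> w [^]\<^bsub>Q\<^esub> (n + n)"
    unfolding yy using i w by (intro Q.nat_pow_distrib)
  also have "\<iota> a [^]\<^bsub>Q\<^esub> (n + n) = \<iota> (a [^]\<^bsub>A\<^esub> (n + n))" using a by (simp add: \<iota>.ring.hom_nat_pow)
  finally have y0: "(y \<otimes>\<^bsub>Q\<^esub> y) [^]\<^bsub>Q\<^esub> (n + n) = \<zero>\<^bsub>Q\<^esub>" using z w by simp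
  obtain t where t: "t \<in> carrier Q" "\<iota> s \<otimes>\<^bsub>Q\<^esub> t = \<one>\<^bsub>Q\<^esub>" using unit_cancel[OF s(2)] .
  have sQ: "\<iota> s \<in> carrier Q" using s by auto
  have "q = (q \<otimes>\<^bsub>Q\<^esub> \<iota> s) \<otimes>\<^bsub>Q\<^esub> t" using s(1) t sQ by (simp add: Q.m_assoc)
  then have q: "q = y \<otimes>\<^bsub>Q\<^esub> t" by (simp add: s(5) y_def)
  have "(q \<otimes>\<^bsub>Q\<^esub> q) = (y \<otimes>\<^bsub>Q\<^esub> y) \<otimes>\<^bsub>Q\<^esub> (t \<otimes>\<^bsub>Q\<^esub> t)" unfolding q using y t by algebra
  then have "(q \<otimes>\<^bsub>Q\<^esub> q) [^]\<^bsub>Q\<^esub> (n + n) = (y \<otimes>\<^bsub>Q\<^esub> y) [^]\<^bsub>Q\<^esub> (n + n) \<otimes>\<^bsub>Q\<^esub> (t \<otimes>\<^bsub>Q\<^esub> t) [^]\<^bsub>Q\<^esub> (n + n)"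
    using y t by (simp only: Q.nat_pow_distrib Q.m_closed)
  then have "(q \<otimes>\<^bsub>Q\<^esub> q) [^]\<^bsub>Q\<^esub> (n + n) = \<zero>\<^bsub>Q\<^esub>" using y0 t by simp
  moreover have "q \<otimes>\<^bsub>Q\<^esub> q = q [^]\<^bsub>Q\<^esub> (2::nat)" using s(1) by (simp add: numeral_2_eq_2)
  ultimately have "q [^]\<^bsub>Q\<^esub> (2 * (n + n)) = \<zero>\<^bsub>Q\<^esub>" using s(1) by (simp only: Q.nat_pow_pow)
  then show ?thesis by blast
qed

lemma natural_unit:
  assumes "n > 0"
  shows "add_pow Q (n::nat) \<one>\<^bsub>Q\<^esub> \<notin> N"
proof -
  have "\<iota> (add_pow A n \<one>\<^bsub>A\<^esub>) = add_pow Q n \<one>\<^bsub>Q\<^esub>"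
    by (induction n) (auto simp: \<iota>_add)
  then show ?thesis using \<iota>_in_N_D[of "add_pow A n \<one>\<^bsub>A\<^esub>"] characteristic[OF assms] by auto
qed

lemma coefficient_subfield_exists: "\<exists>C. coefficient_subfield Q C N"
proof -
  obtain C where "subring C Q" "C \<inter> N = {\<zero>\<^bsub>Q\<^esub>}" "\<forall>c\<in>C - {\<zero>\<^bsub>Q\<^esub>}. \<exists>d\<in>C. c \<otimes>\<^bsub>Q\<^esub> d = \<one>\<^bsub>Q\<^esub>"
    "\<forall>x\<in>carrier Q. \<exists>c\<in>C. x \<ominus>\<^bsub>Q\<^esub> c \<in> N"
    using Q.coefficient_field[OF ideal_N one_notin_N nilpotent_in_N unit_outside_N natural_unit] by auto
  then show ?thesis
    by (intro exI[of _ C] coefficient_subfield.intro Q.is_cring coefficient_subfield_axioms.intro ideal_N) auto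
qed

lemma common_denominator:
  assumes "finite F" "F \<subseteq> carrier Q"
  shows "\<exists>s\<in>S. \<forall>q\<in>F. \<exists>a\<in>carrier A. \<exists>x\<in>carrier M. q \<otimes>\<^bsub>Q\<^esub> \<iota> s = \<theta> (a, x)"
  using assms
proof (induction F rule: finite_induct)
  case empty
  then show ?case using S_one by blast
next
  case (insert q F)
  then obtain s where s: "s \<in> S" "\<forall>q\<in>F. \<exists>a\<in>carrier A. \<exists>x\<in>carrier M. q \<otimes>\<^bsub>Q\<^esub> \<iota> s = \<theta> (a, x)" by auto
  obtain t a x where t: "t \<in> S" "a \<in> carrier A" "x \<in> carrier M" "q \<otimes>\<^bsub>Q\<^esub> \<iota> t = \<theta> (a, x)"
    using insert.prems fraction_E[of q] by auto
  have c: "s \<in> carrier A" "t \<in> carrier A" using s t by auto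
  have *: "\<exists>a'\<in>carrier A. \<exists>x'\<in>carrier M. r \<otimes>\<^bsub>Q\<^esub> \<iota> (u \<otimes>\<^bsub>A\<^esub> v) = \<theta> (a', x')"
    if r: "r \<in> carrier Q" "u \<in> carrier A" "v \<in> carrier A" "a \<in> carrier A" "x \<in> carrier M" "r \<otimes>\<^bsub>Q\<^esub> \<iota> v = \<theta> (a, x)" for r u v a x
  proof -
    have "r \<otimes>\<^bsub>Q\<^esub> \<iota> (u \<otimes>\<^bsub>A\<^esub> v) = \<iota> u \<otimes>\<^bsub>Q\<^esub> (r \<otimes>\<^bsub>Q\<^esub> \<iota> v)" 
      using r(1-5) by (simp add: \<iota>_mult Q.m_lcomm)
    also have "\<dots> = \<theta> (u \<otimes>\<^bsub>A\<^esub> a, u \<odot>\<^bsub>M\<^esub> x)"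
      unfolding r(6) using r by (simp add: \<theta>_split \<iota>_mult \<mu>_smult M.smult_closed Q.r_distr)
    finally show ?thesis using r M.smult_closed by blast
  qed
  have "\<exists>a\<in>carrier A. \<exists>x\<in>carrier M. r \<otimes>\<^bsub>Q\<^esub> \<iota> (t \<otimes>\<^bsub>A\<^esub> s) = \<theta> (a, x)" if "r \<in> insert q F" for r
  proof (cases "r = q")
    case True
    have "q \<in> carrier Q" using insert.prems by simp
    have "s \<otimes>\<^bsub>A\<^esub> t = t \<otimes>\<^bsub>A\<^esub> s" by (rule A.m_comm[OF c])
    then show ?thesis using *[OF \<open>q \<in> carrier Q\<close> c(1,2) t(2-4)] unfolding True by (simp only:)
  next
    case False
    then have r: "r \<in> F" "r \<in> carrier Q" using that insert.prems by auto
    obtain b where b: "b \<in> carrier A" "\<exists>x\<in>carrier M. r \<otimes>\<^bsub>Q\<^esub> \<iota> s = \<theta> (b, x)"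
      using bspec[OF s(2) r(1)] by (rule bexE)
    obtain y where y: "y \<in> carrier M" "r \<otimes>\<^bsub>Q\<^esub> \<iota> s = \<theta> (b, y)" using b(2) by (rule bexE)
    show ?thesis by (rule *[OF r(2) c(2,1) b(1) y])
  qed
  then show ?case using S_mult[OF t(1) s(1)] by blast
qed

text \<open>Finitely many conditions that persist under further multiplication are met by one
  element outside \<open>\<mm>\<close>.\<close>

lemma common_multiplier:
  assumes "finite F" and ex: "\<And>z. z \<in> F \<Longrightarrow> \<exists>u\<in>S. R z u"
    and up: "\<And>z u v. z \<in> F \<Longrightarrow> u \<in> S \<Longrightarrow> v \<in> S \<Longrightarrow> R z u \<Longrightarrow> R z (v \<otimes>\<^bsub>A\<^esub> u)"
  shows "\<exists>u\<in>S. \<forall>z\<in>F. R z u"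
  using assms
proof (induction F rule: finite_induct)
  case empty
  then show ?case using S_one by blast
next
  case (insert z F)
  have "\<exists>u\<in>S. \<forall>z\<in>F. R z u"
  proof (rule insert.IH)
    show "\<exists>u\<in>S. R z u" if "z \<in> F" for z by (rule insert.prems(1)) (simp add: that)
    show "R z (v \<otimes>\<^bsub>A\<^esub> u)" if "z \<in> F" "u \<in> S" "v \<in> S" "R z u" for z u v
      by (rule insert.prems(2)) (use that in simp_all)
  qed
  then obtain u where u: "u \<in> S" "\<forall>z\<in>F. R z u" by (rule bexE)
  obtain v where v: "v \<in> S" "R z v" using insert.prems(1)[of z] by auto
  have c: "u \<in> carrier A" "v \<in> carrier A" using u v by auto
  have "R z (u \<otimes>\<^bsub>A\<^esub> v)" using insert.prems(2)[of z v u] u v by auto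
  moreover have "R y (u \<otimes>\<^bsub>A\<^esub> v)" if "y \<in> F" for y
  proof -
    have "R y (v \<otimes>\<^bsub>A\<^esub> u)" using insert.prems(2)[of y u v] u v that by simp
    then show ?thesis unfolding A.m_comm[OF c] .
  qed
  ultimately show ?case using S_mult[OF u(1) v(1)] by blast
qed

text \<open>Let \<open>G j\<close> consist of the products of \<open>j\<close> generators of \<open>\<mm>\<close> with a generator of \<open>M\<close>. It
  is zero for \<open>j = n\<close>, and \<open>N\<close> maps its image into the ideal generated by that of \<open>G (j + 1)\<close>. All vectors found by
  \<open>triangular_exists\<close> lie in these sets, so they come from elements of \<open>M\<close> without
  denominators.\<close>

lemma triangular_basis_exists:
  assumes C: "coefficient_subfield Q C N"
    and Z: "finite Z" "Z \<subseteq> carrier A" "\<mm> = genideal A Z"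
    and G0: "finite G0" "G0 \<subseteq> carrier M"
      "\<And>x. x \<in> carrier M \<Longrightarrow> \<exists>c\<in>G0 \<rightarrow> carrier A. x = (\<Oplus>\<^bsub>M\<^esub>s\<in>G0. c s \<odot>\<^bsub>M\<^esub> s)"
    and pow: "\<And>a x. a \<in> \<mm> [^]\<^bsub>ideals_set A\<^esub> (n::nat) \<Longrightarrow> x \<in> carrier M \<Longrightarrow> a \<odot>\<^bsub>M\<^esub> x = \<zero>\<^bsub>M\<^esub>"
  shows "\<exists>\<epsilon> d. (\<forall>i<d. \<epsilon> i \<in> carrier M) \<and> coefficient_subfield.triangular Q C N (\<lambda>i. \<mu> (\<epsilon> i)) d \<and>
    \<mu> ` carrier M \<subseteq> filtration_span Q C (\<lambda>i. \<mu> (\<epsilon> i)) d"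
proof -
  interpret C: coefficient_subfield Q C N by (rule C)
  define G where "G = rec_nat G0 (\<lambda>_ H. (\<lambda>(z, g). z \<odot>\<^bsub>M\<^esub> g) ` (Z \<times> H))"
  have G_0: "G 0 = G0" and G_Suc: "G (Suc j) = (\<lambda>(z, g). z \<odot>\<^bsub>M\<^esub> g) ` (Z \<times> G j)" for j
    by (simp_all add: G_def)
  have fin: "finite (G j)" for j by (induction j) (auto simp: G_0 G_Suc G0 Z)
  have GM: "G j \<subseteq> carrier M" for j
    using Z(2) G0(2) by (induction j) (auto simp: G_0 G_Suc intro!: M.smult_closed)
  have mz: "Z \<subseteq> \<mm>" using A.genideal_self[OF Z(2)] Z(3) by simp
  have pc: "\<mm> [^]\<^bsub>ideals_set A\<^esub> l \<subseteq> carrier A" for l :: nat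
  proof (induction l)
    case (Suc l)
    have "x \<in> carrier A" if "x \<in> ideal_prod A (\<mm> [^]\<^bsub>ideals_set A\<^esub> l) \<mm>" for x
      using that Suc m_carrier by (induction x rule: ideal_prod.induct) auto
    then show ?case by (auto simp: ideals_set_def nat_pow_def)
  qed (simp add: ideals_set_def nat_pow_def)
  have kill: "a \<odot>\<^bsub>M\<^esub> g = \<zero>\<^bsub>M\<^esub>" if "g \<in> G j" "l + j = n" "a \<in> \<mm> [^]\<^bsub>ideals_set A\<^esub> l" for a g j l
    using that
  proof (induction j arbitrary: a g l)
    case 0
    then show ?case using pow GM[of 0] by auto
  next
    case (Suc j)
    obtain z g' where z: "z \<in> Z" "g' \<in> G j" "g = z \<odot>\<^bsub>M\<^esub> g'" using Suc.prems(1) by (auto simp: G_Suc)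
    have c: "a \<in> carrier A" "z \<in> carrier A" "g' \<in> carrier M" using Suc.prems(3) pc[of l] z GM[of j] Z by auto
    have "a \<otimes>\<^bsub>A\<^esub> z \<in> ideal_prod A (\<mm> [^]\<^bsub>ideals_set A\<^esub> l) \<mm>" using Suc.prems z mz by (intro ideal_prod.prod) auto
    then have "a \<otimes>\<^bsub>A\<^esub> z \<in> \<mm> [^]\<^bsub>ideals_set A\<^esub> Suc l" by (simp add: ideals_set_def nat_pow_def)
    then have "(a \<otimes>\<^bsub>A\<^esub> z) \<odot>\<^bsub>M\<^esub> g' = \<zero>\<^bsub>M\<^esub>" using Suc.IH[OF z(2), of "Suc l"] Suc.prems by simp
    then show ?case using c z by (simp add: M.smult_assoc1)
  qed
  have Gn: "G n \<subseteq> {\<zero>\<^bsub>M\<^esub>}"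
  proof
    fix g assume g: "g \<in> G n"
    have "\<one>\<^bsub>A\<^esub> \<in> \<mm> [^]\<^bsub>ideals_set A\<^esub> (0::nat)" by (simp add: ideals_set_def nat_pow_def)
    then have "\<one>\<^bsub>A\<^esub> \<odot>\<^bsub>M\<^esub> g = \<zero>\<^bsub>M\<^esub>" using kill[OF g, of 0] by simp
    then show "g \<in> {\<zero>\<^bsub>M\<^esub>}" using subsetD[OF GM g] by simp
  qed
  have gen: "q \<otimes>\<^bsub>Q\<^esub> g \<in> V" if V: "ideal V Q" and sub: "\<mu> ` G (Suc j) \<subseteq> V" and g: "g \<in> \<mu> ` G j" and q: "q \<in> N" for j V g q
  proof -
    interpret V: ideal V Q by (rule V)
    obtain \<gamma> where \<gamma>: "\<gamma> \<in> G j" "g = \<mu> \<gamma>" "\<gamma> \<in> carrier M" using g GM by blast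
    define K where "K = {a \<in> carrier A. \<iota> a \<otimes>\<^bsub>Q\<^esub> g \<in> V}"
    have gQ: "g \<in> carrier Q" using \<gamma> by simp
    have "ideal K A"
    proof (rule idealI)
      show "ring A" by (rule A.ring_axioms)
      show "subgroup K (add_monoid A)"
      proof (rule A.add.subgroupI)
        show "K \<noteq> {}" using gQ by (auto simp: K_def intro!: exI[of _ "\<zero>\<^bsub>A\<^esub>"])
        show "\<ominus>\<^bsub>A\<^esub> a \<in> K" if "a \<in> K" for a using that gQ V.a_inv_closed by (auto simp: K_def Q.l_minus)
        show "a \<oplus>\<^bsub>A\<^esub> b \<in> K" if "a \<in> K" "b \<in> K" for a b using that gQ by (auto simp: K_def \<iota>_add Q.l_distr)
      qed (auto simp: K_def)
      show "x \<otimes>\<^bsub>A\<^esub> a \<in> K" if "a \<in> K" "x \<in> carrier A" for a x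
        using that gQ V.I_l_closed by (auto simp: K_def \<iota>_mult Q.m_assoc)
      then show "a \<otimes>\<^bsub>A\<^esub> x \<in> K" if "a \<in> K" "x \<in> carrier A" for a x
        using that A.m_comm[of a x] by (auto simp: K_def)
    qed
    moreover have "Z \<subseteq> K"
    proof
      fix z assume z: "z \<in> Z"
      have "\<mu> (z \<odot>\<^bsub>M\<^esub> \<gamma>) \<in> V" using sub z \<gamma> by (auto simp: G_Suc)
      then show "z \<in> K" using z Z(2) \<gamma> by (auto simp: K_def \<mu>_smult)
    qed
    ultimately have mK: "\<mm> \<subseteq> K" unfolding Z(3) by (intro A.genideal_minimal)
    obtain s a x where s: "q \<in> carrier Q" "s \<in> S" "a \<in> \<mm>" "x \<in> carrier M" "q \<otimes>\<^bsub>Q\<^esub> \<iota> s = \<theta> (a, x)"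
      using q by (rule N_E)
    have a: "a \<in> carrier A" using s m_carrier by auto
    obtain t where t: "t \<in> carrier Q" "\<iota> s \<otimes>\<^bsub>Q\<^esub> t = \<one>\<^bsub>Q\<^esub>" using unit_cancel[OF s(2)] .
    have sQ: "\<iota> s \<in> carrier Q" "\<iota> a \<in> carrier Q" "\<mu> x \<in> carrier Q" using s a by auto
    have "q \<otimes>\<^bsub>Q\<^esub> g = t \<otimes>\<^bsub>Q\<^esub> ((q \<otimes>\<^bsub>Q\<^esub> \<iota> s) \<otimes>\<^bsub>Q\<^esub> g)"
    proof -
      have "t \<otimes>\<^bsub>Q\<^esub> ((q \<otimes>\<^bsub>Q\<^esub> \<iota> s) \<otimes>\<^bsub>Q\<^esub> g) = (\<iota> s \<otimes>\<^bsub>Q\<^esub> t) \<otimes>\<^bsub>Q\<^esub> (q \<otimes>\<^bsub>Q\<^esub> g)" using sQ t(1) s(1) gQ by algebra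
      then show ?thesis using t(2) s(1) gQ by simp
    qed
    also have "(q \<otimes>\<^bsub>Q\<^esub> \<iota> s) \<otimes>\<^bsub>Q\<^esub> g = \<iota> a \<otimes>\<^bsub>Q\<^esub> g"
      unfolding s(5) \<theta>_split[OF a s(4)] using sQ gQ \<mu>_mult[OF s(4) \<gamma>(3)] \<gamma>(2) by (simp add: Q.l_distr)
    also have "t \<otimes>\<^bsub>Q\<^esub> (\<iota> a \<otimes>\<^bsub>Q\<^esub> g) \<in> V" 
    proof (rule V.I_l_closed[OF _ t(1)])
      have "a \<in> K" using mK s(3) by (rule subsetD)
      then show "\<iota> a \<otimes>\<^bsub>Q\<^esub> g \<in> V" by (simp add: K_def)
    qed
    finally show ?thesis .
  qed
  have "\<exists>e d. C.triangular e d \<and> \<mu> ` G 0 \<subseteq> C.tspan e d \<and> e ` {..<d} \<subseteq> (\<Union>j. \<mu> ` G j)"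
  proof (rule C.triangular_exists)
    show "finite (\<mu> ` G j)" for j using fin by simp
    show "\<mu> ` G j \<subseteq> carrier Q" for j using subsetD[OF GM[of j]] by auto
    show "\<mu> ` G n \<subseteq> {\<zero>\<^bsub>Q\<^esub>}" using Gn by auto
  qed (rule gen)
  then obtain e d where e: "C.triangular e d" "\<mu> ` G0 \<subseteq> C.tspan e d" "e ` {..<d} \<subseteq> (\<Union>j. \<mu> ` G j)"
    by (auto simp: G_0)
  have "\<exists>x. x \<in> carrier M \<and> (i < d \<longrightarrow> e i = \<mu> x)" for i
    using e(3) GM by (cases "i < d") (blast, auto)
  then obtain \<epsilon> where \<epsilon>: "\<And>i. \<epsilon> i \<in> carrier M" "\<And>i. i < d \<Longrightarrow> e i = \<mu> (\<epsilon> i)" by metis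
  have eq: "C.tspan (\<lambda>i. \<mu> (\<epsilon> i)) k = C.tspan e k" if "k \<le> d" for k
  proof (rule C.span_cong)
    show "\<mu> (\<epsilon> i) = e i" if "i < k" for i using \<epsilon>(2)[of i] that \<open>k \<le> d\<close> by simp
    show "e \<in> {..<k} \<rightarrow> carrier Q" by (rule C.triangular_carrier[OF e(1) that])
  qed
  have tri: "C.triangular (\<lambda>i. \<mu> (\<epsilon> i)) d"
    using e(1) eq \<epsilon> unfolding C.triangular_def by auto
  interpret L: ideal "C.tspan e d" Q by (rule C.triangular_ideal[OF e(1) order_refl])
  have "\<mu> x \<in> C.tspan e d" if x: "x \<in> carrier M" for x
  proof -
    obtain c where c: "c \<in> G0 \<rightarrow> carrier A" "x = (\<Oplus>\<^bsub>M\<^esub>s\<in>G0. c s \<odot>\<^bsub>M\<^esub> s)" using bexE[OF G0(3)[OF x]] by blast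
    have "\<mu> x = (\<Oplus>\<^bsub>Q\<^esub>s\<in>G0. \<mu> (c s \<odot>\<^bsub>M\<^esub> s))"
      unfolding c(2) using c(1) G0 by (intro \<mu>_finsum) (auto intro!: M.smult_closed)
    moreover have "\<mu> (c s \<odot>\<^bsub>M\<^esub> s) \<in> C.tspan e d" if "s \<in> G0" for s
      using that c(1) e(2) G0(2) by (auto simp: \<mu>_smult Pi_iff subset_iff intro!: L.I_l_closed)
    ultimately show ?thesis
      using finsum_hom[OF Q.abelian_monoid_axioms Q.abelian_monoid_axioms G0(1), of "\<lambda>s. \<mu> (c s \<odot>\<^bsub>M\<^esub> s)" "C.tspan e d" "\<lambda>x. x"]
        L.a_subset by auto
  qed
  then show ?thesis using tri \<epsilon>(1) eq[of d] by (intro exI[of _ \<epsilon>] exI[of _ d]) auto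
qed


text \<open>Numerators of elements of \<open>Q\<close> carry components in \<open>M\<close>. An equation between two of them still
  yields one between the components in \<open>A\<close>, up to a denominator and modulo the ideal divided out.\<close>

lemma \<theta>_eqD:
  assumes "a \<in> carrier A" "b \<in> carrier A" "x \<in> carrier M" "y \<in> carrier M" "\<theta> (a, x) = \<theta> (b, y)"
  shows "\<exists>u\<in>S. u \<otimes>\<^bsub>A\<^esub> (a \<ominus>\<^bsub>A\<^esub> b) \<in> ideal_prod A (annihilator A M) (annihilator A M)"
proof -
  have i: "\<iota> a \<in> carrier Q" "\<iota> b \<in> carrier Q" "\<mu> x \<in> carrier Q" "\<mu> y \<in> carrier Q" using assms by auto
  have "\<theta> (a \<ominus>\<^bsub>A\<^esub> b, x \<oplus>\<^bsub>M\<^esub> \<ominus>\<^bsub>M\<^esub> y) = (\<iota> a \<oplus>\<^bsub>Q\<^esub> \<ominus>\<^bsub>Q\<^esub> \<iota> b) \<oplus>\<^bsub>Q\<^esub> (\<mu> x \<oplus>\<^bsub>Q\<^esub> \<ominus>\<^bsub>Q\<^esub> \<mu> y)"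
    using assms(1-4) by (simp add: \<theta>_split A.minus_eq \<iota>_add \<mu>_add \<mu>_minus)
  also have "\<dots> = (\<iota> a \<oplus>\<^bsub>Q\<^esub> \<mu> x) \<ominus>\<^bsub>Q\<^esub> (\<iota> b \<oplus>\<^bsub>Q\<^esub> \<mu> y)" using i by algebra
  also have "\<dots> = \<zero>\<^bsub>Q\<^esub>" using assms i by (simp add: \<theta>_split Q.minus_eq Q.r_neg)
  finally show ?thesis using \<theta>_kernel[of "a \<ominus>\<^bsub>A\<^esub> b" "x \<oplus>\<^bsub>M\<^esub> \<ominus>\<^bsub>M\<^esub> y"] assms(1-4) by auto
qed

lemma \<theta>_product_sum:
  assumes "\<And>j. j < (d::nat) \<Longrightarrow> a j \<in> carrier A" "\<And>j. j < d \<Longrightarrow> b j \<in> carrier A"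
    "\<And>j. j < d \<Longrightarrow> x j \<in> carrier M" "\<And>j. j < d \<Longrightarrow> y j \<in> carrier M"
  shows "\<exists>z\<in>carrier M. (\<Oplus>\<^bsub>Q\<^esub>j\<in>{..<d}. \<theta> (a j, x j) \<otimes>\<^bsub>Q\<^esub> \<theta> (b j, y j)) = \<theta> (\<Oplus>\<^bsub>A\<^esub>j\<in>{..<d}. a j \<otimes>\<^bsub>A\<^esub> b j, z)"
proof -
  define z where "z = (\<Oplus>\<^bsub>M\<^esub>j\<in>{..<d}. a j \<odot>\<^bsub>M\<^esub> y j \<oplus>\<^bsub>M\<^esub> b j \<odot>\<^bsub>M\<^esub> x j)"
  have c: "a j \<odot>\<^bsub>M\<^esub> y j \<oplus>\<^bsub>M\<^esub> b j \<odot>\<^bsub>M\<^esub> x j \<in> carrier M" "a j \<otimes>\<^bsub>A\<^esub> b j \<in> carrier A" if "j < d" for j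
    using assms that M.smult_closed by auto
  have z: "z \<in> carrier M" unfolding z_def using c by (intro M.finsum_closed) auto
  have "(\<Oplus>\<^bsub>Q\<^esub>j\<in>{..<d}. \<theta> (a j, x j) \<otimes>\<^bsub>Q\<^esub> \<theta> (b j, y j)) =
    (\<Oplus>\<^bsub>Q\<^esub>j\<in>{..<d}. \<iota> (a j \<otimes>\<^bsub>A\<^esub> b j) \<oplus>\<^bsub>Q\<^esub> \<mu> (a j \<odot>\<^bsub>M\<^esub> y j \<oplus>\<^bsub>M\<^esub> b j \<odot>\<^bsub>M\<^esub> x j))"
  proof (intro Q.finsum_cong' refl)
    fix j assume "j \<in> {..<d}"
    then have j: "j < d" by simp
    show "\<theta> (a j, x j) \<otimes>\<^bsub>Q\<^esub> \<theta> (b j, y j) = \<iota> (a j \<otimes>\<^bsub>A\<^esub> b j) \<oplus>\<^bsub>Q\<^esub> \<mu> (a j \<odot>\<^bsub>M\<^esub> y j \<oplus>\<^bsub>M\<^esub> b j \<odot>\<^bsub>M\<^esub> x j)"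
      unfolding \<theta>_split[OF c(2,1)[OF j], symmetric] using assms j by (simp add: \<theta>_mult)
  qed (use c in auto)
  also have "\<dots> = (\<Oplus>\<^bsub>Q\<^esub>j\<in>{..<d}. \<iota> (a j \<otimes>\<^bsub>A\<^esub> b j)) \<oplus>\<^bsub>Q\<^esub> (\<Oplus>\<^bsub>Q\<^esub>j\<in>{..<d}. \<mu> (a j \<odot>\<^bsub>M\<^esub> y j \<oplus>\<^bsub>M\<^esub> b j \<odot>\<^bsub>M\<^esub> x j))"
    using c by (intro Q.finsum_addf) auto
  also have "(\<Oplus>\<^bsub>Q\<^esub>j\<in>{..<d}. \<mu> (a j \<odot>\<^bsub>M\<^esub> y j \<oplus>\<^bsub>M\<^esub> b j \<odot>\<^bsub>M\<^esub> x j)) = \<mu> z"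
    unfolding z_def using c by (intro \<mu>_finsum[symmetric]) auto
  also have "(\<Oplus>\<^bsub>Q\<^esub>j\<in>{..<d}. \<iota> (a j \<otimes>\<^bsub>A\<^esub> b j)) = \<iota> (\<Oplus>\<^bsub>A\<^esub>j\<in>{..<d}. a j \<otimes>\<^bsub>A\<^esub> b j)"
    using finsum_hom[OF A.abelian_monoid_axioms Q.abelian_monoid_axioms, of "{..<d}" "\<lambda>j. a j \<otimes>\<^bsub>A\<^esub> b j" "carrier A" \<iota>]
      c by (auto simp: \<iota>_add)
  finally have "(\<Oplus>\<^bsub>Q\<^esub>j\<in>{..<d}. \<theta> (a j, x j) \<otimes>\<^bsub>Q\<^esub> \<theta> (b j, y j)) = \<theta> (\<Oplus>\<^bsub>A\<^esub>j\<in>{..<d}. a j \<otimes>\<^bsub>A\<^esub> b j, z)"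
    using c z by (subst \<theta>_split) (auto intro!: A.finsum_closed)
  then show ?thesis using z by blast
qed

lemma \<theta>_mult_\<mu>: "a \<in> carrier A \<Longrightarrow> x \<in> carrier M \<Longrightarrow> y \<in> carrier M \<Longrightarrow>
    \<theta> (a, x) \<otimes>\<^bsub>Q\<^esub> \<mu> y = \<iota> a \<otimes>\<^bsub>Q\<^esub> \<mu> y"
  by (simp add: \<theta>_split Q.l_distr \<mu>_mult)

text \<open>A linear relation over \<open>Q\<close> between elements of \<open>M\<close> holds in \<open>M\<close> itself after
  multiplication by a suitable element outside \<open>\<mm>\<close>.\<close>

lemma relation_denominator:
  assumes s: "s \<in> carrier A" and a: "a \<in> carrier A" and \<epsilon>: "\<And>j. j < d \<Longrightarrow> \<epsilon> j \<in> carrier M"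
    and p: "\<And>i j. p i j \<in> carrier A" "\<And>i j. x i j \<in> carrier M"
    and f: "\<And>i j. f i j \<in> carrier Q" "\<And>i j. f i j \<otimes>\<^bsub>Q\<^esub> \<iota> s = \<theta> (p i j, x i j)"
    and rel: "\<And>i. i < d \<Longrightarrow> \<iota> a \<otimes>\<^bsub>Q\<^esub> \<mu> (\<epsilon> i) = (\<Oplus>\<^bsub>Q\<^esub>j\<in>{..<d}. f i j \<otimes>\<^bsub>Q\<^esub> \<mu> (\<epsilon> j))"
  shows "\<exists>u\<in>S. \<forall>i<(d::nat). (u \<otimes>\<^bsub>A\<^esub> s \<otimes>\<^bsub>A\<^esub> a) \<odot>\<^bsub>M\<^esub> \<epsilon> i = (\<Oplus>\<^bsub>M\<^esub>j\<in>{..<d}. (u \<otimes>\<^bsub>A\<^esub> p i j) \<odot>\<^bsub>M\<^esub> \<epsilon> j)"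
proof -
  define Y where "Y i = (s \<otimes>\<^bsub>A\<^esub> a) \<odot>\<^bsub>M\<^esub> \<epsilon> i \<ominus>\<^bsub>M\<^esub> (\<Oplus>\<^bsub>M\<^esub>j\<in>{..<d}. p i j \<odot>\<^bsub>M\<^esub> \<epsilon> j)" for i
  have sm: "(\<Oplus>\<^bsub>M\<^esub>j\<in>{..<d}. p i j \<odot>\<^bsub>M\<^esub> \<epsilon> j) \<in> carrier M" for i 
    using p \<epsilon> M.smult_closed by (intro M.finsum_closed) auto
  have lc: "(s \<otimes>\<^bsub>A\<^esub> a) \<odot>\<^bsub>M\<^esub> \<epsilon> i \<in> carrier M" if "i < d" for i using s a \<epsilon> that M.smult_closed by simp
  have "\<exists>u\<in>S. \<forall>i\<in>{..<d}. u \<odot>\<^bsub>M\<^esub> Y i = \<zero>\<^bsub>M\<^esub>"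
  proof (rule common_multiplier)
    fix i assume "i \<in> {..<d}"
    then have i: "i < d" by simp
    have "\<mu> ((s \<otimes>\<^bsub>A\<^esub> a) \<odot>\<^bsub>M\<^esub> \<epsilon> i) = \<iota> s \<otimes>\<^bsub>Q\<^esub> (\<iota> a \<otimes>\<^bsub>Q\<^esub> \<mu> (\<epsilon> i))"
      using s a \<epsilon>[OF i] by (simp add: \<mu>_smult \<iota>_mult Q.m_assoc)
    also have "\<dots> = (\<Oplus>\<^bsub>Q\<^esub>j\<in>{..<d}. \<iota> s \<otimes>\<^bsub>Q\<^esub> (f i j \<otimes>\<^bsub>Q\<^esub> \<mu> (\<epsilon> j)))"
      unfolding rel[OF i] using s f(1) \<epsilon> by (intro Q.finsum_rdistr) auto
    also have "\<dots> = (\<Oplus>\<^bsub>Q\<^esub>j\<in>{..<d}. \<mu> (p i j \<odot>\<^bsub>M\<^esub> \<epsilon> j))"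
    proof (intro Q.finsum_cong' refl)
      fix j assume "j \<in> {..<d}"
      then have j: "\<epsilon> j \<in> carrier M" using \<epsilon> by simp
      have "\<iota> s \<otimes>\<^bsub>Q\<^esub> (f i j \<otimes>\<^bsub>Q\<^esub> \<mu> (\<epsilon> j)) = (f i j \<otimes>\<^bsub>Q\<^esub> \<iota> s) \<otimes>\<^bsub>Q\<^esub> \<mu> (\<epsilon> j)"
        using s f(1)[of i j] j by (simp add: Q.m_ac)
      then show "\<iota> s \<otimes>\<^bsub>Q\<^esub> (f i j \<otimes>\<^bsub>Q\<^esub> \<mu> (\<epsilon> j)) = \<mu> (p i j \<odot>\<^bsub>M\<^esub> \<epsilon> j)"
        unfolding f(2) using p[of i j] p(2)[of i j] j by (simp add: \<theta>_mult_\<mu> \<mu>_smult)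
    qed (use p \<epsilon> M.smult_closed in auto)
    also have "\<dots> = \<mu> (\<Oplus>\<^bsub>M\<^esub>j\<in>{..<d}. p i j \<odot>\<^bsub>M\<^esub> \<epsilon> j)"
      using p \<epsilon> M.smult_closed by (intro \<mu>_finsum[symmetric]) auto
    finally have "\<mu> (Y i) = \<zero>\<^bsub>Q\<^esub>"
      unfolding Y_def M.minus_eq using sm lc[OF i] by (simp add: \<mu>_add \<mu>_minus Q.r_neg)
    then show "\<exists>u\<in>S. u \<odot>\<^bsub>M\<^esub> Y i = \<zero>\<^bsub>M\<^esub>" using \<mu>_kernel[of "Y i"] sm lc[OF i] by (simp add: Y_def)
    show "(v \<otimes>\<^bsub>A\<^esub> u) \<odot>\<^bsub>M\<^esub> Y i = \<zero>\<^bsub>M\<^esub>" if "u \<in> S" "v \<in> S" "u \<odot>\<^bsub>M\<^esub> Y i = \<zero>\<^bsub>M\<^esub>" for u v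
      using that sm lc[OF i] by (simp add: M.smult_assoc1 Y_def)
  qed simp
  then obtain u where u: "u \<in> S" "\<forall>i\<in>{..<d}. u \<odot>\<^bsub>M\<^esub> Y i = \<zero>\<^bsub>M\<^esub>" by (rule bexE)
  have uA: "u \<in> carrier A" using u by simp
  have "(u \<otimes>\<^bsub>A\<^esub> s \<otimes>\<^bsub>A\<^esub> a) \<odot>\<^bsub>M\<^esub> \<epsilon> i = (\<Oplus>\<^bsub>M\<^esub>j\<in>{..<d}. (u \<otimes>\<^bsub>A\<^esub> p i j) \<odot>\<^bsub>M\<^esub> \<epsilon> j)" if i: "i < d" for i
  proof -
    define Z where "Z = (\<Oplus>\<^bsub>M\<^esub>j\<in>{..<d}. p i j \<odot>\<^bsub>M\<^esub> \<epsilon> j)"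
    define W where "W = (s \<otimes>\<^bsub>A\<^esub> a) \<odot>\<^bsub>M\<^esub> \<epsilon> i"
    have ZW: "Z \<in> carrier M" "W \<in> carrier M" unfolding Z_def W_def using sm lc[OF i] by auto
    have u0: "u \<odot>\<^bsub>M\<^esub> (W \<oplus>\<^bsub>M\<^esub> \<ominus>\<^bsub>M\<^esub> Z) = \<zero>\<^bsub>M\<^esub>"
      using bspec[OF u(2), of i] i by (simp add: Y_def a_minus_def Z_def W_def)
    have "u \<odot>\<^bsub>M\<^esub> W = u \<odot>\<^bsub>M\<^esub> ((W \<oplus>\<^bsub>M\<^esub> \<ominus>\<^bsub>M\<^esub> Z) \<oplus>\<^bsub>M\<^esub> Z)" using ZW by (simp add: M.a_assoc M.l_neg)
    also have "\<dots> = u \<odot>\<^bsub>M\<^esub> (W \<oplus>\<^bsub>M\<^esub> \<ominus>\<^bsub>M\<^esub> Z) \<oplus>\<^bsub>M\<^esub> u \<odot>\<^bsub>M\<^esub> Z" using ZW uA by (intro M.smult_r_distr) auto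
    also have "\<dots> = u \<odot>\<^bsub>M\<^esub> Z" unfolding u0 using ZW uA M.smult_closed by simp
    finally have "u \<odot>\<^bsub>M\<^esub> ((s \<otimes>\<^bsub>A\<^esub> a) \<odot>\<^bsub>M\<^esub> \<epsilon> i) = u \<odot>\<^bsub>M\<^esub> (\<Oplus>\<^bsub>M\<^esub>j\<in>{..<d}. p i j \<odot>\<^bsub>M\<^esub> \<epsilon> j)"
      unfolding Z_def W_def .
    also have "\<dots> = (\<Oplus>\<^bsub>M\<^esub>j\<in>{..<d}. u \<odot>\<^bsub>M\<^esub> (p i j \<odot>\<^bsub>M\<^esub> \<epsilon> j))"
      using uA p \<epsilon> M.smult_closed by (intro M.finsum_smult_ldistr) auto
    also have "\<dots> = (\<Oplus>\<^bsub>M\<^esub>j\<in>{..<d}. (u \<otimes>\<^bsub>A\<^esub> p i j) \<odot>\<^bsub>M\<^esub> \<epsilon> j)"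
      using uA p \<epsilon> M.smult_closed by (intro M.M.finsum_cong') (auto simp: M.smult_assoc1)
    finally show ?thesis using uA s a \<epsilon>[OF i] by (simp add: M.smult_assoc1 A.m_assoc)
  qed
  then show ?thesis using u by blast
qed

end

text \<open>Divide \<open>R \<oplus> M\<close> by \<open>I\<^sup>2 \<times> 0\<close> and localize. This subset is an ideal
  because \<open>I\<^sup>2\<close> kills \<open>M\<close>, and it leaves \<open>M\<close> intact.\<close>

lemma (in module) localized_extension_exists:
  assumes prime: "primeideal \<mm> R" and sub: "annihilator R M \<subseteq> \<mm>"
    and nil: "\<And>a. a \<in> \<mm> \<Longrightarrow> \<exists>n::nat. a [^] n \<in> annihilator R M"
    and char: "\<And>n::nat. n > 0 \<Longrightarrow> add_pow R n \<one> \<notin> \<mm>"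
  shows "\<exists>(Q :: (('a \<times> 'c) set \<times> ('a \<times> 'c) set) set ring) \<theta>. localized_extension R M Q \<mm> \<theta>"
proof -
  interpret P: primeideal \<mm> R by fact
  let ?E = "idealization R M"
  interpret E: cring ?E by (rule cring_idealization)
  define J where "J = ideal_prod R (annihilator R M) (annihilator R M)"
  note annI = annihilator_ideal
  interpret J: ideal J R unfolding J_def by (rule R.ideal_prod_is_ideal[OF annI annI])
  have J0: "j \<odot>\<^bsub>M\<^esub> x = \<zero>\<^bsub>M\<^esub>" if "j \<in> J" "x \<in> carrier M" for j x
  proof -
    have "j \<in> annihilator R M"
      using subsetD[OF R.ideal_prod_inter[OF annI annI] that(1)[unfolded J_def]] by simp
    then show ?thesis using that(2) by (simp add: annihilator_def)
  qed
  have I: "ideal (J \<times> {\<zero>\<^bsub>M\<^esub>}) ?E"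
  proof (rule idealI)
    show "ring ?E" by (rule E.ring_axioms)
    show "subgroup (J \<times> {\<zero>\<^bsub>M\<^esub>}) (add_monoid ?E)"
    proof (rule E.add.subgroupI)
      show "\<ominus>\<^bsub>?E\<^esub> p \<in> J \<times> {\<zero>\<^bsub>M\<^esub>}" if "p \<in> J \<times> {\<zero>\<^bsub>M\<^esub>}" for p
      proof -
        obtain j where j: "p = (j, \<zero>\<^bsub>M\<^esub>)" "j \<in> J" using \<open>p \<in> J \<times> {\<zero>\<^bsub>M\<^esub>}\<close> by auto
        have "\<ominus>\<^bsub>?E\<^esub> p = (\<ominus> j, \<zero>\<^bsub>M\<^esub>)" using j J.a_Hcarr
          by (intro E.minus_equality) (auto simp: R.l_neg)
        then show ?thesis using j by simp
      qed
      show "J \<times> {\<zero>\<^bsub>M\<^esub>} \<noteq> {}" using J.zero_closed by blast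
    qed (use J.a_Hcarr in auto)
  qed (auto simp: J0 J.I_l_closed J.I_r_closed J.a_Hcarr)
  define S where "S = (\<lambda>s. (s, \<zero>\<^bsub>M\<^esub>)) ` (carrier R - \<mm>)"
  have S: "S \<subseteq> carrier ?E" "\<one>\<^bsub>?E\<^esub> \<in> S" "\<And>s t. s \<in> S \<Longrightarrow> t \<in> S \<Longrightarrow> s \<otimes>\<^bsub>?E\<^esub> t \<in> S"
    using P.I_notcarr P.one_imp_carrier P.I_prime by (auto simp: S_def intro!: image_eqI)
  obtain Q :: "(('a \<times> 'c) set \<times> ('a \<times> 'c) set) set ring" and \<theta> where Q: "cring Q" "\<theta> \<in> ring_hom ?E Q"
    "\<forall>s\<in>S. \<theta> s \<in> Units Q" "\<forall>x\<in>carrier Q. \<exists>a\<in>carrier ?E. \<exists>s\<in>S. x \<otimes>\<^bsub>Q\<^esub> \<theta> s = \<theta> a"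
    "\<forall>a\<in>carrier ?E. \<theta> a = \<zero>\<^bsub>Q\<^esub> \<longleftrightarrow> (\<exists>u\<in>S. u \<otimes>\<^bsub>?E\<^esub> a \<in> J \<times> {\<zero>\<^bsub>M\<^esub>})"
    using localized_quotient[OF cring_idealization I S] by auto
  have "localized_extension R M Q \<mm> \<theta>"
  proof (intro localized_extension.intro localized_extension_axioms.intro)
    show "\<exists>s\<in>carrier R - \<mm>. \<exists>a\<in>carrier R. \<exists>x\<in>carrier M. q \<otimes>\<^bsub>Q\<^esub> \<theta> (s, \<zero>\<^bsub>M\<^esub>) = \<theta> (a, x)" if "q \<in> carrier Q" for q
      using bspec[OF Q(4) that] by (auto simp: S_def)
    show "\<theta> (a, x) = \<zero>\<^bsub>Q\<^esub> \<longleftrightarrow> (\<exists>u\<in>carrier R - \<mm>.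
        u \<otimes> a \<in> ideal_prod R (annihilator R M) (annihilator R M) \<and> u \<odot>\<^bsub>M\<^esub> x = \<zero>\<^bsub>M\<^esub>)"
      if "a \<in> carrier R" "x \<in> carrier M" for a x
      using bspec[OF Q(5), of "(a, x)"] that by (auto simp: S_def J_def)
    show "\<theta> (s, \<zero>\<^bsub>M\<^esub>) \<in> Units Q" if "s \<in> carrier R - \<mm>" for s using Q(3) that by (auto simp: S_def)
  qed (use Q prime sub nil char module_axioms R.is_cring in auto)
  then show ?thesis by blast
qed


section \<open>Commutators of liftings of elements of the prime ideal\<close>

locale localized_lift = square_zero_lift A B M L h \<pi> \<rho> + localized_extension A M Q \<mm> \<theta>
  for A :: "('a, 'x) ring_scheme" and B :: "('b, 'y) ring_scheme"
    and M :: "('a, 'm, 'u) module_scheme" and L :: "('b, 'l, 'v) module_scheme"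
    and h \<pi> \<rho> and Q :: "('q, 'z) ring_scheme" and \<mm> \<theta>
begin

text \<open>In the coefficient matrices \<open>fa\<close> and \<open>fb\<close> of \<open>\<pi> a\<close> and \<open>\<pi> b\<close> over the
  coefficient field, clear all denominators by \<open>\<sigma>\<close> and lift the numerators to \<open>B\<close>. Then \<open>lifted_commutator\<close> applies
  to \<open>a1 = s a\<close> and \<open>b1 = s b\<close> for a lifting \<open>s\<close> of \<open>\<sigma>\<close>. Its conclusion, mapped to \<open>Q\<close> and divided by
  \<open>\<tau> \<sigma>\<close>, is the hypothesis of \<open>commutator_trace\<close>.\<close>

theorem commutator_in_prime:
  assumes Z: "finite Z" "Z \<subseteq> carrier A" "\<mm> = genideal A Z"
    and G0: "finite G0" "G0 \<subseteq> carrier M"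
      "\<And>x. x \<in> carrier M \<Longrightarrow> \<exists>c\<in>G0 \<rightarrow> carrier A. x = (\<Oplus>\<^bsub>M\<^esub>s\<in>G0. c s \<odot>\<^bsub>M\<^esub> s)"
    and pow: "\<And>a x. a \<in> \<mm> [^]\<^bsub>ideals_set A\<^esub> (n::nat) \<Longrightarrow> x \<in> carrier M \<Longrightarrow> a \<odot>\<^bsub>M\<^esub> x = \<zero>\<^bsub>M\<^esub>"
    and supp: "x0 \<in> carrier M" "\<And>s. s \<in> S \<Longrightarrow> s \<odot>\<^bsub>M\<^esub> x0 \<noteq> \<zero>\<^bsub>M\<^esub>"
    and ab: "a \<in> carrier B" "b \<in> carrier B" "\<pi> a \<in> \<mm>" "\<pi> b \<in> \<mm>"
    and c: "c \<in> carrier B" "a \<otimes>\<^bsub>B\<^esub> b = b \<otimes>\<^bsub>B\<^esub> a \<oplus>\<^bsub>B\<^esub> h \<otimes>\<^bsub>B\<^esub> c"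
  shows "\<pi> c \<in> \<mm>"
proof -
  define J where "J = ideal_prod A Ann Ann"
  interpret J: ideal J A unfolding J_def by (rule ideal_prod_annihilator(2))
  obtain C where C: "coefficient_subfield Q C N" using coefficient_subfield_exists by blast
  interpret C: coefficient_subfield Q C N by (rule C)
  have "\<exists>\<epsilon> d. (\<forall>i<d. \<epsilon> i \<in> carrier M) \<and> C.triangular (\<lambda>i. \<mu> (\<epsilon> i)) d \<and>
      \<mu> ` carrier M \<subseteq> C.tspan (\<lambda>i. \<mu> (\<epsilon> i)) d"
    by (rule triangular_basis_exists[OF C Z G0 pow])
  then obtain \<epsilon> d where \<epsilon>: "\<And>i. i < d \<Longrightarrow> \<epsilon> i \<in> carrier M" and tri: "C.triangular (\<lambda>i. \<mu> (\<epsilon> i)) d"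
    and all: "\<mu> ` carrier M \<subseteq> C.tspan (\<lambda>i. \<mu> (\<epsilon> i)) d"
    by auto
  define e where "e i = \<mu> (\<epsilon> i)" for i
  have tri: "C.triangular e d" using tri by (simp add: e_def[abs_def])
  have all: "\<mu> x \<in> C.tspan e d" if "x \<in> carrier M" for x using all that by (auto simp: e_def[abs_def])
  note ec = C.triangular_carrier[OF tri order_refl]
  have d: "d > 0"
  proof (rule ccontr)
    assume "\<not> d > 0"
    then have "\<mu> x0 = \<zero>\<^bsub>Q\<^esub>" using all[OF supp(1)] by simp
    then show False using \<mu>_kernel[OF supp(1)] supp(2) by auto
  qed
  have abA: "\<pi> a \<in> carrier A" "\<pi> b \<in> carrier A" using ab by auto
  obtain fa where "(\<forall>i j. fa i j \<in> C) \<and> (\<forall>i j. i \<le> j \<or> d \<le> i \<longrightarrow> fa i j = \<zero>\<^bsub>Q\<^esub>) \<and>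
    (\<forall>i<d. \<iota> (\<pi> a) \<otimes>\<^bsub>Q\<^esub> e i = (\<Oplus>\<^bsub>Q\<^esub>j\<in>{..<d}. fa i j \<otimes>\<^bsub>Q\<^esub> e j))"
    using C.triangular_matrix[OF tri \<iota>_in_N[OF ab(3)]] by (rule exE)
  then have fa: "\<And>i j. fa i j \<in> C" "\<And>i j. i \<le> j \<or> d \<le> i \<Longrightarrow> fa i j = \<zero>\<^bsub>Q\<^esub>"
    "\<And>i. i < d \<Longrightarrow> \<iota> (\<pi> a) \<otimes>\<^bsub>Q\<^esub> e i = (\<Oplus>\<^bsub>Q\<^esub>j\<in>{..<d}. fa i j \<otimes>\<^bsub>Q\<^esub> e j)" by blast+
  obtain fb where "(\<forall>i j. fb i j \<in> C) \<and> (\<forall>i j. i \<le> j \<or> d \<le> i \<longrightarrow> fb i j = \<zero>\<^bsub>Q\<^esub>) \<and>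
    (\<forall>i<d. \<iota> (\<pi> b) \<otimes>\<^bsub>Q\<^esub> e i = (\<Oplus>\<^bsub>Q\<^esub>j\<in>{..<d}. fb i j \<otimes>\<^bsub>Q\<^esub> e j))"
    using C.triangular_matrix[OF tri \<iota>_in_N[OF ab(4)]] by (rule exE)
  then have fb: "\<And>i j. fb i j \<in> C" "\<And>i j. i \<le> j \<or> d \<le> i \<Longrightarrow> fb i j = \<zero>\<^bsub>Q\<^esub>"
    "\<And>i. i < d \<Longrightarrow> \<iota> (\<pi> b) \<otimes>\<^bsub>Q\<^esub> e i = (\<Oplus>\<^bsub>Q\<^esub>j\<in>{..<d}. fb i j \<otimes>\<^bsub>Q\<^esub> e j)" by blast+
  have fQ: "fa i j \<in> carrier Q" "fb i j \<in> carrier Q" for i j using fa(1) fb(1) by auto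
  define F where "F = insert \<zero>\<^bsub>Q\<^esub> ((\<lambda>(i, j). fa i j) ` ({..<d} \<times> {..<d}) \<union> (\<lambda>(i, j). fb i j) ` ({..<d} \<times> {..<d}))"
  have F: "finite F" "F \<subseteq> carrier Q" using fQ by (auto simp: F_def)
  have fF: "fa i j \<in> F" "fb i j \<in> F" for i j
    using fa(2)[of i j] fb(2)[of i j] by (cases "i < d \<and> j < d"; force simp: F_def)+
  obtain s0 where s0: "s0 \<in> S" "\<forall>q\<in>F. \<exists>x\<in>carrier A. \<exists>y\<in>carrier M. q \<otimes>\<^bsub>Q\<^esub> \<iota> s0 = \<theta> (x, y)"
    using common_denominator[OF F] by (rule bexE)
  have s0A: "s0 \<in> carrier A" using s0 by simp
  \<comment> \<open>zero entries get the numerator zero, so that the matrices stay triangular over \<open>A\<close>\<close>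
  define num where "num q = (if q = \<zero>\<^bsub>Q\<^esub> then (\<zero>\<^bsub>A\<^esub>, \<zero>\<^bsub>M\<^esub>)
    else SOME z. z \<in> carrier A \<times> carrier M \<and> q \<otimes>\<^bsub>Q\<^esub> \<iota> s0 = \<theta> z)" for q
  have num: "num q \<in> carrier A \<times> carrier M \<and> q \<otimes>\<^bsub>Q\<^esub> \<iota> s0 = \<theta> (num q)" if q: "q \<in> F" for q
  proof (cases "q = \<zero>\<^bsub>Q\<^esub>")
    case True
    have "\<theta> (\<zero>\<^bsub>A\<^esub>, \<zero>\<^bsub>M\<^esub>) = \<zero>\<^bsub>Q\<^esub>" using \<mu>_zero by (simp add: \<mu>_def)
    then show ?thesis using True s0A by (simp add: num_def)
  next
    case False
    have "\<exists>z. z \<in> carrier A \<times> carrier M \<and> q \<otimes>\<^bsub>Q\<^esub> \<iota> s0 = \<theta> z" using bspec[OF s0(2) q] by auto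
    from someI_ex[OF this] show ?thesis using False by (simp add: num_def)
  qed
  define pa where "pa i j = fst (num (fa i j))" for i j
  define xa where "xa i j = snd (num (fa i j))" for i j
  define pb where "pb i j = fst (num (fb i j))" for i j
  define xb where "xb i j = snd (num (fb i j))" for i j
  have pa: "pa i j \<in> carrier A" "xa i j \<in> carrier M" "fa i j \<otimes>\<^bsub>Q\<^esub> \<iota> s0 = \<theta> (pa i j, xa i j)" for i j
    using num[OF fF(1)[of i j]] by (auto simp: pa_def xa_def)
  have pb: "pb i j \<in> carrier A" "xb i j \<in> carrier M" "fb i j \<otimes>\<^bsub>Q\<^esub> \<iota> s0 = \<theta> (pb i j, xb i j)" for i j
    using num[OF fF(2)[of i j]] by (auto simp: pb_def xb_def)
  have pz: "pa i j = \<zero>\<^bsub>A\<^esub>" "pb i j = \<zero>\<^bsub>A\<^esub>" if "i \<le> j" for i j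
    using fa(2) fb(2) that by (auto simp: pa_def pb_def num_def)
  have "\<exists>u\<in>S. \<forall>i<d. (u \<otimes>\<^bsub>A\<^esub> s0 \<otimes>\<^bsub>A\<^esub> \<pi> a) \<odot>\<^bsub>M\<^esub> \<epsilon> i = (\<Oplus>\<^bsub>M\<^esub>j\<in>{..<d}. (u \<otimes>\<^bsub>A\<^esub> pa i j) \<odot>\<^bsub>M\<^esub> \<epsilon> j)"
    using fa(3) by (intro relation_denominator[OF s0A abA(1) \<epsilon> pa(1,2) fQ(1) pa(3)]) (auto simp: e_def)
  then obtain ua where ua: "ua \<in> S" 
    "\<forall>i<d. (ua \<otimes>\<^bsub>A\<^esub> s0 \<otimes>\<^bsub>A\<^esub> \<pi> a) \<odot>\<^bsub>M\<^esub> \<epsilon> i = (\<Oplus>\<^bsub>M\<^esub>j\<in>{..<d}. (ua \<otimes>\<^bsub>A\<^esub> pa i j) \<odot>\<^bsub>M\<^esub> \<epsilon> j)" by (rule bexE)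
  have "\<exists>u\<in>S. \<forall>i<d. (u \<otimes>\<^bsub>A\<^esub> s0 \<otimes>\<^bsub>A\<^esub> \<pi> b) \<odot>\<^bsub>M\<^esub> \<epsilon> i = (\<Oplus>\<^bsub>M\<^esub>j\<in>{..<d}. (u \<otimes>\<^bsub>A\<^esub> pb i j) \<odot>\<^bsub>M\<^esub> \<epsilon> j)"
    using fb(3) by (intro relation_denominator[OF s0A abA(2) \<epsilon> pb(1,2) fQ(2) pb(3)]) (auto simp: e_def)
  then obtain ub where ub: "ub \<in> S" 
    "\<forall>i<d. (ub \<otimes>\<^bsub>A\<^esub> s0 \<otimes>\<^bsub>A\<^esub> \<pi> b) \<odot>\<^bsub>M\<^esub> \<epsilon> i = (\<Oplus>\<^bsub>M\<^esub>j\<in>{..<d}. (ub \<otimes>\<^bsub>A\<^esub> pb i j) \<odot>\<^bsub>M\<^esub> \<epsilon> j)" by (rule bexE)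
  have uA: "ua \<in> carrier A" "ub \<in> carrier A" using ua ub by auto
  define u where "u = ua \<otimes>\<^bsub>A\<^esub> ub"
  have u: "u \<in> S" "u \<in> carrier A" using S_mult[OF ua(1) ub(1)] uA by (auto simp: u_def)
  have scale: "(v \<otimes>\<^bsub>A\<^esub> w \<otimes>\<^bsub>A\<^esub> s0 \<otimes>\<^bsub>A\<^esub> z) \<odot>\<^bsub>M\<^esub> \<epsilon> i = (\<Oplus>\<^bsub>M\<^esub>j\<in>{..<d}. (v \<otimes>\<^bsub>A\<^esub> w \<otimes>\<^bsub>A\<^esub> p i j) \<odot>\<^bsub>M\<^esub> \<epsilon> j)"
    if "v \<in> carrier A" "w \<in> carrier A" "z \<in> carrier A" "\<And>i j. p i j \<in> carrier A" "i < d"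
      "(w \<otimes>\<^bsub>A\<^esub> s0 \<otimes>\<^bsub>A\<^esub> z) \<odot>\<^bsub>M\<^esub> \<epsilon> i = (\<Oplus>\<^bsub>M\<^esub>j\<in>{..<d}. (w \<otimes>\<^bsub>A\<^esub> p i j) \<odot>\<^bsub>M\<^esub> \<epsilon> j)" for v w z i and p :: "nat \<Rightarrow> nat \<Rightarrow> 'a"
  proof -
    have "(v \<otimes>\<^bsub>A\<^esub> w \<otimes>\<^bsub>A\<^esub> s0 \<otimes>\<^bsub>A\<^esub> z) \<odot>\<^bsub>M\<^esub> \<epsilon> i = v \<odot>\<^bsub>M\<^esub> ((w \<otimes>\<^bsub>A\<^esub> s0 \<otimes>\<^bsub>A\<^esub> z) \<odot>\<^bsub>M\<^esub> \<epsilon> i)"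
      using that(1-3) s0A \<epsilon>[OF that(5)] by (simp add: M.smult_assoc1[symmetric] A.m_assoc)
    also have "\<dots> = (\<Oplus>\<^bsub>M\<^esub>j\<in>{..<d}. v \<odot>\<^bsub>M\<^esub> ((w \<otimes>\<^bsub>A\<^esub> p i j) \<odot>\<^bsub>M\<^esub> \<epsilon> j))"
      unfolding that(6) using that(1,2,4) \<epsilon> M.smult_closed by (intro M.finsum_smult_ldistr) auto
    also have "\<dots> = (\<Oplus>\<^bsub>M\<^esub>j\<in>{..<d}. (v \<otimes>\<^bsub>A\<^esub> w \<otimes>\<^bsub>A\<^esub> p i j) \<odot>\<^bsub>M\<^esub> \<epsilon> j)"
      using that(1,2,4) \<epsilon> M.smult_closed by (intro M.M.finsum_cong') (auto simp: M.smult_assoc1 A.m_assoc)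
    finally show ?thesis .
  qed
  define \<sigma> where "\<sigma> = u \<otimes>\<^bsub>A\<^esub> s0"
  have \<sigma>: "\<sigma> \<in> S" "\<sigma> \<in> carrier A" using S_mult[OF u(1) s0(1)] u s0A by (auto simp: \<sigma>_def)
  have rela: "(\<sigma> \<otimes>\<^bsub>A\<^esub> \<pi> a) \<odot>\<^bsub>M\<^esub> \<epsilon> i = (\<Oplus>\<^bsub>M\<^esub>j\<in>{..<d}. (u \<otimes>\<^bsub>A\<^esub> pa i j) \<odot>\<^bsub>M\<^esub> \<epsilon> j)" if "i < d" for i
    using scale[of ub ua "\<pi> a" pa i] ua(2) uA abA pa(1) that by (simp add: \<sigma>_def u_def A.m_comm[of ub])
  have relb: "(\<sigma> \<otimes>\<^bsub>A\<^esub> \<pi> b) \<odot>\<^bsub>M\<^esub> \<epsilon> i = (\<Oplus>\<^bsub>M\<^esub>j\<in>{..<d}. (u \<otimes>\<^bsub>A\<^esub> pb i j) \<odot>\<^bsub>M\<^esub> \<epsilon> j)" if "i < d" for i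
    using scale[of ua ub "\<pi> b" pb i] ub(2) uA abA pb(1) that by (simp add: \<sigma>_def u_def)
  \<comment> \<open>the matrices commute over the coefficient field, so the commutator \<open>T\<close> of their numerators falls into \<open>J\<close> after multiplication by some \<open>\<tau>\<close>\<close>
  define T where "T i k = (\<Oplus>\<^bsub>A\<^esub>j\<in>{..<d}. pb i j \<otimes>\<^bsub>A\<^esub> pa j k) \<ominus>\<^bsub>A\<^esub> (\<Oplus>\<^bsub>A\<^esub>j\<in>{..<d}. pa i j \<otimes>\<^bsub>A\<^esub> pb j k)" for i k
  have Tsum: "(\<Oplus>\<^bsub>A\<^esub>j\<in>{..<d}. pb i j \<otimes>\<^bsub>A\<^esub> pa j k) \<in> carrier A" "(\<Oplus>\<^bsub>A\<^esub>j\<in>{..<d}. pa i j \<otimes>\<^bsub>A\<^esub> pb j k) \<in> carrier A" for i k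
    using pa pb by (auto intro!: A.finsum_closed)
  have TA: "T i k \<in> carrier A" for i k using Tsum by (simp add: T_def)
  have "\<exists>v\<in>S. v \<otimes>\<^bsub>A\<^esub> T i k \<in> J" if ik: "i < d" "k < d" for i k
  proof -
    have sq: "(\<Oplus>\<^bsub>Q\<^esub>j\<in>{..<d}. \<theta> (q i j, y i j) \<otimes>\<^bsub>Q\<^esub> \<theta> (p j k, x j k)) =
        (\<iota> s0 \<otimes>\<^bsub>Q\<^esub> \<iota> s0) \<otimes>\<^bsub>Q\<^esub> (\<Oplus>\<^bsub>Q\<^esub>j\<in>{..<d}. g i j \<otimes>\<^bsub>Q\<^esub> f j k)"
      if g: "\<And>i j. g i j \<in> carrier Q" "\<And>i j. g i j \<otimes>\<^bsub>Q\<^esub> \<iota> s0 = \<theta> (q i j, y i j)"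
        and f: "\<And>i j. f i j \<in> carrier Q" "\<And>i j. f i j \<otimes>\<^bsub>Q\<^esub> \<iota> s0 = \<theta> (p i j, x i j)" for f g p q x y
    proof -
      have "(\<Oplus>\<^bsub>Q\<^esub>j\<in>{..<d}. \<theta> (q i j, y i j) \<otimes>\<^bsub>Q\<^esub> \<theta> (p j k, x j k))
        = (\<Oplus>\<^bsub>Q\<^esub>j\<in>{..<d}. (\<iota> s0 \<otimes>\<^bsub>Q\<^esub> \<iota> s0) \<otimes>\<^bsub>Q\<^esub> (g i j \<otimes>\<^bsub>Q\<^esub> f j k))"
      proof (intro Q.finsum_cong' refl)
        fix j
        have m: "g i j \<in> carrier Q" "f j k \<in> carrier Q" "\<iota> s0 \<in> carrier Q" using f g s0A by auto
        show "\<theta> (q i j, y i j) \<otimes>\<^bsub>Q\<^esub> \<theta> (p j k, x j k) = (\<iota> s0 \<otimes>\<^bsub>Q\<^esub> \<iota> s0) \<otimes>\<^bsub>Q\<^esub> (g i j \<otimes>\<^bsub>Q\<^esub> f j k)"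
          unfolding g(2)[symmetric] f(2)[symmetric] using m by algebra
      qed (use f g s0A in auto)
      also have "\<dots> = (\<iota> s0 \<otimes>\<^bsub>Q\<^esub> \<iota> s0) \<otimes>\<^bsub>Q\<^esub> (\<Oplus>\<^bsub>Q\<^esub>j\<in>{..<d}. g i j \<otimes>\<^bsub>Q\<^esub> f j k)"
        using f g s0A by (intro Q.finsum_rdistr[symmetric]) auto
      finally show ?thesis .
    qed
    obtain z1 where z1: "z1 \<in> carrier M" "(\<Oplus>\<^bsub>Q\<^esub>j\<in>{..<d}. \<theta> (pb i j, xb i j) \<otimes>\<^bsub>Q\<^esub> \<theta> (pa j k, xa j k)) =
        \<theta> (\<Oplus>\<^bsub>A\<^esub>j\<in>{..<d}. pb i j \<otimes>\<^bsub>A\<^esub> pa j k, z1)"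
      using \<theta>_product_sum[of d "pb i" "\<lambda>j. pa j k" "xb i" "\<lambda>j. xa j k"] pa pb by auto
    obtain z2 where z2: "z2 \<in> carrier M" "(\<Oplus>\<^bsub>Q\<^esub>j\<in>{..<d}. \<theta> (pa i j, xa i j) \<otimes>\<^bsub>Q\<^esub> \<theta> (pb j k, xb j k)) =
        \<theta> (\<Oplus>\<^bsub>A\<^esub>j\<in>{..<d}. pa i j \<otimes>\<^bsub>A\<^esub> pb j k, z2)"
      using \<theta>_product_sum[of d "pa i" "\<lambda>j. pb j k" "xa i" "\<lambda>j. xb j k"] pa pb by auto
    have "(\<Oplus>\<^bsub>Q\<^esub>j\<in>{..<d}. fb i j \<otimes>\<^bsub>Q\<^esub> fa j k) = (\<Oplus>\<^bsub>Q\<^esub>j\<in>{..<d}. fa i j \<otimes>\<^bsub>Q\<^esub> fb j k)"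
      using abA by (intro C.matrices_commute[OF tri _ _ fa(1,3) fb(1,3) ik]) auto
    then have "\<theta> (\<Oplus>\<^bsub>A\<^esub>j\<in>{..<d}. pb i j \<otimes>\<^bsub>A\<^esub> pa j k, z1) = \<theta> (\<Oplus>\<^bsub>A\<^esub>j\<in>{..<d}. pa i j \<otimes>\<^bsub>A\<^esub> pb j k, z2)"
      using z1(2) z2(2)
        sq[of fb pb xb fa pa xa, OF fQ(2) pb(3) fQ(1) pa(3)]
        sq[of fa pa xa fb pb xb, OF fQ(1) pa(3) fQ(2) pb(3)]
      by simp
    then show ?thesis using \<theta>_eqD[OF Tsum z1(1) z2(1)] by (simp add: T_def J_def)
  qed
  then have "\<exists>v\<in>S. \<forall>z\<in>{..<d} \<times> {..<d}. v \<otimes>\<^bsub>A\<^esub> T (fst z) (snd z) \<in> J"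
    using TA J.I_l_closed by (intro common_multiplier) (auto simp: A.m_assoc)
  then obtain \<tau> where \<tau>: "\<tau> \<in> S" "\<And>i k. i < d \<Longrightarrow> k < d \<Longrightarrow> \<tau> \<otimes>\<^bsub>A\<^esub> T i k \<in> J" by auto
  have \<tau>A: "\<tau> \<in> carrier A" using \<tau> by simp
  \<comment> \<open>likewise zero is lifted to zero, not to an arbitrary multiple of \<open>h\<close>\<close>
  define lift where "lift x = (if x = \<zero>\<^bsub>A\<^esub> then \<zero>\<^bsub>B\<^esub> else SOME y. y \<in> carrier B \<and> \<pi> y = x)" for x
  have lift: "lift x \<in> carrier B \<and> \<pi> (lift x) = x" if "x \<in> carrier A" for x
  proof (cases "x = \<zero>\<^bsub>A\<^esub>")
    case False
    have "\<exists>y. y \<in> carrier B \<and> \<pi> y = x" using \<pi>_surj[OF that] by auto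
    from someI_ex[OF this] show ?thesis using False by (simp add: lift_def)
  qed (simp add: lift_def)
  have l0: "lift \<zero>\<^bsub>A\<^esub> = \<zero>\<^bsub>B\<^esub>" by (simp add: lift_def)
  define p where "p i j = lift (u \<otimes>\<^bsub>A\<^esub> pa i j)" for i j
  define q where "q i j = lift (u \<otimes>\<^bsub>A\<^esub> pb i j)" for i j
  have p: "p i j \<in> carrier B" "\<pi> (p i j) = u \<otimes>\<^bsub>A\<^esub> pa i j" and q: "q i j \<in> carrier B" "\<pi> (q i j) = u \<otimes>\<^bsub>A\<^esub> pb i j" for i j
    using lift u pa pb by (auto simp: p_def q_def)
  have p0: "p i j = \<zero>\<^bsub>B\<^esub>" "q i j = \<zero>\<^bsub>B\<^esub>" if "i \<le> j" for i j using pz[OF that] u l0 by (auto simp: p_def q_def)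
  have "\<exists>x. x \<in> carrier L \<and> (i < d \<longrightarrow> \<rho> x = \<epsilon> i)" for i
    using \<rho>_surj[OF \<epsilon>[of i]] by (cases "i < d") auto
  then obtain \<eta> where \<eta>: "\<And>i. \<eta> i \<in> carrier L" "\<And>i. i < d \<Longrightarrow> \<rho> (\<eta> i) = \<epsilon> i" by metis
  define s where "s = lift \<sigma>"
  define t where "t = lift \<tau>"
  have st: "s \<in> carrier B" "\<pi> s = \<sigma>" "t \<in> carrier B" "\<pi> t = \<tau>" using lift \<sigma> \<tau>A by (auto simp: s_def t_def)
  define a1 where "a1 = s \<otimes>\<^bsub>B\<^esub> a"
  define b1 where "b1 = s \<otimes>\<^bsub>B\<^esub> b"
  have ab1: "a1 \<in> carrier B" "b1 \<in> carrier B" "\<pi> a1 = \<sigma> \<otimes>\<^bsub>A\<^esub> \<pi> a" "\<pi> b1 = \<sigma> \<otimes>\<^bsub>A\<^esub> \<pi> b"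
    using st ab by (auto simp: a1_def b1_def \<pi>_mult)
  have ex: "\<exists>z. z \<in> carrier L \<and> (i < d \<longrightarrow> x \<odot>\<^bsub>L\<^esub> \<eta> i = (\<Oplus>\<^bsub>L\<^esub>j\<in>{..<d}. f i j \<odot>\<^bsub>L\<^esub> \<eta> j) \<oplus>\<^bsub>L\<^esub> h \<odot>\<^bsub>L\<^esub> z)"
    if x: "x \<in> carrier B" and f: "\<And>i j. f i j \<in> carrier B"
      and rel: "\<And>i. i < d \<Longrightarrow> \<pi> x \<odot>\<^bsub>M\<^esub> \<epsilon> i = (\<Oplus>\<^bsub>M\<^esub>j\<in>{..<d}. \<pi> (f i j) \<odot>\<^bsub>M\<^esub> \<epsilon> j)" for x f i
  proof (cases "i < d")
    case True
    have "\<rho> (\<Oplus>\<^bsub>L\<^esub>j\<in>{..<d}. f i j \<odot>\<^bsub>L\<^esub> \<eta> j) = (\<Oplus>\<^bsub>M\<^esub>j\<in>{..<d}. \<rho> (f i j \<odot>\<^bsub>L\<^esub> \<eta> j))"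
      using f \<eta> L.smult_closed by (intro \<rho>_finsum) auto
    also have "\<dots> = (\<Oplus>\<^bsub>M\<^esub>j\<in>{..<d}. \<pi> (f i j) \<odot>\<^bsub>M\<^esub> \<epsilon> j)"
      using f \<eta> \<epsilon> M.smult_closed by (intro M.M.finsum_cong') (auto simp: \<rho>_smult)
    also have "\<dots> = \<rho> (x \<odot>\<^bsub>L\<^esub> \<eta> i)" using rel[OF True] \<eta> x True by (simp add: \<rho>_smult)
    finally have "\<exists>z\<in>carrier L. x \<odot>\<^bsub>L\<^esub> \<eta> i = (\<Oplus>\<^bsub>L\<^esub>j\<in>{..<d}. f i j \<odot>\<^bsub>L\<^esub> \<eta> j) \<oplus>\<^bsub>L\<^esub> h \<odot>\<^bsub>L\<^esub> z"
      using f \<eta> x L.smult_closed by (intro same_image_lift) (auto intro!: L.M.finsum_closed)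
    then show ?thesis by auto
  qed auto
  have "\<forall>i. \<exists>z. z \<in> carrier L \<and> (i < d \<longrightarrow> a1 \<odot>\<^bsub>L\<^esub> \<eta> i = (\<Oplus>\<^bsub>L\<^esub>j\<in>{..<d}. p i j \<odot>\<^bsub>L\<^esub> \<eta> j) \<oplus>\<^bsub>L\<^esub> h \<odot>\<^bsub>L\<^esub> z)"
    using ex[of a1 p] ab1 p rela by simp
  from choice[OF this] obtain \<alpha> where \<alpha>: "\<And>i. \<alpha> i \<in> carrier L"
    "\<And>i. i < d \<Longrightarrow> a1 \<odot>\<^bsub>L\<^esub> \<eta> i = (\<Oplus>\<^bsub>L\<^esub>j\<in>{..<d}. p i j \<odot>\<^bsub>L\<^esub> \<eta> j) \<oplus>\<^bsub>L\<^esub> h \<odot>\<^bsub>L\<^esub> \<alpha> i" by auto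
  have "\<forall>i. \<exists>z. z \<in> carrier L \<and> (i < d \<longrightarrow> b1 \<odot>\<^bsub>L\<^esub> \<eta> i = (\<Oplus>\<^bsub>L\<^esub>j\<in>{..<d}. q i j \<odot>\<^bsub>L\<^esub> \<eta> j) \<oplus>\<^bsub>L\<^esub> h \<odot>\<^bsub>L\<^esub> z)"
    using ex[of b1 q] ab1 q relb by simp
  from choice[OF this] obtain \<beta> where \<beta>: "\<And>i. \<beta> i \<in> carrier L"
    "\<And>i. i < d \<Longrightarrow> b1 \<odot>\<^bsub>L\<^esub> \<eta> i = (\<Oplus>\<^bsub>L\<^esub>j\<in>{..<d}. q i j \<odot>\<^bsub>L\<^esub> \<eta> j) \<oplus>\<^bsub>L\<^esub> h \<odot>\<^bsub>L\<^esub> \<beta> i" by auto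
  obtain w where w: "w \<in> carrier B" "a1 \<otimes>\<^bsub>B\<^esub> b1 = b1 \<otimes>\<^bsub>B\<^esub> a1 \<oplus>\<^bsub>B\<^esub> h \<otimes>\<^bsub>B\<^esub> w"
    by (rule commutator_lift[OF ab1(1,2)])
  have Tlift: "\<pi> t \<otimes>\<^bsub>A\<^esub> \<pi> ((\<Oplus>\<^bsub>B\<^esub>j\<in>{..<d}. q i j \<otimes>\<^bsub>B\<^esub> p j k) \<ominus>\<^bsub>B\<^esub> (\<Oplus>\<^bsub>B\<^esub>j\<in>{..<d}. p i j \<otimes>\<^bsub>B\<^esub> q j k)) \<in> ideal_prod A Ann Ann"
    if ik: "i < d" "k < d" for i k
  proof -
    have ps: "\<pi> (\<Oplus>\<^bsub>B\<^esub>j\<in>{..<d}. f i j \<otimes>\<^bsub>B\<^esub> g j k) = (u \<otimes>\<^bsub>A\<^esub> u) \<otimes>\<^bsub>A\<^esub> (\<Oplus>\<^bsub>A\<^esub>j\<in>{..<d}. f' i j \<otimes>\<^bsub>A\<^esub> g' j k)"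
      if fg: "\<And>i j. f i j \<in> carrier B" "\<And>i j. \<pi> (f i j) = u \<otimes>\<^bsub>A\<^esub> f' i j" "\<And>i j. f' i j \<in> carrier A"
        "\<And>i j. g i j \<in> carrier B" "\<And>i j. \<pi> (g i j) = u \<otimes>\<^bsub>A\<^esub> g' i j" "\<And>i j. g' i j \<in> carrier A" for f g f' g'
    proof -
      have "\<pi> (\<Oplus>\<^bsub>B\<^esub>j\<in>{..<d}. f i j \<otimes>\<^bsub>B\<^esub> g j k) = (\<Oplus>\<^bsub>A\<^esub>j\<in>{..<d}. \<pi> (f i j \<otimes>\<^bsub>B\<^esub> g j k))"
        using finsum_hom[OF B.abelian_monoid_axioms A.abelian_monoid_axioms, of "{..<d}" "\<lambda>j. f i j \<otimes>\<^bsub>B\<^esub> g j k" "carrier B" \<pi>]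
          fg by (auto simp: \<pi>_add)
      also have "\<dots> = (\<Oplus>\<^bsub>A\<^esub>j\<in>{..<d}. (u \<otimes>\<^bsub>A\<^esub> u) \<otimes>\<^bsub>A\<^esub> (f' i j \<otimes>\<^bsub>A\<^esub> g' j k))"
      proof (intro A.finsum_cong' refl)
        fix j
        have "(u \<otimes>\<^bsub>A\<^esub> f' i j) \<otimes>\<^bsub>A\<^esub> (u \<otimes>\<^bsub>A\<^esub> g' j k) = (u \<otimes>\<^bsub>A\<^esub> u) \<otimes>\<^bsub>A\<^esub> (f' i j \<otimes>\<^bsub>A\<^esub> g' j k)"
          using u(2) fg(3)[of i j] fg(6)[of j k] by algebra
        then show "\<pi> (f i j \<otimes>\<^bsub>B\<^esub> g j k) = (u \<otimes>\<^bsub>A\<^esub> u) \<otimes>\<^bsub>A\<^esub> (f' i j \<otimes>\<^bsub>A\<^esub> g' j k)"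
          using fg by (simp add: \<pi>_mult)
      qed (use u fg in auto)
      also have "\<dots> = (u \<otimes>\<^bsub>A\<^esub> u) \<otimes>\<^bsub>A\<^esub> (\<Oplus>\<^bsub>A\<^esub>j\<in>{..<d}. f' i j \<otimes>\<^bsub>A\<^esub> g' j k)"
        using u fg by (intro A.finsum_rdistr[symmetric]) auto
      finally show ?thesis .
    qed
    define K1 where "K1 = (\<Oplus>\<^bsub>A\<^esub>j\<in>{..<d}. pb i j \<otimes>\<^bsub>A\<^esub> pa j k)"
    define K2 where "K2 = (\<Oplus>\<^bsub>A\<^esub>j\<in>{..<d}. pa i j \<otimes>\<^bsub>A\<^esub> pb j k)"
    have K: "K1 \<in> carrier A" "K2 \<in> carrier A" using Tsum by (auto simp: K1_def K2_def)
    have "\<pi> ((\<Oplus>\<^bsub>B\<^esub>j\<in>{..<d}. q i j \<otimes>\<^bsub>B\<^esub> p j k) \<ominus>\<^bsub>B\<^esub> (\<Oplus>\<^bsub>B\<^esub>j\<in>{..<d}. p i j \<otimes>\<^bsub>B\<^esub> q j k))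
      = (u \<otimes>\<^bsub>A\<^esub> u) \<otimes>\<^bsub>A\<^esub> K1 \<ominus>\<^bsub>A\<^esub> (u \<otimes>\<^bsub>A\<^esub> u) \<otimes>\<^bsub>A\<^esub> K2"
      unfolding K1_def K2_def
        ps[of q pb p pa, OF q pb(1) p pa(1), symmetric]
        ps[of p pa q pb, OF p pa(1) q pb(1), symmetric]
      using p q by (intro \<pi>_minus) (auto intro!: B.finsum_closed)
    then have "\<pi> t \<otimes>\<^bsub>A\<^esub> \<pi> ((\<Oplus>\<^bsub>B\<^esub>j\<in>{..<d}. q i j \<otimes>\<^bsub>B\<^esub> p j k) \<ominus>\<^bsub>B\<^esub> (\<Oplus>\<^bsub>B\<^esub>j\<in>{..<d}. p i j \<otimes>\<^bsub>B\<^esub> q j k))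
      = \<tau> \<otimes>\<^bsub>A\<^esub> ((u \<otimes>\<^bsub>A\<^esub> u) \<otimes>\<^bsub>A\<^esub> K1 \<ominus>\<^bsub>A\<^esub> (u \<otimes>\<^bsub>A\<^esub> u) \<otimes>\<^bsub>A\<^esub> K2)" using st by simp
    also have "\<dots> = (u \<otimes>\<^bsub>A\<^esub> u) \<otimes>\<^bsub>A\<^esub> (\<tau> \<otimes>\<^bsub>A\<^esub> (K1 \<ominus>\<^bsub>A\<^esub> K2))" using K u(2) \<tau>A by algebra
    also have "\<dots> = (u \<otimes>\<^bsub>A\<^esub> u) \<otimes>\<^bsub>A\<^esub> (\<tau> \<otimes>\<^bsub>A\<^esub> T i k)" by (simp add: T_def K1_def K2_def)
    also have "\<dots> \<in> J" using J.I_l_closed[OF \<tau>(2)[OF ik], of "u \<otimes>\<^bsub>A\<^esub> u"] u(2) by simp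
    finally show ?thesis by (simp add: J_def)
  qed
  obtain y where y: "\<And>i j. y i j \<in> carrier A" "\<And>i j. i \<le> j \<Longrightarrow> y i j = \<zero>\<^bsub>A\<^esub>"
    and E: "\<And>i. i < d \<Longrightarrow> (\<pi> t \<otimes>\<^bsub>A\<^esub> \<pi> w) \<odot>\<^bsub>M\<^esub> \<rho> (\<eta> i) \<oplus>\<^bsub>M\<^esub>
        \<pi> t \<odot>\<^bsub>M\<^esub> ((\<Oplus>\<^bsub>M\<^esub>j\<in>{..<d}. \<pi> (p i j) \<odot>\<^bsub>M\<^esub> \<rho> (\<beta> j)) \<oplus>\<^bsub>M\<^esub> \<pi> b1 \<odot>\<^bsub>M\<^esub> \<rho> (\<alpha> i)) =
      (\<Oplus>\<^bsub>M\<^esub>k\<in>{..<d}. y i k \<odot>\<^bsub>M\<^esub> \<rho> (\<eta> k)) \<oplus>\<^bsub>M\<^esub>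
        \<pi> t \<odot>\<^bsub>M\<^esub> ((\<Oplus>\<^bsub>M\<^esub>j\<in>{..<d}. \<pi> (q i j) \<odot>\<^bsub>M\<^esub> \<rho> (\<alpha> j)) \<oplus>\<^bsub>M\<^esub> \<pi> a1 \<odot>\<^bsub>M\<^esub> \<rho> (\<beta> i))"
    using lifted_commutator[OF \<eta>(1) ab1(1,2) p(1) p0(1) q(1) p0(2) \<alpha>(1) \<beta>(1) \<alpha>(2) \<beta>(2) w st(3) Tlift] by auto
  obtain v where v: "v \<in> carrier Q" "\<iota> (\<tau> \<otimes>\<^bsub>A\<^esub> \<sigma>) \<otimes>\<^bsub>Q\<^esub> v = \<one>\<^bsub>Q\<^esub>" using unit_cancel[OF S_mult[OF \<tau>(1) \<sigma>(1)]] .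
  define a' where "a' i = \<mu> (\<rho> (\<alpha> i))" for i
  define b' where "b' i = \<mu> (\<rho> (\<beta> i))" for i
  have ab': "a' i \<in> carrier Q" "b' i \<in> carrier Q" "a' i \<in> C.tspan e d" "b' i \<in> C.tspan e d" for i
    using \<alpha>(1) \<beta>(1) all by (auto simp: a'_def b'_def)
  define r where "r i = v \<otimes>\<^bsub>Q\<^esub> (\<Oplus>\<^bsub>Q\<^esub>k\<in>{..<d}. \<iota> (y i k) \<otimes>\<^bsub>Q\<^esub> e k)" for i
  have r: "r i \<in> C.tspan e i" if i: "i < d" for i
  proof -
    interpret I: ideal "C.tspan e i" Q using C.triangular_ideal[OF tri] i by simp
    have "\<iota> (y i k) \<otimes>\<^bsub>Q\<^esub> e k \<in> C.tspan e i" if k: "k < d" for k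
    proof (cases "k < i")
      case True
      have "e k \<in> C.tspan e i" using C.span_base[OF True] C.triangular_carrier[OF tri, of i] i by simp
      then show ?thesis using y(1) by (intro I.I_l_closed) auto
    next
      case False
      then show ?thesis using y(2)[of i k] ec k I.zero_closed by (auto simp: Pi_iff)
    qed
    then have "(\<Oplus>\<^bsub>Q\<^esub>k\<in>{..<d}. \<iota> (y i k) \<otimes>\<^bsub>Q\<^esub> e k) \<in> C.tspan e i"
      by (intro Q.ideal_finsum I.ideal_axioms) auto
    then show ?thesis unfolding r_def using v(1) by (intro I.I_l_closed)
  qed
  \<comment> \<open>\<open>{\<sigma>a, \<sigma>b} / \<sigma>\<close>, the scalar to which the trace identity applies\<close>
  define WW where "WW = v \<otimes>\<^bsub>Q\<^esub> \<iota> \<tau> \<otimes>\<^bsub>Q\<^esub> \<iota> (\<pi> w)"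
  have WQ: "WW \<in> carrier Q" using v \<tau>A w by (simp add: WW_def)
  have cancel: "v \<otimes>\<^bsub>Q\<^esub> (\<iota> \<tau> \<otimes>\<^bsub>Q\<^esub> (\<iota> \<sigma> \<otimes>\<^bsub>Q\<^esub> z)) = z" if z: "z \<in> carrier Q" for z
  proof -
    have m: "\<iota> \<tau> \<in> carrier Q" "\<iota> \<sigma> \<in> carrier Q" using \<tau>A \<sigma> by auto
    have "v \<otimes>\<^bsub>Q\<^esub> (\<iota> \<tau> \<otimes>\<^bsub>Q\<^esub> (\<iota> \<sigma> \<otimes>\<^bsub>Q\<^esub> z)) = ((\<iota> \<tau> \<otimes>\<^bsub>Q\<^esub> \<iota> \<sigma>) \<otimes>\<^bsub>Q\<^esub> v) \<otimes>\<^bsub>Q\<^esub> z" using m v(1) z by algebra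
    then show ?thesis using v(2) z \<tau>A \<sigma> by (simp add: \<iota>_mult)
  qed
  have msum: "\<mu> (\<Oplus>\<^bsub>M\<^esub>j\<in>{..<d}. \<pi> (f i j) \<odot>\<^bsub>M\<^esub> \<rho> (\<gamma> j)) = \<iota> \<sigma> \<otimes>\<^bsub>Q\<^esub> (\<Oplus>\<^bsub>Q\<^esub>j\<in>{..<d}. g i j \<otimes>\<^bsub>Q\<^esub> \<mu> (\<rho> (\<gamma> j)))"
    if f: "\<And>i j. f i j \<in> carrier B" "\<And>i j. \<pi> (f i j) = u \<otimes>\<^bsub>A\<^esub> f' i j" "\<And>i j. f' i j \<in> carrier A" "\<And>i j. x i j \<in> carrier M"
      and g: "\<And>i j. g i j \<in> carrier Q" "\<And>i j. g i j \<otimes>\<^bsub>Q\<^esub> \<iota> s0 = \<theta> (f' i j, x i j)"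
      and \<gamma>: "\<And>j. \<gamma> j \<in> carrier L" for f f' g x \<gamma> i
  proof -
    have "\<mu> (\<Oplus>\<^bsub>M\<^esub>j\<in>{..<d}. \<pi> (f i j) \<odot>\<^bsub>M\<^esub> \<rho> (\<gamma> j)) = (\<Oplus>\<^bsub>Q\<^esub>j\<in>{..<d}. \<mu> (\<pi> (f i j) \<odot>\<^bsub>M\<^esub> \<rho> (\<gamma> j)))"
      using f(1) \<gamma> M.smult_closed by (intro \<mu>_finsum) auto
    also have "\<dots> = (\<Oplus>\<^bsub>Q\<^esub>j\<in>{..<d}. \<iota> \<sigma> \<otimes>\<^bsub>Q\<^esub> (g i j \<otimes>\<^bsub>Q\<^esub> \<mu> (\<rho> (\<gamma> j))))"
    proof (intro Q.finsum_cong' refl)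
      fix j
      have gm: "g i j \<in> carrier Q" "\<mu> (\<rho> (\<gamma> j)) \<in> carrier Q" "\<iota> u \<in> carrier Q" "\<iota> s0 \<in> carrier Q" using g \<gamma> u s0A by auto
      have "\<mu> (\<pi> (f i j) \<odot>\<^bsub>M\<^esub> \<rho> (\<gamma> j)) = \<iota> u \<otimes>\<^bsub>Q\<^esub> (\<iota> (f' i j) \<otimes>\<^bsub>Q\<^esub> \<mu> (\<rho> (\<gamma> j)))"
        unfolding f(2) using f(3)[of i j] u \<gamma> by (simp add: \<mu>_smult \<iota>_mult Q.m_assoc)
      also have "\<iota> (f' i j) \<otimes>\<^bsub>Q\<^esub> \<mu> (\<rho> (\<gamma> j)) = (g i j \<otimes>\<^bsub>Q\<^esub> \<iota> s0) \<otimes>\<^bsub>Q\<^esub> \<mu> (\<rho> (\<gamma> j))"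
        unfolding g(2) using f(3,4) \<gamma> by (simp add: \<theta>_mult_\<mu>)
      also have "\<iota> u \<otimes>\<^bsub>Q\<^esub> ((g i j \<otimes>\<^bsub>Q\<^esub> \<iota> s0) \<otimes>\<^bsub>Q\<^esub> \<mu> (\<rho> (\<gamma> j))) = (\<iota> u \<otimes>\<^bsub>Q\<^esub> \<iota> s0) \<otimes>\<^bsub>Q\<^esub> (g i j \<otimes>\<^bsub>Q\<^esub> \<mu> (\<rho> (\<gamma> j)))"
        using gm by algebra
      finally show "\<mu> (\<pi> (f i j) \<odot>\<^bsub>M\<^esub> \<rho> (\<gamma> j)) = \<iota> \<sigma> \<otimes>\<^bsub>Q\<^esub> (g i j \<otimes>\<^bsub>Q\<^esub> \<mu> (\<rho> (\<gamma> j)))"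
        using u s0A by (simp add: \<sigma>_def \<iota>_mult)
    qed (use g \<gamma> \<sigma> in auto)
    also have "\<dots> = \<iota> \<sigma> \<otimes>\<^bsub>Q\<^esub> (\<Oplus>\<^bsub>Q\<^esub>j\<in>{..<d}. g i j \<otimes>\<^bsub>Q\<^esub> \<mu> (\<rho> (\<gamma> j)))"
      using g \<gamma> \<sigma> by (intro Q.finsum_rdistr[symmetric]) auto
    finally show ?thesis .
  qed
  have key: "WW \<otimes>\<^bsub>Q\<^esub> e i \<oplus>\<^bsub>Q\<^esub> ((\<Oplus>\<^bsub>Q\<^esub>j\<in>{..<d}. fa i j \<otimes>\<^bsub>Q\<^esub> b' j) \<oplus>\<^bsub>Q\<^esub> \<iota> (\<pi> b) \<otimes>\<^bsub>Q\<^esub> a' i) =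
      r i \<oplus>\<^bsub>Q\<^esub> ((\<Oplus>\<^bsub>Q\<^esub>j\<in>{..<d}. fb i j \<otimes>\<^bsub>Q\<^esub> a' j) \<oplus>\<^bsub>Q\<^esub> \<iota> (\<pi> a) \<otimes>\<^bsub>Q\<^esub> b' i)" if i: "i < d" for i
  proof -
    define Fa where "Fa = (\<Oplus>\<^bsub>Q\<^esub>j\<in>{..<d}. fa i j \<otimes>\<^bsub>Q\<^esub> b' j)"
    define Fb where "Fb = (\<Oplus>\<^bsub>Q\<^esub>j\<in>{..<d}. fb i j \<otimes>\<^bsub>Q\<^esub> a' j)"
    define YY where "YY = (\<Oplus>\<^bsub>Q\<^esub>k\<in>{..<d}. \<iota> (y i k) \<otimes>\<^bsub>Q\<^esub> e k)"
    have FQ: "Fa \<in> carrier Q" "Fb \<in> carrier Q" "YY \<in> carrier Q"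
      unfolding Fa_def Fb_def YY_def using fQ ab' y(1) ec by (auto intro!: Q.finsum_closed simp: Pi_iff)
    have mY: "\<mu> (\<Oplus>\<^bsub>M\<^esub>k\<in>{..<d}. y i k \<odot>\<^bsub>M\<^esub> \<rho> (\<eta> k)) = YY"
    proof -
      have "\<mu> (\<Oplus>\<^bsub>M\<^esub>k\<in>{..<d}. y i k \<odot>\<^bsub>M\<^esub> \<rho> (\<eta> k)) = (\<Oplus>\<^bsub>Q\<^esub>k\<in>{..<d}. \<mu> (y i k \<odot>\<^bsub>M\<^esub> \<rho> (\<eta> k)))"
        using y(1) \<eta>(1) M.smult_closed by (intro \<mu>_finsum) auto
      also have "\<dots> = YY" unfolding YY_def
        using y(1) \<eta> \<epsilon> by (intro Q.finsum_cong') (auto simp: \<mu>_smult e_def)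
      finally show ?thesis .
    qed
    have cl: "(\<Oplus>\<^bsub>M\<^esub>j\<in>{..<d}. \<pi> (p i j) \<odot>\<^bsub>M\<^esub> \<rho> (\<beta> j)) \<in> carrier M" "(\<Oplus>\<^bsub>M\<^esub>j\<in>{..<d}. \<pi> (q i j) \<odot>\<^bsub>M\<^esub> \<rho> (\<alpha> j)) \<in> carrier M"
      "(\<Oplus>\<^bsub>M\<^esub>k\<in>{..<d}. y i k \<odot>\<^bsub>M\<^esub> \<rho> (\<eta> k)) \<in> carrier M"
      using p(1) q(1) \<alpha>(1) \<beta>(1) \<eta>(1) y(1) M.smult_closed by (auto intro!: M.finsum_closed)
    have mp: "\<mu> (\<Oplus>\<^bsub>M\<^esub>j\<in>{..<d}. \<pi> (p i j) \<odot>\<^bsub>M\<^esub> \<rho> (\<beta> j)) = \<iota> \<sigma> \<otimes>\<^bsub>Q\<^esub> Fa"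
      unfolding Fa_def b'_def by (rule msum[OF p pa(1,2) fQ(1) pa(3) \<beta>(1)])
    have mq: "\<mu> (\<Oplus>\<^bsub>M\<^esub>j\<in>{..<d}. \<pi> (q i j) \<odot>\<^bsub>M\<^esub> \<rho> (\<alpha> j)) = \<iota> \<sigma> \<otimes>\<^bsub>Q\<^esub> Fb"
      unfolding Fb_def a'_def by (rule msum[OF q pb(1,2) fQ(2) pb(3) \<alpha>(1)])
    have eQ: "e i \<in> carrier Q" "\<rho> (\<eta> i) = \<epsilon> i" "\<mu> (\<epsilon> i) = e i" "\<epsilon> i \<in> carrier M" using ec i \<eta> \<epsilon> by (auto simp: e_def)
    have iQ: "\<iota> \<tau> \<in> carrier Q" "\<iota> \<sigma> \<in> carrier Q" "\<iota> (\<pi> a) \<in> carrier Q" "\<iota> (\<pi> b) \<in> carrier Q" "\<iota> (\<pi> w) \<in> carrier Q"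
      using \<tau>A \<sigma> ab w by auto
    have ma: "\<mu> (\<pi> a1 \<odot>\<^bsub>M\<^esub> \<rho> (\<beta> i)) = \<iota> \<sigma> \<otimes>\<^bsub>Q\<^esub> (\<iota> (\<pi> a) \<otimes>\<^bsub>Q\<^esub> b' i)" "\<pi> a1 \<odot>\<^bsub>M\<^esub> \<rho> (\<beta> i) \<in> carrier M"
      "\<mu> (\<pi> b1 \<odot>\<^bsub>M\<^esub> \<rho> (\<alpha> i)) = \<iota> \<sigma> \<otimes>\<^bsub>Q\<^esub> (\<iota> (\<pi> b) \<otimes>\<^bsub>Q\<^esub> a' i)" "\<pi> b1 \<odot>\<^bsub>M\<^esub> \<rho> (\<alpha> i) \<in> carrier M"
      unfolding ab1(3,4) using \<sigma> abA \<alpha>(1) \<beta>(1) M.smult_closed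
      by (auto simp: \<mu>_smult \<iota>_mult a'_def b'_def Q.m_assoc)
    define x1 where "x1 = \<iota> (\<pi> a) \<otimes>\<^bsub>Q\<^esub> b' i"
    define x2 where "x2 = \<iota> (\<pi> b) \<otimes>\<^bsub>Q\<^esub> a' i"
    have xQ: "x1 \<in> carrier Q" "x2 \<in> carrier Q" using iQ ab' by (auto simp: x1_def x2_def)
    have "\<mu> ((\<pi> t \<otimes>\<^bsub>A\<^esub> \<pi> w) \<odot>\<^bsub>M\<^esub> \<rho> (\<eta> i) \<oplus>\<^bsub>M\<^esub>
        \<pi> t \<odot>\<^bsub>M\<^esub> ((\<Oplus>\<^bsub>M\<^esub>j\<in>{..<d}. \<pi> (p i j) \<odot>\<^bsub>M\<^esub> \<rho> (\<beta> j)) \<oplus>\<^bsub>M\<^esub> \<pi> b1 \<odot>\<^bsub>M\<^esub> \<rho> (\<alpha> i)))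
      = \<iota> \<tau> \<otimes>\<^bsub>Q\<^esub> \<iota> (\<pi> w) \<otimes>\<^bsub>Q\<^esub> e i \<oplus>\<^bsub>Q\<^esub> \<iota> \<tau> \<otimes>\<^bsub>Q\<^esub> (\<iota> \<sigma> \<otimes>\<^bsub>Q\<^esub> Fa \<oplus>\<^bsub>Q\<^esub> \<iota> \<sigma> \<otimes>\<^bsub>Q\<^esub> x2)"
      unfolding st(4) eQ(2) x2_def using cl(1) ma(4) eQ w \<tau>A M.smult_closed
      by (simp add: \<mu>_add \<mu>_smult \<iota>_mult mp ma(3))
    moreover have "\<mu> ((\<Oplus>\<^bsub>M\<^esub>k\<in>{..<d}. y i k \<odot>\<^bsub>M\<^esub> \<rho> (\<eta> k)) \<oplus>\<^bsub>M\<^esub>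
        \<pi> t \<odot>\<^bsub>M\<^esub> ((\<Oplus>\<^bsub>M\<^esub>j\<in>{..<d}. \<pi> (q i j) \<odot>\<^bsub>M\<^esub> \<rho> (\<alpha> j)) \<oplus>\<^bsub>M\<^esub> \<pi> a1 \<odot>\<^bsub>M\<^esub> \<rho> (\<beta> i)))
      = YY \<oplus>\<^bsub>Q\<^esub> \<iota> \<tau> \<otimes>\<^bsub>Q\<^esub> (\<iota> \<sigma> \<otimes>\<^bsub>Q\<^esub> Fb \<oplus>\<^bsub>Q\<^esub> \<iota> \<sigma> \<otimes>\<^bsub>Q\<^esub> x1)"
      unfolding st(4) x1_def using cl(2,3) ma(2) \<tau>A M.smult_closed
      by (simp add: \<mu>_add \<mu>_smult mq ma(1) mY)
    ultimately have "\<iota> \<tau> \<otimes>\<^bsub>Q\<^esub> \<iota> (\<pi> w) \<otimes>\<^bsub>Q\<^esub> e i \<oplus>\<^bsub>Q\<^esub> \<iota> \<tau> \<otimes>\<^bsub>Q\<^esub> (\<iota> \<sigma> \<otimes>\<^bsub>Q\<^esub> Fa \<oplus>\<^bsub>Q\<^esub> \<iota> \<sigma> \<otimes>\<^bsub>Q\<^esub> x2)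
      = YY \<oplus>\<^bsub>Q\<^esub> \<iota> \<tau> \<otimes>\<^bsub>Q\<^esub> (\<iota> \<sigma> \<otimes>\<^bsub>Q\<^esub> Fb \<oplus>\<^bsub>Q\<^esub> \<iota> \<sigma> \<otimes>\<^bsub>Q\<^esub> x1)"
      unfolding E[OF i] by simp
    then have vE: "v \<otimes>\<^bsub>Q\<^esub> (\<iota> \<tau> \<otimes>\<^bsub>Q\<^esub> \<iota> (\<pi> w) \<otimes>\<^bsub>Q\<^esub> e i \<oplus>\<^bsub>Q\<^esub> \<iota> \<tau> \<otimes>\<^bsub>Q\<^esub> (\<iota> \<sigma> \<otimes>\<^bsub>Q\<^esub> Fa \<oplus>\<^bsub>Q\<^esub> \<iota> \<sigma> \<otimes>\<^bsub>Q\<^esub> x2))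
      = v \<otimes>\<^bsub>Q\<^esub> (YY \<oplus>\<^bsub>Q\<^esub> \<iota> \<tau> \<otimes>\<^bsub>Q\<^esub> (\<iota> \<sigma> \<otimes>\<^bsub>Q\<^esub> Fb \<oplus>\<^bsub>Q\<^esub> \<iota> \<sigma> \<otimes>\<^bsub>Q\<^esub> x1))" by simp
    have "WW \<otimes>\<^bsub>Q\<^esub> e i \<oplus>\<^bsub>Q\<^esub> (Fa \<oplus>\<^bsub>Q\<^esub> x2) = WW \<otimes>\<^bsub>Q\<^esub> e i \<oplus>\<^bsub>Q\<^esub> v \<otimes>\<^bsub>Q\<^esub> (\<iota> \<tau> \<otimes>\<^bsub>Q\<^esub> (\<iota> \<sigma> \<otimes>\<^bsub>Q\<^esub> (Fa \<oplus>\<^bsub>Q\<^esub> x2)))"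
      using cancel[of "Fa \<oplus>\<^bsub>Q\<^esub> x2"] FQ xQ by simp
    also have "\<dots> = v \<otimes>\<^bsub>Q\<^esub> (\<iota> \<tau> \<otimes>\<^bsub>Q\<^esub> \<iota> (\<pi> w) \<otimes>\<^bsub>Q\<^esub> e i \<oplus>\<^bsub>Q\<^esub> \<iota> \<tau> \<otimes>\<^bsub>Q\<^esub> (\<iota> \<sigma> \<otimes>\<^bsub>Q\<^esub> Fa \<oplus>\<^bsub>Q\<^esub> \<iota> \<sigma> \<otimes>\<^bsub>Q\<^esub> x2))"
      unfolding WW_def using v(1) iQ eQ(1) FQ xQ by algebra
    also have "\<dots> = v \<otimes>\<^bsub>Q\<^esub> YY \<oplus>\<^bsub>Q\<^esub> v \<otimes>\<^bsub>Q\<^esub> (\<iota> \<tau> \<otimes>\<^bsub>Q\<^esub> (\<iota> \<sigma> \<otimes>\<^bsub>Q\<^esub> (Fb \<oplus>\<^bsub>Q\<^esub> x1)))"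
      unfolding vE using v(1) iQ FQ xQ by algebra
    also have "\<dots> = r i \<oplus>\<^bsub>Q\<^esub> (Fb \<oplus>\<^bsub>Q\<^esub> x1)" using cancel[of "Fb \<oplus>\<^bsub>Q\<^esub> x1"] FQ xQ by (simp add: r_def YY_def)
    finally show ?thesis by (simp add: Fa_def Fb_def x1_def x2_def)
  qed
  have "add_pow Q d WW \<in> N"
    using C.commutator_trace[OF tri _ _ WQ fa(1,3) fb(1,3) ab'(3,4) r key] abA by simp
  have dW: "add_pow Q d \<one>\<^bsub>Q\<^esub> \<otimes>\<^bsub>Q\<^esub> WW = add_pow Q d WW" using Q.add_pow_ldistr[of "\<one>\<^bsub>Q\<^esub>" WW d] WQ by simp
  interpret N: ideal N Q by (rule ideal_N)
  obtain z where z: "z \<in> carrier Q" "z \<otimes>\<^bsub>Q\<^esub> add_pow Q d \<one>\<^bsub>Q\<^esub> = \<one>\<^bsub>Q\<^esub>"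
    using unit_outside_N[of "add_pow Q d \<one>\<^bsub>Q\<^esub>"] natural_unit[OF d] by (auto simp: Units_def)
  have "WW = z \<otimes>\<^bsub>Q\<^esub> add_pow Q d WW" using z WQ unfolding dW[symmetric] by (simp add: Q.m_assoc[symmetric])
  then have WN: "WW \<in> N" using N.I_l_closed[OF \<open>add_pow Q d WW \<in> N\<close> z(1)] by simp
  have wA: "\<pi> w \<in> carrier A" using w by simp
  have "\<iota> (\<pi> w) = \<iota> \<sigma> \<otimes>\<^bsub>Q\<^esub> WW"
  proof -
    have m: "\<iota> \<tau> \<in> carrier Q" "\<iota> \<sigma> \<in> carrier Q" "\<iota> (\<pi> w) \<in> carrier Q" using \<tau>A \<sigma> wA by auto
    have "\<iota> \<sigma> \<otimes>\<^bsub>Q\<^esub> WW = v \<otimes>\<^bsub>Q\<^esub> (\<iota> \<tau> \<otimes>\<^bsub>Q\<^esub> (\<iota> \<sigma> \<otimes>\<^bsub>Q\<^esub> \<iota> (\<pi> w)))" unfolding WW_def using m v(1) by algebra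
    then show ?thesis using cancel[OF m(3)] by simp
  qed
  then have "\<iota> (\<pi> w) \<in> N" using N.I_l_closed[OF WN, of "\<iota> \<sigma>"] \<sigma> by simp
  then have wm: "\<pi> w \<in> \<mm>" by (rule \<iota>_in_N_D[OF wA])
  obtain f g where fg: "f \<in> carrier A" "g \<in> carrier A"
    "\<sigma> \<otimes>\<^bsub>A\<^esub> \<sigma> \<otimes>\<^bsub>A\<^esub> \<pi> c = \<pi> w \<oplus>\<^bsub>A\<^esub> f \<otimes>\<^bsub>A\<^esub> \<pi> a \<oplus>\<^bsub>A\<^esub> g \<otimes>\<^bsub>A\<^esub> \<pi> b"
    using scaled_commutator[OF ab(1,2) st(1) c(1) w(1) c(2) w(2)[unfolded a1_def b1_def]] st(2) by auto
  have "\<sigma> \<otimes>\<^bsub>A\<^esub> \<sigma> \<otimes>\<^bsub>A\<^esub> \<pi> c \<in> \<mm>"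
    unfolding fg(3) using wm P.I_l_closed[OF ab(3) fg(1)] P.I_l_closed[OF ab(4) fg(2)] by simp
  moreover have "\<sigma> \<otimes>\<^bsub>A\<^esub> \<sigma> \<in> S" using S_mult[OF \<sigma>(1) \<sigma>(1)] .
  ultimately show ?thesis using P.I_prime[of "\<sigma> \<otimes>\<^bsub>A\<^esub> \<sigma>" "\<pi> c"] c by auto
qed

end


section \<open>The bracket of a first-order deformation\<close>

context first_order_module_deformation
begin

text \<open>\<open>A\<^sub>h\<close> is an algebra over the dual numbers, so \<open>h\<close> acts on it as the central
  element \<open>h \<cdot> 1\<close>.\<close>

lemma square_zero_lift_deformation:
  "square_zero_lift A Ah M Mh (dual_h k \<odot>\<^bsub>Ah\<^esub> \<one>\<^bsub>Ah\<^esub>)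
    (\<lambda>a. \<phi> (h_multiples k Ah +>\<^bsub>Ah\<^esub> a))
    (\<lambda>x. \<psi> (h_multiples k (restrict_scalars Ah Mh) +>\<^bsub>Mh\<^esub> x))"
proof -
  let ?D = "dual_numbers k" and ?h = "dual_h k" and ?N = "restrict_scalars Ah Mh"
  interpret base: algebra k A by (rule base_algebra)
  interpret Ah: assoc_algebra ?D Ah by (rule deformed_algebra)
  interpret M: module A M by (rule base_module)
  interpret L: left_module Ah Mh by (rule deformed_module)
  have A: "cring A" by (rule base.M_cring)
  note h = dual_h_props[OF base_field]
  define H where "H = ?h \<odot>\<^bsub>Ah\<^esub> \<one>\<^bsub>Ah\<^esub>"
  have HB: "H \<in> carrier Ah" using h(1) by (simp add: H_def)
  have Hl: "H \<otimes>\<^bsub>Ah\<^esub> x = ?h \<odot>\<^bsub>Ah\<^esub> x" and Hr: "x \<otimes>\<^bsub>Ah\<^esub> H = ?h \<odot>\<^bsub>Ah\<^esub> x" if "x \<in> carrier Ah" for x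
    using Ah.smult_mult_left[OF h(1) _ that, of "\<one>\<^bsub>Ah\<^esub>"] Ah.smult_mult_right[OF h(1) that, of "\<one>\<^bsub>Ah\<^esub>"] that
    by (simp_all add: H_def)
  have HH: "H \<otimes>\<^bsub>Ah\<^esub> H = \<zero>\<^bsub>Ah\<^esub>"
    using Hl[OF HB] Ah.smult_assoc1[OF h(1) h(1), of "\<one>\<^bsub>Ah\<^esub>"] h(2) by (simp add: H_def)
  define I where "I = h_multiples k Ah"
  have I_eq: "I = (\<lambda>x. H \<otimes>\<^bsub>Ah\<^esub> x) ` carrier Ah" using Hl by (auto simp: I_def h_multiples_def)
  interpret I: ideal I Ah
  proof (rule idealI)
    show "ring Ah" by (rule Ah.ring_axioms)
    show "subgroup I (add_monoid Ah)"
    proof (rule Ah.M.add.subgroupI)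
      show "I \<subseteq> carrier Ah" "I \<noteq> {}" using HB by (auto simp: I_eq)
      show "\<ominus>\<^bsub>Ah\<^esub> a \<in> I" if "a \<in> I" for a
        using that HB by (auto simp: I_eq Ah.r_minus[symmetric])
      show "a \<oplus>\<^bsub>Ah\<^esub> b \<in> I" if "a \<in> I" "b \<in> I" for a b
        using that HB by (auto simp: I_eq Ah.r_distr[symmetric])
    qed
    fix a x assume a: "a \<in> I" "x \<in> carrier Ah"
    then obtain b where b: "b \<in> carrier Ah" "a = H \<otimes>\<^bsub>Ah\<^esub> b" by (auto simp: I_eq)
    have "a \<otimes>\<^bsub>Ah\<^esub> x = H \<otimes>\<^bsub>Ah\<^esub> (b \<otimes>\<^bsub>Ah\<^esub> x)" using a b HB by (simp add: Ah.m_assoc)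
    then show "a \<otimes>\<^bsub>Ah\<^esub> x \<in> I" using a b by (auto simp: I_eq)
    have "x \<otimes>\<^bsub>Ah\<^esub> a = (x \<otimes>\<^bsub>Ah\<^esub> H) \<otimes>\<^bsub>Ah\<^esub> b" using a b HB by (simp add: Ah.m_assoc)
    also have "\<dots> = H \<otimes>\<^bsub>Ah\<^esub> (x \<otimes>\<^bsub>Ah\<^esub> b)" using a b HB Hl Hr by (simp add: Ah.m_assoc[symmetric])
    finally show "x \<otimes>\<^bsub>Ah\<^esub> a \<in> I" using a b by (auto simp: I_eq)
  qed
  have phi: "\<phi> \<in> ring_hom (Ah Quot I) A" "bij_betw \<phi> (carrier (Ah Quot I)) (carrier A)"
    using reduction_iso by (auto simp: ring_iso_def I_def)
  define \<pi> where "\<pi> a = \<phi> (I +>\<^bsub>Ah\<^esub> a)" for a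
  have pi_hom: "\<pi> \<in> ring_hom Ah A"
    using ring_hom_trans[OF I.rcos_ring_hom phi(1)] by (simp add: \<pi>_def[abs_def] comp_def)
  have quot: "I +>\<^bsub>Ah\<^esub> a \<in> carrier (Ah Quot I)" if "a \<in> carrier Ah" for a
    using ring_hom_closed[OF I.rcos_ring_hom that] .
  interpret pi: ring_hom_ring Ah A \<pi>
    by (intro ring_hom_ringI2 Ah.ring_axioms cring.axioms(1)[OF A] pi_hom)
  have pi_zero_iff: "\<pi> b = \<zero>\<^bsub>A\<^esub> \<longleftrightarrow> b \<in> I" if b: "b \<in> carrier Ah" for b
  proof
    assume "\<pi> b = \<zero>\<^bsub>A\<^esub>"
    then have "\<phi> (I +>\<^bsub>Ah\<^esub> b) = \<phi> (I +>\<^bsub>Ah\<^esub> \<zero>\<^bsub>Ah\<^esub>)" using pi.hom_zero by (simp add: \<pi>_def)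
    then have "I +>\<^bsub>Ah\<^esub> b = I +>\<^bsub>Ah\<^esub> \<zero>\<^bsub>Ah\<^esub>"
      using phi(2) quot b by (auto simp: bij_betw_def dest: inj_onD)
    also have "\<dots> = I" by (rule Ah.a_rcos_zero[OF I.ideal_axioms]) simp
    finally show "b \<in> I" by (rule I.rcos_const_imp_mem[OF b])
  next
    assume "b \<in> I"
    then have "I +>\<^bsub>Ah\<^esub> b = I +>\<^bsub>Ah\<^esub> \<zero>\<^bsub>Ah\<^esub>"
      using Ah.a_rcos_zero[OF I.ideal_axioms] by simp
    then show "\<pi> b = \<zero>\<^bsub>A\<^esub>" using pi.hom_zero by (simp add: \<pi>_def)
  qed
  have N: "module ?D ?N" using flat_restricted by (simp add: flat_module_def)
  have Nsmult: "?h \<odot>\<^bsub>?N\<^esub> x = H \<odot>\<^bsub>Mh\<^esub> x" and Nc: "carrier ?N = carrier Mh" and Nz: "\<zero>\<^bsub>?N\<^esub> = \<zero>\<^bsub>Mh\<^esub>" for x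
    by (simp_all add: restrict_scalars_def H_def)
  define J where "J = h_multiples k ?N"
  have J_eq: "J = (\<lambda>x. H \<odot>\<^bsub>Mh\<^esub> x) ` carrier Mh" by (simp add: J_def h_multiples_def Nsmult Nc)
  have Jsub: "subgroup J (add_monoid Mh)"
  proof (rule L.M.add.subgroupI)
    show "J \<subseteq> carrier Mh" "J \<noteq> {}" using HB L.smult_closed by (auto simp: J_eq)
    show "\<ominus>\<^bsub>Mh\<^esub> x \<in> J" if "x \<in> J" for x
      using that HB by (auto simp: J_eq L.lm_smult_minus_right[symmetric])
    show "x \<oplus>\<^bsub>Mh\<^esub> y \<in> J" if "x \<in> J" "y \<in> J" for x y
      using that HB by (auto simp: J_eq L.smult_r_distr[symmetric])
  qed
  interpret J: abelian_subgroup J Mh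
    by (intro abelian_subgroupI3 additive_subgroup.intro Jsub L.M.abelian_group_axioms)
  define \<rho> where "\<rho> x = \<psi> (J +>\<^bsub>Mh\<^esub> x)" for x
  have psi: "\<psi> \<in> hom (Mh A_Mod J) (add_monoid M)" "bij_betw \<psi> (carrier (Mh A_Mod J)) (carrier M)"
    using module_reduction_iso by (auto simp: iso_def J_def)
  have carJ: "carrier (Mh A_Mod J) = (\<lambda>x. J +>\<^bsub>Mh\<^esub> x) ` carrier Mh"
    by (auto simp: A_FactGroup_def' A_RCOSETS_def')
  have rho_closed: "\<rho> x \<in> carrier M" if "x \<in> carrier Mh" for x
    using psi(2) carJ that by (auto simp: \<rho>_def bij_betw_def)
  have rho_add: "\<rho> (x \<oplus>\<^bsub>Mh\<^esub> y) = \<rho> x \<oplus>\<^bsub>M\<^esub> \<rho> y" if xy: "x \<in> carrier Mh" "y \<in> carrier Mh" for x y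
  proof -
    have "J +>\<^bsub>Mh\<^esub> (x \<oplus>\<^bsub>Mh\<^esub> y) = (J +>\<^bsub>Mh\<^esub> x) \<otimes>\<^bsub>Mh A_Mod J\<^esub> (J +>\<^bsub>Mh\<^esub> y)"
      using J.a_rcos_sum[OF xy] by (simp add: A_FactGroup_def')
    then show ?thesis using hom_mult[OF psi(1), of "J +>\<^bsub>Mh\<^esub> x" "J +>\<^bsub>Mh\<^esub> y"] carJ xy by (simp add: \<rho>_def)
  qed
  have rho_zero: "\<rho> \<zero>\<^bsub>Mh\<^esub> = \<zero>\<^bsub>M\<^esub>"
    using rho_add[of "\<zero>\<^bsub>Mh\<^esub>" "\<zero>\<^bsub>Mh\<^esub>"] rho_closed[of "\<zero>\<^bsub>Mh\<^esub>"] by (simp add: M.M.add.l_cancel_one')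
  have rho_zero_iff: "\<rho> x = \<zero>\<^bsub>M\<^esub> \<longleftrightarrow> x \<in> J" if x: "x \<in> carrier Mh" for x
  proof
    assume "\<rho> x = \<zero>\<^bsub>M\<^esub>"
    then have "\<psi> (J +>\<^bsub>Mh\<^esub> x) = \<psi> (J +>\<^bsub>Mh\<^esub> \<zero>\<^bsub>Mh\<^esub>)" using rho_zero by (simp add: \<rho>_def)
    then have "J +>\<^bsub>Mh\<^esub> x = J +>\<^bsub>Mh\<^esub> \<zero>\<^bsub>Mh\<^esub>"
      using psi(2) carJ x by (auto simp: bij_betw_def dest: inj_onD)
    moreover have "x \<in> J +>\<^bsub>Mh\<^esub> x" by (rule J.a_rcos_self[OF x])
    moreover have "J +>\<^bsub>Mh\<^esub> \<zero>\<^bsub>Mh\<^esub> = J" using J.a_subset by (intro L.M.a_coset_add_zero)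
    ultimately show "x \<in> J" by simp
  next
    assume xJ: "x \<in> J"
    then have "J +>\<^bsub>Mh\<^esub> x = J" by (rule J.a_rcos_const)
    moreover have "J +>\<^bsub>Mh\<^esub> \<zero>\<^bsub>Mh\<^esub> = J" using J.a_subset by (intro L.M.a_coset_add_zero)
    ultimately show "\<rho> x = \<zero>\<^bsub>M\<^esub>" using rho_zero by (simp add: \<rho>_def)
  qed
  have "square_zero_lift A Ah M Mh H \<pi> \<rho>"
  proof (intro square_zero_lift.intro square_zero_lift_axioms.intro)
    show "cring A" by (rule A)
    show "ring Ah" by (rule Ah.ring_axioms)
    show "module A M" by (rule base_module)
    show "left_module Ah Mh" by (rule deformed_module)
    show "H \<in> carrier Ah" by (rule HB)
    show "b \<otimes>\<^bsub>Ah\<^esub> H = H \<otimes>\<^bsub>Ah\<^esub> b" if "b \<in> carrier Ah" for b using Hl Hr that by simp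
    show "H \<otimes>\<^bsub>Ah\<^esub> H = \<zero>\<^bsub>Ah\<^esub>" by (rule HH)
    show "\<pi> \<in> ring_hom Ah A" by (rule pi_hom)
    show "\<exists>b\<in>carrier Ah. \<pi> b = a" if "a \<in> carrier A" for a
    proof -
      have "a \<in> \<phi> ` carrier (Ah Quot I)" using phi(2) that by (simp add: bij_betw_def)
      then show ?thesis by (auto simp: FactRing_def A_RCOSETS_def' \<pi>_def)
    qed
    show "\<exists>c\<in>carrier Ah. b = H \<otimes>\<^bsub>Ah\<^esub> c" if "b \<in> carrier Ah" "\<pi> b = \<zero>\<^bsub>A\<^esub>" for b
      using pi_zero_iff that by (auto simp: I_eq)
    show "H \<otimes>\<^bsub>Ah\<^esub> b = \<zero>\<^bsub>Ah\<^esub> \<longleftrightarrow> \<pi> b = \<zero>\<^bsub>A\<^esub>" if b: "b \<in> carrier Ah" for b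
    proof
      assume "H \<otimes>\<^bsub>Ah\<^esub> b = \<zero>\<^bsub>Ah\<^esub>"
      then have "\<exists>x\<in>carrier Ah. b = ?h \<odot>\<^bsub>Ah\<^esub> x"
        using Hl[OF b] b by (intro flat_module_torsion[OF flat h(1,3)]) auto
      then show "\<pi> b = \<zero>\<^bsub>A\<^esub>" using pi_zero_iff[OF b] by (auto simp: I_def h_multiples_def)
    next
      assume "\<pi> b = \<zero>\<^bsub>A\<^esub>"
      then obtain c where c: "c \<in> carrier Ah" "b = H \<otimes>\<^bsub>Ah\<^esub> c" using pi_zero_iff[OF b] by (auto simp: I_eq)
      then have "H \<otimes>\<^bsub>Ah\<^esub> b = (H \<otimes>\<^bsub>Ah\<^esub> H) \<otimes>\<^bsub>Ah\<^esub> c" using HB by (simp add: Ah.m_assoc)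
      then show "H \<otimes>\<^bsub>Ah\<^esub> b = \<zero>\<^bsub>Ah\<^esub>" using HH c by simp
    qed
    show "\<rho> x \<in> carrier M" if "x \<in> carrier Mh" for x by (rule rho_closed[OF that])
    show "\<rho> (x \<oplus>\<^bsub>Mh\<^esub> y) = \<rho> x \<oplus>\<^bsub>M\<^esub> \<rho> y" if "x \<in> carrier Mh" "y \<in> carrier Mh" for x y by (rule rho_add[OF that])
    show "\<rho> (b \<odot>\<^bsub>Mh\<^esub> x) = \<pi> b \<odot>\<^bsub>M\<^esub> \<rho> x" if "b \<in> carrier Ah" "x \<in> carrier Mh" for b x
      using module_reduction_smult[OF that] by (simp add: \<rho>_def \<pi>_def I_def J_def)
    show "\<exists>x\<in>carrier Mh. \<rho> x = z" if "z \<in> carrier M" for z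
    proof -
      have "z \<in> \<psi> ` carrier (Mh A_Mod J)" using psi(2) that by (simp add: bij_betw_def)
      then show ?thesis by (auto simp: carJ \<rho>_def)
    qed
    show "\<exists>y\<in>carrier Mh. x = H \<odot>\<^bsub>Mh\<^esub> y" if "x \<in> carrier Mh" "\<rho> x = \<zero>\<^bsub>M\<^esub>" for x
      using rho_zero_iff that by (auto simp: J_eq)
    show "\<rho> x = \<zero>\<^bsub>M\<^esub>" if x: "x \<in> carrier Mh" "H \<odot>\<^bsub>Mh\<^esub> x = \<zero>\<^bsub>Mh\<^esub>" for x
    proof -
      have "\<exists>y\<in>carrier ?N. x = ?h \<odot>\<^bsub>?N\<^esub> y"
        using x by (intro flat_module_torsion[OF flat_restricted h(1,3)]) (auto simp: Nsmult Nc Nz)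
      then show ?thesis using rho_zero_iff[OF x(1)] by (auto simp: J_eq Nsmult Nc)
    qed
  qed
  then show ?thesis by (simp add: H_def \<pi>_def[abs_def] \<rho>_def[abs_def] I_def J_def)
qed

lemma deformation_bracket_eq:
  assumes c: "a \<in> carrier Ah" "b \<in> carrier Ah" "c \<in> carrier Ah"
    and ab: "a \<otimes>\<^bsub>Ah\<^esub> b = b \<otimes>\<^bsub>Ah\<^esub> a \<oplus>\<^bsub>Ah\<^esub> (dual_h k \<odot>\<^bsub>Ah\<^esub> \<one>\<^bsub>Ah\<^esub>) \<otimes>\<^bsub>Ah\<^esub> c"
  shows "deformation_bracket k Ah \<phi> (\<phi> (h_multiples k Ah +>\<^bsub>Ah\<^esub> a)) (\<phi> (h_multiples k Ah +>\<^bsub>Ah\<^esub> b)) =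
    \<phi> (h_multiples k Ah +>\<^bsub>Ah\<^esub> c)"
proof -
  define H where "H = dual_h k \<odot>\<^bsub>Ah\<^esub> \<one>\<^bsub>Ah\<^esub>"
  define \<pi> where "\<pi> a = \<phi> (h_multiples k Ah +>\<^bsub>Ah\<^esub> a)" for a
  define \<rho> where "\<rho> x = \<psi> (h_multiples k (restrict_scalars Ah Mh) +>\<^bsub>Mh\<^esub> x)" for x
  interpret lft: square_zero_lift A Ah M Mh H \<pi> \<rho>
    using square_zero_lift_deformation by (simp add: H_def \<pi>_def[abs_def] \<rho>_def[abs_def])
  interpret Ah: assoc_algebra "dual_numbers k" Ah by (rule deformed_algebra)
  have Hl: "H \<otimes>\<^bsub>Ah\<^esub> x = dual_h k \<odot>\<^bsub>Ah\<^esub> x" if "x \<in> carrier Ah" for x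
    using Ah.smult_mult_left[OF dual_h_props(1)[OF base_field] _ that, of "\<one>\<^bsub>Ah\<^esub>"] that by (simp add: H_def)
  have lifts: "x \<in> liftings k Ah \<phi> y \<longleftrightarrow> x \<in> carrier Ah \<and> \<pi> x = y" for x y
    by (simp add: liftings_def \<pi>_def)
  have comm: "a' \<otimes>\<^bsub>Ah\<^esub> b' \<ominus>\<^bsub>Ah\<^esub> b' \<otimes>\<^bsub>Ah\<^esub> a' = H \<otimes>\<^bsub>Ah\<^esub> c"
    if "a' \<in> liftings k Ah \<phi> (\<pi> a)" "b' \<in> liftings k Ah \<phi> (\<pi> b)" for a' b'
  proof -
    have m: "a' \<in> carrier Ah" "b' \<in> carrier Ah" "\<pi> a' = \<pi> a" "\<pi> b' = \<pi> b" using that lifts by auto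
    have "a' \<otimes>\<^bsub>Ah\<^esub> b' = b' \<otimes>\<^bsub>Ah\<^esub> a' \<oplus>\<^bsub>Ah\<^esub> H \<otimes>\<^bsub>Ah\<^esub> c"
      using lft.commutator_independent[OF c(1,2) m(1,2) c(3) m(3,4)] ab by (simp add: H_def)
    then show ?thesis using m c lft.h_closed
      by (simp add: lft.B.minus_eq lft.B.a_comm[of "b' \<otimes>\<^bsub>Ah\<^esub> a'"] lft.B.a_assoc lft.B.r_neg)
  qed
  show ?thesis
    unfolding deformation_bracket_def \<pi>_def[symmetric]
  proof (rule the_equality)
    show "\<forall>a'\<in>liftings k Ah \<phi> (\<pi> a). \<forall>b'\<in>liftings k Ah \<phi> (\<pi> b). \<exists>c'\<in>liftings k Ah \<phi> (\<pi> c).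
        a' \<otimes>\<^bsub>Ah\<^esub> b' \<ominus>\<^bsub>Ah\<^esub> b' \<otimes>\<^bsub>Ah\<^esub> a' = dual_h k \<odot>\<^bsub>Ah\<^esub> c'"
      using comm Hl[OF c(3)] c(3) by (auto simp: lifts intro!: bexI[of _ c])
    fix d assume d: "\<forall>a'\<in>liftings k Ah \<phi> (\<pi> a). \<forall>b'\<in>liftings k Ah \<phi> (\<pi> b). \<exists>c'\<in>liftings k Ah \<phi> d.
        a' \<otimes>\<^bsub>Ah\<^esub> b' \<ominus>\<^bsub>Ah\<^esub> b' \<otimes>\<^bsub>Ah\<^esub> a' = dual_h k \<odot>\<^bsub>Ah\<^esub> c'"
    have l: "a \<in> liftings k Ah \<phi> (\<pi> a)" "b \<in> liftings k Ah \<phi> (\<pi> b)" using c lifts by auto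
    obtain c' where c': "c' \<in> carrier Ah" "\<pi> c' = d" "H \<otimes>\<^bsub>Ah\<^esub> c = H \<otimes>\<^bsub>Ah\<^esub> c'"
      using bspec[OF bspec[OF d l(1)] l(2)] comm[OF l] Hl lifts by auto
    show "d = \<pi> c" using lft.h_mult_eqD[OF c(3) c'(1,3)] c'(2) by simp
  qed
qed

end

theorem theorem3p1:
  fixes k :: "('k, 'x) ring_scheme"
    and A :: "('k, 'a, 'y) module_scheme"
    and Ah :: "((nat \<Rightarrow> 'k) set, 'ah, 'z) module_scheme"
    and \<phi> :: "'ah set \<Rightarrow> 'a"
    and M :: "('a, 'm, 'u) module_scheme"
    and Mh :: "('ah, 'mh, 'v) module_scheme"
    and \<psi> :: "'mh set \<Rightarrow> 'm"
    and \<mm> :: "'a set"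
  assumes "field k"
    and "\<And>n :: nat. n > 0 \<Longrightarrow> [n] \<cdot>\<^bsub>k\<^esub> \<one>\<^bsub>k\<^esub> \<noteq> \<zero>\<^bsub>k\<^esub>"
    and "algebra k A"
    and "primeideal \<mm> A"
    and "module A M"
    and "finitely_generated_module A M"
    and "\<exists>n :: nat. \<forall>a \<in> \<mm> [^]\<^bsub>ideals_set A\<^esub> n. \<forall>x \<in> carrier M. a \<odot>\<^bsub>M\<^esub> x = \<zero>\<^bsub>M\<^esub>"
    and "in_support A M \<mm>"
    and "noetherian_ring A" and "regular_ring A"
    and "noetherian_ring (A Quot \<mm>)" and "regular_ring (A Quot \<mm>)"
    and "first_order_deformation k A Ah \<phi>"
    and "first_order_module_deformation k A Ah \<phi> M Mh \<psi>"
  shows "involutive (deformation_bracket k Ah \<phi>) \<mm>"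
proof -
  interpret k: field k by fact
  interpret A: algebra k A by fact
  interpret M: module A M by fact
  interpret P: primeideal \<mm> A by fact
  interpret deform: first_order_module_deformation k A Ah \<phi> M Mh \<psi> by fact
  define H where "H = dual_h k \<odot>\<^bsub>Ah\<^esub> \<one>\<^bsub>Ah\<^esub>"
  define \<pi> where "\<pi> a = \<phi> (h_multiples k Ah +>\<^bsub>Ah\<^esub> a)" for a
  define \<rho> where "\<rho> x = \<psi> (h_multiples k (restrict_scalars Ah Mh) +>\<^bsub>Mh\<^esub> x)" for x
  have lift: "square_zero_lift A Ah M Mh H \<pi> \<rho>"
    using deform.square_zero_lift_deformation by (simp add: H_def \<pi>_def[abs_def] \<rho>_def[abs_def])
  interpret lft: square_zero_lift A Ah M Mh H \<pi> \<rho> by (rule lift)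
  obtain n :: nat where n: "\<And>a x. a \<in> \<mm> [^]\<^bsub>ideals_set A\<^esub> n \<Longrightarrow> x \<in> carrier M \<Longrightarrow> a \<odot>\<^bsub>M\<^esub> x = \<zero>\<^bsub>M\<^esub>"
    using assms(7) by blast
  obtain x0 where x0: "x0 \<in> carrier M" "\<And>s. s \<in> carrier A - \<mm> \<Longrightarrow> s \<odot>\<^bsub>M\<^esub> x0 \<noteq> \<zero>\<^bsub>M\<^esub>"
    using assms(8) by (auto simp: in_support_def)
  obtain G0 where G0: "finite G0" "G0 \<subseteq> carrier M"
      "\<And>x. x \<in> carrier M \<Longrightarrow> \<exists>c\<in>G0 \<rightarrow> carrier A. x = (\<Oplus>\<^bsub>M\<^esub>s\<in>G0. c s \<odot>\<^bsub>M\<^esub> s)"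
    using assms(6) by (auto simp: finitely_generated_module_def)
  obtain Z where Z: "Z \<subseteq> carrier A" "finite Z" "\<mm> = genideal A Z"
    using noetherian_ring.finetely_gen[OF assms(9) P.is_ideal] by auto
  have sub: "annihilator A M \<subseteq> \<mm>" using x0 by (auto simp: annihilator_def)
  have pow: "a [^]\<^bsub>A\<^esub> l \<in> \<mm> [^]\<^bsub>ideals_set A\<^esub> l" if "a \<in> \<mm>" for a and l :: nat
  proof (induction l)
    case 0
    then show ?case by (simp add: ideals_set_def nat_pow_def)
  next
    case (Suc l)
    then have "a [^]\<^bsub>A\<^esub> l \<otimes>\<^bsub>A\<^esub> a \<in> ideal_prod A (\<mm> [^]\<^bsub>ideals_set A\<^esub> l) \<mm>"
      using that by (intro ideal_prod.prod) auto
    then show ?case by (simp add: ideals_set_def nat_pow_def)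
  qed
  have nil: "\<exists>n::nat. a [^]\<^bsub>A\<^esub> n \<in> annihilator A M" if "a \<in> \<mm>" for a
  proof -
    have "a \<in> carrier A" using P.Icarr[OF that] .
    then show ?thesis using n[OF pow[OF that, of n]] by (intro exI[of _ n]) (simp add: annihilator_def)
  qed
  have char: "add_pow A n \<one>\<^bsub>A\<^esub> \<notin> \<mm>" if n: "n > 0" for n :: nat
  proof
    assume m: "add_pow A n \<one>\<^bsub>A\<^esub> \<in> \<mm>"
    define c where "c = add_pow k n \<one>\<^bsub>k\<^esub>"
    have c: "c \<in> carrier k" "c \<noteq> \<zero>\<^bsub>k\<^esub>" using assms(2)[OF n] by (auto simp: c_def)
    have "add_pow k m \<one>\<^bsub>k\<^esub> \<odot>\<^bsub>A\<^esub> \<one>\<^bsub>A\<^esub> = add_pow A m \<one>\<^bsub>A\<^esub>" for m :: nat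
      by (induction m) (auto simp: A.smult_l_distr)
    then have cm: "c \<odot>\<^bsub>A\<^esub> \<one>\<^bsub>A\<^esub> \<in> \<mm>" using m by (simp add: c_def)
    have "inv\<^bsub>k\<^esub> c \<in> carrier k" "inv\<^bsub>k\<^esub> c \<otimes>\<^bsub>k\<^esub> c = \<one>\<^bsub>k\<^esub>" using c k.field_Units by auto
    then have "inv\<^bsub>k\<^esub> c \<odot>\<^bsub>A\<^esub> (c \<odot>\<^bsub>A\<^esub> \<one>\<^bsub>A\<^esub>) = \<one>\<^bsub>A\<^esub>" "inv\<^bsub>k\<^esub> c \<odot>\<^bsub>A\<^esub> \<one>\<^bsub>A\<^esub> \<in> carrier A"
      using c by (auto simp: A.smult_assoc1[symmetric])
    then have "(inv\<^bsub>k\<^esub> c \<odot>\<^bsub>A\<^esub> \<one>\<^bsub>A\<^esub>) \<otimes>\<^bsub>A\<^esub> (c \<odot>\<^bsub>A\<^esub> \<one>\<^bsub>A\<^esub>) = \<one>\<^bsub>A\<^esub>"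
      using A.smult_assoc2[of "inv\<^bsub>k\<^esub> c" "\<one>\<^bsub>A\<^esub>" "c \<odot>\<^bsub>A\<^esub> \<one>\<^bsub>A\<^esub>"] c \<open>inv\<^bsub>k\<^esub> c \<in> carrier k\<close> by simp
    then have "\<one>\<^bsub>A\<^esub> \<in> \<mm>" using P.I_l_closed[OF cm \<open>inv\<^bsub>k\<^esub> c \<odot>\<^bsub>A\<^esub> \<one>\<^bsub>A\<^esub> \<in> carrier A\<close>] by simp
    then show False using P.one_imp_carrier P.I_notcarr by simp
  qed
  obtain Q :: "(('a \<times> 'm) set \<times> ('a \<times> 'm) set) set ring" and \<theta> where loc: "localized_extension A M Q \<mm> \<theta>"
    using M.localized_extension_exists[OF assms(4) sub nil char] by blast
  interpret ll: localized_lift A Ah M Mh H \<pi> \<rho> Q \<mm> \<theta>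
    by (intro localized_lift.intro lift loc)
  show ?thesis
    unfolding involutive_def
  proof (intro ballI)
    fix x y assume xy: "x \<in> \<mm>" "y \<in> \<mm>"
    obtain a where a: "a \<in> carrier Ah" "\<pi> a = x" using lft.\<pi>_surj[OF P.Icarr[OF xy(1)]] by auto
    obtain b where b: "b \<in> carrier Ah" "\<pi> b = y" using lft.\<pi>_surj[OF P.Icarr[OF xy(2)]] by auto
    obtain c where c: "c \<in> carrier Ah" "a \<otimes>\<^bsub>Ah\<^esub> b = b \<otimes>\<^bsub>Ah\<^esub> a \<oplus>\<^bsub>Ah\<^esub> H \<otimes>\<^bsub>Ah\<^esub> c"
      by (rule lft.commutator_lift[OF a(1) b(1)])
    have "\<pi> c \<in> \<mm>"
      using ll.commutator_in_prime[OF Z(2,1,3) G0 n x0 a(1) b(1) _ _ c] a(2) b(2) xy by blast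
    moreover have "deformation_bracket k Ah \<phi> x y = \<pi> c"
      using deform.deformation_bracket_eq[OF a(1) b(1) c(1)] c(2) a(2) b(2) by (simp add: \<pi>_def H_def)
    ultimately show "deformation_bracket k Ah \<phi> x y \<in> \<mm>" by simp
  qed
qed

end
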